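(* Let $K$ be a field of characteristic $p>0$, let $B$ be a subset of a $p$-basis of $K$ over $K^p$, and let $R$ be a discrete valuation ring over $K$ whose residue field $L$ is a finite extension of $K$. Suppose that $R$ is $B$-integral and $B$-Japanese. Let $R(1_B)$ be the normalization of $R\otimes_K K(B^{1/p})$ in its field of fractions, and let $R(2_B)$ be the normalization of $R(1_B)\otimes_{K(B^{1/p})}K(B^{1/p^2})$ in its field of fractions. Put $$g'_{10}=\dim_{K(B^{1/p})}\big(R(1_B)/R\otimes_K K(B^{1/p})\big),\qquad g'_{21}=\dim_{K(B^{1/p^2})}\big(R(2_B)/R(1_B)\otimes_{K(B^{1/p})}K(B^{1/p^2})\big).$$ Then $p\,g'_{21}\leq g'_{10}$.
   Context: For $n\ge 1$, $K(B^{1/p^n})=K(x^{1/p^n}\mid x\in B)$ and $K(B^{1/p^\infty})=\bigcup_{n\geq 1}K(B^{1/p^n})$. $R$ is $B$-integral if $R\otimes_K K(B^{1/p^\infty})$ is an integral domain. A $B$-integral $R$ is $B$-Japanese if, for every natural number $n$, the normalization of $R\otimes_K K(B^{1/p^n})$ in its field of fractions is finite over $R\otimes_K K(B^{1/p^n})$. Under these hypotheses $g'_{10}$ and $g'_{21}$ are finite. The set $B$ may be infinite. *)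

theory Defs
  imports "HOL-Algebra.Algebra" "Jordan_Normal_Form.Missing_VectorSpace" "HOL-Library.Extended_Nat"
begin

section \<open>Fields of positive characteristic\<close>

definition has_characteristic :: "('a, 'm) ring_scheme \<Rightarrow> nat \<Rightarrow> bool" where
  "has_characteristic R p \<longleftrightarrow> (\<forall>n::nat. [n] \<cdot>\<^bsub>R\<^esub> \<one>\<^bsub>R\<^esub> = \<zero>\<^bsub>R\<^esub> \<longleftrightarrow> p dvd n)"

definition pth_powers :: "('a, 'm) ring_scheme \<Rightarrow> nat \<Rightarrow> 'a set" where
  "pth_powers K p = (\<lambda>x. x [^]\<^bsub>K\<^esub> p) ` carrier K"

text \<open>\<open>C\<close> is \<open>p\<close>-independent over \<open>K\<^sup>p\<close> if \<open>[K\<^sup>p(c\<^sub>1,\<dots>,c\<^sub>r) : K\<^sup>p] = p\<^sup>r\<close> for all distinct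
  \<open>c\<^sub>1,\<dots>,c\<^sub>r \<in> C\<close>; it is a \<open>p\<close>-basis if moreover \<open>K = K\<^sup>p(C)\<close>.\<close>

definition p_basis :: "('a, 'm) ring_scheme \<Rightarrow> nat \<Rightarrow> 'a set \<Rightarrow> bool" where
  "p_basis K p C \<longleftrightarrow>
     C \<subseteq> carrier K \<and>
     (\<forall>S. finite S \<and> S \<subseteq> C \<longrightarrow>
        ring.dimension K (p ^ card S) (pth_powers K p) (generate_field K (pth_powers K p \<union> S))) \<and>
     generate_field K (pth_powers K p \<union> C) = carrier K"

text \<open>Roots are taken in an extension \<open>\<Omega>\<close> of \<open>K\<close> given by an embedding \<open>\<iota>\<close>. In characteristic
  \<open>p\<close> the set of all \<open>y\<close> with \<open>y\<^bsup>p^n\<^esup> = \<iota> x\<close> has at most one element, namely \<open>x\<^bsup>1/p^n\<^esup>\<close>.\<close>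

definition adjoin_roots ::
  "('o, 'n) ring_scheme \<Rightarrow> ('k, 'm) ring_scheme \<Rightarrow> ('k \<Rightarrow> 'o) \<Rightarrow> nat \<Rightarrow> 'k set \<Rightarrow> nat
    \<Rightarrow> ('o, 'n) ring_scheme" where
  "adjoin_roots \<Omega> K \<iota> p B n =
     \<Omega>\<lparr>carrier := generate_field \<Omega>
         (\<iota> ` carrier K \<union> {y \<in> carrier \<Omega>. y [^]\<^bsub>\<Omega>\<^esub> (p ^ n) \<in> \<iota> ` B})\<rparr>"

definition adjoin_all_roots ::
  "('o, 'n) ring_scheme \<Rightarrow> ('k, 'm) ring_scheme \<Rightarrow> ('k \<Rightarrow> 'o) \<Rightarrow> nat \<Rightarrow> 'k set
    \<Rightarrow> ('o, 'n) ring_scheme" where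
  "adjoin_all_roots \<Omega> K \<iota> p B =
     \<Omega>\<lparr>carrier := (\<Union>n\<in>{1..}. carrier (adjoin_roots \<Omega> K \<iota> p B n))\<rparr>"


section \<open>Algebras and vector spaces\<close>

definition algebra_via :: "('k \<Rightarrow> 'a) \<Rightarrow> ('a, 'm) ring_scheme \<Rightarrow> ('k, 'a) module" where
  "algebra_via h A =
     \<lparr>carrier = carrier A, monoid.mult = monoid.mult A, one = \<one>\<^bsub>A\<^esub>, ring.zero = \<zero>\<^bsub>A\<^esub>, ring.add = ring.add A,
      smult = (\<lambda>k a. h k \<otimes>\<^bsub>A\<^esub> a)\<rparr>"

text \<open>The fields \<open>mult\<close> and \<open>one\<close> of a module record are irrelevant to its module structure.\<close>

definition quotient_module :: "('k, 'a, 'm) module_scheme \<Rightarrow> 'a set \<Rightarrow> ('k, 'a set) module" where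
  "quotient_module M H =
     \<lparr>carrier = a_rcosets\<^bsub>M\<^esub> H, monoid.mult = undefined, one = undefined, ring.zero = H, ring.add = set_add M,
      smult = (\<lambda>k U. \<Union>x\<in>U. H +>\<^bsub>M\<^esub> (k \<odot>\<^bsub>M\<^esub> x))\<rparr>"

definition edim :: "('k, 'm) ring_scheme \<Rightarrow> ('k, 'v, 'n) module_scheme \<Rightarrow> enat" where
  "edim K V = (if vectorspace.fin_dim K V then enat (vectorspace.dim K V) else \<infinity>)"

definition finitely_generated_module ::
  "('a, 'm) ring_scheme \<Rightarrow> ('a, 'b, 'n) module_scheme \<Rightarrow> bool" where
  "finitely_generated_module A M \<longleftrightarrow>
     (\<exists>S. finite S \<and> S \<subseteq> carrier M \<and> module.span A M S = carrier M)"


section \<open>Tensor products of commutative algebras\<close>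

text \<open>\<open>A \<otimes>\<^sub>K C\<close> is the quotient of the free abelian group on \<open>A \<times> C\<close> by the bilinearity
  relations. The free group carries the multiplication \<open>(a,c)(a',c') = (aa',cc')\<close>, for which the
  subgroup generated by the relations is an ideal, so that it coincides with the ideal they generate.\<close>

definition free_pairs ::
  "('k, 'a, 'm) module_scheme \<Rightarrow> ('k, 'c, 'n) module_scheme \<Rightarrow> (('a \<times> 'c) \<Rightarrow>\<^sub>0 int) ring" where
  "free_pairs A C =
     \<lparr>carrier = {u. Poly_Mapping.keys u \<subseteq> carrier A \<times> carrier C},
      monoid.mult = (\<lambda>u v. frag_extend (\<lambda>(a, c). frag_extend (\<lambda>(a', c').
                frag_of (a \<otimes>\<^bsub>A\<^esub> a', c \<otimes>\<^bsub>C\<^esub> c')) v) u),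
      one = frag_of (\<one>\<^bsub>A\<^esub>, \<one>\<^bsub>C\<^esub>), ring.zero = 0, ring.add = (+)\<rparr>"

definition tensor_ideal ::
  "('k, 'l) ring_scheme \<Rightarrow> ('k, 'a, 'm) module_scheme \<Rightarrow> ('k, 'c, 'n) module_scheme
    \<Rightarrow> (('a \<times> 'c) \<Rightarrow>\<^sub>0 int) set" where
  "tensor_ideal K A C = Idl\<^bsub>free_pairs A C\<^esub>
     ({frag_of (a \<oplus>\<^bsub>A\<^esub> a', c) - frag_of (a, c) - frag_of (a', c) | a a' c.
         a \<in> carrier A \<and> a' \<in> carrier A \<and> c \<in> carrier C}
    \<union> {frag_of (a, c \<oplus>\<^bsub>C\<^esub> c') - frag_of (a, c) - frag_of (a, c') | a c c'.
         a \<in> carrier A \<and> c \<in> carrier C \<and> c' \<in> carrier C}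
    \<union> {frag_of (k \<odot>\<^bsub>A\<^esub> a, c) - frag_of (a, k \<odot>\<^bsub>C\<^esub> c) | k a c.
         k \<in> carrier K \<and> a \<in> carrier A \<and> c \<in> carrier C})"

definition pure_tensor ::
  "('k, 'l) ring_scheme \<Rightarrow> ('k, 'a, 'm) module_scheme \<Rightarrow> ('k, 'c, 'n) module_scheme
    \<Rightarrow> 'a \<Rightarrow> 'c \<Rightarrow> (('a \<times> 'c) \<Rightarrow>\<^sub>0 int) set" where
  "pure_tensor K A C a c = tensor_ideal K A C +>\<^bsub>free_pairs A C\<^esub> frag_of (a, c)"

text \<open>\<open>A \<otimes>\<^sub>K C\<close> as an algebra over its second factor.\<close>

definition base_change ::
  "('k, 'l) ring_scheme \<Rightarrow> ('k, 'a, 'm) module_scheme \<Rightarrow> ('k, 'c, 'n) module_scheme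
    \<Rightarrow> ('c, (('a \<times> 'c) \<Rightarrow>\<^sub>0 int) set) module" where
  "base_change K A C =
     algebra_via (pure_tensor K A C \<one>\<^bsub>A\<^esub>) (free_pairs A C Quot tensor_ideal K A C)"


section \<open>Fields of fractions and normalization\<close>

definition frac_rel :: "('a, 'm) ring_scheme \<Rightarrow> (('a \<times> 'a) \<times> ('a \<times> 'a)) set" where
  "frac_rel D = {((a, b), (c, d)).
     a \<in> carrier D \<and> b \<in> carrier D - {\<zero>\<^bsub>D\<^esub>} \<and> c \<in> carrier D \<and> d \<in> carrier D - {\<zero>\<^bsub>D\<^esub>} \<and>
     a \<otimes>\<^bsub>D\<^esub> d = c \<otimes>\<^bsub>D\<^esub> b}"

definition fraction :: "('a, 'm) ring_scheme \<Rightarrow> 'a \<Rightarrow> 'a \<Rightarrow> ('a \<times> 'a) set" where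
  "fraction D a b = frac_rel D `` {(a, b)}"

definition frac_field :: "('a, 'm) ring_scheme \<Rightarrow> ('a \<times> 'a) set ring" where
  "frac_field D =
     \<lparr>carrier = (carrier D \<times> (carrier D - {\<zero>\<^bsub>D\<^esub>})) // frac_rel D,
      monoid.mult = (\<lambda>U V. \<Union>(a, b)\<in>U. \<Union>(c, d)\<in>V. fraction D (a \<otimes>\<^bsub>D\<^esub> c) (b \<otimes>\<^bsub>D\<^esub> d)),
      one = fraction D \<one>\<^bsub>D\<^esub> \<one>\<^bsub>D\<^esub>, ring.zero = fraction D \<zero>\<^bsub>D\<^esub> \<one>\<^bsub>D\<^esub>,
      ring.add = (\<lambda>U V. \<Union>(a, b)\<in>U. \<Union>(c, d)\<in>V.
               fraction D (a \<otimes>\<^bsub>D\<^esub> d \<oplus>\<^bsub>D\<^esub> c \<otimes>\<^bsub>D\<^esub> b) (b \<otimes>\<^bsub>D\<^esub> d))\<rparr>"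

definition to_frac :: "('a, 'm) ring_scheme \<Rightarrow> 'a \<Rightarrow> ('a \<times> 'a) set" where
  "to_frac D a = fraction D a \<one>\<^bsub>D\<^esub>"

text \<open>Polynomials of \<^theory>\<open>HOL-Algebra.Polynomials\<close> are coefficient lists, head first, and
  \<open>hd []\<close> is unspecified; hence the explicit \<open>P \<noteq> []\<close>.\<close>

definition integral_over :: "('a, 'm) ring_scheme \<Rightarrow> 'a set \<Rightarrow> 'a \<Rightarrow> bool" where
  "integral_over F A x \<longleftrightarrow>
     (\<exists>P \<in> carrier (univ_poly F A). P \<noteq> [] \<and> hd P = \<one>\<^bsub>F\<^esub> \<and> ring.eval F P x = \<zero>\<^bsub>F\<^esub>)"

text \<open>The normalization of a \<open>K\<close>-algebra \<open>D\<close> that is a domain, again as a \<open>K\<close>-algebra.\<close>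

definition normalization :: "('k, 'a, 'm) module_scheme \<Rightarrow> ('k, ('a \<times> 'a) set) module" where
  "normalization D = algebra_via (\<lambda>k. to_frac D (k \<odot>\<^bsub>D\<^esub> \<one>\<^bsub>D\<^esub>))
     ((frac_field D)\<lparr>carrier :=
        {x \<in> carrier (frac_field D). integral_over (frac_field D) (to_frac D ` carrier D) x}\<rparr>)"


section \<open>Discrete valuation rings\<close>

locale discrete_valuation_ring = principal_domain R for R (structure) +
  assumes unique_maximal: "\<exists>!M. maximalideal M R"
    and not_field: "\<not> field R"

definition max_ideal :: "('a, 'm) ring_scheme \<Rightarrow> 'a set" where
  "max_ideal R = (THE M. maximalideal M R)"

definition residue_field :: "('k, 'a, 'm) module_scheme \<Rightarrow> ('k, 'a set) module" where
  "residue_field R = algebra_via (\<lambda>k. max_ideal R +>\<^bsub>R\<^esub> (k \<odot>\<^bsub>R\<^esub> \<one>\<^bsub>R\<^esub>)) (R Quot max_ideal R)"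

definition B_integral ::
  "('o, 'n) ring_scheme \<Rightarrow> ('k, 'l) ring_scheme \<Rightarrow> ('k \<Rightarrow> 'o) \<Rightarrow> nat \<Rightarrow> 'k set
    \<Rightarrow> ('k, 'r, 'm) module_scheme \<Rightarrow> bool" where
  "B_integral \<Omega> K \<iota> p B R \<longleftrightarrow>
     domain (base_change K R (algebra_via \<iota> (adjoin_all_roots \<Omega> K \<iota> p B)))"

definition B_Japanese ::
  "('o, 'n) ring_scheme \<Rightarrow> ('k, 'l) ring_scheme \<Rightarrow> ('k \<Rightarrow> 'o) \<Rightarrow> nat \<Rightarrow> 'k set
    \<Rightarrow> ('k, 'r, 'm) module_scheme \<Rightarrow> bool" where
  "B_Japanese \<Omega> K \<iota> p B R \<longleftrightarrow>
     (\<forall>n\<ge>1. let T = base_change K R (algebra_via \<iota> (adjoin_roots \<Omega> K \<iota> p B n)) in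
        finitely_generated_module T (algebra_via (to_frac T) (normalization T)))"

end

theory Submission
  imports Defs "HOL-Computational_Algebra.Primes"
begin

text \<open>Write \<open>T\<^sub>1\<close>, \<open>T\<^sub>2\<close> for the two tensor products, \<open>S\<^sub>1\<close>, \<open>S\<^sub>2\<close> for their normalizations and
  \<open>k\<^sub>2 = K\<^sub>2\<^sup>p \<subseteq> K\<^sub>1\<close>. The \<open>p\<close>-th powers of \<open>S\<^sub>1\<close> lie in \<open>R\<close> and those of \<open>S\<^sub>2\<close> in \<open>S\<^sub>1\<close>, so Frobenius turns
  \<open>S\<^sub>2/T\<^sub>2\<close> over \<open>K\<^sub>2\<close> into \<open>C/D\<close> over \<open>k\<^sub>2\<close>, where \<open>D = A k\<^sub>2 \<subseteq> C \<subseteq> S\<^sub>1\<close> and \<open>A = S\<^sub>1\<^sup>p\<close>. Let \<open>t\<close> be a uniformizer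
  of \<open>S\<^sub>1\<close>; then \<open>A\<close> is a discrete valuation ring with uniformizer \<open>\<pi> = t\<^sup>p\<close>, and \<open>R\<close> is flat over \<open>A\<close>. A filtration
  of \<open>C/D\<close> with quotients \<open>D/n\<close>, \<open>n\<close> the maximal ideal of \<open>D\<close>, thus becomes one of \<open>R C/R D\<close> with quotients
  \<open>T\<^sub>1/R n\<close>, as \<open>R D = T\<^sub>1\<close>. The same holds for \<open>D/\<pi>D\<close>, and \<open>dim T\<^sub>1/\<pi>T\<^sub>1 = dim S\<^sub>1/\<pi>S\<^sub>1 = p dim S\<^sub>1/tS\<^sub>1\<close> is at
  least \<open>p dim D/\<pi>D\<close>. Hence \<open>p dim D/n \<le> dim T\<^sub>1/R n\<close> and \<open>p dim C/D \<le> dim R C/T\<^sub>1 \<le> dim S\<^sub>1/T\<^sub>1\<close>.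

  The field that contains all these rings is realised as the ideal \<open>e U\<close> of a commutative ring type \<open>U\<close>,
  \<open>e\<close> idempotent: every field on a carrier set embeds into such a type, and the operations of \<open>U\<close> need
  no carrier conditions. The unit of the field is \<open>e\<close> instead of \<open>1\<close>.\<close>

text \<open>The factor \<open>p\<close> comes from \<open>\<pi> = t ^ p\<close>:
  \<open>S1/\<pi> S1\<close> has \<open>p\<close> layers \<open>S1/t S1\<close>, whereas
  \<open>D/\<pi> D\<close> is generated by the Frobenius image of a single layer. The obstacle is
  that \<open>D\<close> need not be a valuation ring, so neither \<open>D/n\<close> nor its
  extension has a dimension known beforehand. Counting both through one filtration, first on
  \<open>D/\<pi> D\<close> and then on \<open>C/D\<close>, makes the unknown dimensions comparable.

  The filtration survives extension from \<open>D\<close> to \<open>T1\<close> because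
  \<open>R\<close> and \<open>D\<close> are linearly disjoint over \<open>A\<close>. This is where
  the p-basis enters: monomials in the p-th roots of \<open>B\<close> span \<open>K2^p\<close> over
  \<open>K1^p\<close> and stay independent over \<open>K\<close>, for the p-th power of a relation
  over \<open>K\<close> is a relation over \<open>K^p\<close> between monomials in \<open>B\<close>.

  The common field is the fraction field of the tensor product of \<open>R\<close> with
  \<open>K(B^(1/p^\<infinity>))\<close>, a domain by \<open>B\<close>-integrality; in it
  \<open>R\<close> is linearly disjoint over \<open>K\<close> from every field between
  \<open>K\<close> and \<open>K(B^(1/p^\<infinity>))\<close>. As \<open>B\<close> may be infinite,
  these fields may have infinite degree, so dimensions are always those of quotients and arguments
  pass to finite subsets of \<open>B\<close>.\<close>

inductive_set mprod :: "'u::comm_ring_1 set \<Rightarrow> 'u set \<Rightarrow> 'u set" for A M where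
  zero: "0 \<in> mprod A M"
| step: "x \<in> mprod A M \<Longrightarrow> a \<in> A \<Longrightarrow> m \<in> M \<Longrightarrow> x + a * m \<in> mprod A M"

text \<open>Adjoins one generator; dimensions are measured below as the number of such
  steps.\<close>

definition lext :: "'u::comm_ring_1 set \<Rightarrow> 'u \<Rightarrow> 'u set \<Rightarrow> 'u set" where
  "lext k x N = {y + c * x | y c. y \<in> N \<and> c \<in> k}"

definition sumset :: "'u::comm_ring_1 set \<Rightarrow> 'u set \<Rightarrow> 'u set" where
  "sumset M N = {x + y | x y. x \<in> M \<and> y \<in> N}"

lemma lextI: "y \<in> N \<Longrightarrow> c \<in> k \<Longrightarrow> y + c * x \<in> lext k x N"
  by (auto simp: lext_def)

lemma lextE:
  assumes "z \<in> lext k x N" obtains y c where "y \<in> N" "c \<in> k" "z = y + c * x"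
  using assms by (auto simp: lext_def)

lemma sumsetI: "x \<in> M \<Longrightarrow> y \<in> N \<Longrightarrow> x + y \<in> sumset M N"
  by (auto simp: sumset_def)

lemma sumsetE:
  assumes "z \<in> sumset M N" obtains x y where "x \<in> M" "y \<in> N" "z = x + y"
  using assms by (auto simp: sumset_def)

lemma sumset_incl1: "0 \<in> N \<Longrightarrow> M \<subseteq> sumset M N"
  using sumsetI[of _ M 0 N] by auto

lemma sumset_incl2: "0 \<in> M \<Longrightarrow> N \<subseteq> sumset M N"
  using sumsetI[of 0 M _ N] by auto

lemma mprod_mono: "A \<subseteq> A' \<Longrightarrow> M \<subseteq> M' \<Longrightarrow> mprod A M \<subseteq> mprod A' M'"
proof
  fix x assume "A \<subseteq> A'" "M \<subseteq> M'" "x \<in> mprod A M"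
  then show "x \<in> mprod A' M'"
    by (induction rule: mprod.induct[OF \<open>x \<in> mprod A M\<close>]) (auto intro: mprod.intros)
qed

section \<open>Subrings, subfields and submodules of the field with unit \<open>e\<close>\<close>

locale idf =
  fixes e :: "'u::comm_ring_1"
  assumes ee: "e * e = e" and e0: "e \<noteq> 0"
    and ex_inverse: "\<And>x. e * x = x \<Longrightarrow> x \<noteq> 0 \<Longrightarrow> \<exists>y. e * y = y \<and> x * y = e"
begin

text \<open>\<open>A\<close> may be any set of scalars. Restriction of scalars is then the inclusion
  \<open>sm_subset\<close>, and one set can be regarded over several rings without
  conversion.\<close>

definition sm :: "'u set \<Rightarrow> 'u set \<Rightarrow> bool" where
  "sm A M \<longleftrightarrow> (\<forall>x\<in>M. e * x = x) \<and> 0 \<in> M \<and> (\<forall>x\<in>M. \<forall>y\<in>M. x - y \<in> M) \<and> (\<forall>a\<in>A. \<forall>x\<in>M. a * x \<in> M)"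

definition subr :: "'u set \<Rightarrow> bool" where
  "subr A \<longleftrightarrow> sm A A \<and> e \<in> A"

definition subf :: "'u set \<Rightarrow> bool" where
  "subf k \<longleftrightarrow> subr k \<and> (\<forall>x\<in>k. x \<noteq> 0 \<longrightarrow> (\<exists>y\<in>k. x * y = e))"

lemma smI:
  assumes "\<And>x. x \<in> M \<Longrightarrow> e * x = x" "0 \<in> M" "\<And>x y. x \<in> M \<Longrightarrow> y \<in> M \<Longrightarrow> x - y \<in> M"
    "\<And>a x. a \<in> A \<Longrightarrow> x \<in> M \<Longrightarrow> a * x \<in> M"
  shows "sm A M"
  using assms unfolding sm_def by blast

lemma sm_e: "sm A M \<Longrightarrow> x \<in> M \<Longrightarrow> e * x = x"
  and sm_0: "sm A M \<Longrightarrow> 0 \<in> M"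
  and sm_diff: "sm A M \<Longrightarrow> x \<in> M \<Longrightarrow> y \<in> M \<Longrightarrow> x - y \<in> M"
  and sm_mult: "sm A M \<Longrightarrow> a \<in> A \<Longrightarrow> x \<in> M \<Longrightarrow> a * x \<in> M"
  unfolding sm_def by blast+

lemma sm_minus: "sm A M \<Longrightarrow> x \<in> M \<Longrightarrow> - x \<in> M"
  using sm_diff[of A M 0 x] sm_0 by simp

lemma sm_add: "sm A M \<Longrightarrow> x \<in> M \<Longrightarrow> y \<in> M \<Longrightarrow> x + y \<in> M"
  using sm_diff[of A M x "- y"] sm_minus by simp

lemma sm_sum: "sm A M \<Longrightarrow> (\<And>i. i \<in> I \<Longrightarrow> f i \<in> M) \<Longrightarrow> sum f I \<in> M"
proof (induction I rule: infinite_finite_induct)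
  case (insert i I)
  then show ?case using sm_add[OF insert.prems(1) insert.prems(2)[of i] insert.IH[OF insert.prems(1)]] by simp
qed (simp_all add: sm_0)

lemma sm_subset: "sm A M \<Longrightarrow> A' \<subseteq> A \<Longrightarrow> sm A' M"
  unfolding sm_def by blast

lemma subr_sm: "subr A \<Longrightarrow> sm A A" and subr_e: "subr A \<Longrightarrow> e \<in> A"
  unfolding subr_def by blast+

lemma subr_unit: "subr A \<Longrightarrow> x \<in> A \<Longrightarrow> e * x = x"
  using subr_sm sm_e by blast

lemmas subr_0 = sm_0[OF subr_sm]
  and subr_add = sm_add[OF subr_sm]
  and subr_diff = sm_diff[OF subr_sm]
  and subr_minus = sm_minus[OF subr_sm]
  and subr_mult = sm_mult[OF subr_sm]

text \<open>\<open>x ^ 0\<close> is \<open>1\<close>, which need not lie in the field with unit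
  \<open>e\<close>. Powers whose exponent may vanish are therefore written
  \<open>e * x ^ n\<close>.\<close>

lemma subr_pow: "subr A \<Longrightarrow> x \<in> A \<Longrightarrow> e * x ^ n \<in> A"
proof (induction n)
  case (Suc n)
  have "e * x ^ Suc n = x * (e * x ^ n)" by (simp add: algebra_simps)
  then show ?case using Suc subr_mult by metis
qed (simp add: subr_e)

lemma subr_pow': "subr A \<Longrightarrow> x \<in> A \<Longrightarrow> n > 0 \<Longrightarrow> x ^ n \<in> A"
proof -
  assume a: "subr A" "x \<in> A" "n > 0"
  then obtain m where n: "n = Suc m" by (cases n) auto
  have "x ^ n = (e * x) * x ^ m" using subr_unit[OF a(1,2)] n by simp
  also have "\<dots> = x * (e * x ^ m)" by (simp add: algebra_simps)
  finally show ?thesis using subr_mult[OF a(1,2) subr_pow[OF a(1,2)]] by metis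
qed

lemma subrI:
  assumes "\<And>x. x \<in> A \<Longrightarrow> e * x = x" "\<And>x y. x \<in> A \<Longrightarrow> y \<in> A \<Longrightarrow> x - y \<in> A"
    "\<And>x y. x \<in> A \<Longrightarrow> y \<in> A \<Longrightarrow> x * y \<in> A" "e \<in> A"
  shows "subr A"
proof -
  have "0 \<in> A" using assms(2)[OF assms(4) assms(4)] by simp
  then show ?thesis unfolding subr_def sm_def using assms by blast
qed

lemma subf_r: "subf k \<Longrightarrow> subr k" and subf_inv: "subf k \<Longrightarrow> x \<in> k \<Longrightarrow> x \<noteq> 0 \<Longrightarrow> \<exists>y\<in>k. x * y = e"
  unfolding subf_def by blast+

lemma no_zero_div:
  assumes "e * x = x" "x * y = 0" "e * y = y" "x \<noteq> 0" shows "y = 0"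
proof -
  obtain z where z: "x * z = e" using ex_inverse assms by blast
  have "y = (x * z) * y" using z assms by simp
  also have "\<dots> = z * (x * y)" by (simp add: algebra_simps)
  finally show ?thesis using assms by simp
qed

lemma cancel:
  assumes "e * x = x" "e * y = y" "e * z = z" "x \<noteq> 0" "x * y = x * z" shows "y = z"
  using no_zero_div[of x "y - z"] assms by (simp add: algebra_simps)

lemma power_nz:
  assumes "e * x = x" "x \<noteq> 0" "n > 0" shows "x ^ n \<noteq> 0"
  using assms(3)
proof (induction n rule: nat_induct_non_zero)
  case (Suc n)
  have "e * x ^ n = x ^ n" using Suc(1) assms(1)
    by (cases n) (auto simp: mult.assoc[symmetric])
  then show ?case using no_zero_div[of x "x ^ n"] assms Suc by auto
qed (use assms in simp)

lemma pow_e: "e * x = x \<Longrightarrow> n > 0 \<Longrightarrow> e * x ^ n = x ^ n"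
  by (cases n) (auto simp: mult.assoc[symmetric])

lemma e_pow: "n > 0 \<Longrightarrow> e ^ n = e"
  by (induction n rule: nat_induct_non_zero) (auto simp: ee)

lemma mprod_e: "x \<in> mprod A M \<Longrightarrow> (\<And>m. m \<in> M \<Longrightarrow> e * m = m) \<Longrightarrow> e * x = x"
  by (induction rule: mprod.induct) (auto simp: algebra_simps)

lemma mprod_add:
  assumes "y \<in> mprod A M" "x \<in> mprod A M" shows "x + y \<in> mprod A M"
  using assms(1)
proof (induction rule: mprod.induct)
  case (step y a m)
  have "x + y + a * m \<in> mprod A M" using mprod.step[OF step.IH step.hyps(2,3)] .
  then show ?case by (simp only: add.assoc)
qed (simp add: assms(2))

lemma mprod_mem: "a \<in> A \<Longrightarrow> m \<in> M \<Longrightarrow> a * m \<in> mprod A M"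
  using mprod.step[OF mprod.zero, of a A m M] by simp

lemma mprod_minus:
  assumes "x \<in> mprod A M" and A: "\<And>a. a \<in> A \<Longrightarrow> - a \<in> A"
  shows "- x \<in> mprod A M"
  using assms(1)
proof (induction rule: mprod.induct)
  case (step x a m)
  have "- (x + a * m) = - x + (- a) * m" by simp
  then show ?case using mprod.step[OF step.IH A[OF step.hyps(2)] step.hyps(3)] by metis
qed (simp add: mprod.zero)

lemma mprod_mult:
  assumes "x \<in> mprod A M" and "\<And>a m. a \<in> A \<Longrightarrow> m \<in> M \<Longrightarrow> b * (a * m) \<in> mprod A M"
  shows "b * x \<in> mprod A M"
  using assms(1)
proof (induction rule: mprod.induct)
  case (step x a m)
  have "b * (x + a * m) = b * x + b * (a * m)" by (simp add: algebra_simps)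
  then show ?case using mprod_add[OF assms(2)[OF step.hyps(2,3)] step.IH] by metis
qed (simp add: mprod.zero)

lemma mprod_sm:
  assumes "subr A" "\<And>m. m \<in> M \<Longrightarrow> e * m = m"
  shows "sm A (mprod A M)"
proof (rule smI)
  show "\<And>x. x \<in> mprod A M \<Longrightarrow> e * x = x" using mprod_e assms(2) by blast
  show "0 \<in> mprod A M" by (rule mprod.zero)
next
  fix x y assume x: "x \<in> mprod A M" and y: "y \<in> mprod A M"
  have "- y \<in> mprod A M" using y mprod_minus subr_minus[OF assms(1)] by blast
  from mprod_add[OF this x] show "x - y \<in> mprod A M" by simp
next
  fix b x assume b: "b \<in> A" and x: "x \<in> mprod A M"
  show "b * x \<in> mprod A M"
  proof (rule mprod_mult[OF x])
    fix a m assume "a \<in> A" "m \<in> M"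
    then have "(b * a) * m \<in> mprod A M" using subr_mult[OF assms(1) b] mprod_mem by blast
    then show "b * (a * m) \<in> mprod A M" by (simp add: mult.assoc)
  qed
qed

lemma mprod_sm2:
  assumes "subr A" "sm B M"
  shows "sm B (mprod A M)"
proof (rule smI)
  have me: "\<And>m. m \<in> M \<Longrightarrow> e * m = m" using assms(2) sm_e by blast
  show "\<And>x. x \<in> mprod A M \<Longrightarrow> e * x = x" using mprod_e me by blast
  show "0 \<in> mprod A M" by (rule mprod.zero)
  fix x y assume x: "x \<in> mprod A M" and y: "y \<in> mprod A M"
  have "- y \<in> mprod A M" using y mprod_minus subr_minus[OF assms(1)] by blast
  from mprod_add[OF this x] show "x - y \<in> mprod A M" by simp
next
  fix b x assume b: "b \<in> B" and x: "x \<in> mprod A M"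
  show "b * x \<in> mprod A M"
  proof (rule mprod_mult[OF x])
    fix a m assume "a \<in> A" "m \<in> M"
    then have "a * (b * m) \<in> mprod A M" using sm_mult[OF assms(2) b] mprod_mem by blast
    then show "b * (a * m) \<in> mprod A M" by (simp add: algebra_simps)
  qed
qed

lemma mprod_subset:
  assumes "sm A N" "\<And>m. m \<in> M \<Longrightarrow> m \<in> N"
  shows "mprod A M \<subseteq> N"
proof
  fix x assume "x \<in> mprod A M"
  then show "x \<in> N"
  proof (induction rule: mprod.induct)
    case (step x a m)
    show ?case using sm_add[OF assms(1) step.IH sm_mult[OF assms(1) step.hyps(2) assms(2)[OF step.hyps(3)]]] .
  qed (rule sm_0[OF assms(1)])
qed

lemma mprod_incl: "subr A \<Longrightarrow> (\<And>m. m \<in> M \<Longrightarrow> e * m = m) \<Longrightarrow> m \<in> M \<Longrightarrow> m \<in> mprod A M"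
  using mprod_mem[OF subr_e, of A m M] by simp

text \<open>The compositum. For \<open>R\<close> and \<open>K1\<close> it is the image of their
  tensor product in the common field, see \<open>tensor_map.tmap_image\<close>.\<close>

lemma mprod_subr:
  assumes "subr A" "subr B"
  shows "subr (mprod A B)"
proof (rule subrI)
  have be: "\<And>m. m \<in> B \<Longrightarrow> e * m = m" using assms(2) subr_unit by blast
  note s = mprod_sm[OF assms(1) be] and s2 = mprod_sm2[OF assms(1) subr_sm[OF assms(2)]]
  show "\<And>x. x \<in> mprod A B \<Longrightarrow> e * x = x" using s sm_e by blast
  show "\<And>x y. x \<in> mprod A B \<Longrightarrow> y \<in> mprod A B \<Longrightarrow> x - y \<in> mprod A B" using s sm_diff by blast
  show "e \<in> mprod A B" using mprod_mem[OF subr_e subr_e] assms ee by metis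
  fix x y assume x: "x \<in> mprod A B" and y: "y \<in> mprod A B"
  show "x * y \<in> mprod A B" using x
  proof (induction rule: mprod.induct)
    case (step x a m)
    have "(x + a * m) * y = x * y + a * (m * y)" by (simp add: algebra_simps)
    then show ?case using sm_add[OF s step.IH sm_mult[OF s step.hyps(2) sm_mult[OF s2 step.hyps(3) y]]] by simp
  qed (simp add: mprod.zero)
qed

lemma sumset_sm:
  assumes "sm A M" "sm A N" shows "sm A (sumset M N)"
proof (rule smI)
  show "\<And>x. x \<in> sumset M N \<Longrightarrow> e * x = x"
    using assms by (auto elim!: sumsetE simp: distrib_left sm_e)
  show "0 \<in> sumset M N" using sumsetI[OF sm_0[OF assms(1)] sm_0[OF assms(2)]] by simp
next
  fix x y assume "x \<in> sumset M N" "y \<in> sumset M N"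
  then obtain a b c d where *: "a \<in> M" "b \<in> N" "c \<in> M" "d \<in> N" "x = a + b" "y = c + d"
    by (metis sumsetE)
  have "x - y = (a - c) + (b - d)" using * by simp
  then show "x - y \<in> sumset M N" using sumsetI sm_diff assms * by metis
next
  fix a x assume a: "a \<in> A" "x \<in> sumset M N"
  then obtain b c where *: "b \<in> M" "c \<in> N" "x = b + c" by (metis sumsetE)
  have "a * x = a * b + a * c" using * by (simp add: algebra_simps)
  then show "a * x \<in> sumset M N" using sumsetI sm_mult assms * a by metis
qed

lemma sumset_least:
  assumes "sm A P" "M \<subseteq> P" "N \<subseteq> P" shows "sumset M N \<subseteq> P"
proof
  fix z assume "z \<in> sumset M N"
  then obtain x y where "x \<in> M" "y \<in> N" "z = x + y" by (rule sumsetE)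
  then show "z \<in> P" using sm_add[OF assms(1) subsetD[OF assms(2)] subsetD[OF assms(3)]] by blast
qed

lemma Int_sm: "sm A M \<Longrightarrow> sm A N \<Longrightarrow> sm A (M \<inter> N)"
  unfolding sm_def by blast

lemma times_sm:
  assumes "sm A M" "e * x = x" shows "sm A ((\<lambda>m. x * m) ` M)"
proof (rule smI)
  show "\<And>y. y \<in> (\<lambda>m. x * m) ` M \<Longrightarrow> e * y = y" using assms by (auto simp: mult.assoc[symmetric])
  show "0 \<in> (\<lambda>m. x * m) ` M" using sm_0[OF assms(1)] by force
next
  fix y z assume "y \<in> (\<lambda>m. x * m) ` M" "z \<in> (\<lambda>m. x * m) ` M"
  then obtain u v where *: "u \<in> M" "v \<in> M" "y = x * u" "z = x * v" by blast
  then have "y - z = x * (u - v)" by (simp add: algebra_simps)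
  then show "y - z \<in> (\<lambda>m. x * m) ` M" using sm_diff[OF assms(1)] * by blast
next
  fix a y assume a: "a \<in> A" "y \<in> (\<lambda>m. x * m) ` M"
  then obtain u where *: "u \<in> M" "y = x * u" by blast
  then have "a * y = x * (a * u)" by (simp add: algebra_simps)
  then show "a * y \<in> (\<lambda>m. x * m) ` M" using sm_mult[OF assms(1) a(1)] * by blast
qed

subsection \<open>Codimensions\<close>

lemma lext_sm:
  assumes "subr k" "sm k N" "e * x = x" shows "sm k (lext k x N)"
proof -
  have "lext k x N = sumset N ((\<lambda>m. x * m) ` k)"
  proof (intro Set.set_eqI iffI)
    fix z assume "z \<in> lext k x N"
    then obtain y c where "y \<in> N" "c \<in> k" "z = y + c * x" by (rule lextE)
    then show "z \<in> sumset N ((\<lambda>m. x * m) ` k)"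
      using sumsetI[of y N "x * c" "(\<lambda>m. x * m) ` k"] imageI[of c k "\<lambda>m. x * m"] by (simp add: mult.commute)
  next
    fix z assume "z \<in> sumset N ((\<lambda>m. x * m) ` k)"
    then obtain y c where "y \<in> N" "c \<in> k" "z = y + x * c" unfolding sumset_def by blast
    then show "z \<in> lext k x N" using lextI[of y N c k x] by (simp add: mult.commute)
  qed
  then show ?thesis using sumset_sm[OF assms(2) times_sm[OF subr_sm[OF assms(1)] assms(3)]] by simp
qed

lemma lext_incl: "subr k \<Longrightarrow> N \<subseteq> lext k x N"
proof
  fix y assume "subr k" "y \<in> N"
  then have "y + 0 * x \<in> lext k x N" by (intro lextI subr_0)
  then show "y \<in> lext k x N" by simp
qed

lemma lext_self:
  assumes "subr k" "e * x = x" "0 \<in> N" shows "x \<in> lext k x N"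
proof -
  have "0 + e * x \<in> lext k x N" using lextI[OF assms(3) subr_e[OF assms(1)]] .
  then show ?thesis by (simp only: assms add_0)
qed

lemma lext_least:
  assumes "sm k P" "N \<subseteq> P" "x \<in> P" shows "lext k x N \<subseteq> P"
proof
  fix z assume "z \<in> lext k x N"
  then obtain y c where "y \<in> N" "c \<in> k" "z = y + c * x" by (rule lextE)
  then show "z \<in> P" using sm_add[OF assms(1) subsetD[OF assms(2)] sm_mult[OF assms(1) _ assms(3)]] by blast
qed

text \<open>Steinitz exchange: the coefficient of \<open>x\<close> in \<open>z\<close> is nonzero
  because \<open>z\<close> is outside \<open>N\<close>, so the equation can be solved for
  \<open>x\<close>.\<close>

lemma lext_exchange:
  assumes k: "subf k" and N: "sm k N" and x: "e * x = x" and z: "z \<in> lext k x N" "z \<notin> N"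
  shows "lext k z N = lext k x N"
proof
  have kr: "subr k" using k subf_r by blast
  have s: "sm k (lext k x N)" using lext_sm kr N x by blast
  show "lext k z N \<subseteq> lext k x N" using lext_least[OF s lext_incl[OF kr] z(1)] .
  obtain y c where yc: "y \<in> N" "c \<in> k" "z = y + c * x" using z(1) by (rule lextE)
  have "c \<noteq> 0" using yc z by auto
  then obtain d where d: "d \<in> k" "c * d = e" using subf_inv k yc by blast
  have ze: "e * z = z" using sm_e s z by blast
  have s': "sm k (lext k z N)" using lext_sm kr N ze by blast
  have "x = (c * d) * x" using d x by simp
  also have "\<dots> = d * (z - y)" using yc by (simp add: algebra_simps)
  finally have "x = d * (z - y)" .
  moreover have "z - y \<in> lext k z N"
    using sm_diff[OF s' lext_self[OF kr ze sm_0[OF N]] subsetD[OF lext_incl[OF kr] yc(1)]] .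
  ultimately have "x \<in> lext k z N" using sm_mult[OF s' d(1)] by blast
  then show "lext k x N \<subseteq> lext k z N" using lext_least[OF s' lext_incl[OF kr]] by blast
qed

text \<open>The dimension of \<open>N/M\<close> over \<open>k\<close>, counted along a chain that
  adjoins one new vector at a time. No quotient space is formed, \<open>M\<close> may be infinite
  dimensional, and finiteness is part of the statement.\<close>

inductive codim :: "'u set \<Rightarrow> 'u set \<Rightarrow> nat \<Rightarrow> 'u set \<Rightarrow> bool" for k M where
  codim_refl: "codim k M 0 M"
| codim_lext: "codim k M n N \<Longrightarrow> e * x = x \<Longrightarrow> x \<notin> N \<Longrightarrow> codim k M (Suc n) (lext k x N)"

lemma codim_sm: "codim k M n N \<Longrightarrow> subr k \<Longrightarrow> sm k M \<Longrightarrow> sm k N"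
  by (induction rule: codim.induct) (auto intro: lext_sm)

lemma codim_incl: "codim k M n N \<Longrightarrow> subr k \<Longrightarrow> M \<subseteq> N"
  by (induction rule: codim.induct) (use lext_incl in blast)+

lemma codim_trans: "codim k N m P \<Longrightarrow> codim k M n N \<Longrightarrow> codim k M (n + m) P"
  by (induction rule: codim.induct) (auto intro: codim.intros)

lemma codim_Suc_proper:
  assumes "codim k M (Suc n) N" "subr k" "sm k M" shows "M \<noteq> N"
  using assms(1)
proof cases
  case (codim_lext N' x)
  then have "M \<subseteq> N'" using codim_incl assms(2) by blast
  moreover have "x \<in> N"
    using codim_lext lext_self[OF assms(2)] sm_0[OF codim_sm[OF _ assms(2,3)]] by blast
  ultimately show ?thesis using codim_lext by blast
qed

lemma codim_self: "codim k M n M \<Longrightarrow> subr k \<Longrightarrow> sm k M \<Longrightarrow> n = 0"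
  using codim_Suc_proper by (cases n) blast+

lemma codim_0: "codim k M 0 N \<Longrightarrow> N = M"
  by (erule codim.cases) auto

text \<open>The elements of \<open>Z\<close> are adjoined in turn and those already reached are
  skipped, so each contributes at most one.\<close>

lemma codim_spanned:
  assumes k: "subf k" and M: "sm k M" and "finite Z" and "\<forall>x\<in>Z. e * x = x"
  shows "\<exists>n\<le>card Z. codim k M n (sumset M (mprod k Z))"
  using assms(3,4)
proof (induction Z rule: finite_induct)
  case empty
  have "mprod k {} = {0}"
    using mprod.zero by (auto elim: mprod.cases)
  then have "sumset M (mprod k {}) = M" by (auto simp: sumset_def)
  then show ?case using codim_refl by force
next
  case (insert z Z)
  have kr: "subr k" using k subf_r by blast
  obtain n where n: "n \<le> card Z" "codim k M n (sumset M (mprod k Z))" using insert by auto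
  have ze: "\<And>m. m \<in> insert z Z \<Longrightarrow> e * m = m" using insert by blast
  have sZ: "sm k (mprod k Z)" using mprod_sm[OF kr] ze by blast
  have szZ: "sm k (mprod k (insert z Z))" using mprod_sm[where M = "insert z Z", OF kr] ze by blast
  have sMZ: "sm k (sumset M (mprod k Z))" using sumset_sm[OF M sZ] .
  have sMzZ: "sm k (sumset M (mprod k (insert z Z)))" using sumset_sm[OF M szZ] .
  have eq: "lext k z (sumset M (mprod k Z)) = sumset M (mprod k (insert z Z))"
  proof
    have "sumset M (mprod k Z) \<subseteq> sumset M (mprod k (insert z Z))"
      using mprod_mono[of k k Z "insert z Z"] unfolding sumset_def by blast
    moreover have "z \<in> sumset M (mprod k (insert z Z))"
      using sumsetI[OF sm_0[OF M] mprod_incl[OF kr, of "insert z Z" z]] ze by simp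
    ultimately show "lext k z (sumset M (mprod k Z)) \<subseteq> sumset M (mprod k (insert z Z))"
      using lext_least[OF sMzZ] by blast
    have ex: "sm k (lext k z (sumset M (mprod k Z)))" using lext_sm[OF kr sMZ] ze by blast
    have in1: "M \<subseteq> lext k z (sumset M (mprod k Z))" and in2: "mprod k Z \<subseteq> lext k z (sumset M (mprod k Z))"
    proof -
      have "M \<subseteq> sumset M (mprod k Z)" "mprod k Z \<subseteq> sumset M (mprod k Z)"
        using sumset_incl1[OF mprod.zero] sumset_incl2[OF sm_0[OF M]] by blast+
      then show "M \<subseteq> lext k z (sumset M (mprod k Z))" "mprod k Z \<subseteq> lext k z (sumset M (mprod k Z))"
        using lext_incl[OF kr, of "sumset M (mprod k Z)" z] by blast+
    qed
    have zi: "z \<in> lext k z (sumset M (mprod k Z))" using lext_self[OF kr] ze sm_0[OF sMZ] by blast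
    have "mprod k (insert z Z) \<subseteq> lext k z (sumset M (mprod k Z))"
    proof (rule mprod_subset[OF ex])
      fix m assume "m \<in> insert z Z"
      then show "m \<in> lext k z (sumset M (mprod k Z))"
        using zi in2 mprod_incl[OF kr, of Z m] ze by blast
    qed
    then show "sumset M (mprod k (insert z Z)) \<subseteq> lext k z (sumset M (mprod k Z))"
      using sumset_least[OF ex in1] by blast
  qed
  show ?case
  proof (cases "z \<in> sumset M (mprod k Z)")
    case True
    then have "lext k z (sumset M (mprod k Z)) = sumset M (mprod k Z)"
      using lext_least[OF sMZ] lext_incl[OF kr] by blast
    then show ?thesis using n eq insert by (auto intro!: exI[of _ n])
  next
    case False
    then have "codim k M (Suc n) (lext k z (sumset M (mprod k Z)))"
      using codim_lext n ze by blast
    then show ?thesis using n eq insert by auto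
  qed
qed

text \<open>The vectors adjoined along the chain generate. This turns a codimension back into a
  generating set, the form that is carried through Frobenius and to quotient spaces.\<close>

lemma codim_span:
  assumes "codim k M n N" "subr k" "sm k M"
  shows "\<exists>Z. finite Z \<and> card Z \<le> n \<and> Z \<subseteq> N \<and> N = sumset M (mprod k Z)"
  using assms(1)
proof (induction rule: codim.induct)
  case codim_refl
  have "mprod k {} = {0}"
    using mprod.zero by (auto elim: mprod.cases)
  then have "sumset M (mprod k {}) = M" by (auto simp: sumset_def)
  then show ?case by (intro exI[of _ "{}"]) simp
next
  case (codim_lext n N x)
  note kr = assms(2) and M = assms(3)
  obtain Z where Z: "finite Z" "card Z \<le> n" "Z \<subseteq> N" "N = sumset M (mprod k Z)"
    using codim_lext by blast
  have sN: "sm k N" using codim_sm codim_lext assms by blast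
  have sL: "sm k (lext k x N)" using lext_sm[OF kr sN] codim_lext by blast
  have xL: "x \<in> lext k x N" using lext_self[OF kr codim_lext(2) sm_0[OF sN]] .
  have ZL: "insert x Z \<subseteq> lext k x N" using xL Z lext_incl[OF kr] by blast
  have "lext k x N = sumset M (mprod k (insert x Z))"
  proof
    have inc: "M \<subseteq> lext k x N" using codim_incl[OF codim_lext(1) kr] lext_incl[OF kr] by (rule subset_trans)
    have "mprod k (insert x Z) \<subseteq> lext k x N" by (rule mprod_subset[OF sL subsetD[OF ZL]])
    then show "sumset M (mprod k (insert x Z)) \<subseteq> lext k x N" using sumset_least[OF sL inc] by blast
  next
    show "lext k x N \<subseteq> sumset M (mprod k (insert x Z))"
    proof
      fix w assume "w \<in> lext k x N"
      then obtain y c where yc: "y \<in> N" "c \<in> k" "w = y + c * x" by (rule lextE)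
      then obtain u v where uv: "u \<in> M" "v \<in> mprod k Z" "y = u + v" using Z sumsetE by metis
      have "v \<in> mprod k (insert x Z)" using uv(2) mprod_mono[OF subset_refl, of Z "insert x Z" k] by blast
      then have "v + c * x \<in> mprod k (insert x Z)" using mprod.step[OF _ yc(2)] by blast
      then have "u + (v + c * x) \<in> sumset M (mprod k (insert x Z))" using sumsetI[OF uv(1)] by blast
      then show "w \<in> sumset M (mprod k (insert x Z))" using yc(3) uv(3) by (simp only: add.assoc)
    qed
  qed
  moreover have "card (insert x Z) \<le> Suc n" using Z by (simp add: card_insert_if)
  ultimately show ?case using Z(1) ZL by (intro exI[of _ "insert x Z"] conjI) simp_all
qed

text \<open>A vector outside the top of the chain is outside every link. By exchange, adjoining it
  to all links keeps all steps proper.\<close>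

lemma codim_lext_both:
  assumes "codim k Q b N" and k: "subf k" and Q: "sm k Q" and y: "e * y = y"
  shows "y \<notin> N \<Longrightarrow> codim k (lext k y Q) b (lext k y N)"
  using assms(1)
proof (induction rule: codim.induct)
  case codim_refl
  show ?case by (rule codim.codim_refl)
next
  case (codim_lext n N x)
  have kr: "subr k" using k subf_r by blast
  have sN: "sm k N" using codim_sm codim_lext kr Q by blast
  have yN: "y \<notin> N" using codim_lext lext_incl[OF kr, of N x] by blast
  have xy: "x \<notin> lext k y N"
  proof
    assume "x \<in> lext k y N"
    then have "lext k x N = lext k y N"
      using lext_exchange[OF k sN y] codim_lext by blast
    then show False using codim_lext lext_self[OF kr y sm_0[OF sN]] by blast
  qed
  have "lext k y (lext k x N) = lext k x (lext k y N)"
  proof -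
    have "lext k a (lext k b N) \<subseteq> lext k b (lext k a N)" for a b
    proof
      fix z assume "z \<in> lext k a (lext k b N)"
      then obtain n c d where "n \<in> N" "c \<in> k" "d \<in> k" "z = (n + d * b) + c * a"
        unfolding lext_def by blast
      then have "z = (n + c * a) + d * b" "n + c * a \<in> lext k a N" using lextI[of n N c k a] by (simp_all add: ac_simps)
      then show "z \<in> lext k b (lext k a N)" using lextI \<open>d \<in> k\<close> by metis
    qed
    then show ?thesis by blast
  qed
  then show ?case using codim.codim_lext[OF codim_lext.IH[OF yN] codim_lext.hyps(2) xy] by simp
qed

text \<open>Additivity of dimension. Intersect \<open>P\<close> with the last but one link
  \<open>N\<close>: either \<open>P\<close> lies in \<open>N\<close>, or a vector of
  \<open>P\<close> outside \<open>N\<close> generates both \<open>P\<close> over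
  \<open>P \<inter> N\<close> and the last step of the chain.\<close>

lemma codim_between:
  assumes "codim k M n N" and k: "subf k" and M: "sm k M"
  shows "M \<subseteq> P \<Longrightarrow> P \<subseteq> N \<Longrightarrow> sm k P \<Longrightarrow> \<exists>a b. codim k M a P \<and> codim k P b N \<and> a + b = n"
  using assms(1)
proof (induction arbitrary: P rule: codim.induct)
  case codim_refl
  then have "P = M" by blast
  then show ?case using codim.codim_refl by (intro exI[of _ 0]) simp
next
  case (codim_lext n N x)
  have kr: "subr k" using k subf_r by blast
  have sN: "sm k N" using codim_sm codim_lext kr M by blast
  have sL: "sm k (lext k x N)" using lext_sm[OF kr sN] codim_lext by blast
  have MN: "M \<subseteq> N" using codim_incl[OF codim_lext(1) kr] .
  have "M \<subseteq> P \<inter> N" "P \<inter> N \<subseteq> N" "sm k (P \<inter> N)"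
    using codim_lext.prems(1) MN Int_sm[OF codim_lext.prems(3) sN] by simp_all
  then obtain a b where ab: "codim k M a (P \<inter> N)" "codim k (P \<inter> N) b N" "a + b = n"
    using codim_lext.IH by blast
  show ?case
  proof (cases "P \<subseteq> N")
    case True
    then have "P \<inter> N = P" by blast
    then show ?thesis using ab codim.codim_lext[OF _ codim_lext.hyps(2,3), of k P b]
      by (intro exI[of _ a] exI[of _ "Suc b"]) simp
  next
    case False
    then obtain y where y: "y \<in> P" "y \<notin> N" by blast
    have ye: "e * y = y" using sm_e codim_lext.prems(3) y by blast
    have L: "lext k y N = lext k x N"
      using lext_exchange[OF k sN codim_lext.hyps(2)] y codim_lext.prems by blast
    have PL: "lext k y (P \<inter> N) = P"
    proof
      show "lext k y (P \<inter> N) \<subseteq> P" using lext_least[OF codim_lext.prems(3)] y by blast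
      show "P \<subseteq> lext k y (P \<inter> N)"
      proof
        fix z assume z: "z \<in> P"
        then have "z \<in> lext k y N" using L codim_lext.prems by blast
        then obtain u c where uc: "u \<in> N" "c \<in> k" "z = u + c * y" by (rule lextE)
        have "u = z - c * y" using uc by simp
        then have "u \<in> P" using sm_diff[OF codim_lext.prems(3) z sm_mult[OF codim_lext.prems(3) uc(2) y(1)]] by simp
        then show "z \<in> lext k y (P \<inter> N)" using uc lextI[of u "P \<inter> N" c k y] by simp
      qed
    qed
    have "codim k M (Suc a) P" using codim.codim_lext[OF ab(1) ye] y PL by auto
    moreover have "codim k P b (lext k x N)"
      using codim_lext_both[OF ab(2) k _ ye y(2)] Int_sm[OF codim_lext.prems(3) sN] PL L by simp
    ultimately show ?thesis using ab by (intro exI[of _ "Suc a"] exI[of _ b]) simp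
  qed
qed

text \<open>Invariance of dimension. By additivity the second chain can be routed through the last
  but one link of the first, and the induction hypothesis applies below it.\<close>

lemma codim_unique:
  assumes "codim k M n N" and k: "subf k" and M: "sm k M"
  shows "codim k M m N \<Longrightarrow> n = m"
  using assms(1)
proof (induction arbitrary: m rule: codim.induct)
  case codim_refl
  then show ?case using codim_self[OF _ subf_r[OF k] M] by simp
next
  case (codim_lext n N x)
  have kr: "subr k" using k subf_r by blast
  have sN: "sm k N" using codim_sm codim_lext kr M by blast
  have MN: "M \<subseteq> N" using codim_incl[OF codim_lext.hyps(1) kr] .
  obtain a b where ab: "codim k M a N" "codim k N b (lext k x N)" "a + b = m"
    using codim_between[OF codim_lext.prems k M MN lext_incl[OF kr] sN] by blast
  \<comment> \<open>No space lies strictly between \<open>N\<close> and \<open>lext k x N\<close>: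
    by exchange, any vector of it outside \<open>N\<close> already regenerates the whole.\<close>
  have "b = 1"
    using ab(2)
  proof cases
    case codim_refl
    then show ?thesis using codim_lext.hyps lext_self[OF kr _ sm_0[OF sN]] by blast
  next
    case (codim_lext n' Q w)
    note c = this
    have sQ: "sm k Q" using codim_sm[OF c(3) kr sN] .
    have NQ: "N \<subseteq> Q" using codim_incl[OF c(3) kr] .
    have wL: "w \<in> lext k x N" using c lext_self[OF kr c(4) sm_0[OF sQ]] by simp
    have "Q \<subseteq> N"
    proof (rule ccontr)
      assume "\<not> Q \<subseteq> N"
      then obtain z where z: "z \<in> Q" "z \<notin> N" by blast
      then have "z \<in> lext k x N" using c lext_incl[OF kr, of Q w] by blast
      then have "lext k z N = lext k x N" using lext_exchange[OF k sN codim_lext.hyps(2)] z by blast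
      then have "w \<in> Q" using wL lext_least[OF sQ NQ z(1)] by blast
      then show False using c by blast
    qed
    then have "n' = 0" using c NQ codim_self[OF _ kr sN] by (metis subset_antisym)
    then show ?thesis using c by simp
  qed
  then show ?case using codim_lext.IH[OF ab(1)] ab by simp
qed

text \<open>The map may be semilinear along \<open>\<chi>\<close>. It is applied to the p-th power,
  which changes the field of scalars, and to multiplication by a nonzero element.\<close>

lemma codim_image:
  assumes "codim k M n N" and kr: "subr k" and M: "sm k M"
    and add: "\<And>x y. e * x = x \<Longrightarrow> e * y = y \<Longrightarrow> \<phi> (x + y) = \<phi> x + \<phi> y"
    and \<phi>e: "\<And>x. e * x = x \<Longrightarrow> e * \<phi> x = \<phi> x"
    and inj: "\<And>x y. e * x = x \<Longrightarrow> e * y = y \<Longrightarrow> \<phi> x = \<phi> y \<Longrightarrow> x = y"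
    and scal: "\<And>c x. c \<in> k \<Longrightarrow> e * x = x \<Longrightarrow> \<phi> (c * x) = \<chi> c * \<phi> x"
  shows "codim (\<chi> ` k) (\<phi> ` M) n (\<phi> ` N)"
  using assms(1)
proof (induction rule: codim.induct)
  case codim_refl
  show ?case by (rule codim.codim_refl)
next
  case (codim_lext n N x)
  have sN: "sm k N" using codim_sm codim_lext kr M by blast
  have eN: "\<And>y. y \<in> N \<Longrightarrow> e * y = y" using sm_e sN by blast
  have "\<phi> x \<notin> \<phi> ` N" using inj codim_lext eN by blast
  then have *: "codim (\<chi> ` k) (\<phi> ` M) (Suc n) (lext (\<chi> ` k) (\<phi> x) (\<phi> ` N))"
    using codim.codim_lext[OF codim_lext.IH \<phi>e[OF codim_lext.hyps(2)]] by blast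
  have eq: "\<phi> (y + c * x) = \<phi> y + \<chi> c * \<phi> x" if "y \<in> N" "c \<in> k" for y c
  proof -
    have "e * (c * x) = c * x" using codim_lext.hyps(2) by (metis mult.left_commute)
    then show ?thesis using add[OF eN[OF that(1)]] scal[OF that(2) codim_lext.hyps(2)] by simp
  qed
  have "lext (\<chi> ` k) (\<phi> x) (\<phi> ` N) = \<phi> ` lext k x N"
  proof
    show "lext (\<chi> ` k) (\<phi> x) (\<phi> ` N) \<subseteq> \<phi> ` lext k x N"
    proof
      fix z assume "z \<in> lext (\<chi> ` k) (\<phi> x) (\<phi> ` N)"
      then obtain y c where "y \<in> N" "c \<in> k" "z = \<phi> y + \<chi> c * \<phi> x" unfolding lext_def by blast
      then show "z \<in> \<phi> ` lext k x N" using eq lextI by (metis imageI)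
    qed
    show "\<phi> ` lext k x N \<subseteq> lext (\<chi> ` k) (\<phi> x) (\<phi> ` N)"
      using eq unfolding lext_def by blast
  qed
  then show ?case using * by simp
qed

text \<open>Second isomorphism theorem: \<open>M \<inter> P \<subseteq> Q\<close> makes
  \<open>P/Q\<close> inject into the quotient of \<open>M + P\<close> by
  \<open>M + Q\<close>.\<close>

lemma codim_diamond:
  assumes "codim k Q n P" and kr: "subr k" and Q: "sm k Q" and M: "sm k M"
  shows "M \<inter> P \<subseteq> Q \<Longrightarrow> codim k (sumset M Q) n (sumset M P)"
  using assms(1)
proof (induction rule: codim.induct)
  case codim_refl
  show ?case by (rule codim.codim_refl)
next
  case (codim_lext n P x)
  have sP: "sm k P" using codim_sm[OF codim_lext.hyps(1) kr Q] .
  have PL: "P \<subseteq> lext k x P" using lext_incl[OF kr] .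
  have QP: "Q \<subseteq> P" using codim_incl[OF codim_lext.hyps(1) kr] .
  have sL: "sm k (lext k x P)" using lext_sm[OF kr sP codim_lext.hyps(2)] .
  have xL: "x \<in> lext k x P" using lext_self[OF kr codim_lext.hyps(2) sm_0[OF sP]] .
  have "x \<notin> sumset M P"
  proof
    assume "x \<in> sumset M P"
    then obtain m q where mq: "m \<in> M" "q \<in> P" "x = m + q" by (metis sumsetE)
    then have "m \<in> lext k x P" using sm_diff[OF sL xL, of q] PL by auto
    then have "m \<in> P" using mq codim_lext.prems QP by blast
    then show False using sm_add[OF sP] mq codim_lext.hyps by blast
  qed
  then have *: "codim k (sumset M Q) (Suc n) (lext k x (sumset M P))"
    using codim.codim_lext codim_lext PL by blast
  have "lext k x (sumset M P) = sumset M (lext k x P)"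
  proof (intro Set.set_eqI iffI)
    fix z assume "z \<in> lext k x (sumset M P)"
    then obtain m q c where "m \<in> M" "q \<in> P" "c \<in> k" "z = m + (q + c * x)"
      by (elim lextE sumsetE) (metis add.assoc)
    then show "z \<in> sumset M (lext k x P)"
      using sumsetI[of m M "q + c * x" "lext k x P"] lextI[of q P c k x] by simp
  next
    fix z assume "z \<in> sumset M (lext k x P)"
    then obtain m q c where "m \<in> M" "q \<in> P" "c \<in> k" "z = m + q + c * x"
      by (elim lextE sumsetE) (metis add.assoc)
    then show "z \<in> lext k x (sumset M P)"
      using sumsetI[of m M q P] lextI[of "m + q" "sumset M P" c k x] by simp
  qed
  then show ?case using * by simp
qed

lemma sumset_absorb:
  assumes "sm A M" "N \<subseteq> M" "0 \<in> N" shows "sumset M N = M"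
proof
  show "sumset M N \<subseteq> M" using sumset_least[OF assms(1) subset_refl assms(2)] .
  show "M \<subseteq> sumset M N" using sumset_incl1[OF assms(3)] .
qed

end

section \<open>Extending scalars along a Frobenius subring\<close>

lemma (in idf) e_absorb: "e * x = x \<Longrightarrow> x * (e * y) = x * y"
  by (simp add: mult.assoc[symmetric] mult.commute[of x e])

lemma (in idf) sm_mprod_scalars:
  assumes "sm A Xs" "sm B Xs" shows "sm (mprod A B) Xs"
proof (rule smI)
  show "\<And>x. x \<in> Xs \<Longrightarrow> e * x = x" "0 \<in> Xs" "\<And>x y. x \<in> Xs \<Longrightarrow> y \<in> Xs \<Longrightarrow> x - y \<in> Xs"
    using sm_e[OF assms(1)] sm_0[OF assms(1)] sm_diff[OF assms(1)] by blast+
  fix c x assume "c \<in> mprod A B" "x \<in> Xs"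
  then show "c * x \<in> Xs"
  proof (induction rule: mprod.induct)
    case (step c a m)
    have "c * x + a * (m * x) \<in> Xs"
      using sm_add[OF assms(1) step.IH[OF step.prems] sm_mult[OF assms(1) step.hyps(2) sm_mult[OF assms(2) step.hyps(3) step.prems]]] .
    then show ?case by (simp add: algebra_simps)
  qed (simp add: sm_0[OF assms(1)])
qed

locale idf_char = idf e for e :: "'u::comm_ring_1" +
  fixes p :: nat
  assumes prime_p: "Factorial_Ring.prime p" and char_p: "of_nat p * e = 0"
begin

lemma p0: "p > 0" using prime_p by (rule prime_gt_0_nat)

lemma frob:
  assumes "e * x = x" "e * y = y" shows "(x + y) ^ p = x ^ p + y ^ p"
proof -
  have z: "of_nat (p choose k) * x ^ k * y ^ (p - k) = 0" if k: "k \<in> {1..<p}" for k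
  proof -
    have "p dvd (p choose k)" by (rule dvd_choose_prime) (use k prime_p in auto)
    then obtain m where m: "p choose k = p * m" by blast
    \<comment> \<open>The ambient ring itself need not have characteristic \<open>p\<close>. Only
      the \<open>p\<close>-fold of \<open>e\<close> vanishes, so a factor \<open>e\<close> is split
      off from \<open>x ^ k\<close>.\<close>
    have "x ^ k = e * x ^ k" using pow_e[OF assms(1)] k by simp
    then have "of_nat (p choose k) * x ^ k * y ^ (p - k) = of_nat m * (of_nat p * e) * (x ^ k * y ^ (p - k))"
      unfolding m by (metis (no_types, lifting) mult.assoc mult.commute of_nat_mult)
    then show ?thesis using char_p by simp
  qed
  have "{..p} = insert 0 (insert p {1..<p})" using p0 by auto
  then have "(x + y) ^ p = (\<Sum>k\<in>insert 0 (insert p {1..<p}). of_nat (p choose k) * x ^ k * y ^ (p - k))"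
    by (simp add: binomial_ring)
  also have "\<dots> = y ^ p + (x ^ p + (\<Sum>k\<in>{1..<p}. of_nat (p choose k) * x ^ k * y ^ (p - k)))"
    using p0 by simp
  also have "(\<Sum>k\<in>{1..<p}. of_nat (p choose k) * x ^ k * y ^ (p - k)) = 0" using z by (intro sum.neutral) blast
  finally show ?thesis by (simp add: add.commute)
qed

lemma frob_diff:
  assumes "e * x = x" "e * y = y" shows "(x - y) ^ p = x ^ p - y ^ p"
  using frob[of "x - y" y] assms by (simp add: right_diff_distrib eq_diff_eq)

lemma frob_subr:
  assumes "subr Xs" shows "subr ((\<lambda>s. s ^ p) ` Xs)"
proof (rule subrI)
  show "e \<in> (\<lambda>s. s ^ p) ` Xs" using subr_e[OF assms] e_pow[OF p0] by force
next
  fix x assume "x \<in> (\<lambda>s. s ^ p) ` Xs"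
  then show "e * x = x" using pow_e[OF subr_unit[OF assms] p0] by blast
next
  fix x y assume "x \<in> (\<lambda>s. s ^ p) ` Xs" "y \<in> (\<lambda>s. s ^ p) ` Xs"
  then obtain a b where ab: "a \<in> Xs" "b \<in> Xs" "x = a ^ p" "y = b ^ p" by blast
  have "x - y = (a - b) ^ p" using frob_diff[OF subr_unit[OF assms] subr_unit[OF assms]] ab by simp
  then show "x - y \<in> (\<lambda>s. s ^ p) ` Xs" using subr_diff[OF assms] ab by blast
  have "x * y = (a * b) ^ p" using ab by (simp add: power_mult_distrib)
  then show "x * y \<in> (\<lambda>s. s ^ p) ` Xs" using subr_mult[OF assms] ab by blast
qed

lemma frob_subf:
  assumes "subf Xs" shows "subf ((\<lambda>s. s ^ p) ` Xs)"
  unfolding subf_def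
proof (intro conjI ballI impI)
  show "subr ((\<lambda>s. s ^ p) ` Xs)" using frob_subr[OF subf_r[OF assms]] .
  fix x assume x: "x \<in> (\<lambda>s. s ^ p) ` Xs" "x \<noteq> 0"
  then obtain a where a: "a \<in> Xs" "x = a ^ p" by blast
  then have "a \<noteq> 0" using x p0 by (auto simp: power_0_left)
  then obtain b where b: "b \<in> Xs" "a * b = e" using subf_inv[OF assms a(1)] by blast
  then have "x * b ^ p = e" using a e_pow[OF p0] by (metis power_mult_distrib)
  then show "\<exists>y\<in>(\<lambda>s. s ^ p) ` Xs. x * y = e" using b by blast
qed

lemma frob_inj:
  assumes "e * x = x" "e * y = y" "x ^ p = y ^ p" shows "x = y"
proof (rule ccontr)
  assume "x \<noteq> y"
  moreover have "e * (x - y) = x - y" using assms by (simp add: right_diff_distrib)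
  ultimately have "(x - y) ^ p \<noteq> 0" using power_nz[OF _ _ p0] by simp
  then show False using frob_diff[OF assms(1,2)] assms(3) by simp
qed

end

section \<open>The local ring \<open>D\<close> generated by \<open>A\<close> and
  \<open>k2\<close>\<close>

locale core = idf_char e p for e :: "'u::comm_ring_1" and p +
  fixes S R K1 k2 :: "'u set" and t :: 'u
  assumes S: "subr S" and R: "subr R" and RS: "R \<subseteq> S"
    and K1: "subf K1" and K1S: "K1 \<subseteq> S" and k2: "subf k2" and k2K1: "k2 \<subseteq> K1"
    and k0k2: "(\<lambda>c. c ^ p) ` K1 \<subseteq> k2" and AR: "(\<lambda>s. s ^ p) ` S \<subseteq> R"
    and tS: "t \<in> S" and t0: "t \<noteq> 0" and t_nonunit: "\<And>v. v \<in> S \<Longrightarrow> t * v \<noteq> e"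
    and dvr: "\<And>s. s \<in> S \<Longrightarrow> s \<noteq> 0 \<Longrightarrow> \<exists>j u v. u \<in> S \<and> v \<in> S \<and> u * v = e \<and> s = u * t ^ j"
begin

definition "A = (\<lambda>s. s ^ p) ` S"
definition "k0 = (\<lambda>c. c ^ p) ` K1"
definition "D = mprod A k2"
definition "T = mprod R K1"
definition "\<pi> = t ^ p"
text \<open>The contraction to \<open>D\<close> of the maximal ideal of \<open>S\<close>; by
  \<open>D_cases\<close> it is the maximal ideal of \<open>D\<close>.\<close>

definition "n = {d \<in> D. \<exists>s\<in>S. d = t * s}"
text \<open>The fraction field of \<open>D\<close>. Denominators from \<open>A\<close> suffice
  because \<open>d ^ p \<in> A\<close> for every \<open>d\<close> in \<open>D\<close>, and in
  \<open>A\<close> they can be taken apart into powers of \<open>\<pi>\<close>.\<close>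

definition "V = {v. e * v = v \<and> (\<exists>a\<in>A. a \<noteq> 0 \<and> a * v \<in> D)}"

lemma subr_A: "subr A" unfolding A_def by (rule frob_subr[OF S])
lemma subf_k0: "subf k0" unfolding k0_def by (rule frob_subf[OF K1])
lemma subr_D: "subr D" unfolding D_def by (rule mprod_subr[OF subr_A subf_r[OF k2]])
lemma subr_T: "subr T" unfolding T_def by (rule mprod_subr[OF R subf_r[OF K1]])
lemma subr_K1: "subr K1" using subf_r[OF K1] .
lemma subr_k2: "subr k2" using subf_r[OF k2] .

lemma A_R: "A \<subseteq> R" using AR A_def by simp
lemma D_T: "D \<subseteq> T" unfolding D_def T_def by (rule mprod_mono[OF A_R k2K1])
lemma k2_D: "k2 \<subseteq> D"
  unfolding D_def using mprod_incl[OF subr_A subr_unit[OF subr_k2]] by blast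
lemma A_D: "A \<subseteq> D"
proof
  fix a assume "a \<in> A"
  then have "e * a = a" "a * e \<in> D" unfolding D_def
    using subr_unit[OF subr_A] mprod_mem[OF _ subr_e[OF subr_k2]] by blast+
  then show "a \<in> D" by (simp add: mult.commute)
qed
lemma K1_T: "K1 \<subseteq> T"
  unfolding T_def using mprod_incl[OF R subr_unit[OF subr_K1]] by blast
lemma R_T: "R \<subseteq> T"
proof
  fix a assume "a \<in> R"
  then have "e * a = a" "a * e \<in> T" unfolding T_def
    using subr_unit[OF R] mprod_mem[OF _ subr_e[OF subr_K1]] by blast+
  then show "a \<in> T" by (simp add: mult.commute)
qed
lemma T_S: "T \<subseteq> S"
  unfolding T_def using mprod_subset[OF sm_subset[OF subr_sm[OF S] RS] subsetD[OF K1S]] .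
lemma D_S: "D \<subseteq> S" using D_T T_S by blast

lemma te: "e * t = t" using subr_unit[OF S tS] .
lemma \<pi>e: "e * \<pi> = \<pi>" unfolding \<pi>_def using pow_e[OF te p0] .
lemma \<pi>0: "\<pi> \<noteq> 0" unfolding \<pi>_def using power_nz[OF te t0 p0] .
lemma \<pi>A: "\<pi> \<in> A" unfolding \<pi>_def A_def using tS by blast
lemma \<pi>D: "\<pi> \<in> D" using \<pi>A A_D by blast

lemma \<pi>_tS: "\<exists>s\<in>S. \<pi> = t * s"
proof -
  have "\<pi> = t * (e * t ^ (p - 1))"
    unfolding \<pi>_def using p0 by (cases p) (simp_all add: e_absorb[OF te])
  then show ?thesis using subr_pow[OF S tS] by blast
qed

lemma \<pi>_n: "\<pi> \<in> n" unfolding n_def using \<pi>D \<pi>_tS by blast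

lemma \<pi>_nonunit: "x \<in> S \<Longrightarrow> \<pi> * x \<noteq> e"
proof
  assume x: "x \<in> S" "\<pi> * x = e"
  obtain s where "s \<in> S" "\<pi> = t * s" using \<pi>_tS by blast
  then have "t * (s * x) = e" "s * x \<in> S" using x subr_mult[OF S] by (auto simp: mult.assoc)
  then show False using t_nonunit by blast
qed

lemma A_form:
  assumes "a \<in> A" "a \<noteq> 0"
  shows "\<exists>j u v. u \<in> A \<and> v \<in> A \<and> u * v = e \<and> a = u * \<pi> ^ j"
proof -
  obtain s where s: "s \<in> S" "a = s ^ p" using assms A_def by blast
  then have "s \<noteq> 0" using assms p0 by (auto simp: power_0_left)
  then obtain j u v where juv: "u \<in> S" "v \<in> S" "u * v = e" "s = u * t ^ j" using dvr s by blast
  have "a = u ^ p * \<pi> ^ j"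
    unfolding \<pi>_def s(2) juv(4) by (simp add: power_mult_distrib power_mult[symmetric] mult.commute)
  moreover have "u ^ p * v ^ p = e" using juv(3) e_pow[OF p0] by (metis power_mult_distrib)
  ultimately show ?thesis using juv A_def by blast
qed

lemma A_cases:
  assumes "a \<in> A" shows "(\<exists>v\<in>A. a * v = e) \<or> a \<in> (*) \<pi> ` A"
proof (cases "a = 0")
  case True
  then show ?thesis using subr_0[OF subr_A] by force
next
  case False
  then obtain j u v where *: "u \<in> A" "v \<in> A" "u * v = e" "a = u * \<pi> ^ j" using A_form assms by blast
  show ?thesis
  proof (cases j)
    case 0
    then show ?thesis using * by auto
  next
    case (Suc i)
    have "a = u * (\<pi> * (e * \<pi> ^ i))" using * Suc e_absorb[OF \<pi>e] by simp
    then have "a = \<pi> * (u * (e * \<pi> ^ i))" by (simp only: mult.left_commute)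
    then show ?thesis using subr_mult[OF subr_A *(1) subr_pow[OF subr_A \<pi>A]] by blast
  qed
qed

text \<open>Outside \<open>n\<close> an element \<open>d\<close> is a unit of \<open>S\<close>, with
  inverse \<open>v\<close> say. Then \<open>v ^ p\<close> lies in \<open>A\<close>, and
  \<open>d ^ (p - 1) * v ^ p\<close> is an inverse inside \<open>D\<close>.\<close>

lemma D_cases:
  assumes "d \<in> D" "d \<notin> n" shows "\<exists>g\<in>D. d * g = e"
proof -
  have dS: "d \<in> S" using assms D_S by blast
  have d0: "d \<noteq> 0" using assms subr_0[OF S] unfolding n_def by force
  then obtain j u v where *: "u \<in> S" "v \<in> S" "u * v = e" "d = u * t ^ j" using dvr[OF dS] by blast
  have "j = 0"
  proof (rule ccontr)
    assume "j \<noteq> 0"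
    then obtain i where i: "j = Suc i" by (cases j) auto
    have "d = u * (t * (e * t ^ i))" using * i e_absorb[OF te] by simp
    then have "d = t * (u * (e * t ^ i))" by (simp only: mult.left_commute)
    then show False using assms subr_mult[OF S *(1) subr_pow[OF S tS]] unfolding n_def by blast
  qed
  then have "d * v = e" using * by simp
  then have "d ^ p * v ^ p = e" using e_pow[OF p0] by (metis power_mult_distrib)
  moreover have "d ^ p * v ^ p = d * (e * d ^ (p - 1) * v ^ p)"
    using p0 e_absorb[OF subr_unit[OF S dS]] by (cases p) (simp_all add: mult.assoc)
  moreover have "v ^ p \<in> D" using *(2) A_D A_def by blast
  ultimately show ?thesis using subr_mult[OF subr_D subr_pow[OF subr_D assms(1)]] by metis
qed

text \<open>Makes \<open>n\<close> nil modulo \<open>\<pi>\<close>, which is what produces elements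
  killed by \<open>n\<close> in \<open>exists_socle_element\<close>.\<close>

lemma n_nil:
  assumes "d \<in> n" shows "d ^ p \<in> (*) \<pi> ` A"
proof -
  obtain s where "s \<in> S" "d = t * s" using assms unfolding n_def by blast
  then show ?thesis unfolding \<pi>_def A_def by (auto simp: power_mult_distrib)
qed

lemma sm_tS: "sm S ((*) t ` S)" using times_sm[OF subr_sm[OF S] te] by simp

lemma sm_n: "sm D n"
proof -
  have "n = D \<inter> (*) t ` S" unfolding n_def by auto
  then show ?thesis using Int_sm[OF subr_sm[OF subr_D] sm_subset[OF sm_tS D_S]] by simp
qed

lemma D_V: "D \<subseteq> V"
proof
  fix d assume "d \<in> D"
  then have "e * d = d" using subr_unit[OF subr_D] by blast
  then show "d \<in> V" unfolding V_def using subr_e[OF subr_A] e0 \<open>d \<in> D\<close> by auto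
qed

lemma Ae: "a \<in> A \<Longrightarrow> e * a = a" using subr_unit[OF subr_A] .
lemma De: "a \<in> D \<Longrightarrow> e * a = a" using subr_unit[OF subr_D] .

lemma A_mult_nz: "a \<in> A \<Longrightarrow> a \<noteq> 0 \<Longrightarrow> e * v = v \<Longrightarrow> v \<noteq> 0 \<Longrightarrow> a * v \<noteq> 0"
  using no_zero_div[OF Ae] by blast

lemma V_common:
  assumes "finite J" "\<And>j. j \<in> J \<Longrightarrow> v j \<in> V"
  shows "\<exists>a\<in>A. a \<noteq> 0 \<and> (\<forall>j\<in>J. a * v j \<in> D)"
  using assms
proof (induction J rule: finite_induct)
  case empty
  then show ?case using subr_e[OF subr_A] e0 by auto
next
  case (insert i J)
  then obtain a where a: "a \<in> A" "a \<noteq> 0" "\<forall>j\<in>J. a * v j \<in> D" by auto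
  obtain b where b: "b \<in> A" "b \<noteq> 0" "b * v i \<in> D" using insert.prems[of i] V_def by auto
  have "a * b \<noteq> 0" using A_mult_nz[OF a(1,2) Ae[OF b(1)] b(2)] .
  moreover have "\<forall>j\<in>insert i J. a * b * v j \<in> D"
  proof
    fix j assume "j \<in> insert i J"
    then consider "j = i" | "j \<in> J" by blast
    then show "a * b * v j \<in> D"
    proof cases
      case 1
      then show ?thesis using subr_mult[OF subr_D _ b(3)] a(1) A_D by (auto simp: mult.assoc)
    next
      case 2
      have "b * (a * v j) \<in> D" using subr_mult[OF subr_D] b(1) A_D a(3) 2 by blast
      then show ?thesis by (simp add: algebra_simps)
    qed
  qed
  ultimately show ?case using subr_mult[OF subr_A a(1) b(1)] by blast
qed

lemma sm_V: "sm A V"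
proof (rule smI)
  show "\<And>x. x \<in> V \<Longrightarrow> e * x = x" unfolding V_def by blast
  show "0 \<in> V" using D_V subr_0[OF subr_D] by blast
next
  fix x y assume xy: "x \<in> V" "y \<in> V"
  have "\<exists>a\<in>A. a \<noteq> 0 \<and> (\<forall>j\<in>{x, y}. a * j \<in> D)"
    using V_common[of "{x, y}" "\<lambda>z. z"] xy by blast
  then obtain a where a: "a \<in> A" "a \<noteq> 0" "a * x \<in> D" "a * y \<in> D" by blast
  have "a * (x - y) \<in> D" using subr_diff[OF subr_D a(3,4)] by (simp add: algebra_simps)
  moreover have "e * (x - y) = x - y" using xy unfolding V_def by (simp add: algebra_simps)
  ultimately show "x - y \<in> V" using a unfolding V_def by blast
next
  fix a x assume a: "a \<in> A" and x: "x \<in> V"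
  then obtain b where b: "b \<in> A" "b \<noteq> 0" "b * x \<in> D" and xe: "e * x = x" using V_def by auto
  have "a * (b * x) \<in> D" using subr_mult[OF subr_D _ b(3)] a A_D by blast
  then have "b * (a * x) \<in> D" by (simp add: algebra_simps)
  moreover have "e * (a * x) = a * x" using Ae[OF a] by (metis mult.assoc)
  ultimately show "a * x \<in> V" using b unfolding V_def by blast
qed

text \<open>Linear independence of the images of \<open>w\<close> in \<open>R/\<pi> R\<close> over
  the field \<open>A/\<pi> A\<close>, stated without quotient rings.\<close>

definition indep :: "nat set \<Rightarrow> (nat \<Rightarrow> 'u) \<Rightarrow> bool" where
  "indep J w \<longleftrightarrow> (\<forall>c. (\<forall>j\<in>J. c j \<in> A) \<longrightarrow> (\<Sum>j\<in>J. c j * w j) \<in> (*) \<pi> ` R \<longrightarrow> (\<forall>j\<in>J. c j \<in> (*) \<pi> ` A))"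

text \<open>Common factors \<open>\<pi>\<close> are divided out. Each division lowers the exponent
  of the fixed nonzero coefficient \<open>c i\<close>, so after finitely many of them some
  coefficient is a unit of \<open>A\<close>.\<close>

lemma primitive_relation:
  assumes J: "finite J" and w: "\<And>j. j \<in> J \<Longrightarrow> w j \<in> R"
    and c: "\<And>j. j \<in> J \<Longrightarrow> c j \<in> A" and rel: "(\<Sum>j\<in>J. c j * w j) = 0" and nz: "i \<in> J" "c i \<noteq> 0"
  shows "\<exists>c'. (\<forall>j\<in>J. c' j \<in> A) \<and> (\<Sum>j\<in>J. c' j * w j) = 0 \<and> (\<exists>j\<in>J. \<exists>g\<in>A. c' j * g = e)"
proof -
  obtain m u v where m: "u \<in> A" "v \<in> A" "u * v = e" "c i = u * \<pi> ^ m" using A_form[OF c[OF nz(1)] nz(2)] by blast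
  show ?thesis
    using c rel m(4)
  proof (induction m arbitrary: c)
    case 0
    then have "c i * v = e" using m by simp
    then show ?case using 0 m nz by blast
  next
    case (Suc m)
    show ?case
    proof (cases "\<exists>j\<in>J. \<exists>g\<in>A. c j * g = e")
      case True
      then show ?thesis using Suc.prems by blast
    next
      case False
      then have "\<forall>j\<in>J. \<exists>b\<in>A. c j = \<pi> * b" using A_cases[OF Suc.prems(1)] by blast
      then obtain b where b: "\<And>j. j \<in> J \<Longrightarrow> b j \<in> A" "\<And>j. j \<in> J \<Longrightarrow> c j = \<pi> * b j" by metis
      have be: "e * (\<Sum>j\<in>J. b j * w j) = (\<Sum>j\<in>J. b j * w j)"
        using Ae[OF b(1)] by (auto simp: sum_distrib_left mult.assoc[symmetric] intro!: sum.cong)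
      have "\<pi> * (\<Sum>j\<in>J. b j * w j) = (\<Sum>j\<in>J. c j * w j)"
        using b by (auto simp: sum_distrib_left mult.assoc intro!: sum.cong)
      then have r0: "(\<Sum>j\<in>J. b j * w j) = 0" using Suc.prems no_zero_div[OF \<pi>e _ be \<pi>0] by simp
      have "\<pi> * b i = \<pi> * (u * \<pi> ^ m)" using b(2)[OF nz(1)] Suc.prems(3) by (simp add: algebra_simps)
      moreover have "e * (u * \<pi> ^ m) = u * \<pi> ^ m" using Ae[OF m(1)] by (metis mult.assoc)
      ultimately have "b i = u * \<pi> ^ m" using cancel[OF \<pi>e Ae[OF b(1)[OF nz(1)]] _ \<pi>0] by blast
      from Suc.IH[OF b(1) r0 this] show ?thesis .
    qed
  qed
qed

end

text \<open>\<open>LD\<close> is linear disjointness of \<open>R\<close> and \<open>D\<close> over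
  \<open>A\<close>, as a transfer of relations: a nontrivial relation with coefficients in
  \<open>D\<close> yields a nontrivial one over \<open>A\<close> between the same elements of
  \<open>R\<close>. Together with \<open>TD\<close> it stands for the bijectivity of the map from
  the tensor product of \<open>R\<close> and \<open>D\<close> over \<open>A\<close> to
  \<open>T\<close>.\<close>

locale core2 = core +
  assumes TD: "T \<subseteq> mprod R D"
    and LD: "\<And>J w d i. finite J \<Longrightarrow> (\<And>j. j \<in> J \<Longrightarrow> w j \<in> R) \<Longrightarrow> (\<And>j. j \<in> J \<Longrightarrow> d j \<in> D) \<Longrightarrow>
       (\<Sum>j\<in>J. w j * d j) = 0 \<Longrightarrow> i \<in> J \<Longrightarrow> d i \<noteq> 0 \<Longrightarrow>
       \<exists>c. (\<forall>j\<in>J. c j \<in> A) \<and> (\<exists>j\<in>J. c j \<noteq> 0) \<and> (\<Sum>j\<in>(J::nat set). c j * w j) = 0"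
begin

lemma T_eq: "T = mprod R D"
  using TD mprod_subset[OF sm_subset[OF subr_sm[OF subr_T] R_T] subsetD[OF D_T]] by blast

text \<open>Denominators are cleared in \<open>A\<close>, and the resulting relation is made
  primitive so that it can be solved for one of the \<open>w j\<close>.\<close>

lemma LD_V:
  assumes J: "finite J" and w: "\<And>j. j \<in> J \<Longrightarrow> w j \<in> R" and v: "\<And>j. j \<in> J \<Longrightarrow> v j \<in> V"
    and rel: "(\<Sum>j\<in>J. w j * v j) = 0" and i: "i \<in> (J::nat set)" "v i \<noteq> 0"
  shows "\<exists>c. (\<forall>j\<in>J. c j \<in> A) \<and> (\<Sum>j\<in>J. c j * w j) = 0 \<and> (\<exists>j\<in>J. \<exists>g\<in>A. c j * g = e)"
proof -
  obtain a where a: "a \<in> A" "a \<noteq> 0" "\<forall>j\<in>J. a * v j \<in> D" using V_common[of J v, OF J v] by blast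
  have vi: "e * v i = v i" using v[OF i(1)] unfolding V_def by blast
  have av: "a * v i \<noteq> 0" using A_mult_nz[OF a(1,2) vi i(2)] .
  have "(\<Sum>j\<in>J. w j * (a * v j)) = a * (\<Sum>j\<in>J. w j * v j)"
    by (simp add: sum_distrib_left mult.left_commute)
  then have "(\<Sum>j\<in>J. w j * (a * v j)) = 0" using rel by simp
  then obtain c where c: "\<forall>j\<in>J. c j \<in> A" "\<exists>j\<in>J. c j \<noteq> 0" "(\<Sum>j\<in>J. c j * w j) = 0"
    using LD[of J w "\<lambda>j. a * v j" i] J w a(3) i(1) av by blast
  then obtain i' where "i' \<in> J" "c i' \<noteq> 0" by blast
  then show ?thesis using primitive_relation[of J w c i'] J w c by blast
qed

text \<open>Flatness of \<open>R\<close> over the discrete valuation ring \<open>A\<close>, by hand: the terms of the given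
  element of \<open>R M\<close> are eliminated one at a time by exact linear relations over \<open>A\<close>.\<close>

lemma coeffs_in_submodule:
  assumes J: "finite J" and wJ: "\<And>j. j \<in> J \<Longrightarrow> w j \<in> R" and ind: "indep J w"
    and M: "sm D M" and MV: "M \<subseteq> V"
  shows "finite I \<Longrightarrow> I \<inter> J = {} \<Longrightarrow> (\<And>i. i \<in> I \<Longrightarrow> w i \<in> R) \<Longrightarrow> (\<And>i. i \<in> I \<Longrightarrow> v i \<in> M) \<Longrightarrow>
    (\<And>j. j \<in> J \<Longrightarrow> v j \<in> V) \<Longrightarrow> (\<Sum>j\<in>I \<union> J. w j * v j) = 0 \<Longrightarrow> j \<in> J \<Longrightarrow> v j \<in> M"
proof (induction "card I" arbitrary: I v j rule: less_induct)
  case less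
  note I = less.prems(1) and IJ = less.prems(2) and wI = less.prems(3) and vI = less.prems(4)
    and vJ = less.prems(5) and rel = less.prems(6) and j = less.prems(7)
  have MA: "sm A M" using sm_subset[OF M A_D] .
  have wIJ: "\<And>l. l \<in> I \<union> J \<Longrightarrow> w l \<in> R" using wI wJ by blast
  have vIJ: "\<And>l. l \<in> I \<union> J \<Longrightarrow> v l \<in> V" using vI vJ MV by blast
  have fin: "finite (I \<union> J)" using I J by simp
  show ?case
  proof (cases "v j = 0")
    case True
    then show ?thesis using sm_0[OF M] by simp
  next
    case False
    obtain c i g where c: "\<And>l. l \<in> I \<union> J \<Longrightarrow> c l \<in> A" "(\<Sum>l\<in>I \<union> J. c l * w l) = 0"
      "i \<in> I \<union> J" "g \<in> A" "c i * g = e"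
      using LD_V[of "I \<union> J" w v j, OF fin wIJ vIJ rel _ False] j by blast
    show ?thesis
    proof (cases "\<exists>i\<in>I. \<exists>g\<in>A. c i * g = e")
      case True
      then obtain i g where i: "i \<in> I" "g \<in> A" "c i * g = e" by blast
      \<comment> \<open>Solve the relation for \<open>w i\<close> and substitute: \<open>I\<close>
        loses a member, and every other \<open>v l\<close> changes by an element of
        \<open>M\<close>.\<close>
      define v' where "v' l = v l - g * c l * v i" for l
      have viM: "v i \<in> M" using vI i by blast
      have gc: "g * c l * v i \<in> M" if "l \<in> I \<union> J" for l
        using sm_mult[OF MA subr_mult[OF subr_A i(2) c(1)[OF that]] viM] .
      have ij: "i \<notin> J" using i IJ by blast
      have un: "I \<union> J = insert i (I - {i} \<union> J)" "i \<notin> I - {i} \<union> J" using i ij by blast+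
      have f': "finite (I - {i} \<union> J)" using fin by simp
      have wi: "e * (w i * v i) = w i * v i" using subr_unit[OF R wI[OF i(1)]] by (simp add: mult.assoc[symmetric])
      have s1: "w i * v i + (\<Sum>l\<in>I - {i} \<union> J. w l * v l) = 0"
        using rel unfolding un(1) sum.insert[OF f' un(2)] .
      have s2: "c i * w i + (\<Sum>l\<in>I - {i} \<union> J. c l * w l) = 0"
        using c(2) unfolding un(1) sum.insert[OF f' un(2)] .
      have "(\<Sum>l\<in>I - {i} \<union> J. w l * v' l)
          = (\<Sum>l\<in>I - {i} \<union> J. w l * v l) - g * v i * (\<Sum>l\<in>I - {i} \<union> J. c l * w l)"
        unfolding v'_def by (simp add: right_diff_distrib sum_subtractf sum_distrib_left ac_simps)
      also have "(\<Sum>l\<in>I - {i} \<union> J. c l * w l) = - (c i * w i)" using s2 by (simp add: eq_neg_iff_add_eq_0 add.commute)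
      also have "(\<Sum>l\<in>I - {i} \<union> J. w l * v l) = - (w i * v i)" using s1 by (simp add: eq_neg_iff_add_eq_0 add.commute)
      also have "- (w i * v i) - g * v i * - (c i * w i) = - (w i * v i) + (c i * g) * (w i * v i)"
        by (simp add: ac_simps)
      also have "\<dots> = 0" using i wi by simp
      finally have rel': "(\<Sum>l\<in>I - {i} \<union> J. w l * v' l) = 0" .
      have "v' j \<in> M"
      proof (rule less.hyps[OF _ _ _ _ _ _ rel' j])
        show "card (I - {i}) < card I" using card_Diff1_less[OF I i(1)] .
        show "finite (I - {i})" "(I - {i}) \<inter> J = {}" using I IJ by blast+
        show "\<And>l. l \<in> I - {i} \<Longrightarrow> w l \<in> R" using wI by blast
        show "v' l \<in> M" if "l \<in> I - {i}" for l
          unfolding v'_def using sm_diff[OF M vI gc] that by blast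
        show "v' l \<in> V" if "l \<in> J" for l
          unfolding v'_def using sm_diff[OF sm_V vJ subsetD[OF MV gc]] that by blast
      qed
      then have "v' j + g * c j * v i \<in> M" using sm_add[OF M _ gc] j by blast
      then show ?thesis unfolding v'_def by simp
    next
      case False
      \<comment> \<open>No coefficient on \<open>I\<close> is a unit, so \<open>\<pi>\<close>
        divides them all. Independence modulo \<open>\<pi>\<close> then makes it divide those on
        \<open>J\<close> as well, and none is left to be the unit.\<close>
      then have "\<forall>l\<in>I. \<exists>b\<in>A. c l = \<pi> * b" using A_cases c(1) by blast
      then obtain b where b: "\<And>l. l \<in> I \<Longrightarrow> b l \<in> A" "\<And>l. l \<in> I \<Longrightarrow> c l = \<pi> * b l" by metis
      have "(\<Sum>l\<in>I. c l * w l) + (\<Sum>l\<in>J. c l * w l) = 0" using c(2) sum.union_disjoint[OF I J IJ] by metis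
      then have "(\<Sum>l\<in>J. c l * w l) = - (\<Sum>l\<in>I. c l * w l)" by (simp add: eq_neg_iff_add_eq_0 add.commute)
      also have "\<dots> = \<pi> * (- (\<Sum>l\<in>I. b l * w l))"
        using b by (auto simp: sum_distrib_left mult.assoc intro!: sum.cong)
      finally have e1: "(\<Sum>l\<in>J. c l * w l) = \<pi> * (- (\<Sum>l\<in>I. b l * w l))" .
      have "(\<Sum>l\<in>I. b l * w l) \<in> R"
      proof (rule sm_sum[OF subr_sm[OF R]])
        fix l assume l: "l \<in> I"
        show "b l * w l \<in> R" using subr_mult[OF R subsetD[OF A_R b(1)[OF l]] wI[OF l]] .
      qed
      then have "(\<Sum>l\<in>J. c l * w l) \<in> (*) \<pi> ` R" using e1 subr_minus[OF R] by blast
      then have cJ: "\<forall>l\<in>J. c l \<in> (*) \<pi> ` A" using ind c(1) unfolding indep_def by blast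
      have "i \<in> J" using c(3,4,5) False by blast
      then obtain b' where "b' \<in> A" "c i = \<pi> * b'" using cJ by blast
      then have "\<pi> * (b' * g) = e" "b' * g \<in> S"
        using c(4,5) subr_mult[OF subr_A] A_R RS by (auto simp: mult.assoc)
      then show ?thesis using \<pi>_nonunit by blast
    qed
  qed
qed

text \<open>Linear algebra modulo \<open>\<pi>\<close>: a new left factor \<open>r\<close> either
  enlarges the independent family or is a combination of it modulo \<open>\<pi> R\<close>. In the
  latter case the coefficients \<open>d\<close> absorb its term.\<close>

lemma T_decomposition:
  assumes "y \<in> mprod R D"
  shows "\<exists>J w d. finite (J::nat set) \<and> (\<forall>j\<in>J. w j \<in> R) \<and> (\<forall>j\<in>J. d j \<in> D) \<and> indep J w \<and>
    y - (\<Sum>j\<in>J. w j * d j) \<in> (*) \<pi> ` T"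
  using assms
proof (induction rule: mprod.induct)
  case zero
  have "indep {} (\<lambda>_. 0)" unfolding indep_def by blast
  moreover have "0 \<in> (*) \<pi> ` T" using subr_0[OF subr_T] by force
  ultimately show ?case by (intro exI[of _ "{}"]) auto
next
  case (step y r x)
  obtain J w d where J: "finite (J::nat set)" and w: "\<forall>j\<in>J. w j \<in> R" and d: "\<forall>j\<in>J. d j \<in> D"
    and ind: "indep J w" and y: "y - (\<Sum>j\<in>J. w j * d j) \<in> (*) \<pi> ` T" using step.IH by blast
  obtain m where m: "m \<notin> J" using ex_new_if_finite[OF infinite_UNIV_nat J] by blast
  define w' where "w' = w(m := r)"
  have w': "(\<Sum>j\<in>J. f j * w' j) = (\<Sum>j\<in>J. f j * w j)" "(\<Sum>j\<in>J. w' j * f j) = (\<Sum>j\<in>J. w j * f j)" for f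
    using m unfolding w'_def by (auto intro!: sum.cong)
  have wm: "w' m = r" unfolding w'_def by simp
  show ?case
  proof (cases "indep (insert m J) w'")
    case True
    define d' where "d' = d(m := x)"
    have "(\<Sum>j\<in>insert m J. w' j * d' j) = r * x + (\<Sum>j\<in>J. w j * d j)"
      using J m unfolding w'_def d'_def by (auto intro!: sum.cong)
    then have "y + r * x - (\<Sum>j\<in>insert m J. w' j * d' j) \<in> (*) \<pi> ` T" using y by (simp add: algebra_simps)
    moreover have "\<forall>j\<in>insert m J. w' j \<in> R" "\<forall>j\<in>insert m J. d' j \<in> D"
      using w d step.hyps unfolding w'_def d'_def by auto
    ultimately show ?thesis using True J by (intro exI[of _ "insert m J"] exI[of _ w'] exI[of _ d']) simp
  next
    case False
    then obtain c where c: "\<forall>j\<in>insert m J. c j \<in> A" "(\<Sum>j\<in>insert m J. c j * w' j) \<in> (*) \<pi> ` R"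
      "\<exists>j\<in>insert m J. c j \<notin> (*) \<pi> ` A" unfolding indep_def by blast
    then obtain \<rho> where \<rho>: "\<rho> \<in> R" "c m * r + (\<Sum>j\<in>J. c j * w j) = \<pi> * \<rho>"
      using J m wm w'(1) by auto
    \<comment> \<open>If \<open>\<pi>\<close> divided \<open>c m\<close>, the relation would
      restrict to the old family, whose independence makes \<open>\<pi>\<close> divide every
      coefficient.\<close>
    have "c m \<notin> (*) \<pi> ` A"
    proof
      assume "c m \<in> (*) \<pi> ` A"
      then obtain b where b: "b \<in> A" "c m = \<pi> * b" by blast
      have "(\<Sum>j\<in>J. c j * w j) = \<pi> * (\<rho> - b * r)" using \<rho>(2) b by (simp add: algebra_simps)
      moreover have "\<rho> - b * r \<in> R"
        using subr_diff[OF R \<rho>(1) subr_mult[OF R subsetD[OF A_R b(1)] step.hyps(2)]] .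
      ultimately have "\<forall>j\<in>J. c j \<in> (*) \<pi> ` A" using ind c(1) unfolding indep_def by blast
      then show False using c(3) b by blast
    qed
    then obtain g where g: "g \<in> A" "c m * g = e" using A_cases c(1) by blast
    have re: "e * r = r" using subr_unit[OF R step.hyps(2)] .
    have "r = g * (c m * r)" using g re by (metis mult.assoc mult.commute)
    also have "\<dots> = g * (\<pi> * \<rho> - (\<Sum>j\<in>J. c j * w j))" by (simp add: \<rho>(2)[symmetric])
    finally have r: "r = \<pi> * (g * \<rho>) - (\<Sum>j\<in>J. w j * (g * c j))"
      by (simp add: right_diff_distrib sum_distrib_left ac_simps)
    define d' where "d' j = d j - g * c j * x" for j
    have d': "\<forall>j\<in>J. d' j \<in> D"
      unfolding d'_def using subr_diff[OF subr_D] d subr_mult[OF subr_D subr_mult[OF subr_D]] c(1) g(1) A_D step.hyps(3)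
      by (metis insertCI subsetD)
    obtain \<tau> where \<tau>: "\<tau> \<in> T" "y - (\<Sum>j\<in>J. w j * d j) = \<pi> * \<tau>" using y by blast
    have "(\<Sum>j\<in>J. w j * d' j) = (\<Sum>j\<in>J. w j * d j) - (\<Sum>j\<in>J. w j * (g * c j)) * x"
      unfolding d'_def by (simp add: right_diff_distrib sum_subtractf sum_distrib_left ac_simps)
    then have "y + r * x - (\<Sum>j\<in>J. w j * d' j) = (y - (\<Sum>j\<in>J. w j * d j)) + (r + (\<Sum>j\<in>J. w j * (g * c j))) * x"
      by (simp add: algebra_simps)
    also have "\<dots> = \<pi> * (\<tau> + g * \<rho> * x)" using \<tau> r by (simp add: algebra_simps)
    finally have "y + r * x - (\<Sum>j\<in>J. w j * d' j) = \<pi> * (\<tau> + g * \<rho> * x)" .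
    moreover have "\<tau> + g * \<rho> * x \<in> T"
      using subr_add[OF subr_T \<tau>(1) subr_mult[OF subr_T subr_mult[OF subr_T]]] g(1) A_R R_T \<rho>(1) step.hyps(3) D_T
      by (meson subsetD)
    ultimately show ?thesis using J w d' ind by (intro exI[of _ J] exI[of _ w] exI[of _ d']) blast
  qed
qed

text \<open>The indices avoid a given finite set, so that the expression can be merged with one
  indexed by \<open>J\<close> into a single family.\<close>

lemma mprod_as_sum:
  assumes "x \<in> mprod P M" "finite (J::nat set)"
  shows "\<exists>I w v. finite I \<and> I \<inter> J = {} \<and> (\<forall>i\<in>I. w i \<in> P) \<and> (\<forall>i\<in>I. v i \<in> M) \<and> x = (\<Sum>i\<in>I. w i * v i)"
  using assms(1)
proof (induction rule: mprod.induct)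
  case zero
  then show ?case by (intro exI[of _ "{}"]) auto
next
  case (step x a m)
  then obtain I w v where I: "finite I" "I \<inter> J = {}" "\<forall>i\<in>I. w i \<in> P" "\<forall>i\<in>I. v i \<in> M" "x = (\<Sum>i\<in>I. w i * v i)"
    by blast
  obtain l where l: "l \<notin> I \<union> J" using ex_new_if_finite[OF infinite_UNIV_nat, of "I \<union> J"] I assms by blast
  define W U where "W = w(l := a)" and "U = v(l := m)"
  have "(\<Sum>i\<in>insert l I. W i * U i) = a * m + (\<Sum>i\<in>I. w i * v i)"
    using l I(1) unfolding W_def U_def by (auto intro!: sum.cong)
  then have f1: "x + a * m = (\<Sum>i\<in>insert l I. W i * U i)" using I(5) by (simp only: add.commute)
  have f2: "\<forall>i\<in>insert l I. W i \<in> P" and f3: "\<forall>i\<in>insert l I. U i \<in> M"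
    using I(3,4) step.hyps unfolding W_def U_def by simp_all
  have f4: "finite (insert l I)" and f5: "insert l I \<inter> J = {}" using I(1,2) l by simp_all
  show ?case
    by (rule exI[of _ "insert l I"], rule exI[of _ W], rule exI[of _ U]) (intro conjI f1 f2 f3 f4 f5)
qed

text \<open>The consequence of flatness that the filtration uses: extension creates no new
  annihilators of \<open>x\<close>. Modulo \<open>\<pi>\<close>, which carries \<open>x\<close> into
  \<open>M\<close>, write \<open>y\<close> as a combination of independent \<open>w j\<close> with
  coefficients \<open>d j\<close>. A \<open>d j\<close> outside \<open>n\<close> would be a unit,
  and \<open>coeffs_in_submodule\<close> would put \<open>d j * x\<close>, hence \<open>x\<close>,
  into \<open>M\<close>.\<close>

lemma colon_ideal:
  assumes M: "sm D M" and MV: "M \<subseteq> V" and x: "x \<in> V" "x \<notin> M" and nx: "\<And>d. d \<in> n \<Longrightarrow> d * x \<in> M"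
    and y: "y \<in> T" "y * x \<in> mprod R M"
  shows "y \<in> mprod R n"
proof -
  obtain J w d where J: "finite (J::nat set)" and w: "\<forall>j\<in>J. w j \<in> R" and d: "\<forall>j\<in>J. d j \<in> D"
    and ind: "indep J w" and dec: "y - (\<Sum>j\<in>J. w j * d j) \<in> (*) \<pi> ` T"
    using T_decomposition[OF y(1)[unfolded T_eq]] by blast
  obtain \<tau> where \<tau>: "\<tau> \<in> T" "y - (\<Sum>j\<in>J. w j * d j) = \<pi> * \<tau>" using dec by blast
  have \<pi>T: "\<tau> * m \<in> mprod R M" if "\<tau> \<in> T" "m \<in> M" "sm D M" for \<tau> m M
  proof -
    have "\<tau> \<in> mprod R D" using that(1) T_eq by simp
    then show ?thesis
    proof (induction rule: mprod.induct)
      case (step x a b)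
      have "x * m + a * (b * m) \<in> mprod R M" using mprod.step[OF step.IH step.hyps(2) sm_mult[OF that(3) step.hyps(3) that(2)]] .
      then show ?case by (simp add: algebra_simps)
    qed (simp add: mprod.zero)
  qed
  have Me: "\<And>m. m \<in> M \<Longrightarrow> e * m = m" using sm_e[OF M] .
  have sRM: "sm R (mprod R M)" using mprod_sm[OF R Me] by blast
  have "(\<Sum>j\<in>J. w j * (d j * x)) = (\<Sum>j\<in>J. w j * d j) * x"
    by (simp add: sum_distrib_right mult.assoc)
  also have "(\<Sum>j\<in>J. w j * d j) = y - \<pi> * \<tau>" using \<tau>(2) by (simp add: algebra_simps)
  also have "(y - \<pi> * \<tau>) * x = y * x - \<tau> * (\<pi> * x)" by (simp add: algebra_simps)
  finally have "(\<Sum>j\<in>J. w j * (d j * x)) = y * x - \<tau> * (\<pi> * x)" .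
  then have "(\<Sum>j\<in>J. w j * (d j * x)) \<in> mprod R M"
    using sm_diff[OF sRM y(2) \<pi>T[OF \<tau>(1) nx[OF \<pi>_n] M]] by simp
  from mprod_as_sum[OF this J]
  obtain I u v where I: "finite I" "I \<inter> J = {}" "\<forall>i\<in>I. u i \<in> R" "\<forall>i\<in>I. v i \<in> M"
    "(\<Sum>j\<in>J. w j * (d j * x)) = (\<Sum>i\<in>I. u i * v i)" by (elim exE conjE) (rule that)
  \<comment> \<open>Two expressions of the same element, one through \<open>J\<close> and one in
    \<open>R M\<close> through \<open>I\<close>, become a single relation.\<close>
  define W where "W j = (if j \<in> J then w j else u j)" for j
  define v' where "v' j = (if j \<in> J then d j * x else - v j)" for j
  have sJ: "(\<Sum>j\<in>J. W j * v' j) = (\<Sum>j\<in>J. w j * (d j * x))"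
    unfolding W_def v'_def by (auto intro!: sum.cong)
  have "(\<Sum>j\<in>I. W j * v' j) = (\<Sum>i\<in>I. - (u i * v i))"
    unfolding W_def v'_def using I(2) by (intro sum.cong) auto
  also have "\<dots> = - (\<Sum>i\<in>I. u i * v i)" by (simp add: sum_negf)
  finally have rel: "(\<Sum>j\<in>I \<union> J. W j * v' j) = 0"
    using sum.union_disjoint[OF I(1) J I(2), of "\<lambda>j. W j * v' j"] sJ I(5) by simp
  have indW: "indep J W"
  proof -
    have "(\<Sum>j\<in>J. c j * W j) = (\<Sum>j\<in>J. c j * w j)" for c unfolding W_def by (auto intro!: sum.cong)
    then show ?thesis using ind unfolding indep_def by simp
  qed
  have xV: "d j * x \<in> V" if "j \<in> J" for j
  proof -
    obtain a where a: "a \<in> A" "a \<noteq> 0" "a * x \<in> D" using x(1) unfolding V_def by blast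
    have dj: "d j \<in> D" using d that by blast
    have "a * (d j * x) \<in> D" using subr_mult[OF subr_D dj a(3)] by (simp add: mult.left_commute)
    moreover have "e * (d j * x) = d j * x" using De[OF dj] by (simp add: mult.assoc[symmetric])
    ultimately show ?thesis using a unfolding V_def by blast
  qed
  have dn: "d j \<in> n" if j: "j \<in> J" for j
  proof (rule ccontr)
    assume "d j \<notin> n"
    then obtain g where g: "g \<in> D" "d j * g = e" using D_cases d j by blast
    have "v' j \<in> M"
    proof (rule coeffs_in_submodule[OF J _ indW M MV I(1,2) _ _ _ rel j])
      show "\<And>j. j \<in> J \<Longrightarrow> W j \<in> R" "\<And>i. i \<in> I \<Longrightarrow> W i \<in> R" unfolding W_def using w I(3) by auto
      show "v' i \<in> M" if "i \<in> I" for i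
        unfolding v'_def using I(2,4) that sm_minus[OF M] by auto
      show "\<And>j. j \<in> J \<Longrightarrow> v' j \<in> V" unfolding v'_def using xV by simp
    qed
    then have "d j * x \<in> M" unfolding v'_def using j by simp
    then have "g * (d j * x) \<in> M" using sm_mult[OF M g(1)] by blast
    moreover have "g * (d j * x) = x"
    proof -
      have "e * x = x" using x(1) unfolding V_def by blast
      then show ?thesis using g(2) by (metis mult.assoc mult.commute)
    qed
    ultimately show False using x(2) by simp
  qed
  have ne: "\<And>m. m \<in> n \<Longrightarrow> e * m = m" using sm_e[OF sm_n] .
  have sRn: "sm R (mprod R n)" using mprod_sm[OF R ne] by blast
  have "(\<Sum>j\<in>J. w j * d j) \<in> mprod R n"
  proof (rule sm_sum[OF sRn])
    show "\<And>j. j \<in> J \<Longrightarrow> w j * d j \<in> mprod R n" using mprod_mem w dn by blast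
  qed
  moreover have "\<tau> * \<pi> \<in> mprod R n" using \<pi>T[OF \<tau>(1) \<pi>_n sm_n] .
  ultimately have "\<tau> * \<pi> + (\<Sum>j\<in>J. w j * d j) \<in> mprod R n" using sm_add[OF sRn] by blast
  moreover have "y = \<tau> * \<pi> + (\<Sum>j\<in>J. w j * d j)" using \<tau>(2) by (simp add: algebra_simps)
  ultimately show ?thesis by simp
qed

end

section \<open>The filtration and its extension to \<open>T\<close>\<close>

lemma (in idf) codim_times:
  assumes "codim k M n N" "subr k" "sm k M" and x: "e * x = x" "x \<noteq> 0"
  shows "codim k ((*) x ` M) n ((*) x ` N)"
proof -
  have "codim ((\<lambda>c. c) ` k) ((*) x ` M) n ((*) x ` N)"
  proof (rule codim_image[OF assms(1-3)])
    show "x * (y + z) = x * y + x * z" for y z by (rule distrib_left)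
    show "e * (x * y) = x * y" for y using x(1) by (metis mult.assoc)
    show "e * y = y \<Longrightarrow> e * z = z \<Longrightarrow> x * y = x * z \<Longrightarrow> y = z" for y z using cancel[OF x(1) _ _ x(2)] .
    show "x * (c * y) = c * (x * y)" for c y by (rule mult.left_commute)
  qed
  then show ?thesis by simp
qed

lemma (in idf) mprod_mult_into:
  assumes "x \<in> mprod A M" and "\<And>a m. a \<in> A \<Longrightarrow> m \<in> M \<Longrightarrow> b * (a * m) \<in> mprod B N"
  shows "b * x \<in> mprod B N"
  using assms(1)
proof (induction rule: mprod.induct)
  case (step x a m)
  have "b * (x + a * m) = b * x + b * (a * m)" by (simp add: algebra_simps)
  then show ?case using mprod_add[OF assms(2)[OF step.hyps(2,3)] step.IH] by metis
qed (simp add: mprod.zero)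

context core2
begin

lemma sm_T_mprod:
  assumes "sm D M" shows "sm T (mprod R M)"
  using sm_mprod_scalars[OF mprod_sm[OF R sm_e[OF assms]] mprod_sm2[OF R assms]] T_eq by simp

lemma sm_k2: "sm D M \<Longrightarrow> sm k2 M" using sm_subset k2_D by blast

lemma sm_K1_mprod: "sm D M \<Longrightarrow> sm K1 (mprod R M)" using sm_subset[OF sm_T_mprod K1_T] .

lemma \<pi>D_ideal: "sm D ((*) \<pi> ` D)" using times_sm[OF subr_sm[OF subr_D] \<pi>e] by simp

text \<open>Up to a unit of \<open>A\<close> the multiplier \<open>a\<close> is a power of
  \<open>\<pi>\<close>. The wanted element is the last one outside \<open>M\<close> among
  \<open>x\<close>, \<open>\<pi> x\<close>, \<open>\<pi>^2 x\<close> and so on.\<close>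

lemma \<pi>_descent:
  assumes "sm D M" "x \<in> M'" "x \<notin> M" "sm D M'" "a \<in> A" "a \<noteq> 0" "a * x \<in> M"
  shows "\<exists>y\<in>M'. y \<notin> M \<and> \<pi> * y \<in> M"
proof -
  obtain j u v where juv: "u \<in> A" "v \<in> A" "u * v = e" "a = u * \<pi> ^ j" using A_form assms by blast
  have xe: "e * x = x" using sm_e assms by blast
  have "v * (a * x) \<in> M" using sm_mult[OF assms(1) _ assms(7)] juv(2) A_D by blast
  moreover have "v * (a * x) = (u * v) * (\<pi> ^ j * x)" using juv(4) by (simp add: ac_simps)
  moreover have "e * (\<pi> ^ j * x) = \<pi> ^ j * x" using xe by (metis mult.left_commute)
  ultimately have "\<pi> ^ j * x \<in> M" using juv(3) by simp
  then show ?thesis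
    using assms(2,3)
  proof (induction j arbitrary: x)
    case (Suc j)
    show ?case
    proof (cases "\<pi> * x \<in> M")
      case False
      have "\<pi> * x \<in> M'" using sm_mult[OF assms(4) \<pi>D Suc.prems(2)] .
      moreover have "\<pi> ^ j * (\<pi> * x) \<in> M" using Suc.prems(1) by (simp add: ac_simps)
      ultimately show ?thesis using Suc.IH False by blast
    qed (use Suc.prems in blast)
  qed simp
qed

text \<open>The annihilator of \<open>x\<close> modulo \<open>M\<close> contains
  \<open>\<pi> D\<close>, so its codimension in \<open>D\<close> is finite. As long as some
  \<open>d\<close> in \<open>n\<close> does not carry \<open>x\<close> into \<open>M\<close>,
  replacing \<open>x\<close> by \<open>d * x\<close> enlarges the annihilator strictly,
  \<open>d\<close> being nilpotent modulo \<open>\<pi>\<close>.\<close>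

lemma exists_socle_element:
  assumes q: "codim k2 ((*) \<pi> ` D) q D" and M: "sm D M" and M': "sm D M'"
    and x: "x \<in> M'" "x \<notin> M" "\<pi> * x \<in> M"
  shows "\<exists>x\<in>M'. x \<notin> M \<and> (\<forall>d\<in>n. d * x \<in> M)"
proof -
  have ann: "sm D {d \<in> D. d * x \<in> M}" for x
  proof (rule smI)
    show "\<And>y. y \<in> {d \<in> D. d * x \<in> M} \<Longrightarrow> e * y = y" using De by blast
    show "0 \<in> {d \<in> D. d * x \<in> M}" using subr_0[OF subr_D] sm_0[OF M] by simp
    show "\<And>y z. y \<in> {d \<in> D. d * x \<in> M} \<Longrightarrow> z \<in> {d \<in> D. d * x \<in> M} \<Longrightarrow> y - z \<in> {d \<in> D. d * x \<in> M}"
      using subr_diff[OF subr_D] sm_diff[OF M] by (simp add: left_diff_distrib)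
    show "\<And>a y. a \<in> D \<Longrightarrow> y \<in> {d \<in> D. d * x \<in> M} \<Longrightarrow> a * y \<in> {d \<in> D. d * x \<in> M}"
      using subr_mult[OF subr_D] sm_mult[OF M] by (simp add: mult.assoc)
  qed
  have sub: "{d \<in> D. d * x \<in> M} \<subseteq> D" for x by blast
  have "(*) \<pi> ` D \<subseteq> {d \<in> D. d * x \<in> M}"
  proof
    fix z assume "z \<in> (*) \<pi> ` D"
    then obtain d where d: "d \<in> D" "z = \<pi> * d" by blast
    have "d * (\<pi> * x) \<in> M" using sm_mult[OF M d(1) x(3)] .
    then have "z * x \<in> M" unfolding d(2) by (simp add: ac_simps)
    then show "z \<in> {d \<in> D. d * x \<in> M}" using subr_mult[OF subr_D \<pi>D d(1)] d(2) by blast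
  qed
  then obtain a b where "codim k2 {d \<in> D. d * x \<in> M} b D"
    using codim_between[OF q k2 sm_k2[OF \<pi>D_ideal] _ sub[of x] sm_k2[OF ann[of x]]] by blast
  then show ?thesis
    using x
  proof (induction b arbitrary: x rule: less_induct)
    case (less b)
    show ?case
    proof (cases "\<forall>d\<in>n. d * x \<in> M")
      case False
      then obtain d where d: "d \<in> n" "d * x \<notin> M" by blast
      have dD: "d \<in> D" using d n_def by blast
      let ?Z = "{c \<in> D. c * x \<in> M}" and ?Z' = "{c \<in> D. c * (d * x) \<in> M}"
      have incl: "?Z \<subseteq> ?Z'"
      proof
        fix c assume "c \<in> ?Z"
        then have "d * (c * x) \<in> M" "c \<in> D" using sm_mult[OF M dD] by blast+
        then show "c \<in> ?Z'" using mult.left_commute[of d c x] by simp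
      qed
      obtain s where s: "s \<in> A" "d ^ p = \<pi> * s" using n_nil[OF d(1)] by blast
      have "s * (\<pi> * x) \<in> M" using sm_mult[OF M _ less.prems(4)] s(1) A_D by blast
      then have dp: "d ^ p * x \<in> M" unfolding s(2) by (simp only: ac_simps)
      \<comment> \<open>If the annihilators were equal, no power of \<open>d\<close> could carry
        \<open>x\<close> into \<open>M\<close>; but \<open>d ^ p\<close> is a multiple of
        \<open>\<pi>\<close>.\<close>
      have "?Z \<noteq> ?Z'"
      proof
        assume eq: "?Z = ?Z'"
        have "d ^ Suc j * x \<notin> M" for j
        proof (induction j)
          case (Suc j)
          have "d ^ Suc j \<in> D" using subr_pow'[OF subr_D dD] by blast
          then have "d ^ Suc j \<notin> ?Z'" using Suc eq by blast
          then show ?case using \<open>d ^ Suc j \<in> D\<close> by (simp add: ac_simps)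
        qed (use d in simp)
        then show False using dp p0 by (metis Suc_pred)
      qed
      obtain a' b' where ab: "codim k2 ?Z a' ?Z'" "codim k2 ?Z' b' D" "a' + b' = b"
        using codim_between[OF less.prems(1) k2 sm_k2[OF ann[of x]] incl sub[of "d * x"] sm_k2[OF ann[of "d * x"]]]
        by (elim exE conjE) (rule that)
      have "a' \<noteq> 0" using \<open>?Z \<noteq> ?Z'\<close> ab(1) codim_0 by metis
      then have lt: "b' < b" using ab by simp
      have "\<pi> * (d * x) \<in> M" using sm_mult[OF M dD less.prems(4)] by (simp add: mult.left_commute)
      then show ?thesis using less.IH[OF lt ab(2) sm_mult[OF M' dD less.prems(2)] d(2)] by blast
    qed (use less.prems in blast)
  qed
qed

lemma e_notin_mprod_n: "e \<notin> mprod R n"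
proof
  assume "e \<in> mprod R n"
  moreover have "mprod R n \<subseteq> (*) t ` S"
    by (rule mprod_subset[OF sm_subset[OF sm_tS RS]]) (auto simp: n_def)
  ultimately show False using t_nonunit by blast
qed

text \<open>The filtration of \<open>M'/M\<close> with all quotients isomorphic to \<open>D/n\<close> extends to one of
  \<open>R M'/R M\<close> with all quotients isomorphic to \<open>T/R n\<close>.\<close>

lemma codim_proportional:
  assumes q: "codim k2 ((*) \<pi> ` D) q D"
    and f: "codim k2 n f D" and g: "codim K1 (mprod R n) g T"
  shows "sm D M \<Longrightarrow> sm D M' \<Longrightarrow> M \<subseteq> M' \<Longrightarrow> M' \<subseteq> V \<Longrightarrow>
    (\<And>x. x \<in> M' \<Longrightarrow> \<exists>a\<in>A. a \<noteq> 0 \<and> a * x \<in> M) \<Longrightarrow> codim K1 (mprod R M) G (mprod R M') \<Longrightarrow>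
    \<exists>m. codim k2 M (m * f) M' \<and> G = m * g"
proof (induction G arbitrary: M rule: less_induct)
  case (less G)
  note M = less.prems(1) and M' = less.prems(2) and MM' = less.prems(3) and M'V = less.prems(4)
    and tors = less.prems(5) and G = less.prems(6)
  have MV: "M \<subseteq> V" using MM' M'V by blast
  show ?case
  proof (cases "M = M'")
    case True
    then have "G = 0" using codim_self[OF _ subr_K1 sm_K1_mprod[OF M]] G by simp
    then show ?thesis using True codim_refl by (intro exI[of _ 0]) simp
  next
    case False
    then obtain x0 where x0: "x0 \<in> M'" "x0 \<notin> M" using MM' by blast
    obtain a where a: "a \<in> A" "a \<noteq> 0" "a * x0 \<in> M" using tors[OF x0(1)] by blast
    from \<pi>_descent[OF M x0 M' a] obtain x1 where "x1 \<in> M'" "x1 \<notin> M" "\<pi> * x1 \<in> M" by (elim bexE conjE)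
    from exists_socle_element[OF q M M' this]
    obtain x where x: "x \<in> M'" "x \<notin> M" "\<forall>d\<in>n. d * x \<in> M" by (elim bexE conjE)
    have nx: "d * x \<in> M" if "d \<in> n" for d using x(3) that by (rule bspec)
    have xV: "x \<in> V" using x M'V by blast
    have xe: "e * x = x" using sm_e[OF M' x(1)] .
    have xnz: "x \<noteq> 0" using x(2) sm_0[OF M] by blast
    let ?Dx = "(*) x ` D" and ?nx = "(*) x ` n" and ?Tx = "(*) x ` T" and ?Rnx = "(*) x ` mprod R n"
    have sDx: "sm D ?Dx" by (rule times_sm[OF subr_sm[OF subr_D] xe])
    have snx: "sm D ?nx" by (rule times_sm[OF sm_n xe])
    have sTx: "sm T ?Tx" by (rule times_sm[OF subr_sm[OF subr_T] xe])
    have sRnx: "sm T ?Rnx" by (rule times_sm[OF sm_T_mprod[OF sm_n] xe])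
    have c1: "codim k2 ?nx f ?Dx" by (rule codim_times[OF f subr_k2 sm_k2[OF sm_n] xe xnz])
    have c2: "codim K1 ?Rnx g ?Tx" by (rule codim_times[OF g subr_K1 sm_K1_mprod[OF sm_n] xe xnz])
    have i1: "M \<inter> ?Dx \<subseteq> ?nx"
    proof
      fix z assume z: "z \<in> M \<inter> ?Dx"
      then obtain d where d: "d \<in> D" "z = x * d" by blast
      have "d \<in> n"
      proof (rule ccontr)
        assume "d \<notin> n"
        then obtain h where h: "h \<in> D" "d * h = e" using D_cases d by blast
        have "h * z = x" using d h xe by (metis mult.left_commute mult.commute)
        moreover have "h * z \<in> M" using sm_mult[OF M h(1)] z by blast
        ultimately show False using x(2) by simp
      qed
      then show "z \<in> ?nx" using d by blast
    qed
    have nxM: "?nx \<subseteq> M" using nx by (auto simp: mult.commute[of x])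
    \<comment> \<open>The only point of the induction that depends on flatness.\<close>
    have i2: "mprod R M \<inter> ?Tx \<subseteq> ?Rnx"
    proof
      fix z assume z: "z \<in> mprod R M \<inter> ?Tx"
      then obtain y where y: "y \<in> T" "z = x * y" by blast
      then have "y \<in> mprod R n" using colon_ideal[OF M MV xV x(2) nx y(1)] z by (simp add: mult.commute)
      then show "z \<in> ?Rnx" using y by blast
    qed
    \<comment> \<open>The next step of the filtration: \<open>M1/M\<close> is a copy of
      \<open>D/n\<close>, and \<open>R M1/R M\<close> is a copy of \<open>T/R n\<close>.\<close>
    define M1 where "M1 = sumset M ?Dx"
    have M1: "sm D M1" unfolding M1_def by (rule sumset_sm[OF M sDx])
    have DxM': "?Dx \<subseteq> M'" using sm_mult[OF M' _ x(1)] by (auto simp: mult.commute)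
    have M1M': "M1 \<subseteq> M'" unfolding M1_def by (rule sumset_least[OF M' MM' DxM'])
    have MM1: "M \<subseteq> M1" unfolding M1_def by (rule sumset_incl1[OF sm_0[OF sDx]])
    have DxM1: "?Dx \<subseteq> M1" unfolding M1_def by (rule sumset_incl2[OF sm_0[OF M]])
    have k1: "codim k2 M f M1"
      using codim_diamond[OF c1 subr_k2 sm_k2[OF snx] sm_k2[OF M] i1] sumset_absorb[OF M nxM sm_0[OF snx]]
      unfolding M1_def by simp
    have RnxRM: "?Rnx \<subseteq> mprod R M"
    proof
      fix z assume "z \<in> ?Rnx"
      then obtain y where y: "y \<in> mprod R n" "z = x * y" by blast
      from y(1) have "x * y \<in> mprod R M"
      proof (rule mprod_mult_into)
        fix r d assume "r \<in> R" "d \<in> n"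
        then have "r * (d * x) \<in> mprod R M" using mprod_mem nx by blast
        then show "x * (r * d) \<in> mprod R M" by (simp add: ac_simps)
      qed
      then show "z \<in> mprod R M" using y by simp
    qed
    have sRM1: "sm T (mprod R M1)" using sm_T_mprod[OF M1] .
    have RM1: "sumset (mprod R M) ?Tx = mprod R M1"
    proof
      have "?Tx \<subseteq> mprod R M1"
      proof
        fix z assume "z \<in> ?Tx"
        then obtain y where y: "y \<in> mprod R D" "z = x * y" using T_eq by blast
        from y(1) have "x * y \<in> mprod R M1"
        proof (rule mprod_mult_into)
          fix r d assume "r \<in> R" "d \<in> D"
          then have "r * (x * d) \<in> mprod R M1" using mprod_mem[of r R "x * d" M1] DxM1 by blast
          then show "x * (r * d) \<in> mprod R M1" by (simp add: ac_simps)
        qed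
        then show "z \<in> mprod R M1" using y by simp
      qed
      then show "sumset (mprod R M) ?Tx \<subseteq> mprod R M1"
        using sumset_least[OF sRM1 mprod_mono[OF subset_refl MM1]] by blast
      have s: "sm R (sumset (mprod R M) ?Tx)"
        using sm_subset[OF sumset_sm[OF sm_T_mprod[OF M] sTx] R_T] .
      have "M \<subseteq> mprod R M" using mprod_incl[OF R sm_e[OF M]] by blast
      then have "M \<subseteq> sumset (mprod R M) ?Tx" using sumset_incl1[OF sm_0[OF sTx]] by blast
      moreover have "?Dx \<subseteq> sumset (mprod R M) ?Tx"
        using D_T sumset_incl2[OF sm_0[OF sm_T_mprod[OF M]], of ?Tx] by blast
      ultimately have "M1 \<subseteq> sumset (mprod R M) ?Tx"
        unfolding M1_def using sumset_least[OF s] by blast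
      from mprod_subset[OF s subsetD[OF this]] show "mprod R M1 \<subseteq> sumset (mprod R M) ?Tx" .
    qed
    have k3: "codim K1 (mprod R M) g (mprod R M1)"
      using codim_diamond[OF c2 subr_K1 sm_subset[OF sRnx K1_T] sm_K1_mprod[OF M] i2]
        sumset_absorb[OF sm_T_mprod[OF M] RnxRM sm_0[OF sRnx]] RM1 by simp
    obtain a' b where ab: "codim K1 (mprod R M) a' (mprod R M1)" "codim K1 (mprod R M1) b (mprod R M')" "a' + b = G"
      using codim_between[OF G K1 sm_K1_mprod[OF M] mprod_mono[OF subset_refl MM1]
          mprod_mono[OF subset_refl M1M'] sm_K1_mprod[OF M1]]
      by (elim exE conjE) (rule that)
    have a'g: "a' = g" using codim_unique[OF ab(1) K1 sm_K1_mprod[OF M] k3] .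
    \<comment> \<open>Positivity of \<open>g\<close> is what lets the induction on \<open>G\<close>
      descend.\<close>
    have "g \<noteq> 0"
    proof
      assume "g = 0"
      then have "T = mprod R n" using codim_0 g by blast
      then show False using e_notin_mprod_n subr_e[OF subr_T] by simp
    qed
    then have lt: "b < G" using ab(3) a'g by simp
    have tors1: "\<exists>a\<in>A. a \<noteq> 0 \<and> a * x \<in> M1" if "x \<in> M'" for x using tors[OF that] MM1 by blast
    have "\<exists>m. codim k2 M1 (m * f) M' \<and> b = m * g"
      by (rule less.IH[OF lt M1 M' M1M' M'V tors1 ab(2)])
    then obtain m where m: "codim k2 M1 (m * f) M'" "b = m * g" by (elim exE conjE) (rule that)
    have "codim k2 M (Suc m * f) M'" using codim_trans[OF m(1) k1] by simp
    moreover have "G = Suc m * g" using ab(3) a'g m(2) by simp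
    ultimately show ?thesis by (intro exI conjI)
  qed
qed

end

section \<open>Dimensions modulo \<open>\<pi>\<close> and the factor \<open>p\<close>\<close>

context core2
begin

lemma K1_S_sm: "sm S M \<Longrightarrow> sm K1 M" using sm_subset[OF _ K1S] .

lemma \<pi>T_sm: "sm T ((*) \<pi> ` T)" by (rule times_sm[OF subr_sm[OF subr_T] \<pi>e])
lemma \<pi>S_sm: "sm S ((*) \<pi> ` S)" by (rule times_sm[OF subr_sm[OF S] \<pi>e])
lemma sm_K1_T: "sm K1 T" using sm_subset[OF subr_sm[OF subr_T] K1_T] .
text \<open>Multiplication by \<open>t ^ j\<close> carries the layer \<open>S/t S\<close> to the
  layer between \<open>t ^ j S\<close> and \<open>t ^ (j + 1) S\<close>. The case
  \<open>j = p\<close> is the origin of the factor \<open>p\<close>.\<close>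

lemma codim_uniformizer_powers:
  assumes "codim K1 ((*) t ` S) \<delta> S"
  shows "codim K1 ((*) (e * t ^ j) ` S) (j * \<delta>) S"
proof (induction j)
  case 0
  have "(*) (e * t ^ 0) ` S = S" using subr_unit[OF S] by simp
  then show ?case using codim_refl by simp
next
  case (Suc j)
  have x: "e * (e * t ^ j) = e * t ^ j" using ee by (simp add: mult.assoc[symmetric])
  have x0: "e * t ^ j \<noteq> 0"
  proof (cases "j = 0")
    case False
    then show ?thesis using power_nz[OF te t0] pow_e[OF te] by simp
  qed (use e0 in simp)
  have "codim K1 ((*) (e * t ^ j) ` (*) t ` S) \<delta> ((*) (e * t ^ j) ` S)"
    by (rule codim_times[OF assms subr_K1 K1_S_sm[OF sm_tS] x x0])
  moreover have "(*) (e * t ^ j) ` (*) t ` S = (*) (e * t ^ Suc j) ` S"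
    by (simp add: image_image ac_simps)
  ultimately show ?case using codim_trans[OF Suc.IH] by simp
qed

text \<open>Frobenius maps \<open>S/t S\<close> over \<open>K1\<close> semilinearly onto
  \<open>A/\<pi> A\<close> over \<open>k0\<close>. Generators of the latter still generate
  \<open>D/\<pi> D\<close> over \<open>k2\<close>, but they may become dependent there, whence only
  an inequality.\<close>

lemma codim_mod_\<pi>:
  assumes "codim K1 ((*) t ` S) \<delta> S"
  shows "\<exists>q\<le>\<delta>. codim k2 ((*) \<pi> ` D) q D"
proof -
  have "codim ((\<lambda>c. c ^ p) ` K1) ((\<lambda>s. s ^ p) ` (*) t ` S) \<delta> ((\<lambda>s. s ^ p) ` S)"
  proof (rule codim_image[OF assms subr_K1 K1_S_sm[OF sm_tS]])
    show "e * x = x \<Longrightarrow> e * y = y \<Longrightarrow> (x + y) ^ p = x ^ p + y ^ p" for x y by (rule frob)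
    show "e * x = x \<Longrightarrow> e * x ^ p = x ^ p" for x by (rule pow_e[OF _ p0])
    show "e * x = x \<Longrightarrow> e * y = y \<Longrightarrow> x ^ p = y ^ p \<Longrightarrow> x = y" for x y by (rule frob_inj)
    show "c \<in> K1 \<Longrightarrow> (c * x) ^ p = c ^ p * x ^ p" for c x by (rule power_mult_distrib)
  qed
  moreover have "(\<lambda>s. s ^ p) ` (*) t ` S = (*) \<pi> ` A"
    unfolding A_def \<pi>_def by (simp add: image_image power_mult_distrib)
  ultimately have c: "codim k0 ((*) \<pi> ` A) \<delta> A" unfolding k0_def A_def by simp
  have k0A: "k0 \<subseteq> A" unfolding k0_def A_def using K1S by blast
  have s: "sm k0 ((*) \<pi> ` A)" using sm_subset[OF times_sm[OF subr_sm[OF subr_A] \<pi>e] k0A] by simp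
  from codim_span[OF c subf_r[OF subf_k0] s]
  obtain Z where Z: "finite Z" "card Z \<le> \<delta>" "Z \<subseteq> A" "A = sumset ((*) \<pi> ` A) (mprod k0 Z)"
    by (elim exE conjE) (rule that)
  have ZD: "Z \<subseteq> D" using Z(3) A_D by blast
  have Ze: "\<And>m. m \<in> Z \<Longrightarrow> e * m = m" using De ZD by blast
  have sZ: "sm k2 (mprod k2 Z)" using mprod_sm[OF subr_k2, of Z] Ze by simp
  have s\<pi>: "sm k2 ((*) \<pi> ` D)" using sm_k2[OF \<pi>D_ideal] .
  let ?Xs = "sumset ((*) \<pi> ` D) (mprod k2 Z)"
  have sX: "sm k2 ?Xs" using sumset_sm[OF s\<pi> sZ] .
  have "?Xs = D"
  proof
    have "mprod k2 Z \<subseteq> D" by (rule mprod_subset[OF sm_k2[OF subr_sm[OF subr_D]] subsetD[OF ZD]])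
    moreover have "(*) \<pi> ` D \<subseteq> D" using subr_mult[OF subr_D \<pi>D] by blast
    ultimately show "?Xs \<subseteq> D" using sumset_least[OF subr_sm[OF subr_D]] by simp
    show "D \<subseteq> ?Xs"
    proof
      fix x assume "x \<in> D"
      then have "x \<in> mprod A k2" unfolding D_def .
      then show "x \<in> ?Xs"
      proof (induction rule: mprod.induct)
        case zero
        then show ?case using sm_0[OF sX] .
      next
        case (step x a c)
        from step.hyps(2) Z(4) have "a \<in> sumset ((*) \<pi> ` A) (mprod k0 Z)" by simp
        then obtain b z where b: "b \<in> (*) \<pi> ` A" "z \<in> mprod k0 Z" "a = b + z" by (rule sumsetE)
        have "z \<in> mprod k2 Z" using b(2) mprod_mono[of k0 k2 Z Z] k0k2 k0_def by blast
        moreover have "b \<in> (*) \<pi> ` D" using b(1) A_D by blast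
        ultimately have "a \<in> ?Xs" unfolding b(3) by (intro sumsetI)
        then have "c * a \<in> ?Xs" by (rule sm_mult[OF sX step.hyps(3)])
        then show ?case using sm_add[OF sX step.IH] by (simp add: mult.commute)
      qed
    qed
  qed
  then show ?thesis using codim_spanned[OF k2 s\<pi> Z(1)] Ze Z(2) by (metis le_trans)
qed

text \<open>The unknowns \<open>f\<close> and \<open>g\<close>, the dimensions of \<open>D/n\<close>
  and \<open>T/R n\<close>, are compared on \<open>D/\<pi> D\<close>, where both totals are
  controlled by \<open>S/t S\<close>; the comparison is then reused on \<open>C/D\<close>. The set
  \<open>Z\<close> makes \<open>T/\<pi> T\<close> finite dimensional.\<close>

theorem codim_frobenius_bound:
  assumes Z: "finite Z" "Z \<subseteq> T" "T \<subseteq> sumset ((*) \<pi> ` T) (mprod K1 Z)"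
    and C: "sm D C" "D \<subseteq> C" "C \<subseteq> S" and tors: "\<And>x. x \<in> C \<Longrightarrow> \<exists>a\<in>A. a \<noteq> 0 \<and> a * x \<in> D"
    and N: "codim K1 T N S"
  shows "\<exists>m. codim k2 D m C \<and> p * m \<le> N"
proof -
  have s\<pi>T: "sm K1 ((*) \<pi> ` T)" using sm_subset[OF \<pi>T_sm K1_T] .
  have s\<pi>S: "sm K1 ((*) \<pi> ` S)" using K1_S_sm[OF \<pi>S_sm] .
  have stS: "sm K1 ((*) t ` S)" using K1_S_sm[OF sm_tS] .
  have \<pi>T: "\<pi> \<in> T" using \<pi>D D_T by blast
  have \<pi>S: "\<pi> \<in> S" using \<pi>T T_S by blast
  have "mprod K1 Z \<subseteq> T" by (rule mprod_subset[OF sm_K1_T subsetD[OF Z(2)]])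
  moreover have "(*) \<pi> ` T \<subseteq> T" using subr_mult[OF subr_T \<pi>T] by blast
  ultimately have "sumset ((*) \<pi> ` T) (mprod K1 Z) \<subseteq> T" using sumset_least[OF sm_K1_T] by simp
  then have eqT: "sumset ((*) \<pi> ` T) (mprod K1 Z) = T" using Z(3) by simp
  have "\<forall>x\<in>Z. e * x = x" using Z(2) subr_unit[OF subr_T] by blast
  from codim_spanned[OF K1 s\<pi>T Z(1) this] obtain h where h: "codim K1 ((*) \<pi> ` T) h T" unfolding eqT by blast
  have i1: "(*) \<pi> ` T \<subseteq> (*) \<pi> ` S" using T_S by blast
  have i2: "(*) \<pi> ` S \<subseteq> S" using subr_mult[OF S \<pi>S] by blast
  \<comment> \<open>Both \<open>T\<close> and \<open>\<pi> S\<close> lie between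
    \<open>\<pi> T\<close> and \<open>S\<close>. As \<open>S/T\<close> and
    \<open>\<pi> S/\<pi> T\<close> have equal dimension, so have \<open>T/\<pi> T\<close> and
    \<open>S/\<pi> S\<close>.\<close>
  from codim_between[OF codim_trans[OF N h] K1 s\<pi>T i1 i2 s\<pi>S]
  obtain a b where ab: "codim K1 ((*) \<pi> ` T) a ((*) \<pi> ` S)" "codim K1 ((*) \<pi> ` S) b S" "a + b = h + N"
    by (elim exE conjE) (rule that)
  have "codim K1 ((*) \<pi> ` T) N ((*) \<pi> ` S)" by (rule codim_times[OF N subr_K1 sm_K1_T \<pi>e \<pi>0])
  from codim_unique[OF ab(1) K1 s\<pi>T this] have bh: "b = h" using ab(3) by simp
  obtain s0 where s0: "s0 \<in> S" "\<pi> = t * s0" using \<pi>_tS by blast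
  have i3: "(*) \<pi> ` S \<subseteq> (*) t ` S"
  proof
    fix z assume "z \<in> (*) \<pi> ` S"
    then obtain s where s: "s \<in> S" "z = \<pi> * s" by blast
    then have "z = t * (s0 * s)" using s0 by (simp add: mult.assoc)
    then show "z \<in> (*) t ` S" using subr_mult[OF S s0(1) s(1)] by blast
  qed
  have i4: "(*) t ` S \<subseteq> S" using subr_mult[OF S tS] by blast
  from codim_between[OF ab(2) K1 s\<pi>S i3 i4 stS]
  obtain c \<delta> where \<delta>: "codim K1 ((*) t ` S) \<delta> S" by (elim exE conjE) (rule that)
  have "codim K1 ((*) \<pi> ` S) (p * \<delta>) S"
    using codim_uniformizer_powers[OF \<delta>, of p] pow_e[OF te p0] unfolding \<pi>_def by simp
  from codim_unique[OF ab(2) K1 s\<pi>S this] have h\<delta>: "h = p * \<delta>" using bh by simp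
  obtain q where q: "q \<le> \<delta>" "codim k2 ((*) \<pi> ` D) q D" using codim_mod_\<pi>[OF \<delta>] by blast
  have i5: "(*) \<pi> ` D \<subseteq> n" using sm_mult[OF sm_n _ \<pi>_n] by (auto simp: mult.commute)
  have nD: "n \<subseteq> D" unfolding n_def by blast
  from codim_between[OF q(2) k2 sm_k2[OF \<pi>D_ideal] i5 nD sm_k2[OF sm_n]]
  obtain f' f where f: "codim k2 n f D" by (elim exE conjE) (rule that)
  have Rne: "\<And>m. m \<in> n \<Longrightarrow> e * m = m" using sm_e[OF sm_n] .
  have \<pi>Rn: "\<pi> \<in> mprod R n" by (rule mprod_incl[OF R Rne \<pi>_n])
  have i6: "(*) \<pi> ` T \<subseteq> mprod R n" using sm_mult[OF sm_T_mprod[OF sm_n] _ \<pi>Rn] by (auto simp: mult.commute)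
  have i7: "mprod R n \<subseteq> T" using mprod_mono[OF subset_refl nD, of R] T_eq by simp
  from codim_between[OF h K1 s\<pi>T i6 i7 sm_K1_mprod[OF sm_n]]
  obtain g' g where g: "codim K1 (mprod R n) g T" by (elim exE conjE) (rule that)
  have sD: "sm D D" using subr_sm[OF subr_D] .
  have \<pi>Dsub: "(*) \<pi> ` D \<subseteq> D" using i5 nD by blast
  have eq1: "mprod R ((*) \<pi> ` D) = (*) \<pi> ` T"
  proof
    show "mprod R ((*) \<pi> ` D) \<subseteq> (*) \<pi> ` T"
      using mprod_subset[OF sm_subset[OF \<pi>T_sm R_T], of "(*) \<pi> ` D"] D_T by blast
    show "(*) \<pi> ` T \<subseteq> mprod R ((*) \<pi> ` D)"
    proof
      fix z assume "z \<in> (*) \<pi> ` T"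
      then obtain y where y: "y \<in> mprod R D" "z = \<pi> * y" using T_eq by blast
      from y(1) have "\<pi> * y \<in> mprod R ((*) \<pi> ` D)"
      proof (rule mprod_mult_into)
        fix r d assume "r \<in> R" "d \<in> D"
        then have "r * (\<pi> * d) \<in> mprod R ((*) \<pi> ` D)" by (intro mprod_mem imageI)
        then show "\<pi> * (r * d) \<in> mprod R ((*) \<pi> ` D)" by (simp add: mult.left_commute)
      qed
      then show "z \<in> mprod R ((*) \<pi> ` D)" using y(2) by simp
    qed
  qed
  have tors1: "\<exists>a\<in>A. a \<noteq> 0 \<and> a * x \<in> (*) \<pi> ` D" if "x \<in> D" for x using \<pi>A \<pi>0 that by blast
  have hG: "codim K1 (mprod R ((*) \<pi> ` D)) h (mprod R D)" using h eq1 T_eq by simp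
  \<comment> \<open>First use of the filtration, on the pair
    \<open>\<pi> D \<subseteq> D\<close>.\<close>
  have "\<exists>m. codim k2 ((*) \<pi> ` D) (m * f) D \<and> h = m * g"
    by (rule codim_proportional[OF q(2) f g \<pi>D_ideal sD \<pi>Dsub D_V tors1 hG])
  then obtain m where m: "codim k2 ((*) \<pi> ` D) (m * f) D" "h = m * g" by blast
  have qm: "q = m * f" by (rule codim_unique[OF q(2) k2 sm_k2[OF \<pi>D_ideal] m(1)])
  have "m \<noteq> 0"
  proof
    assume "m = 0"
    then have "D = (*) \<pi> ` D" using codim_0[of k2 "(*) \<pi> ` D" D] m(1) by simp
    then have "e \<in> (*) \<pi> ` D" using subr_e[OF subr_D] by simp
    then show False using \<pi>_nonunit D_S by blast
  qed
  \<comment> \<open>From \<open>q \<le> \<delta>\<close> and \<open>h = p * \<delta>\<close>; the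
    length \<open>m\<close> cancels because \<open>D/\<pi> D\<close> is nonzero.\<close>
  have "m * (p * f) = p * q" using qm by simp
  also have "\<dots> \<le> m * g" using mult_le_mono2[OF q(1), of p] m(2) h\<delta> by (simp only:)
  finally have pfg: "p * f \<le> g" using \<open>m \<noteq> 0\<close> by simp
  have CV: "C \<subseteq> V"
  proof
    fix x assume "x \<in> C"
    then show "x \<in> V" unfolding V_def using tors[of x] sm_e[OF C(1)] by blast
  qed
  have i8: "T \<subseteq> mprod R C" using mprod_mono[OF subset_refl C(2), of R] T_eq by simp
  have i9: "mprod R C \<subseteq> S" by (rule mprod_subset[OF sm_subset[OF subr_sm[OF S] RS] subsetD[OF C(3)]])
  from codim_between[OF N K1 sm_K1_T i8 i9 sm_K1_mprod[OF C(1)]]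
  obtain G b' where G: "codim K1 T G (mprod R C)" "G + b' = N" by (elim exE conjE) (rule that)
  \<comment> \<open>Second use, on the pair \<open>D \<subseteq> C\<close>; the extension
    \<open>R C\<close> lies between \<open>T\<close> and \<open>S\<close>.\<close>
  have "\<exists>m. codim k2 D (m * f) C \<and> G = m * g"
    by (rule codim_proportional[OF q(2) f g sD C(1,2) CV tors G(1)[unfolded T_eq]])
  then obtain m' where m': "codim k2 D (m' * f) C" "G = m' * g" by blast
  have "p * (m' * f) = m' * (p * f)" by simp
  also have "\<dots> \<le> m' * g" using pfg by simp
  also have "\<dots> \<le> N" using m'(2) G(2) by simp
  finally show ?thesis using m'(1) by blast
qed

end

section \<open>Purely inseparable normalizations\<close>

lemma (in idf) mprod_coeffs:
  assumes "x \<in> mprod P E" "finite E" and P: "subr P"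
  shows "\<exists>a. (\<forall>y\<in>E. a y \<in> P) \<and> x = (\<Sum>y\<in>E. a y * y)"
  using assms(1)
proof (induction rule: mprod.induct)
  case zero
  show ?case using subr_0[OF P] by (intro exI[of _ "\<lambda>_. 0"]) simp
next
  case (step x c m)
  then obtain a where a: "\<forall>y\<in>E. a y \<in> P" "x = (\<Sum>y\<in>E. a y * y)" by blast
  define a' where "a' = a(m := a m + c)"
  have "(\<Sum>y\<in>E. a' y * y) = (\<Sum>y\<in>E. a y * y + (if y = m then c * y else 0))"
    unfolding a'_def by (intro sum.cong) (auto simp: algebra_simps)
  also have "\<dots> = x + c * m" using assms(2) step.hyps(3) a(2) by (simp add: sum.distrib)
  finally have "x + c * m = (\<Sum>y\<in>E. a' y * y)" by simp
  moreover have "\<forall>y\<in>E. a' y \<in> P" unfolding a'_def using a(1) subr_add[OF P _ step.hyps(2)] step.hyps(3) by simp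
  ultimately show ?case by (intro exI[of _ a']) simp
qed

context idf_char
begin

text \<open>The elements \<open>x\<close> of the fraction field of \<open>M\<close> with \<open>x\<^sup>p \<in> Xs\<close>.\<close>

definition frob_closure :: "'u set \<Rightarrow> 'u set \<Rightarrow> 'u set" where
  "frob_closure M Xs = {x. e * x = x \<and> (\<exists>b\<in>M. b \<noteq> 0 \<and> x * b \<in> M) \<and> x ^ p \<in> Xs}"

lemma frob_closureI:
  "e * x = x \<Longrightarrow> b \<in> M \<Longrightarrow> b \<noteq> 0 \<Longrightarrow> x * b \<in> M \<Longrightarrow> x ^ p \<in> Xs \<Longrightarrow> x \<in> frob_closure M Xs"
  unfolding frob_closure_def by blast

lemma subr_nz_mult: "subr M \<Longrightarrow> a \<in> M \<Longrightarrow> b \<in> M \<Longrightarrow> a \<noteq> 0 \<Longrightarrow> b \<noteq> 0 \<Longrightarrow> a * b \<noteq> 0"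
  using no_zero_div[OF subr_unit _ subr_unit] by blast

lemma frob_closure_incl:
  assumes M: "subr M" and Xs: "\<And>m. m \<in> M \<Longrightarrow> m ^ p \<in> Xs"
  shows "M \<subseteq> frob_closure M Xs"
proof
  fix m assume m: "m \<in> M"
  then have "m * e \<in> M" using subr_mult[OF M _ subr_e[OF M]] by blast
  then show "m \<in> frob_closure M Xs"
    using frob_closureI[OF subr_unit[OF M m] subr_e[OF M] e0] Xs[OF m] by blast
qed

text \<open>The condition on p-th powers passes to differences because Frobenius is additive;
  denominators are multiplied.\<close>

lemma frob_closure_subr:
  assumes M: "subr M" and Xs: "subr Xs"
  shows "subr (frob_closure M Xs)"
proof (rule subrI)
  show "\<And>x. x \<in> frob_closure M Xs \<Longrightarrow> e * x = x" unfolding frob_closure_def by blast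
  show "e \<in> frob_closure M Xs"
    using frob_closureI[OF ee subr_e[OF M] e0] subr_e[OF M] subr_e[OF Xs] ee e_pow[OF p0] by simp
next
  fix x y assume "x \<in> frob_closure M Xs" "y \<in> frob_closure M Xs"
  then obtain b c where x: "e * x = x" "b \<in> M" "b \<noteq> 0" "x * b \<in> M" "x ^ p \<in> Xs"
    and y: "e * y = y" "c \<in> M" "c \<noteq> 0" "y * c \<in> M" "y ^ p \<in> Xs"
    unfolding frob_closure_def by blast
  have bc: "b * c \<in> M" "b * c \<noteq> 0" using subr_mult[OF M x(2) y(2)] subr_nz_mult[OF M x(2) y(2) x(3) y(3)] .
  have "(x - y) * (b * c) = (x * b) * c - (y * c) * b" by (simp add: algebra_simps)
  then have 1: "(x - y) * (b * c) \<in> M"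
    using subr_diff[OF M subr_mult[OF M x(4) y(2)] subr_mult[OF M y(4) x(2)]] by simp
  have 2: "(x - y) ^ p \<in> Xs" using frob_diff[OF x(1) y(1)] subr_diff[OF Xs x(5) y(5)] by simp
  have "e * (x - y) = x - y" using x(1) y(1) by (simp add: right_diff_distrib)
  then show "x - y \<in> frob_closure M Xs" using frob_closureI[OF _ bc 1 2] by blast
  have "(x * y) * (b * c) = (x * b) * (y * c)" by (simp add: ac_simps)
  then have 3: "(x * y) * (b * c) \<in> M" using subr_mult[OF M x(4) y(4)] by (simp only:)
  have 4: "(x * y) ^ p \<in> Xs" using subr_mult[OF Xs x(5) y(5)] by (simp add: power_mult_distrib)
  have "e * (x * y) = x * y" using x(1) by (simp add: mult.assoc[symmetric])
  then show "x * y \<in> frob_closure M Xs" using frob_closureI[OF _ bc 3 4] by blast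
qed

text \<open>Frobenius is a ring map and so respects composita. It turns \<open>T2\<close>, the
  compositum of \<open>S1\<close> and \<open>K2\<close>, into \<open>D\<close>, that of
  \<open>A\<close> and \<open>K2^p\<close>.\<close>

lemma mprod_frob:
  assumes P: "\<And>a. a \<in> P \<Longrightarrow> e * a = a" and Q: "\<And>a. a \<in> Q \<Longrightarrow> e * a = a"
  shows "(\<lambda>x. x ^ p) ` mprod P Q = mprod ((\<lambda>x. x ^ p) ` P) ((\<lambda>x. x ^ p) ` Q)"
proof
  show "(\<lambda>x. x ^ p) ` mprod P Q \<subseteq> mprod ((\<lambda>x. x ^ p) ` P) ((\<lambda>x. x ^ p) ` Q)"
  proof
    fix z assume "z \<in> (\<lambda>x. x ^ p) ` mprod P Q"
    then obtain x where x: "x \<in> mprod P Q" "z = x ^ p" by blast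
    from x(1) have "x ^ p \<in> mprod ((\<lambda>x. x ^ p) ` P) ((\<lambda>x. x ^ p) ` Q)"
    proof (induction rule: mprod.induct)
      case zero
      then show ?case using p0 mprod.zero by (simp add: power_0_left)
    next
      case (step x a m)
      have "e * (a * m) = a * m" using P[OF step.hyps(2)] by (simp add: mult.assoc[symmetric])
      from frob[OF mprod_e[OF step.hyps(1) Q] this]
      have "(x + a * m) ^ p = x ^ p + a ^ p * m ^ p" by (simp add: power_mult_distrib)
      then show ?case using mprod.step[OF step.IH imageI[OF step.hyps(2)] imageI[OF step.hyps(3)]] by simp
    qed
    then show "z \<in> mprod ((\<lambda>x. x ^ p) ` P) ((\<lambda>x. x ^ p) ` Q)" using x(2) by simp
  qed
  show "mprod ((\<lambda>x. x ^ p) ` P) ((\<lambda>x. x ^ p) ` Q) \<subseteq> (\<lambda>x. x ^ p) ` mprod P Q"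
  proof
    fix z assume "z \<in> mprod ((\<lambda>x. x ^ p) ` P) ((\<lambda>x. x ^ p) ` Q)"
    then show "z \<in> (\<lambda>x. x ^ p) ` mprod P Q"
    proof (induction rule: mprod.induct)
      case zero
      have "0 = (0::'u) ^ p" using p0 by (simp add: power_0_left)
      then show ?case using mprod.zero by (intro image_eqI[of _ _ 0])
    next
      case (step z a' m')
      then obtain x a m where x: "x \<in> mprod P Q" "z = x ^ p" "a \<in> P" "a' = a ^ p" "m \<in> Q" "m' = m ^ p" by blast
      have "e * (a * m) = a * m" using P[OF x(3)] by (simp add: mult.assoc[symmetric])
      from frob[OF mprod_e[OF x(1) Q] this]
      have "(x + a * m) ^ p = z + a' * m'" using x by (simp add: power_mult_distrib)
      then show ?case using mprod.step[OF x(1,3,5)] by (metis imageI)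
    qed
  qed
qed

lemma mprod_finite_support:
  assumes "finite J" "\<And>j. j \<in> J \<Longrightarrow> d j \<in> mprod P Q"
  shows "\<exists>Xs. finite Xs \<and> Xs \<subseteq> Q \<and> (\<forall>j\<in>J. d j \<in> mprod P Xs)"
proof -
  have one: "\<exists>Xs. finite Xs \<and> Xs \<subseteq> Q \<and> x \<in> mprod P Xs" if "x \<in> mprod P Q" for x
    using that
  proof (induction rule: mprod.induct)
    case zero
    then show ?case using mprod.zero by blast
  next
    case (step x a m)
    then obtain Xs where Xs: "finite Xs" "Xs \<subseteq> Q" "x \<in> mprod P Xs" by blast
    have "x \<in> mprod P (insert m Xs)" using Xs(3) mprod_mono[OF subset_refl, of Xs "insert m Xs" P] by blast
    then have "x + a * m \<in> mprod P (insert m Xs)" using mprod.step[OF _ step.hyps(2)] by blast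
    then show ?case using Xs step.hyps(3) by (intro exI[of _ "insert m Xs"]) simp
  qed
  have "\<forall>j\<in>J. \<exists>Xs. finite Xs \<and> Xs \<subseteq> Q \<and> d j \<in> mprod P Xs" using one assms(2) by blast
  then obtain F where F: "\<forall>j\<in>J. finite (F j) \<and> F j \<subseteq> Q \<and> d j \<in> mprod P (F j)" by (rule bchoice[THEN exE])
  have "d j \<in> mprod P (\<Union>(F ` J))" if "j \<in> J" for j
    using F that mprod_mono[OF subset_refl, of "F j" "\<Union>(F ` J)" P] by blast
  moreover have "finite (\<Union>(F ` J))" "\<Union>(F ` J) \<subseteq> Q" using F assms(1) by auto
  ultimately show ?thesis by (intro exI[of _ "\<Union>(F ` J)"]) simp
qed

end

text \<open>The arithmetic input in axiomatic form. \<open>Z0\<close> expresses that the residue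
  field of \<open>R\<close> is finite over \<open>K\<close>, \<open>gen\<close> that
  \<open>K1\<close> is spanned over \<open>K\<close> by \<open>K2^p\<close>,
  \<open>K_indep_basis\<close> that finite subsets of \<open>K2^p\<close> are spanned over
  \<open>K1^p\<close> by elements independent over \<open>K\<close>, and
  \<open>R_K1_disjoint\<close> that \<open>R\<close> and \<open>K1\<close> are linearly disjoint
  over \<open>K\<close>.\<close>

locale tower = idf_char e p for e :: "'u::comm_ring_1" and p +
  fixes R K K1 K2 :: "'u set" and \<eta> :: 'u and Z0 :: "'u set"
  assumes R: "subr R" and K: "subf K" and KR: "K \<subseteq> R" and K1: "subf K1" and KK1: "K \<subseteq> K1"
    and K2: "subf K2" and K1K2: "K1 \<subseteq> K2"
    and K1p: "(\<lambda>x. x ^ p) ` K1 \<subseteq> K" and K2p: "(\<lambda>x. x ^ p) ` K2 \<subseteq> K1"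
    and \<eta>R: "\<eta> \<in> R" and \<eta>0: "\<eta> \<noteq> 0" and \<eta>_nonunit: "\<And>v. v \<in> R \<Longrightarrow> \<eta> * v \<noteq> e"
    and dvr_R: "\<And>r. r \<in> R \<Longrightarrow> r \<noteq> 0 \<Longrightarrow> \<exists>j u v. u \<in> R \<and> v \<in> R \<and> u * v = e \<and> r = u * \<eta> ^ j"
    and Z0: "finite Z0" "Z0 \<subseteq> R" "R \<subseteq> sumset ((*) \<eta> ` R) (mprod K Z0)"
    and gen: "K1 \<subseteq> mprod K ((\<lambda>x. x ^ p) ` K2)"
    and K_indep_basis: "\<And>Xs. finite Xs \<Longrightarrow> Xs \<subseteq> (\<lambda>x. x ^ p) ` K2 \<Longrightarrow>
      \<exists>E. finite E \<and> E \<subseteq> (\<lambda>x. x ^ p) ` K2 \<and> Xs \<subseteq> mprod ((\<lambda>x. x ^ p) ` K1) E \<and>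
        (\<forall>c. (\<forall>y\<in>E. c y \<in> K) \<longrightarrow> (\<Sum>y\<in>E. c y * y) = 0 \<longrightarrow> (\<forall>y\<in>E. c y = 0))"
    and R_K1_disjoint: "\<And>E r. finite E \<Longrightarrow> E \<subseteq> K1 \<Longrightarrow>
      (\<forall>c. (\<forall>y\<in>E. c y \<in> K) \<longrightarrow> (\<Sum>y\<in>E. c y * y) = 0 \<longrightarrow> (\<forall>y\<in>E. c y = 0)) \<Longrightarrow>
      (\<forall>y\<in>E. r y \<in> R) \<Longrightarrow> (\<Sum>y\<in>E. r y * y) = 0 \<Longrightarrow> \<forall>y\<in>E. r y = 0"
begin

text \<open>\<open>S1\<close> and \<open>S2\<close> are the normalizations in a form fit for
  Frobenius; \<open>normalized.N_image\<close> identifies them with the integral closures.\<close>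

definition "T1 = mprod R K1"
definition "S1 = frob_closure T1 R"
definition "T2 = mprod S1 K2"
definition "S2 = frob_closure T2 S1"

lemma subr_T1: "subr T1" unfolding T1_def by (rule mprod_subr[OF R subf_r[OF K1]])

lemma \<eta>e: "e * \<eta> = \<eta>" using subr_unit[OF R \<eta>R] .

lemma T1_pow: "m \<in> T1 \<Longrightarrow> m ^ p \<in> R"
proof -
  assume "m \<in> T1"
  then have "m ^ p \<in> mprod ((\<lambda>x. x ^ p) ` R) ((\<lambda>x. x ^ p) ` K1)"
    using mprod_frob[OF subr_unit[OF R] subr_unit[OF subf_r[OF K1]]] unfolding T1_def by blast
  moreover have "mprod ((\<lambda>x. x ^ p) ` R) ((\<lambda>x. x ^ p) ` K1) \<subseteq> R"
  proof (rule mprod_subset[OF sm_subset[OF subr_sm[OF R]]])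
    show "(\<lambda>x. x ^ p) ` R \<subseteq> R" using subr_pow'[OF R _ p0] by blast
    show "m \<in> (\<lambda>x. x ^ p) ` K1 \<Longrightarrow> m \<in> R" for m using K1p KR by blast
  qed
  ultimately show ?thesis by blast
qed

lemma T1_S1: "T1 \<subseteq> S1" unfolding S1_def by (rule frob_closure_incl[OF subr_T1 T1_pow])
lemma subr_S1: "subr S1" unfolding S1_def by (rule frob_closure_subr[OF subr_T1 R])

lemma R_T1: "R \<subseteq> T1"
proof
  fix a assume "a \<in> R"
  then have "e * a = a" "a * e \<in> T1" unfolding T1_def
    using subr_unit[OF R] mprod_mem[OF _ subr_e[OF subf_r[OF K1]]] by blast+
  then show "a \<in> T1" by (simp add: mult.commute)
qed

lemma K1_T1: "K1 \<subseteq> T1"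
  unfolding T1_def using mprod_incl[OF R subr_unit[OF subf_r[OF K1]]] by blast

lemma subr_T2: "subr T2" unfolding T2_def by (rule mprod_subr[OF subr_S1 subf_r[OF K2]])

lemma S1_pow: "s \<in> S1 \<Longrightarrow> s ^ p \<in> R" unfolding S1_def frob_closure_def by blast
lemma S1_e: "s \<in> S1 \<Longrightarrow> e * s = s" using subr_unit[OF subr_S1] .

lemma T2_pow: "m \<in> T2 \<Longrightarrow> m ^ p \<in> S1"
proof -
  assume "m \<in> T2"
  then have "m ^ p \<in> mprod ((\<lambda>x. x ^ p) ` S1) ((\<lambda>x. x ^ p) ` K2)"
    using mprod_frob[OF S1_e subr_unit[OF subf_r[OF K2]]] unfolding T2_def by blast
  moreover have "mprod ((\<lambda>x. x ^ p) ` S1) ((\<lambda>x. x ^ p) ` K2) \<subseteq> S1"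
  proof (rule mprod_subset[OF sm_subset[OF subr_sm[OF subr_S1]]])
    show "(\<lambda>x. x ^ p) ` S1 \<subseteq> S1" using subr_pow'[OF subr_S1 _ p0] by blast
    show "m \<in> (\<lambda>x. x ^ p) ` K2 \<Longrightarrow> m \<in> S1" for m using K2p K1_T1 T1_S1 by blast
  qed
  ultimately show ?thesis by blast
qed

lemma T2_S2: "T2 \<subseteq> S2" unfolding S2_def by (rule frob_closure_incl[OF subr_T2 T2_pow])
lemma subr_S2: "subr S2" unfolding S2_def by (rule frob_closure_subr[OF subr_T2 subr_S1])

text \<open>The order of \<open>s ^ p\<close> at \<open>\<eta>\<close>: a rescaled valuation of
  \<open>S1\<close> that is read off in \<open>R\<close>. Its value group is found in
  \<open>S1_uniformizer\<close>.\<close>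

definition vanishes :: "'u \<Rightarrow> nat \<Rightarrow> bool" where
  "vanishes s m \<longleftrightarrow> s \<in> S1 \<and> (\<exists>u v. u \<in> R \<and> v \<in> R \<and> u * v = e \<and> s ^ p = u * \<eta> ^ m)"

lemma vanishes_ex: "s \<in> S1 \<Longrightarrow> s \<noteq> 0 \<Longrightarrow> \<exists>m. vanishes s m"
  using dvr_R[OF S1_pow power_nz[OF S1_e _ p0]] unfolding vanishes_def by blast

text \<open>The inverse is \<open>s ^ (p - 1)\<close> times that of the unit \<open>s ^ p\<close> of
  \<open>R\<close>.\<close>

lemma vanishes_0_unit:
  assumes "vanishes s 0" shows "\<exists>v\<in>S1. s * v = e"
proof -
  obtain u v where s: "s \<in> S1" "v \<in> R" "u * v = e" "s ^ p = u * \<eta> ^ 0" using assms vanishes_def by blast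
  have "s * (e * s ^ (p - 1) * v) = e"
  proof -
    have "s * (e * s ^ (p - 1) * v) = (e * s) * s ^ (p - 1) * v" by (simp add: ac_simps)
    also have "\<dots> = s ^ p * v" using S1_e[OF s(1)] p0 by (cases p) simp_all
    finally show ?thesis using s(3,4) by simp
  qed
  moreover have "e * s ^ (p - 1) * v \<in> S1"
    using subr_mult[OF subr_S1 subr_pow[OF subr_S1 s(1)]] s(2) R_T1 T1_S1 by blast
  ultimately show ?thesis by blast
qed

lemma vanishes_nonunit:
  assumes "vanishes s m" "m > 0" "v \<in> S1" shows "s * v \<noteq> e"
proof
  assume sv: "s * v = e"
  obtain u where s: "u \<in> R" "s ^ p = u * \<eta> ^ m" using assms vanishes_def by blast
  have "e = s ^ p * v ^ p" using sv e_pow[OF p0] by (metis power_mult_distrib)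
  also have "\<dots> = \<eta> * (u * (e * \<eta> ^ (m - 1)) * v ^ p)"
  proof -
    have "\<eta> ^ m = \<eta> * (e * \<eta> ^ (m - 1))" using assms(2) e_absorb[OF \<eta>e] by (cases m) simp_all
    then have "s ^ p * v ^ p = u * (\<eta> * (e * \<eta> ^ (m - 1))) * v ^ p" using s(2) by simp
    then show ?thesis by (simp only: ac_simps)
  qed
  finally show False
    using \<eta>_nonunit subr_mult[OF R subr_mult[OF R s(1) subr_pow[OF R \<eta>R]] S1_pow[OF assms(3)]] by metis
qed

text \<open>The quotient is again a fraction of \<open>T1\<close>, and its p-th power is a unit of
  \<open>R\<close> times \<open>\<eta> ^ (m - k)\<close>, hence in \<open>R\<close>.\<close>

lemma vanishes_divide:
  assumes t: "vanishes t k" and s: "vanishes s m" and km: "k \<le> m" and t0: "t \<noteq> 0"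
  shows "\<exists>s'. vanishes s' (m - k) \<and> s = s' * t"
proof -
  obtain u v where t': "t \<in> S1" "u \<in> R" "v \<in> R" "u * v = e" "t ^ p = u * \<eta> ^ k" using t vanishes_def by blast
  obtain u' v' where s': "s \<in> S1" "u' \<in> R" "v' \<in> R" "u' * v' = e" "s ^ p = u' * \<eta> ^ m" using s vanishes_def by blast
  obtain y where y: "e * y = y" "t * y = e" using ex_inverse[OF S1_e[OF t'(1)] t0] by blast
  obtain b where b: "b \<in> T1" "b \<noteq> 0" "s * b \<in> T1" using s'(1) unfolding S1_def frob_closure_def by blast
  obtain c where c: "c \<in> T1" "c \<noteq> 0" "t * c \<in> T1" using t'(1) unfolding S1_def frob_closure_def by blast
  have se: "e * s = s" using S1_e[OF s'(1)] .
  have sy: "e * (s * y) = s * y" using se by (simp add: mult.assoc[symmetric])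
  have ce: "e * c = c" using subr_unit[OF subr_T1 c(1)] .
  have tc0: "t * c \<noteq> 0" using no_zero_div[OF S1_e[OF t'(1)] _ ce t0] c(2) by blast
  have d: "t * c * b \<in> T1" "t * c * b \<noteq> 0"
    using subr_mult[OF subr_T1 c(3) b(1)] subr_nz_mult[OF subr_T1 c(3) b(1) tc0 b(2)] .
  have "(s * y) * (t * c * b) = (t * y) * c * (s * b)" by (simp add: ac_simps)
  also have "\<dots> = c * (s * b)" using y ce by simp
  finally have fr: "(s * y) * (t * c * b) \<in> T1" using subr_mult[OF subr_T1 c(1) b(3)] by simp
  have yp: "t ^ p * y ^ p = e" using y(2) e_pow[OF p0] by (metis power_mult_distrib)
  have "\<eta> ^ m = \<eta> ^ k * \<eta> ^ (m - k)" using km by (simp add: power_add[symmetric])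
  then have "(s * y) ^ p = u' * (\<eta> ^ k * y ^ p) * \<eta> ^ (m - k)" using s'(5) by (simp add: power_mult_distrib ac_simps)
  moreover have "\<eta> ^ k * y ^ p = v"
  proof -
    have 1: "v * (t ^ p * y ^ p) = (u * v) * (\<eta> ^ k * y ^ p)" unfolding t'(5) by (simp only: ac_simps)
    have "e * y ^ p = y ^ p" using pow_e[OF y(1) p0] .
    then have "\<eta> ^ k * y ^ p = e * (\<eta> ^ k * y ^ p)" by (metis mult.left_commute)
    also have "\<dots> = v * e" using 1 yp t'(4) by (simp only:)
    also have "\<dots> = v" using subr_unit[OF R t'(3)] by (simp only: mult.commute)
    finally show ?thesis .
  qed
  ultimately have pw: "(s * y) ^ p = (u' * v) * \<eta> ^ (m - k)" by (simp only:)
  have "(u' * v) * \<eta> ^ (m - k) \<in> R"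
  proof -
    have "(u' * v) * (e * \<eta> ^ (m - k)) \<in> R" using subr_mult[OF R subr_mult[OF R s'(2) t'(3)] subr_pow[OF R \<eta>R]] .
    moreover have "e * (u' * v) = u' * v" using subr_unit[OF R subr_mult[OF R s'(2) t'(3)]] .
    ultimately show ?thesis by (simp add: e_absorb)
  qed
  then have "s * y \<in> S1" using frob_closureI[OF sy d fr] pw unfolding S1_def by simp
  moreover have "(u' * v) * (v' * u) = e"
  proof -
    have "(u' * v) * (v' * u) = (u' * v') * (u * v)" by (simp only: ac_simps)
    then show ?thesis using s'(4) t'(4) ee by simp
  qed
  ultimately have "vanishes (s * y) (m - k)"
    unfolding vanishes_def using pw subr_mult[OF R s'(2) t'(3)] subr_mult[OF R s'(3) t'(2)] by blast
  moreover have "s = (s * y) * t"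
  proof -
    have "(s * y) * t = (t * y) * s" by (simp only: ac_simps)
    then show ?thesis using y se by simp
  qed
  ultimately show ?thesis by blast
qed

text \<open>An element \<open>t\<close> of least positive order \<open>k\<close> exists since
  \<open>\<eta>\<close> has order \<open>p\<close>. A nonzero element of order less than
  \<open>k\<close> has order zero and is a unit, so repeated division by \<open>t\<close> ends in a
  unit.\<close>

lemma S1_uniformizer:
  "\<exists>t k. vanishes t k \<and> k > 0 \<and> t \<noteq> 0 \<and>
    (\<forall>s\<in>S1. s \<noteq> 0 \<longrightarrow> (\<exists>j u v. u \<in> S1 \<and> v \<in> S1 \<and> u * v = e \<and> s = u * t ^ j))"
proof -
  define P where "P k \<longleftrightarrow> k > 0 \<and> (\<exists>t. t \<noteq> 0 \<and> vanishes t k)" for k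
  have \<eta>S: "\<eta> \<in> S1" using \<eta>R R_T1 T1_S1 by blast
  have "\<eta> ^ p = e * \<eta> ^ p" using pow_e[OF \<eta>e p0] by simp
  then have "vanishes \<eta> p" unfolding vanishes_def using \<eta>S subr_e[OF R] ee by blast
  then have "P p" unfolding P_def using p0 \<eta>0 by blast
  define k where "k = (LEAST k. P k)"
  have Pk: "P k" unfolding k_def using \<open>P p\<close> by (rule LeastI)
  have kmin: "k \<le> m" if "P m" for m unfolding k_def using that by (rule Least_le)
  obtain t where t: "t \<noteq> 0" "vanishes t k" "k > 0" using Pk P_def by blast
  have fac: "\<exists>j u v. u \<in> S1 \<and> v \<in> S1 \<and> u * v = e \<and> s = u * t ^ j" if "vanishes s m" "s \<noteq> 0" for s m
    using that
  proof (induction m arbitrary: s rule: less_induct)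
    case (less m)
    show ?case
    proof (cases "m = 0")
      case True
      then obtain v where "v \<in> S1" "s * v = e" using vanishes_0_unit less.prems by blast
      moreover have "s = s * t ^ 0" by simp
      moreover have "s \<in> S1" using less.prems vanishes_def by blast
      ultimately show ?thesis by blast
    next
      case False
      then have km: "k \<le> m" using kmin less.prems P_def by blast
      obtain s' where s': "vanishes s' (m - k)" "s = s' * t" using vanishes_divide[OF t(2) less.prems(1) km t(1)] by blast
      have lt: "m - k < m" using False t(3) by simp
      have "s' \<noteq> 0" using s'(2) less.prems(2) by auto
      then obtain j u v where juv: "u \<in> S1" "v \<in> S1" "u * v = e" "s' = u * t ^ j" using less.IH[OF lt s'(1)] by blast
      have "s = u * t ^ Suc j" using s'(2) juv(4) by (simp add: ac_simps)
      then show ?thesis using juv by blast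
    qed
  qed
  have "\<forall>s\<in>S1. s \<noteq> 0 \<longrightarrow> (\<exists>j u v. u \<in> S1 \<and> v \<in> S1 \<and> u * v = e \<and> s = u * t ^ j)"
  proof (intro ballI impI)
    fix s assume s: "s \<in> S1" "s \<noteq> 0"
    obtain m where "vanishes s m" using vanishes_ex[OF s] by (rule exE)
    from fac[OF this s(2)] show "\<exists>j u v. u \<in> S1 \<and> v \<in> S1 \<and> u * v = e \<and> s = u * t ^ j" .
  qed
  then show ?thesis using t by (intro exI conjI)
qed

end

section \<open>The inequality in the abstract tower\<close>

context tower
begin

text \<open>Multiplication by a power of \<open>\<eta>\<close> moves the generators
  \<open>Z0\<close> of the residue field to the next layer.\<close>

lemma R_mod_power:
  "\<exists>Z. finite Z \<and> Z \<subseteq> R \<and> R \<subseteq> sumset ((*) (e * \<eta> ^ j) ` R) (mprod K Z)"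
proof (induction j)
  case 0
  have "(*) (e * \<eta> ^ 0) ` R = R" using subr_unit[OF R] by simp
  then show ?case using sumset_incl1[OF mprod.zero, of R K "{}"] by (intro exI[of _ "{}"]) simp
next
  case (Suc j)
  then obtain Z where Z: "finite Z" "Z \<subseteq> R" "R \<subseteq> sumset ((*) (e * \<eta> ^ j) ` R) (mprod K Z)"
    by (elim exE conjE) (rule that)
  let ?w = "e * \<eta> ^ j" and ?w' = "e * \<eta> ^ Suc j"
  have w: "?w \<in> R" "?w' \<in> R" using subr_pow[OF R \<eta>R] by blast+
  define Z' where "Z' = Z \<union> (*) ?w ` Z0"
  have Z': "finite Z'" "Z' \<subseteq> R" unfolding Z'_def using Z(1,2) Z0(1,2) subr_mult[OF R w(1)] by auto
  have Kr: "subr K" using subf_r[OF K] .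
  have sR: "sm K R" using sm_subset[OF subr_sm[OF R] KR] .
  have Z'e: "\<And>m. m \<in> Z' \<Longrightarrow> e * m = m" using Z'(2) subr_unit[OF R] by blast
  have sZ': "sm K (mprod K Z')" using mprod_sm[OF Kr, of Z'] Z'e by simp
  have sw: "sm K ((*) ?w' ` R)" using times_sm[OF sR subr_unit[OF R w(2)]] by simp
  have sX: "sm K (sumset ((*) ?w' ` R) (mprod K Z'))" by (rule sumset_sm[OF sw sZ'])
  have "R \<subseteq> sumset ((*) ?w' ` R) (mprod K Z')"
  proof
    fix r assume "r \<in> R"
    with Z(3) have "r \<in> sumset ((*) ?w ` R) (mprod K Z)" by blast
    then obtain a z where a: "a \<in> (*) ?w ` R" "z \<in> mprod K Z" "r = a + z" by (rule sumsetE)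
    then obtain r1 where r1: "r1 \<in> R" "a = ?w * r1" by blast
    with Z0(3) have "r1 \<in> sumset ((*) \<eta> ` R) (mprod K Z0)" by blast
    then obtain b y where b: "b \<in> (*) \<eta> ` R" "y \<in> mprod K Z0" "r1 = b + y" by (rule sumsetE)
    then obtain r2 where r2: "r2 \<in> R" "b = \<eta> * r2" by blast
    have "?w * y \<in> mprod K Z'" using b(2)
    proof (rule mprod_mult_into)
      fix c m assume "c \<in> K" "m \<in> Z0"
      then have "c * (?w * m) \<in> mprod K Z'" by (intro mprod_mem) (auto simp: Z'_def)
      then show "?w * (c * m) \<in> mprod K Z'" by (simp only: ac_simps)
    qed
    moreover have "z \<in> mprod K Z'" using a(2) mprod_mono[OF subset_refl, of Z Z' K] Z'_def by blast
    ultimately have "?w * y + z \<in> mprod K Z'" using sm_add[OF sZ'] by blast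
    then have "?w' * r2 + (?w * y + z) \<in> sumset ((*) ?w' ` R) (mprod K Z')" using r2(1) by (intro sumsetI imageI)
    moreover have "r = ?w' * r2 + (?w * y + z)" using a(3) r1(2) b(3) r2(2) by (simp add: algebra_simps)
    ultimately show "r \<in> sumset ((*) ?w' ` R) (mprod K Z')" by simp
  qed
  then show ?case using Z' by (intro exI[of _ Z'] conjI)
qed

text \<open>An instance of \<open>codim_frobenius_bound\<close> in which \<open>D\<close> and
  \<open>C\<close> are the p-th powers of \<open>T2\<close> and \<open>S2\<close>. Generating sets
  are used instead of dimensions because they also translate directly into quotient spaces.\<close>

theorem tower_bound:
  assumes Z: "finite Z" "Z \<subseteq> S1" "S1 \<subseteq> sumset T1 (mprod K1 Z)"
  shows "\<exists>Z2. finite Z2 \<and> Z2 \<subseteq> S2 \<and> S2 \<subseteq> sumset T2 (mprod K2 Z2) \<and> p * card Z2 \<le> card Z"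
proof -
  obtain t k where t: "vanishes t k" "k > 0" "t \<noteq> 0"
    and dvr: "\<forall>s\<in>S1. s \<noteq> 0 \<longrightarrow> (\<exists>j u v. u \<in> S1 \<and> v \<in> S1 \<and> u * v = e \<and> s = u * t ^ j)"
    using S1_uniformizer by (elim exE conjE)
  let ?k2 = "(\<lambda>x. x ^ p) ` K2"
  have tS: "t \<in> S1" using t(1) vanishes_def by blast
  have RS: "R \<subseteq> S1" and KS: "K1 \<subseteq> S1" using R_T1 K1_T1 T1_S1 by blast+
  have k0k2: "(\<lambda>x. x ^ p) ` K1 \<subseteq> ?k2" using K1K2 by blast
  have AR: "(\<lambda>x. x ^ p) ` S1 \<subseteq> R" using S1_pow by blast
  interpret c: core e p S1 R K1 ?k2 t
    by (unfold_locales; (rule subr_S1 R RS K1 KS frob_subf[OF K2] K2p k0k2 AR tS t(3) vanishes_nonunit[OF t(1,2)])?)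
       (use dvr in blast)+
  have T: "c.T = T1" unfolding c.T_def T1_def ..
  have D: "c.D = (\<lambda>x. x ^ p) ` T2"
    unfolding c.D_def c.A_def T2_def using mprod_frob[OF S1_e subr_unit[OF subf_r[OF K2]]] by simp
  have k2_D: "?k2 \<subseteq> c.D" using c.k2_D .
  have De: "\<And>m. m \<in> c.D \<Longrightarrow> e * m = m" using c.De .
  have sRD: "sm R (mprod R c.D)" using mprod_sm[OF R, of c.D] De by simp
  interpret c: core2 e p S1 R K1 ?k2 t
  proof
    have "D_incl": "c.D \<subseteq> mprod R c.D" using mprod_incl[OF R, of c.D] De by blast
    have "mprod K ?k2 \<subseteq> mprod R c.D" by (rule mprod_mono[OF KR k2_D])
    then have "K1 \<subseteq> mprod R c.D" using gen by blast
    from mprod_subset[OF sRD subsetD[OF this]] show "c.T \<subseteq> mprod R c.D" unfolding T T1_def .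
  next
    fix J :: "nat set" and w d i
    assume J: "finite J" and w: "\<And>j. j \<in> J \<Longrightarrow> w j \<in> R" and d: "\<And>j. j \<in> J \<Longrightarrow> d j \<in> c.D"
      and rel: "(\<Sum>j\<in>J. w j * d j) = 0" and i: "i \<in> J" "d i \<noteq> 0"
    \<comment> \<open>Every \<open>d j\<close> is written with coefficients in \<open>A\<close>
      through finitely many elements \<open>E\<close> of \<open>K2^p\<close> independent over
      \<open>K\<close>. As \<open>R\<close> and \<open>K1\<close> are linearly disjoint over
      \<open>K\<close>, the total coefficient of each \<open>y\<close> in \<open>E\<close> vanishes;
      a \<open>y\<close> with \<open>a i y \<noteq> 0\<close> provides the relation over
      \<open>A\<close>.\<close>
    have "\<exists>Xs. finite Xs \<and> Xs \<subseteq> ?k2 \<and> (\<forall>j\<in>J. d j \<in> mprod c.A Xs)"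
      using mprod_finite_support[OF J, of d c.A ?k2] d unfolding c.D_def by blast
    then obtain Xs where Xs: "finite Xs" "Xs \<subseteq> ?k2" "\<forall>j\<in>J. d j \<in> mprod c.A Xs" by (elim exE conjE)
    from K_indep_basis[OF Xs(1,2)]
    obtain E where E: "finite E" "E \<subseteq> ?k2" "Xs \<subseteq> mprod ((\<lambda>x. x ^ p) ` K1) E"
      and ind: "\<forall>c. (\<forall>y\<in>E. c y \<in> K) \<longrightarrow> (\<Sum>y\<in>E. c y * y) = 0 \<longrightarrow> (\<forall>y\<in>E. c y = 0)" by (elim exE conjE)
    have k0A: "(\<lambda>x. x ^ p) ` K1 \<subseteq> c.A" unfolding c.A_def using KS by blast
    have Ee: "\<And>m. m \<in> E \<Longrightarrow> e * m = m" using E(2) De k2_D by blast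
    have sAE: "sm c.A (mprod c.A E)" using mprod_sm[OF c.subr_A, of E] Ee by simp
    have XE: "Xs \<subseteq> mprod c.A E" using E(3) mprod_mono[OF k0A subset_refl, of E] by blast
    have "\<forall>j\<in>J. \<exists>a. (\<forall>y\<in>E. a y \<in> c.A) \<and> d j = (\<Sum>y\<in>E. a y * y)"
    proof
      fix j assume "j \<in> J"
      then have "d j \<in> mprod c.A E" using Xs(3) mprod_subset[OF sAE subsetD[OF XE]] by blast
      from mprod_coeffs[OF this E(1) c.subr_A] show "\<exists>a. (\<forall>y\<in>E. a y \<in> c.A) \<and> d j = (\<Sum>y\<in>E. a y * y)" .
    qed
    then obtain a where a: "\<forall>j\<in>J. (\<forall>y\<in>E. a j y \<in> c.A) \<and> d j = (\<Sum>y\<in>E. a j y * y)" by (rule bchoice[THEN exE])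
    have "(\<Sum>y\<in>E. (\<Sum>j\<in>J. w j * a j y) * y) = (\<Sum>y\<in>E. \<Sum>j\<in>J. w j * (a j y * y))"
      by (simp add: sum_distrib_right mult.assoc)
    also have "\<dots> = (\<Sum>j\<in>J. \<Sum>y\<in>E. w j * (a j y * y))" by (rule sum.swap)
    also have "\<dots> = (\<Sum>j\<in>J. w j * d j)"
    proof (rule sum.cong[OF HOL.refl])
      fix j assume "j \<in> J"
      then have "d j = (\<Sum>y\<in>E. a j y * y)" using a by blast
      then show "(\<Sum>y\<in>E. w j * (a j y * y)) = w j * d j" by (simp add: sum_distrib_left)
    qed
    finally have r0: "(\<Sum>y\<in>E. (\<Sum>j\<in>J. w j * a j y) * y) = 0" using rel by simp
    have rR: "\<forall>y\<in>E. (\<Sum>j\<in>J. w j * a j y) \<in> R"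
    proof
      fix y assume y: "y \<in> E"
      show "(\<Sum>j\<in>J. w j * a j y) \<in> R"
      proof (rule sm_sum[OF subr_sm[OF R]])
        fix j assume j: "j \<in> J"
        show "w j * a j y \<in> R" using subr_mult[OF R w[OF j]] a j y c.A_R by blast
      qed
    qed
    have EK1: "E \<subseteq> K1" using E(2) K2p by blast
    have z: "\<forall>y\<in>E. (\<Sum>j\<in>J. w j * a j y) = 0" by (rule R_K1_disjoint[OF E(1) EK1 ind rR r0])
    have "\<exists>y\<in>E. a i y \<noteq> 0"
    proof (rule ccontr)
      assume "\<not> (\<exists>y\<in>E. a i y \<noteq> 0)"
      then have "(\<Sum>y\<in>E. a i y * y) = 0" by (intro sum.neutral) simp
      then show False using a i by simp
    qed
    then obtain y where y: "y \<in> E" "a i y \<noteq> 0" by blast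
    have "(\<Sum>j\<in>J. a j y * w j) = 0" using z y(1) by (simp add: mult.commute)
    moreover have "\<forall>j\<in>J. a j y \<in> c.A" using a y(1) by blast
    moreover have "\<exists>j\<in>J. a j y \<noteq> 0" using i(1) y(2) by blast
    ultimately show "\<exists>c. (\<forall>j\<in>J. c j \<in> c.A) \<and> (\<exists>j\<in>J. c j \<noteq> 0) \<and> (\<Sum>j\<in>J. c j * w j) = 0"
      by (intro exI[of _ "\<lambda>j. a j y"] conjI)
  qed
  obtain u v where uv: "u \<in> R" "v \<in> R" "u * v = e" "t ^ p = u * \<eta> ^ k" using t(1) vanishes_def by blast
  obtain ZR where ZR: "finite ZR" "ZR \<subseteq> R" "R \<subseteq> sumset ((*) (e * \<eta> ^ k) ` R) (mprod K ZR)"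
    using R_mod_power[of k] by (elim exE conjE)
  \<comment> \<open>\<open>\<pi> = t ^ p\<close> is a unit of \<open>R\<close> times
    \<open>\<eta> ^ k\<close>, so finiteness of \<open>R\<close> modulo \<open>\<eta> ^ k\<close>
    over \<open>K\<close> yields that of \<open>T1/\<pi> T1\<close> over \<open>K1\<close>.\<close>
  have \<eta>\<pi>: "(*) (e * \<eta> ^ k) ` R \<subseteq> (*) c.\<pi> ` R"
  proof
    fix z assume "z \<in> (*) (e * \<eta> ^ k) ` R"
    then obtain r where r: "r \<in> R" "z = e * \<eta> ^ k * r" by blast
    have "z = (u * v) * \<eta> ^ k * r" using r uv(3) by simp
    also have "\<dots> = c.\<pi> * (v * r)" unfolding c.\<pi>_def uv(4) by (simp only: ac_simps)
    finally show "z \<in> (*) c.\<pi> ` R" using subr_mult[OF R uv(2) r(1)] by blast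
  qed
  have ZRT: "ZR \<subseteq> T1" using ZR(2) R_T1 by blast
  have K1r: "subr K1" using subf_r[OF K1] .
  have ZRe: "\<And>m. m \<in> ZR \<Longrightarrow> e * m = m" using ZR(2) subr_unit[OF R] by blast
  have s1: "sm K1 (mprod K1 ZR)" using mprod_sm[OF K1r, of ZR] ZRe by simp
  have s2: "sm K1 ((*) c.\<pi> ` T1)" using sm_subset[OF c.\<pi>T_sm c.K1_T] unfolding T .
  have sX: "sm K1 (sumset ((*) c.\<pi> ` T1) (mprod K1 ZR))" by (rule sumset_sm[OF s2 s1])
  have TT: "T1 \<subseteq> sumset ((*) c.\<pi> ` T1) (mprod K1 ZR)"
  proof
    fix x assume "x \<in> T1"
    then have "x \<in> mprod R K1" unfolding T1_def .
    then show "x \<in> sumset ((*) c.\<pi> ` T1) (mprod K1 ZR)"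
    proof (induction rule: mprod.induct)
      case zero
      show ?case by (rule sm_0[OF sX])
    next
      case (step x r m)
      have "r \<in> sumset ((*) (e * \<eta> ^ k) ` R) (mprod K ZR)" using ZR(3) step.hyps(2) by blast
      then obtain b z where b: "b \<in> (*) (e * \<eta> ^ k) ` R" "z \<in> mprod K ZR" "r = b + z" by (rule sumsetE)
      have "b \<in> (*) c.\<pi> ` T1" using b(1) \<eta>\<pi> R_T1 by blast
      moreover have "z \<in> mprod K1 ZR" using b(2) mprod_mono[OF KK1 subset_refl, of ZR] by blast
      ultimately have "r \<in> sumset ((*) c.\<pi> ` T1) (mprod K1 ZR)" unfolding b(3) by (intro sumsetI)
      then have "m * r \<in> sumset ((*) c.\<pi> ` T1) (mprod K1 ZR)" by (rule sm_mult[OF sX step.hyps(3)])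
      then show ?case using sm_add[OF sX step.IH] by (simp add: mult.commute)
    qed
  qed
  have sT1: "sm K1 T1" using sm_subset[OF subr_sm[OF subr_T1] K1_T1] .
  have sS1: "sm K1 S1" using sm_subset[OF subr_sm[OF subr_S1] KS] .
  have Ze: "\<forall>x\<in>Z. e * x = x" using Z(2) S1_e by blast
  have eqS: "sumset T1 (mprod K1 Z) = S1"
    using Z(3) sumset_least[OF sS1 T1_S1 mprod_subset[OF sS1 subsetD[OF Z(2)]]] by blast
  from codim_spanned[OF K1 sT1 Z(1) Ze]
  obtain N where N: "N \<le> card Z" "codim K1 T1 N S1" unfolding eqS by (elim exE conjE)
  let ?C = "(\<lambda>x. x ^ p) ` S2"
  have sC: "sm c.D ?C"
    unfolding D using sm_subset[OF subr_sm[OF frob_subr[OF subr_S2]]] T2_S2 by (simp add: image_mono)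
  have DC: "c.D \<subseteq> ?C" unfolding D using T2_S2 by blast
  have CS: "?C \<subseteq> S1" unfolding S2_def frob_closure_def by blast
  \<comment> \<open>A denominator \<open>b\<close> of \<open>y\<close> in \<open>T2\<close> gives
    the denominator \<open>b ^ p\<close> of \<open>y ^ p\<close> in \<open>D\<close>; a further p-th
    power puts it into \<open>A\<close>.\<close>
  have tors: "\<exists>a\<in>c.A. a \<noteq> 0 \<and> a * x \<in> c.D" if x: "x \<in> ?C" for x
  proof -
    obtain y b where y: "x = y ^ p" "b \<in> T2" "b \<noteq> 0" "y * b \<in> T2"
      using x unfolding S2_def frob_closure_def by blast
    have be: "e * b = b" using subr_unit[OF subr_T2 y(2)] .
    have bD: "b ^ p \<in> c.D" "y ^ p * b ^ p \<in> c.D" unfolding D using y(2,4) by (auto simp: power_mult_distrib[symmetric])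
    have bp: "e * b ^ p = b ^ p" "b ^ p \<noteq> 0" using pow_e[OF be p0] power_nz[OF be y(3) p0] .
    have "(b ^ p) ^ p \<in> c.A" unfolding c.A_def using bD(1) c.D_S by blast
    moreover have "(b ^ p) ^ p \<noteq> 0" using power_nz[OF bp p0] .
    moreover have "(b ^ p) ^ p * x = (e * (b ^ p) ^ (p - 1)) * (y ^ p * b ^ p)"
    proof -
      have "(b ^ p) ^ p = b ^ p * (e * (b ^ p) ^ (p - 1))" using p0 e_absorb[OF bp(1)] by (cases p) simp_all
      then show ?thesis using y(1) by (simp only: ac_simps)
    qed
    ultimately show ?thesis using subr_mult[OF c.subr_D subr_pow[OF c.subr_D bD(1)] bD(2)] by (metis (no_types))
  qed
  have "\<exists>m. codim ?k2 c.D m ?C \<and> p * m \<le> N"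
    by (rule c.codim_frobenius_bound[OF ZR(1)]) (use ZRT TT sC DC CS tors N(2) T in simp_all)
  then obtain m where m: "codim ?k2 c.D m ?C" "p * m \<le> N" by (elim exE conjE)
  have sD: "sm ?k2 c.D" using sm_subset[OF subr_sm[OF c.subr_D] k2_D] .
  from codim_span[OF m(1) subf_r[OF frob_subf[OF K2]] sD]
  obtain W where W: "finite W" "card W \<le> m" "W \<subseteq> ?C" "?C = sumset c.D (mprod ?k2 W)" by (elim exE conjE)
  \<comment> \<open>Frobenius is undone: p-th roots in \<open>S2\<close> are chosen for the
    generators of \<open>C/D\<close>, one for each.\<close>
  from subset_image_inj[THEN iffD1, OF W(3)]
  obtain Z2 where Z2: "Z2 \<subseteq> S2" "inj_on (\<lambda>x. x ^ p) Z2" "W = (\<lambda>x. x ^ p) ` Z2" by (elim exE conjE)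
  have fin: "finite Z2" using W(1) Z2(2,3) finite_image_iff by blast
  have card: "card Z2 \<le> m" using W(2) Z2(2,3) by (simp add: card_image)
  have S2e: "\<And>x. x \<in> S2 \<Longrightarrow> e * x = x" using subr_unit[OF subr_S2] .
  have Z2e: "\<And>x. x \<in> Z2 \<Longrightarrow> e * x = x" using S2e Z2(1) by blast
  have "S2 \<subseteq> sumset T2 (mprod K2 Z2)"
  proof
    fix x assume x: "x \<in> S2"
    then have "x ^ p \<in> sumset c.D (mprod ?k2 W)" using W(4) by blast
    then obtain a b where ab: "a \<in> c.D" "b \<in> mprod ?k2 W" "x ^ p = a + b" by (rule sumsetE)
    obtain a' where a': "a' \<in> T2" "a = a' ^ p" using ab(1) D by blast
    have "b \<in> (\<lambda>x. x ^ p) ` mprod K2 Z2"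
      using ab(2) mprod_frob[OF subr_unit[OF subf_r[OF K2]] Z2e] Z2(3) by simp
    then obtain b' where b': "b' \<in> mprod K2 Z2" "b = b' ^ p" by blast
    have ea: "e * a' = a'" using subr_unit[OF subr_T2 a'(1)] .
    have eb: "e * b' = b'" using mprod_e[OF b'(1) Z2e] .
    have "x ^ p = (a' + b') ^ p" using ab(3) a'(2) b'(2) frob[OF ea eb] by simp
    moreover have "e * (a' + b') = a' + b'" using ea eb by (simp add: distrib_left)
    ultimately have "x = a' + b'" using frob_inj[OF S2e[OF x]] by blast
    then show "x \<in> sumset T2 (mprod K2 Z2)" using sumsetI[OF a'(1) b'(1)] by simp
  qed
  moreover have "p * card Z2 \<le> card Z"
    using mult_le_mono2[OF card, of p] m(2) N(1) by linarith
  ultimately show ?thesis using fin Z2(1) by (intro exI[of _ Z2] conjI)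
qed

end

section \<open>Monomials in a \<open>p\<close>-basis\<close>

context idf_char
begin

lemma frob_sum:
  assumes "\<And>i. i \<in> I \<Longrightarrow> e * f i = f i"
  shows "(\<Sum>i\<in>I. f i) ^ p = (\<Sum>i\<in>I. f i ^ p)"
  using assms
proof (induction I rule: infinite_finite_induct)
  case (insert i I)
  have "e * (\<Sum>i\<in>I. f i) = (\<Sum>i\<in>I. f i)" using insert.prems by (simp add: sum_distrib_left)
  then show ?case using insert frob by simp
qed (use p0 in \<open>simp_all add: power_0_left\<close>)

text \<open>The preimage of a field under Frobenius is a field. Together with the minimality of
  \<open>K1\<close> and \<open>K2\<close> this bounds their p-th powers.\<close>

lemma root_closure_subf:
  assumes F: "subf F" shows "subf {y. e * y = y \<and> y ^ p \<in> F}"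
  unfolding subf_def
proof (intro conjI ballI impI)
  have Fr: "subr F" using subf_r[OF F] .
  show "subr {y. e * y = y \<and> y ^ p \<in> F}"
  proof (rule subrI)
    show "e \<in> {y. e * y = y \<and> y ^ p \<in> F}" using ee e_pow[OF p0] subr_e[OF Fr] by simp
    fix x y assume xy: "x \<in> {y. e * y = y \<and> y ^ p \<in> F}" "y \<in> {y. e * y = y \<and> y ^ p \<in> F}"
    then show "x - y \<in> {y. e * y = y \<and> y ^ p \<in> F}"
      using frob_diff subr_diff[OF Fr] by (simp add: right_diff_distrib)
    show "x * y \<in> {y. e * y = y \<and> y ^ p \<in> F}"
      using xy subr_mult[OF Fr] by (simp add: power_mult_distrib mult.assoc[symmetric])
  qed blast
  fix x assume x: "x \<in> {y. e * y = y \<and> y ^ p \<in> F}" "x \<noteq> 0"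
  then have xe: "e * x = x" "x ^ p \<in> F" by blast+
  obtain y where y: "e * y = y" "x * y = e" using ex_inverse[OF xe(1) x(2)] by blast
  obtain z where z: "z \<in> F" "x ^ p * z = e" using subf_inv[OF F xe(2) power_nz[OF xe(1) x(2) p0]] by blast
  have "x ^ p * y ^ p = x ^ p * z" using y(2) z(2) e_pow[OF p0] by (metis power_mult_distrib)
  then have "y ^ p = z"
    using cancel[OF subr_unit[OF Fr xe(2)] pow_e[OF y(1) p0] subr_unit[OF Fr z(1)] power_nz[OF xe(1) x(2) p0]] by blast
  then show "\<exists>y\<in>{y. e * y = y \<and> y ^ p \<in> F}. x * y = e" using y z(1) by blast
qed

text \<open>An inverse of \<open>x\<close> is \<open>x ^ (p - 1)\<close> times the inverse of
  \<open>x ^ p\<close> in \<open>F\<close>.\<close>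

lemma subf_if_pow:
  assumes G: "subr G" and F: "subf F" "F \<subseteq> G" and pw: "\<And>x. x \<in> G \<Longrightarrow> x ^ p \<in> F"
  shows "subf G"
  unfolding subf_def
proof (intro conjI ballI impI)
  show "subr G" by (rule G)
  fix x assume x: "x \<in> G" "x \<noteq> 0"
  have xe: "e * x = x" using subr_unit[OF G x(1)] .
  obtain z where z: "z \<in> F" "x ^ p * z = e" using subf_inv[OF F(1) pw[OF x(1)] power_nz[OF xe x(2) p0]] by blast
  have "x * (e * x ^ (p - 1) * z) = (x * (e * x ^ (p - 1))) * z" by (simp only: ac_simps)
  also have "x * (e * x ^ (p - 1)) = x ^ p" using p0 e_absorb[OF xe] by (cases p) simp_all
  finally have "x * (e * x ^ (p - 1) * z) = e" using z(2) by simp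
  moreover have "e * x ^ (p - 1) * z \<in> G" using subr_mult[OF G subr_pow[OF G x(1)] subsetD[OF F(2) z(1)]] .
  ultimately show "\<exists>y\<in>G. x * y = e" by blast
qed

text \<open>The factor \<open>e\<close> is the value at exponent zero. The family
  \<open>\<beta>\<close> is arbitrary so that monomials in elements of \<open>B\<close> and in their
  p-th roots share the index set and the exponents.\<close>

definition monomial :: "('u \<Rightarrow> 'u) \<Rightarrow> 'u set \<Rightarrow> ('u \<Rightarrow> nat) \<Rightarrow> 'u" where
  "monomial \<beta> S a = e * (\<Prod>b\<in>S. \<beta> b ^ a b)"

lemma monomial_e: "e * monomial \<beta> S a = monomial \<beta> S a"
  unfolding monomial_def by (simp add: mult.assoc[symmetric] ee)

lemma monomial_in:
  assumes "finite S" "subr A" "\<And>b. b \<in> S \<Longrightarrow> \<beta> b \<in> A" shows "monomial \<beta> S a \<in> A"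
  using assms(1,3)
proof (induction S rule: finite_induct)
  case empty
  then show ?case unfolding monomial_def using subr_e[OF assms(2)] by simp
next
  case (insert b S)
  have "monomial \<beta> (insert b S) a = (e * e) * (\<beta> b ^ a b * (\<Prod>b\<in>S. \<beta> b ^ a b))"
    unfolding monomial_def ee using insert.hyps by simp
  then have "monomial \<beta> (insert b S) a = (e * \<beta> b ^ a b) * monomial \<beta> S a"
    unfolding monomial_def by (simp only: ac_simps)
  moreover have "monomial \<beta> S a \<in> A" using insert by blast
  moreover have "e * \<beta> b ^ a b \<in> A" using subr_pow[OF assms(2)] insert.prems by blast
  ultimately show ?case using subr_mult[OF assms(2)] by simp
qed

lemma monomial_mult: "monomial \<beta> S a * monomial \<beta> S a' = monomial \<beta> S (\<lambda>b. a b + a' b)"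
proof -
  have "monomial \<beta> S a * monomial \<beta> S a' = (e * e) * ((\<Prod>b\<in>S. \<beta> b ^ a b) * (\<Prod>b\<in>S. \<beta> b ^ a' b))"
    unfolding monomial_def by (simp only: ac_simps)
  then show ?thesis unfolding monomial_def by (simp add: ee prod.distrib[symmetric] power_add)
qed

lemma monomial_pow: "monomial \<beta> S a ^ p = monomial (\<lambda>b. \<beta> b ^ p) S a"
  unfolding monomial_def
  by (simp add: power_mult_distrib e_pow[OF p0] prod_power_distrib power_mult[symmetric] mult.commute)

lemma monomial_subset:
  assumes "finite S'" "S \<subseteq> S'"
  shows "monomial \<beta> S a = monomial \<beta> S' (\<lambda>b. if b \<in> S then a b else 0)"
  unfolding monomial_def
  using assms by (simp add: if_distrib[of "\<lambda>n. _ ^ n"] prod.If_cases Int_absorb1)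

text \<open>Extensional functions, so that there are exactly \<open>p ^ card S\<close> of
  them.\<close>

definition reduced_exponents :: "'u set \<Rightarrow> ('u \<Rightarrow> nat) set" where
  "reduced_exponents S = S \<rightarrow>\<^sub>E {..<p}"

lemma reduced_exponents_card: "finite S \<Longrightarrow> finite (reduced_exponents S) \<and> card (reduced_exponents S) = p ^ card S"
  unfolding reduced_exponents_def by (simp add: finite_PiE card_PiE)

definition monomials :: "('u \<Rightarrow> 'u) \<Rightarrow> 'u set \<Rightarrow> 'u set" where
  "monomials \<beta> S = monomial \<beta> S ` reduced_exponents S"

lemma monomials_e: "m \<in> monomials \<beta> S \<Longrightarrow> e * m = m"
  unfolding monomials_def using monomial_e by blast

text \<open>Every exponent is divided by \<open>p\<close> with remainder; the quotients give a
  monomial in the \<open>\<beta> b ^ p\<close>, which lies in \<open>F\<close>.\<close>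

lemma monomial_reduce:
  assumes S: "finite S" and F: "subf F" and \<beta>: "\<And>b. b \<in> S \<Longrightarrow> \<beta> b ^ p \<in> F"
  shows "monomial \<beta> S a \<in> mprod F (monomials \<beta> S)"
proof -
  have Fr: "subr F" using subf_r[OF F] .
  define r where "r = restrict (\<lambda>b. a b mod p) S"
  have r: "r \<in> reduced_exponents S" unfolding r_def reduced_exponents_def using p0 by auto
  have "monomial \<beta> S r = monomial \<beta> S (\<lambda>b. a b mod p)"
    unfolding monomial_def r_def by (intro arg_cong[of _ _ "(*) e"] prod.cong) auto
  then have "monomial (\<lambda>b. \<beta> b ^ p) S (\<lambda>b. a b div p) * monomial \<beta> S r
      = (e * e) * ((\<Prod>b\<in>S. (\<beta> b ^ p) ^ (a b div p)) * (\<Prod>b\<in>S. \<beta> b ^ (a b mod p)))"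
    unfolding monomial_def by (simp only: ac_simps)
  also have "(\<Prod>b\<in>S. (\<beta> b ^ p) ^ (a b div p)) * (\<Prod>b\<in>S. \<beta> b ^ (a b mod p)) = (\<Prod>b\<in>S. \<beta> b ^ a b)"
    unfolding prod.distrib[symmetric] by (simp add: power_mult[symmetric] power_add[symmetric])
  finally have "monomial \<beta> S a = monomial (\<lambda>b. \<beta> b ^ p) S (\<lambda>b. a b div p) * monomial \<beta> S r"
    unfolding monomial_def by (simp only: ee)
  moreover have "monomial (\<lambda>b. \<beta> b ^ p) S (\<lambda>b. a b div p) \<in> F" by (rule monomial_in[OF S Fr \<beta>])
  moreover have "monomial \<beta> S r \<in> monomials \<beta> S" unfolding monomials_def using r by blast
  ultimately show ?thesis using mprod_mem by simp
qed

text \<open>The span is closed under products by reduction of exponents, and it is a field because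
  all its p-th powers lie in \<open>F\<close>. It is thus an explicit form of the field generated by
  \<open>F\<close> and the \<open>\<beta> b\<close>.\<close>

lemma monomials_subf:
  assumes S: "finite S" and F: "subf F" and \<beta>: "\<And>b. b \<in> S \<Longrightarrow> \<beta> b ^ p \<in> F"
    and \<beta>e: "\<And>b. b \<in> S \<Longrightarrow> e * \<beta> b = \<beta> b"
  shows "subf (mprod F (monomials \<beta> S))" and "F \<subseteq> mprod F (monomials \<beta> S)"
    and "b \<in> S \<Longrightarrow> \<beta> b \<in> mprod F (monomials \<beta> S)"
proof -
  have Fr: "subr F" using subf_r[OF F] .
  let ?G = "mprod F (monomials \<beta> S)"
  have sG: "sm F ?G" using mprod_sm[OF Fr, of "monomials \<beta> S"] monomials_e by simp
  have red: "monomial \<beta> S a \<in> ?G" for a by (rule monomial_reduce[OF S F \<beta>])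
  have e_mon: "e = monomial \<beta> S (\<lambda>_. 0)" unfolding monomial_def by simp
  have m2: "m * y \<in> ?G" if m: "m \<in> monomials \<beta> S" and y: "y \<in> ?G" for m y
    using y
  proof (rule mprod_mult_into)
    fix a n assume a: "a \<in> F" "n \<in> monomials \<beta> S"
    obtain x x' where "m = monomial \<beta> S x" "n = monomial \<beta> S x'" using m a(2) unfolding monomials_def by blast
    then have "m * n \<in> ?G" using red monomial_mult by simp
    then have "a * (m * n) \<in> ?G" by (rule sm_mult[OF sG a(1)])
    then show "m * (a * n) \<in> ?G" by (simp only: mult.left_commute)
  qed
  have rG: "subr ?G"
  proof (rule subrI)
    show "\<And>x. x \<in> ?G \<Longrightarrow> e * x = x" using sm_e[OF sG] .
    show "\<And>x y. x \<in> ?G \<Longrightarrow> y \<in> ?G \<Longrightarrow> x - y \<in> ?G" using sm_diff[OF sG] .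
    show "e \<in> ?G" using red e_mon by metis
    fix x y assume x: "x \<in> ?G" and y: "y \<in> ?G"
    have "y * x \<in> ?G" using x
    proof (rule mprod_mult_into)
      fix a m assume "a \<in> F" "m \<in> monomials \<beta> S"
      then have "a * (m * y) \<in> ?G" using sm_mult[OF sG] m2 y by blast
      then show "y * (a * m) \<in> ?G" by (simp only: ac_simps)
    qed
    then show "x * y \<in> ?G" by (simp only: mult.commute)
  qed
  show FG: "F \<subseteq> ?G"
  proof
    fix a assume a: "a \<in> F"
    have "a * e = a" using subr_unit[OF Fr a] by (subst mult.commute)
    with sm_mult[OF sG a subr_e[OF rG]] show "a \<in> ?G" by (rule back_subst[of "\<lambda>x. x \<in> mprod F (monomials \<beta> S)"])
  qed
  show "subf ?G"
  proof (rule subf_if_pow[OF rG F FG])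
    fix x assume "x \<in> ?G"
    then have "x ^ p \<in> (\<lambda>x. x ^ p) ` ?G" by (rule imageI)
    then have "x ^ p \<in> mprod ((\<lambda>x. x ^ p) ` F) ((\<lambda>x. x ^ p) ` monomials \<beta> S)"
      using mprod_frob[of F "monomials \<beta> S"] subr_unit[OF Fr] monomials_e by simp
    moreover have "mprod ((\<lambda>x. x ^ p) ` F) ((\<lambda>x. x ^ p) ` monomials \<beta> S) \<subseteq> F"
    proof (rule mprod_subset[OF sm_subset[OF subr_sm[OF Fr]]])
      show "(\<lambda>x. x ^ p) ` F \<subseteq> F" using subr_pow'[OF Fr _ p0] by blast
      fix m assume "m \<in> (\<lambda>x. x ^ p) ` monomials \<beta> S"
      then obtain a where "m = monomial (\<lambda>b. \<beta> b ^ p) S a" unfolding monomials_def using monomial_pow by auto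
      then show "m \<in> F" using monomial_in[where \<beta> = "\<lambda>b. \<beta> b ^ p", OF S Fr \<beta>] by simp
    qed
    ultimately show "x ^ p \<in> F" by blast
  qed
  assume b: "b \<in> S"
  have "(\<Prod>c\<in>S. \<beta> c ^ (if c = b then 1 else 0)) = (\<Prod>c\<in>S. if c = b then \<beta> c else 1)"
    by (intro prod.cong) simp_all
  also have "\<dots> = \<beta> b" using S b by (simp add: prod.delta)
  finally have "\<beta> b = monomial \<beta> S (\<lambda>c. if c = b then 1 else 0)" unfolding monomial_def using \<beta>e[OF b] by simp
  then show "\<beta> b \<in> ?G" using red by metis
qed

lemma monomials_subset:
  assumes "finite S'" "S \<subseteq> S'" and F: "subf F" and \<beta>: "\<And>b. b \<in> S' \<Longrightarrow> \<beta> b ^ p \<in> F"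
  shows "mprod F (monomials \<beta> S) \<subseteq> mprod F (monomials \<beta> S')"
proof -
  have s: "sm F (mprod F (monomials \<beta> S'))" using mprod_sm[OF subf_r[OF F], of "monomials \<beta> S'"] monomials_e by simp
  show ?thesis
  proof (rule mprod_subset[OF s])
    fix m assume "m \<in> monomials \<beta> S"
    then obtain a where "m = monomial \<beta> S a" unfolding monomials_def by blast
    then show "m \<in> mprod F (monomials \<beta> S')"
      using monomial_subset[OF assms(1,2)] monomial_reduce[OF assms(1) F \<beta>] by simp
  qed
qed

text \<open>A directed union over the finite subsets of the possibly infinite \<open>B\<close>; any
  two elements lie in a common member.\<close>

lemma monomials_union_subf:
  assumes F: "subf F" and \<beta>: "\<And>b. b \<in> B \<Longrightarrow> \<beta> b ^ p \<in> F" and \<beta>e: "\<And>b. b \<in> B \<Longrightarrow> e * \<beta> b = \<beta> b"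
  shows "subf (\<Union>S\<in>{S. finite S \<and> S \<subseteq> B}. mprod F (monomials \<beta> S))"
    (is "subf ?G")
proof -
  let ?m = "\<lambda>S. mprod F (monomials \<beta> S)"
  have sf: "subf (?m S)" if "finite S" "S \<subseteq> B" for S using monomials_subf(1)[OF that(1) F] \<beta> \<beta>e that(2) by blast
  have sub: "?m S \<subseteq> ?m S'" if "finite S'" "S' \<subseteq> B" "S \<subseteq> S'" for S S' using monomials_subset[OF that(1,3) F] \<beta> that(2) by blast
  have two: "\<exists>S. finite S \<and> S \<subseteq> B \<and> x \<in> ?m S \<and> y \<in> ?m S" if "x \<in> ?G" "y \<in> ?G" for x y
  proof -
    obtain S S' where S: "finite S" "S \<subseteq> B" "x \<in> ?m S" "finite S'" "S' \<subseteq> B" "y \<in> ?m S'" using \<open>x \<in> ?G\<close> \<open>y \<in> ?G\<close> by blast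
    have "finite (S \<union> S')" "S \<union> S' \<subseteq> B" using S by blast+
    moreover have "x \<in> ?m (S \<union> S')" using sub[OF calculation, of S] S(3) by blast
    moreover have "y \<in> ?m (S \<union> S')" using sub[OF \<open>finite (S \<union> S')\<close> \<open>S \<union> S' \<subseteq> B\<close>, of S'] S(6) by blast
    ultimately show ?thesis by blast
  qed
  show ?thesis
    unfolding subf_def
  proof (intro conjI ballI impI)
    show "subr ?G"
    proof (rule subrI)
      fix x assume "x \<in> ?G"
      then show "e * x = x" using subr_unit[OF subf_r[OF sf]] by blast
    next
      fix x y assume "x \<in> ?G" "y \<in> ?G"
      from two[OF this] obtain S where S: "finite S" "S \<subseteq> B" "x \<in> ?m S" "y \<in> ?m S" by (elim exE conjE)
      have in_G: "z \<in> ?G" if "z \<in> ?m S" for z using that S(1,2) by auto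
      show "x - y \<in> ?G" by (rule in_G[OF subr_diff[OF subf_r[OF sf[OF S(1,2)]] S(3,4)]])
      show "x * y \<in> ?G" by (rule in_G[OF subr_mult[OF subf_r[OF sf[OF S(1,2)]] S(3,4)]])
    next
      show "e \<in> ?G" by (rule UN_I[of "{}"]) (use subr_e[OF subf_r[OF sf[of "{}"]]] in simp_all)
    qed
    fix x assume x: "x \<in> ?G" "x \<noteq> 0"
    then obtain S where S: "finite S" "S \<subseteq> B" "x \<in> ?m S" by blast
    show "\<exists>y\<in>?G. x * y = e" using subf_inv[OF sf[OF S(1,2)] S(3) x(2)] S(1,2) by blast
  qed
qed

lemma monomials_independent:
  assumes S: "finite S" and F: "subf F" and W: "codim F {0} (p ^ card S) W" "W \<subseteq> mprod F (monomials \<beta> S)"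
    and rel: "\<And>a. a \<in> reduced_exponents S \<Longrightarrow> c a \<in> F" "(\<Sum>a\<in>reduced_exponents S. c a * monomial \<beta> S a) = 0"
    and a0: "a0 \<in> reduced_exponents S"
  shows "c a0 = 0"
proof (rule ccontr)
  assume c0: "c a0 \<noteq> 0"
  have Fr: "subr F" using subf_r[OF F] .
  let ?I = "reduced_exponents S" and ?m = "monomial \<beta> S"
  have I: "finite ?I" "card ?I = p ^ card S" using reduced_exponents_card[OF S] by blast+
  obtain g where g: "g \<in> F" "c a0 * g = e" using subf_inv[OF F rel(1)[OF a0] c0] by blast
  let ?Z = "?m ` (?I - {a0})"
  have Ze: "\<And>m. m \<in> ?Z \<Longrightarrow> e * m = m" using monomial_e by blast
  have sZ: "sm F (mprod F ?Z)" using mprod_sm[OF Fr, of ?Z] Ze by simp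
  have s0: "sm F {0}" by (rule smI) simp_all
  have "c a0 * ?m a0 + (\<Sum>a\<in>?I - {a0}. c a * ?m a) = 0" using rel(2) sum.remove[OF I(1) a0] by metis
  then have "c a0 * ?m a0 = - (\<Sum>a\<in>?I - {a0}. c a * ?m a)" by (simp add: eq_neg_iff_add_eq_0)
  moreover have "(\<Sum>a\<in>?I - {a0}. c a * ?m a) \<in> mprod F ?Z"
  proof (rule sm_sum[OF sZ])
    fix a assume "a \<in> ?I - {a0}"
    then show "c a * ?m a \<in> mprod F ?Z" using rel(1) by (intro mprod_mem) auto
  qed
  ultimately have "c a0 * ?m a0 \<in> mprod F ?Z" using sm_minus[OF sZ] by simp
  then have "g * (c a0 * ?m a0) \<in> mprod F ?Z" by (rule sm_mult[OF sZ g(1)])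
  moreover have "g * (c a0 * ?m a0) = ?m a0" using g(2) monomial_e by (metis mult.assoc mult.commute)
  ultimately have a0Z: "?m a0 \<in> mprod F ?Z" by simp
  have inc: "mprod F (monomials \<beta> S) \<subseteq> mprod F ?Z"
  proof (rule mprod_subset[OF sZ])
    fix m assume "m \<in> monomials \<beta> S"
    then obtain a where a: "a \<in> ?I" "m = ?m a" unfolding monomials_def by blast
    show "m \<in> mprod F ?Z"
    proof (cases "a = a0")
      case False
      then have "m \<in> ?Z" using a by blast
      then show ?thesis using mprod_incl[OF Fr, of ?Z] Ze by blast
    qed (use a a0Z in simp)
  qed
  have fZ: "finite ?Z" using I(1) by simp
  have zz: "sumset {0} (mprod F ?Z) = mprod F ?Z" by (auto simp: sumset_def)
  have "\<forall>x\<in>?Z. e * x = x" using Ze by blast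
  from codim_spanned[OF F s0 fZ this]
  obtain n where n: "n \<le> card ?Z" "codim F {0} n (mprod F ?Z)" unfolding zz by (elim exE conjE)
  have i1: "{0} \<subseteq> W" using codim_incl[OF W(1) Fr] .
  have i2: "W \<subseteq> mprod F ?Z" using W(2) inc by blast
  from codim_between[OF n(2) F s0 i1 i2 codim_sm[OF W(1) Fr s0]]
  obtain a b where ab: "codim F {0} a W" "a + b = n" by (elim exE conjE)
  have "a = p ^ card S" by (rule codim_unique[OF ab(1) F s0 W(1)])
  moreover have "card ?Z \<le> card (?I - {a0})" using I(1) by (intro card_image_le) simp
  moreover have "card (?I - {a0}) < card ?I" using card_Diff1_less[OF I(1) a0] .
  ultimately show False using n(1) ab(2) I(2) by linarith
qed

end

text \<open>\<open>K1\<close> and \<open>K2\<close> are characterised by containing the roots and by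
  minimality. \<open>p_indep\<close> is the degree condition on a p-independent set:
  \<open>W\<close> is the field generated by \<open>S\<close> over the p-th powers of
  \<open>K\<close>, described by its dimension and its minimality.\<close>

locale p_root_tower = idf_char e p for e :: "'u::comm_ring_1" and p +
  fixes K K1 K2 B :: "'u set"
  assumes K: "subf K" and BK: "B \<subseteq> K" and K1: "subf K1" and K2: "subf K2"
    and KK1: "K \<subseteq> K1" and KK2: "K \<subseteq> K2"
    and K1_root: "\<And>b. b \<in> B \<Longrightarrow> \<exists>y\<in>K1. y ^ p = b"
    and K2_root: "\<And>b. b \<in> B \<Longrightarrow> \<exists>y\<in>K2. (y ^ p) ^ p = b"
    and K1_min: "\<And>F. subf F \<Longrightarrow> K \<subseteq> F \<Longrightarrow> (\<And>y. e * y = y \<Longrightarrow> y ^ p \<in> B \<Longrightarrow> y \<in> F) \<Longrightarrow> K1 \<subseteq> F"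
    and K2_min: "\<And>F. subf F \<Longrightarrow> K \<subseteq> F \<Longrightarrow> (\<And>y. e * y = y \<Longrightarrow> (y ^ p) ^ p \<in> B \<Longrightarrow> y \<in> F) \<Longrightarrow> K2 \<subseteq> F"
    and p_indep: "\<And>S. finite S \<Longrightarrow> S \<subseteq> B \<Longrightarrow> \<exists>W. codim ((\<lambda>x. x ^ p) ` K) {0} (p ^ card S) W \<and>
      (\<forall>F. subf F \<longrightarrow> (\<lambda>x. x ^ p) ` K \<subseteq> F \<longrightarrow> S \<subseteq> F \<longrightarrow> W \<subseteq> F)"
begin

abbreviation "Kp \<equiv> (\<lambda>x. x ^ p) ` K"
abbreviation "k0 \<equiv> (\<lambda>x. x ^ p) ` K1"
abbreviation "k2 \<equiv> (\<lambda>x. x ^ p) ` K2"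

lemma K1e: "y \<in> K1 \<Longrightarrow> e * y = y" and K2e: "y \<in> K2 \<Longrightarrow> e * y = y" and Ke: "y \<in> K \<Longrightarrow> e * y = y"
  using subr_unit[OF subf_r] K1 K2 K by blast+

lemma root_unique: "e * y = y \<Longrightarrow> e * z = z \<Longrightarrow> y ^ p = z ^ p \<Longrightarrow> y = z"
  by (rule frob_inj)

lemma K1_pow: "k0 \<subseteq> K"
proof -
  have "K1 \<subseteq> {y. e * y = y \<and> y ^ p \<in> K}"
    by (rule K1_min[OF root_closure_subf[OF K]]) (use Ke subr_pow'[OF subf_r[OF K] _ p0] BK in blast)+
  then show ?thesis by blast
qed

lemma root_in_K1: "e * y = y \<Longrightarrow> y ^ p \<in> B \<Longrightarrow> y \<in> K1"
  using K1_root root_unique K1e by metis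

lemma K2_pow: "k2 \<subseteq> K1"
proof -
  have "K2 \<subseteq> {y. e * y = y \<and> y ^ p \<in> K1}"
  proof (rule K2_min[OF root_closure_subf[OF K1]])
    show "K \<subseteq> {y. e * y = y \<and> y ^ p \<in> K1}"
      using Ke subr_pow'[OF subf_r[OF K] _ p0] KK1 by blast
    fix y assume "e * y = y" "(y ^ p) ^ p \<in> B"
    then show "y \<in> {y. e * y = y \<and> y ^ p \<in> K1}" using root_in_K1 pow_e[OF _ p0] by blast
  qed
  then show ?thesis by blast
qed

lemma K1_K2: "K1 \<subseteq> K2"
proof (rule K1_min[OF K2 KK2])
  fix y assume y: "e * y = y" "y ^ p \<in> B"
  obtain z where z: "z \<in> K2" "(z ^ p) ^ p = y ^ p" using K2_root[OF y(2)] by blast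
  have "z ^ p = y" using root_unique[OF pow_e[OF K2e[OF z(1)] p0] y(1) z(2)] .
  then show "y \<in> K2" using subr_pow'[OF subf_r[OF K2] z(1) p0] by simp
qed

definition root :: "'u \<Rightarrow> 'u" where "root b = (SOME y. y \<in> K1 \<and> y ^ p = b)"

lemma root: "b \<in> B \<Longrightarrow> root b \<in> K1" "b \<in> B \<Longrightarrow> root b ^ p = b"
  unfolding root_def using someI_ex[of "\<lambda>y. y \<in> K1 \<and> y ^ p = b"] K1_root by blast+

text \<open>The p-th root of \<open>b\<close> is the p-th power of a \<open>p^2\<close>-th root;
  uniqueness of roots identifies the two.\<close>

lemma root_k2: assumes "b \<in> B" shows "root b \<in> k2"
proof -
  obtain z where z: "z \<in> K2" "(z ^ p) ^ p = b" using K2_root[OF assms] by blast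
  have "z ^ p = root b"
    using root_unique[OF pow_e[OF K2e[OF z(1)] p0] K1e[OF root(1)[OF assms]]] z(2) root(2)[OF assms] by simp
  then show ?thesis using z(1) by (intro image_eqI[of _ _ z]) simp_all
qed

lemma subf_k0: "subf k0" and subf_k2: "subf k2" and subf_Kp: "subf Kp"
  using frob_subf K1 K2 K by blast+

lemma B_k0: "b \<in> B \<Longrightarrow> b \<in> k0" using root by (metis imageI)

lemma monomials_k2:
  assumes "finite S" "S \<subseteq> B" shows "monomials root S \<subseteq> k2"
  unfolding monomials_def using monomial_in[OF assms(1) subf_r[OF subf_k2]] root_k2 assms(2) by blast

text \<open>Monomials in the p-th roots of \<open>B\<close> span \<open>K1\<close> over
  \<open>K\<close>, and these roots lie in \<open>k2\<close>.\<close>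

lemma K1_generated: "K1 \<subseteq> mprod K k2"
proof -
  let ?G = "\<Union>S\<in>{S. finite S \<and> S \<subseteq> B}. mprod K (monomials root S)"
  have rp: "root b ^ p \<in> K" "e * root b = root b" if "b \<in> B" for b
    using root(2)[OF that] BK that K1e[OF root(1)[OF that]] by auto
  have "K1 \<subseteq> ?G"
  proof (rule K1_min)
    show "subf ?G" by (rule monomials_union_subf[OF K rp])
    show "K \<subseteq> ?G" using monomials_subf(2)[of "{}" K root, OF _ K] by blast
    fix y assume y: "e * y = y" "y ^ p \<in> B"
    have "y = root (y ^ p)" using root_unique[OF y(1) K1e[OF root(1)[OF y(2)]]] root(2)[OF y(2)] by simp
    moreover have "root (y ^ p) \<in> mprod K (monomials root {y ^ p})"
      by (rule monomials_subf(3)[OF _ K]) (use rp y in auto)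
    ultimately show "y \<in> ?G" using y(2) by auto
  qed
  moreover have "?G \<subseteq> mprod K k2" using mprod_mono[OF subset_refl monomials_k2] by blast
  ultimately show ?thesis by blast
qed

text \<open>The p-th powers of \<open>K2\<close> are generated by \<open>K^p\<close>, which lies in
  \<open>k0\<close>, and by the p-th roots of \<open>B\<close>. Monomials in these roots suffice
  over \<open>k0\<close> because it contains their p-th powers, the elements of
  \<open>B\<close>.\<close>

lemma k2_generated: "k2 \<subseteq> (\<Union>S\<in>{S. finite S \<and> S \<subseteq> B}. mprod k0 (monomials root S))"
proof -
  let ?G = "\<Union>S\<in>{S. finite S \<and> S \<subseteq> B}. mprod k0 (monomials root S)"
  have rp: "root b ^ p \<in> k0" "e * root b = root b" if "b \<in> B" for b
    using root(2)[OF that] B_k0 that K1e[OF root(1)[OF that]] by auto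
  have G: "subf ?G" by (rule monomials_union_subf[OF subf_k0 rp])
  have k0G: "k0 \<subseteq> ?G" using monomials_subf(2)[of "{}" k0 root, OF _ subf_k0] by blast
  have "K2 \<subseteq> {y. e * y = y \<and> y ^ p \<in> ?G}"
  proof (rule K2_min[OF root_closure_subf[OF G]])
    show "K \<subseteq> {y. e * y = y \<and> y ^ p \<in> ?G}" using Ke KK1 k0G by blast
    fix y assume y: "e * y = y" "(y ^ p) ^ p \<in> B"
    let ?b = "(y ^ p) ^ p"
    have "y ^ p = root ?b"
      using root_unique[OF pow_e[OF y(1) p0] K1e[OF root(1)[OF y(2)]]] root(2)[OF y(2)] by simp
    moreover have "root ?b \<in> mprod k0 (monomials root {?b})"
      by (rule monomials_subf(3)[OF _ subf_k0]) (use rp y in auto)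
    ultimately show "y \<in> {y. e * y = y \<and> y ^ p \<in> ?G}" using y by auto
  qed
  then show ?thesis by blast
qed

text \<open>The step that rests on p-independence. Monomials in the p-th roots span over
  \<open>k0\<close>. A relation between them over \<open>K\<close>, raised to the p-th power,
  becomes one over \<open>K^p\<close> between monomials in elements of \<open>B\<close>, and such a
  relation is trivial.\<close>

lemma k2_independent_basis:
  assumes Xs: "finite Xs" "Xs \<subseteq> k2"
  shows "\<exists>E. finite E \<and> E \<subseteq> k2 \<and> Xs \<subseteq> mprod k0 E \<and>
    (\<forall>c. (\<forall>y\<in>E. c y \<in> K) \<longrightarrow> (\<Sum>y\<in>E. c y * y) = 0 \<longrightarrow> (\<forall>y\<in>E. c y = 0))"
proof -
  have "\<forall>x\<in>Xs. \<exists>S. finite S \<and> S \<subseteq> B \<and> x \<in> mprod k0 (monomials root S)"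
  proof
    fix x assume "x \<in> Xs"
    with Xs(2) k2_generated have "x \<in> (\<Union>S\<in>{S. finite S \<and> S \<subseteq> B}. mprod k0 (monomials root S))"
      by (meson subsetD)
    then show "\<exists>S. finite S \<and> S \<subseteq> B \<and> x \<in> mprod k0 (monomials root S)" by (elim UN_E CollectE conjE) (intro exI conjI)
  qed
  then obtain f where f: "\<forall>x\<in>Xs. finite (f x) \<and> f x \<subseteq> B \<and> x \<in> mprod k0 (monomials root (f x))" by (rule bchoice[THEN exE])
  define S where "S = \<Union>(f ` Xs)"
  have S: "finite S" "S \<subseteq> B" unfolding S_def using f Xs(1) by auto
  have rp: "root b ^ p \<in> k0" if "b \<in> S" for b using root(2) B_k0 that S(2) by auto
  have XS: "Xs \<subseteq> mprod k0 (monomials root S)"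
  proof
    fix x assume x: "x \<in> Xs"
    then have "f x \<subseteq> S" unfolding S_def by blast
    from monomials_subset[where \<beta> = root, OF S(1) this subf_k0 rp]
    have "mprod k0 (monomials root (f x)) \<subseteq> mprod k0 (monomials root S)" .
    moreover have "x \<in> mprod k0 (monomials root (f x))" using f x by simp
    ultimately show "x \<in> mprod k0 (monomials root S)" by (rule subsetD)
  qed
  let ?I = "reduced_exponents S" and ?m = "monomial root S" and ?m' = "monomial (\<lambda>b. b) S"
  have mm': "?m a ^ p = ?m' a" for a
  proof -
    have "?m a ^ p = monomial (\<lambda>b. root b ^ p) S a" by (rule monomial_pow)
    also have "\<dots> = ?m' a"
      unfolding monomial_def using root(2) S(2) by (intro arg_cong[of _ _ "(*) e"] prod.cong) auto
    finally show ?thesis .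
  qed
  obtain W where W: "codim Kp {0} (p ^ card S) W" "\<forall>F. subf F \<longrightarrow> Kp \<subseteq> F \<longrightarrow> S \<subseteq> F \<longrightarrow> W \<subseteq> F"
    using p_indep[OF S] by (elim exE conjE)
  have bp: "b ^ p \<in> Kp" "e * b = b" if "b \<in> S" for b using that S(2) BK Ke by blast+
  have Wm: "W \<subseteq> mprod Kp (monomials (\<lambda>b. b) S)"
  proof (rule W(2)[rule_format])
    show "subf (mprod Kp (monomials (\<lambda>b. b) S))" by (rule monomials_subf(1)[OF S(1) subf_Kp bp])
    show "Kp \<subseteq> mprod Kp (monomials (\<lambda>b. b) S)" by (rule monomials_subf(2)[OF S(1) subf_Kp bp])
    show "S \<subseteq> mprod Kp (monomials (\<lambda>b. b) S)" by (rule subsetI) (rule monomials_subf(3)[OF S(1) subf_Kp bp])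
  qed
  have ind: "c a0 = 0" if "\<And>a. a \<in> ?I \<Longrightarrow> c a \<in> Kp" "(\<Sum>a\<in>?I. c a * ?m' a) = 0" "a0 \<in> ?I" for c a0
    by (rule monomials_independent[OF S(1) subf_Kp W(1) Wm that])
  have fI: "finite ?I" using reduced_exponents_card[OF S(1)] by blast
  have e_Kp: "e \<in> Kp" "0 \<in> Kp" "- e \<in> Kp"
    using subr_e[OF subf_r[OF subf_Kp]] subr_0[OF subf_r[OF subf_Kp]]
      subr_minus[OF subf_r[OF subf_Kp] subr_e[OF subf_r[OF subf_Kp]]] by simp_all
  have inj: "inj_on ?m ?I"
  proof (rule inj_onI, rule ccontr)
    fix a b assume ab: "a \<in> ?I" "b \<in> ?I" "?m a = ?m b" "a \<noteq> b"
    \<comment> \<open>Two equal monomials would give a relation with coefficients \<open>e\<close>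
      and \<open>- e\<close>. Injectivity is needed to pass between relations over the set of
      monomials and those indexed by exponents.\<close>
    define c where "c x = (if x = a then e else if x = b then - e else 0)" for x
    have "(\<Sum>x\<in>?I. c x * ?m' x) = (\<Sum>x\<in>{a, b}. c x * ?m' x)"
      using ab(1,2) by (intro sum.mono_neutral_right[OF fI]) (auto simp: c_def)
    also have "\<dots> = ?m' a - ?m' b" using ab(4) monomial_e by (simp add: c_def)
    also have "\<dots> = 0" using mm' ab(3) by (metis diff_self)
    finally have "c a = 0" using ind[of c a] ab(1) e_Kp by (simp add: c_def)
    then show False using e0 by (simp add: c_def)
  qed
  let ?E = "monomials root S"
  have "\<forall>y\<in>?E. c y = 0" if c: "\<forall>y\<in>?E. c y \<in> K" "(\<Sum>y\<in>?E. c y * y) = 0" for c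
  proof
    fix y assume "y \<in> ?E"
    then obtain a0 where a0: "a0 \<in> ?I" "y = ?m a0" unfolding monomials_def by blast
    have cK: "c (?m a) \<in> K" if "a \<in> ?I" for a using c(1) that unfolding monomials_def by blast
    have "(\<Sum>a\<in>?I. c (?m a) * ?m a) = 0" using c(2) unfolding monomials_def by (simp add: sum.reindex[OF inj])
    then have "(\<Sum>a\<in>?I. (c (?m a) * ?m a)) ^ p = 0" using p0 by (simp add: power_0_left)
    moreover have "e * (c (?m a) * ?m a) = c (?m a) * ?m a" for a using monomial_e by (metis mult.left_commute)
    ultimately have "(\<Sum>a\<in>?I. (c (?m a)) ^ p * ?m' a) = 0"
      using frob_sum[of ?I "\<lambda>a. c (?m a) * ?m a"] by (simp add: power_mult_distrib mm')
    then have "(c (?m a0)) ^ p = 0" by (intro ind[of "\<lambda>a. (c (?m a)) ^ p" a0] imageI cK a0(1))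
    then show "c y = 0" using power_nz[OF Ke[OF cK[OF a0(1)]] _ p0] a0(2) by blast
  qed
  moreover have "finite ?E" unfolding monomials_def using fI by simp
  ultimately show ?thesis using XS monomials_k2[OF S] by (intro exI[of _ ?E]) simp
qed

end

section \<open>Embedding rings into a ring type\<close>

text \<open>The product of all commutative rings with carrier in \<open>'a\<close>, and of \<open>\<int>\<close> to exclude the zero ring.\<close>

typedef 'a ring_product =
  "{x :: ('a ring \<Rightarrow> 'a) \<times> int. \<forall>A. if cring A then fst x A \<in> carrier A else fst x A = undefined}"
proof
  show "(\<lambda>A. if cring A then \<zero>\<^bsub>A\<^esub> else undefined, 0) \<in>
    {x :: ('a ring \<Rightarrow> 'a) \<times> int. \<forall>A. if cring A then fst x A \<in> carrier A else fst x A = undefined}"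
    by (simp add: cring.cring_simprules)
qed

definition component :: "'a ring_product \<Rightarrow> 'a ring \<Rightarrow> 'a" where
  "component x = fst (Rep_ring_product x)"

definition int_component :: "'a ring_product \<Rightarrow> int" where
  "int_component x = snd (Rep_ring_product x)"

text \<open>The value outside commutative rings is fixed, so equality can be tested on components,
  as in \<open>product_eqI\<close>.\<close>

definition make_product :: "('a ring \<Rightarrow> 'a) \<Rightarrow> int \<Rightarrow> 'a ring_product" where
  "make_product f m = Abs_ring_product (\<lambda>A. if cring A then f A else undefined, m)"

lemma component_closed: "cring A \<Longrightarrow> component x A \<in> carrier A"
  using Rep_ring_product[of x] unfolding component_def by (auto split: if_splits)

lemma component_make: "cring A \<Longrightarrow> (\<And>A. cring A \<Longrightarrow> f A \<in> carrier A) \<Longrightarrow> component (make_product f m) A = f A"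
  unfolding component_def make_product_def by (subst Abs_ring_product_inverse) auto

lemma int_component_make: "(\<And>A. cring A \<Longrightarrow> f A \<in> carrier A) \<Longrightarrow> int_component (make_product f m) = m"
  unfolding int_component_def make_product_def by (subst Abs_ring_product_inverse) auto

lemma product_eqI:
  assumes "\<And>A. cring A \<Longrightarrow> component x A = component y A" "int_component x = int_component y"
  shows "x = y"
proof -
  have "fst (Rep_ring_product x) A = fst (Rep_ring_product y) A" for A
  proof (cases "cring A")
    case False
    then show ?thesis using Rep_ring_product[of x] Rep_ring_product[of y] by simp
  qed (use assms(1) component_def in metis)
  then have "Rep_ring_product x = Rep_ring_product y"
    using assms(2) unfolding int_component_def by (intro prod_eqI ext) simp_all
  then show ?thesis by (simp add: Rep_ring_product_inject)
qed

instantiation ring_product :: (type) comm_ring_1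
begin

definition "0 = make_product (\<lambda>A. \<zero>\<^bsub>A\<^esub>) 0"
definition "1 = make_product (\<lambda>A. \<one>\<^bsub>A\<^esub>) 1"
definition "x + y = make_product (\<lambda>A. component x A \<oplus>\<^bsub>A\<^esub> component y A) (int_component x + int_component y)"
definition "x * y = make_product (\<lambda>A. component x A \<otimes>\<^bsub>A\<^esub> component y A) (int_component x * int_component y)"
definition "- x = make_product (\<lambda>A. \<ominus>\<^bsub>A\<^esub> component x A) (- int_component x)"
definition "x - y = make_product (\<lambda>A. component x A \<ominus>\<^bsub>A\<^esub> component y A) (int_component x - int_component y)"

lemma component_simps [simp]:
  assumes "cring A"
  shows "component 0 A = \<zero>\<^bsub>A\<^esub>" "component 1 A = \<one>\<^bsub>A\<^esub>"
    "component (x + y) A = component x A \<oplus>\<^bsub>A\<^esub> component y A"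
    "component (x * y) A = component x A \<otimes>\<^bsub>A\<^esub> component y A"
    "component (- x) A = \<ominus>\<^bsub>A\<^esub> component x A"
    "component (x - y) A = component x A \<ominus>\<^bsub>A\<^esub> component y A"
  unfolding zero_ring_product_def one_ring_product_def plus_ring_product_def times_ring_product_def
    uminus_ring_product_def minus_ring_product_def
  by (subst component_make[OF assms]; simp add: cring.cring_simprules component_closed)+

lemma int_component_simps [simp]:
  "int_component 0 = 0" "int_component 1 = 1"
  "int_component (x + y) = int_component x + int_component y"
  "int_component (x * y) = int_component x * int_component y"
  "int_component (- x) = - int_component x"
  "int_component (x - y) = int_component x - int_component y"
  unfolding zero_ring_product_def one_ring_product_def plus_ring_product_def times_ring_product_def
    uminus_ring_product_def minus_ring_product_def
  by (subst int_component_make; simp add: cring.cring_simprules component_closed)+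

instance
proof
  fix x y z :: "'a ring_product"
  show "x * y * z = x * (y * z)"
    by (rule product_eqI) (simp_all add: cring.cring_simprules component_closed)
  show "x * y = y * x"
    by (rule product_eqI) (simp_all add: cring.cring_simprules(14) component_closed)
  show "1 * x = x"
    by (rule product_eqI) (simp_all add: cring.cring_simprules component_closed)
  show "x + y + z = x + (y + z)"
    by (rule product_eqI) (simp_all add: cring.cring_simprules component_closed)
  show "x + y = y + x"
    by (rule product_eqI) (simp_all add: cring.cring_simprules(10) component_closed)
  show "0 + x = x"
    by (rule product_eqI) (simp_all add: cring.cring_simprules component_closed)
  show "- x + x = 0"
    by (rule product_eqI) (simp_all add: cring.cring_simprules component_closed)
  show "x - y = x + - y"
    by (rule product_eqI) (simp_all add: a_minus_def)
  show "(x + y) * z = x * z + y * z"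
    by (rule product_eqI) (simp_all add: cring.cring_simprules(13) component_closed distrib_right)
  show "(0::'a ring_product) \<noteq> 1"
    using int_component_simps(1,2) by (metis zero_neq_one)
qed

end

lemma cring_basic:
  assumes "cring A"
  shows "\<zero>\<^bsub>A\<^esub> \<in> carrier A" "\<one>\<^bsub>A\<^esub> \<in> carrier A"
    "x \<in> carrier A \<Longrightarrow> y \<in> carrier A \<Longrightarrow> x \<oplus>\<^bsub>A\<^esub> y \<in> carrier A"
    "x \<in> carrier A \<Longrightarrow> y \<in> carrier A \<Longrightarrow> x \<otimes>\<^bsub>A\<^esub> y \<in> carrier A"
    "x \<in> carrier A \<Longrightarrow> \<ominus>\<^bsub>A\<^esub> x \<in> carrier A"
    "x \<in> carrier A \<Longrightarrow> \<zero>\<^bsub>A\<^esub> \<oplus>\<^bsub>A\<^esub> x = x" "x \<in> carrier A \<Longrightarrow> \<zero>\<^bsub>A\<^esub> \<otimes>\<^bsub>A\<^esub> x = \<zero>\<^bsub>A\<^esub>"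
    "x \<in> carrier A \<Longrightarrow> \<one>\<^bsub>A\<^esub> \<otimes>\<^bsub>A\<^esub> x = x" "x \<in> carrier A \<Longrightarrow> \<ominus>\<^bsub>A\<^esub> x \<oplus>\<^bsub>A\<^esub> x = \<zero>\<^bsub>A\<^esub>"
proof -
  interpret cring A by fact
  show "\<zero>\<^bsub>A\<^esub> \<in> carrier A" "\<one>\<^bsub>A\<^esub> \<in> carrier A"
    "x \<in> carrier A \<Longrightarrow> y \<in> carrier A \<Longrightarrow> x \<oplus>\<^bsub>A\<^esub> y \<in> carrier A"
    "x \<in> carrier A \<Longrightarrow> y \<in> carrier A \<Longrightarrow> x \<otimes>\<^bsub>A\<^esub> y \<in> carrier A"
    "x \<in> carrier A \<Longrightarrow> \<ominus>\<^bsub>A\<^esub> x \<in> carrier A"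
    "x \<in> carrier A \<Longrightarrow> \<zero>\<^bsub>A\<^esub> \<oplus>\<^bsub>A\<^esub> x = x" "x \<in> carrier A \<Longrightarrow> \<zero>\<^bsub>A\<^esub> \<otimes>\<^bsub>A\<^esub> x = \<zero>\<^bsub>A\<^esub>"
    "x \<in> carrier A \<Longrightarrow> \<one>\<^bsub>A\<^esub> \<otimes>\<^bsub>A\<^esub> x = x" "x \<in> carrier A \<Longrightarrow> \<ominus>\<^bsub>A\<^esub> x \<oplus>\<^bsub>A\<^esub> x = \<zero>\<^bsub>A\<^esub>"
    by (simp_all add: l_neg)
qed

text \<open>Zero in every other component, so the image is an ideal generated by an idempotent, the
  image of the unit.\<close>

definition emb :: "'a ring \<Rightarrow> 'a \<Rightarrow> 'a ring_product" where
  "emb A x = make_product (\<lambda>A'. if A' = A then x else \<zero>\<^bsub>A'\<^esub>) 0"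

lemma component_emb:
  "cring A' \<Longrightarrow> x \<in> carrier A \<Longrightarrow> component (emb A x) A' = (if A' = A then x else \<zero>\<^bsub>A'\<^esub>)"
  unfolding emb_def by (subst component_make) (auto simp: cring_basic)

lemma int_component_emb: "x \<in> carrier A \<Longrightarrow> int_component (emb A x) = 0"
  unfolding emb_def by (subst int_component_make) (auto simp: cring_basic)

lemma emb_add:
  "cring A \<Longrightarrow> x \<in> carrier A \<Longrightarrow> y \<in> carrier A \<Longrightarrow> emb A (x \<oplus>\<^bsub>A\<^esub> y) = emb A x + emb A y"
  by (rule product_eqI) (simp_all add: component_emb int_component_emb cring_basic)

lemma emb_mult:
  "cring A \<Longrightarrow> x \<in> carrier A \<Longrightarrow> y \<in> carrier A \<Longrightarrow> emb A (x \<otimes>\<^bsub>A\<^esub> y) = emb A x * emb A y"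
  by (rule product_eqI) (simp_all add: component_emb int_component_emb cring_basic)

lemma emb_zero: "cring A \<Longrightarrow> emb A \<zero>\<^bsub>A\<^esub> = 0"
  by (rule product_eqI) (simp_all add: component_emb int_component_emb cring_basic)

lemma emb_inj:
  assumes "cring A" "x \<in> carrier A" "y \<in> carrier A" "emb A x = emb A y" shows "x = y"
proof -
  have "x = component (emb A x) A" using component_emb[OF assms(1,2)] by simp
  also have "\<dots> = component (emb A y) A" using assms(4) by (rule arg_cong)
  also have "\<dots> = y" using component_emb[OF assms(1,3)] by simp
  finally show ?thesis .
qed

text \<open>The other components of an element of the ideal vanish. Hence the ideal is exactly a
  copy of \<open>A\<close> and takes over its inverses.\<close>

lemma emb_surj:
  assumes A: "cring A" and y: "emb A \<one>\<^bsub>A\<^esub> * y = y" shows "y = emb A (component y A)"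
proof (rule product_eqI)
  fix A' :: "'a ring" assume A': "cring A'"
  have "component y A' = component (emb A \<one>\<^bsub>A\<^esub>) A' \<otimes>\<^bsub>A'\<^esub> component y A'" using y A' component_simps(4) by metis
  then show "component y A' = component (emb A (component y A)) A'"
    using A A' component_emb[OF A', of "\<one>\<^bsub>A\<^esub>" A] component_emb[OF A', of "component y A" A]
    by (cases "A' = A") (simp_all add: cring_basic component_closed)
next
  have "int_component y = int_component (emb A \<one>\<^bsub>A\<^esub>) * int_component y" using y int_component_simps(4) by metis
  then show "int_component y = int_component (emb A (component y A))"
    using A by (simp add: int_component_emb cring_basic component_closed)
qed

lemma emb_idf:
  assumes "field A" shows "idf (emb A \<one>\<^bsub>A\<^esub>)"
proof
  interpret field A by fact
  have A: "cring A" by (rule is_cring)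
  show "emb A \<one>\<^bsub>A\<^esub> * emb A \<one>\<^bsub>A\<^esub> = emb A \<one>\<^bsub>A\<^esub>" using emb_mult[OF A one_closed one_closed] by simp
  show "emb A \<one>\<^bsub>A\<^esub> \<noteq> 0" using emb_inj[OF A one_closed zero_closed] emb_zero[OF A] by auto
  fix x assume x: "emb A \<one>\<^bsub>A\<^esub> * x = x" "x \<noteq> 0"
  let ?x = "component x A"
  have xe: "x = emb A ?x" by (rule emb_surj[OF A x(1)])
  have xc: "?x \<in> carrier A" by (rule component_closed[OF A])
  have "?x \<noteq> \<zero>\<^bsub>A\<^esub>" using x(2) xe emb_zero[OF A] by metis
  then have u: "?x \<in> Units A" using xc field_Units by blast
  have ic: "inv\<^bsub>A\<^esub> ?x \<in> carrier A" using u by blast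
  have "x * emb A (inv\<^bsub>A\<^esub> ?x) = emb A \<one>\<^bsub>A\<^esub>" using emb_mult[OF A xc ic] xe u by (metis Units_r_inv)
  moreover have "emb A \<one>\<^bsub>A\<^esub> * emb A (inv\<^bsub>A\<^esub> ?x) = emb A (inv\<^bsub>A\<^esub> ?x)"
    using emb_mult[OF A one_closed ic] ic by simp
  ultimately show "\<exists>y. emb A \<one>\<^bsub>A\<^esub> * y = y \<and> x * y = emb A \<one>\<^bsub>A\<^esub>" by blast
qed

section \<open>Rings embedded in a field with unit \<open>e\<close>\<close>

locale ring_embedding = idf e for e :: "'u::comm_ring_1" +
  fixes A :: "('a, 'm) ring_scheme" (structure) and \<phi> :: "'a \<Rightarrow> 'u"
  assumes add_closed: "\<And>x y. x \<in> carrier A \<Longrightarrow> y \<in> carrier A \<Longrightarrow> x \<oplus> y \<in> carrier A"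
    and mult_closed: "\<And>x y. x \<in> carrier A \<Longrightarrow> y \<in> carrier A \<Longrightarrow> x \<otimes> y \<in> carrier A"
    and unit_closed: "\<zero> \<in> carrier A" "\<one> \<in> carrier A"
    and neg_closed: "\<And>x. x \<in> carrier A \<Longrightarrow> \<exists>y\<in>carrier A. \<phi> y = - \<phi> x"
    and \<phi>_add: "\<And>x y. x \<in> carrier A \<Longrightarrow> y \<in> carrier A \<Longrightarrow> \<phi> (x \<oplus> y) = \<phi> x + \<phi> y"
    and \<phi>_mult: "\<And>x y. x \<in> carrier A \<Longrightarrow> y \<in> carrier A \<Longrightarrow> \<phi> (x \<otimes> y) = \<phi> x * \<phi> y"
    and \<phi>_zero: "\<phi> \<zero> = 0" and \<phi>_one: "\<phi> \<one> = e"
    and \<phi>_e: "\<And>x. x \<in> carrier A \<Longrightarrow> e * \<phi> x = \<phi> x"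
    and \<phi>_inj: "\<And>x y. x \<in> carrier A \<Longrightarrow> y \<in> carrier A \<Longrightarrow> \<phi> x = \<phi> y \<Longrightarrow> x = y"
begin

text \<open>The axioms are pulled back along the injective map. The locale presupposes none of them,
  and asks of negatives only that they exist, so that it can be verified for the records built by
  \<open>base_change\<close> and \<open>normalization\<close>.\<close>

lemma domain: "domain A"
proof (rule domain.intro)
  note s = \<phi>_add \<phi>_mult \<phi>_zero \<phi>_one add_closed mult_closed unit_closed
  have ag: "abelian_group A"
  proof (rule abelian_groupI)
    fix x y z assume x: "x \<in> carrier A" and y: "y \<in> carrier A" and z: "z \<in> carrier A"
    show "x \<oplus> y \<in> carrier A" using x y by (rule add_closed)
    show "x \<oplus> y \<oplus> z = x \<oplus> (y \<oplus> z)" by (rule \<phi>_inj) (use x y z in \<open>simp_all add: s add.assoc\<close>)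
    show "x \<oplus> y = y \<oplus> x" by (rule \<phi>_inj) (use x y in \<open>simp_all add: s add.commute\<close>)
    show "\<zero> \<oplus> x = x" by (rule \<phi>_inj) (use x in \<open>simp_all add: s\<close>)
    obtain x' where x': "x' \<in> carrier A" "\<phi> x' = - \<phi> x" using neg_closed[OF x] by blast
    have "x' \<oplus> x = \<zero>" by (rule \<phi>_inj) (use x x' in \<open>simp_all add: s\<close>)
    then show "\<exists>y\<in>carrier A. y \<oplus> x = \<zero>" using x'(1) by blast
  qed (rule unit_closed)
  have cm: "comm_monoid A"
  proof (rule comm_monoidI)
    fix x y z assume x: "x \<in> carrier A" and y: "y \<in> carrier A" and z: "z \<in> carrier A"
    show "x \<otimes> y \<in> carrier A" using x y by (rule mult_closed)
    show "x \<otimes> y \<otimes> z = x \<otimes> (y \<otimes> z)" by (rule \<phi>_inj) (use x y z in \<open>simp_all add: s mult.assoc\<close>)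
    show "x \<otimes> y = y \<otimes> x" by (rule \<phi>_inj) (use x y in \<open>simp_all add: s mult.commute\<close>)
    show "\<one> \<otimes> x = x" by (rule \<phi>_inj) (use x \<phi>_e[OF x] in \<open>simp_all add: s\<close>)
  qed (rule unit_closed)
  show "cring A"
  proof (rule cringI[OF ag cm])
    fix x y z assume x: "x \<in> carrier A" and y: "y \<in> carrier A" and z: "z \<in> carrier A"
    show "(x \<oplus> y) \<otimes> z = x \<otimes> z \<oplus> y \<otimes> z" by (rule \<phi>_inj) (use x y z in \<open>simp_all add: s distrib_right\<close>)
  qed
  show "domain_axioms A"
  proof
    show "\<one> \<noteq> \<zero>" using \<phi>_one \<phi>_zero e0 by auto
    fix a b assume ab: "a \<otimes> b = \<zero>" "a \<in> carrier A" "b \<in> carrier A"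
    have "\<phi> a * \<phi> b = 0" using \<phi>_mult[OF ab(2,3)] ab(1) \<phi>_zero by simp
    then have "\<phi> a = 0 \<or> \<phi> b = 0" using no_zero_div[OF \<phi>_e[OF ab(2)] _ \<phi>_e[OF ab(3)]] by blast
    then show "a = \<zero> \<or> b = \<zero>" using \<phi>_inj[OF _ unit_closed(1)] ab(2,3) \<phi>_zero by metis
  qed
qed

end

section \<open>Fields of fractions\<close>

context domain
begin

abbreviation "fracs \<equiv> carrier R \<times> (carrier R - {\<zero>})"

lemma equiv_frac_rel: "equiv fracs (frac_rel R)"
proof (rule equivI)
  show "frac_rel R \<subseteq> fracs \<times> fracs" unfolding frac_rel_def by auto
  show "refl_on fracs (frac_rel R)" unfolding refl_on_def frac_rel_def by auto
  show "sym (frac_rel R)" unfolding sym_def frac_rel_def by auto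
  show "trans (frac_rel R)"
  proof (rule transI)
    fix x y z assume xy: "(x, y) \<in> frac_rel R" and yz: "(y, z) \<in> frac_rel R"
    obtain a b where x: "x = (a, b)" by (cases x)
    obtain c d where y: "y = (c, d)" by (cases y)
    obtain f g where z: "z = (f, g)" by (cases z)
    have c1: "a \<in> carrier R" "b \<in> carrier R" "b \<noteq> \<zero>" "c \<in> carrier R" "d \<in> carrier R" "d \<noteq> \<zero>" "a \<otimes> d = c \<otimes> b"
      "f \<in> carrier R" "g \<in> carrier R" "g \<noteq> \<zero>" "c \<otimes> g = f \<otimes> d"
      using xy yz unfolding x y z frac_rel_def by auto
    note cl = c1(1,2,4,5,8,9)
    have "d \<otimes> (a \<otimes> g) = (a \<otimes> d) \<otimes> g" using cl by (simp add: m_ac)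
    also have "\<dots> = (c \<otimes> g) \<otimes> b" unfolding c1(7) using cl by (simp add: m_ac)
    also have "\<dots> = d \<otimes> (f \<otimes> b)" unfolding c1(11) using cl by (simp add: m_ac)
    finally have "a \<otimes> g = f \<otimes> b" using c1 m_lcancel by (metis m_closed)
    then show "(x, z) \<in> frac_rel R" using c1 unfolding x z frac_rel_def by auto
  qed
qed

lemma fraction_eq:
  assumes "a \<in> carrier R" "b \<in> carrier R" "b \<noteq> \<zero>" "c \<in> carrier R" "d \<in> carrier R" "d \<noteq> \<zero>"
  shows "fraction R a b = fraction R c d \<longleftrightarrow> a \<otimes> d = c \<otimes> b"
  unfolding fraction_def using eq_equiv_class_iff[OF equiv_frac_rel, of "(a, b)" "(c, d)"] assms
  by (auto simp: frac_rel_def)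

lemma fraction_closed:
  "a \<in> carrier R \<Longrightarrow> b \<in> carrier R \<Longrightarrow> b \<noteq> \<zero> \<Longrightarrow> fraction R a b \<in> carrier (frac_field R)"
  unfolding fraction_def frac_field_def by (auto intro: quotientI)

lemma fraction_cases:
  assumes "x \<in> carrier (frac_field R)"
  obtains a b where "a \<in> carrier R" "b \<in> carrier R" "b \<noteq> \<zero>" "x = fraction R a b"
  using assms unfolding frac_field_def fraction_def by (auto elim!: quotientE)

text \<open>Operations on fractions are unions over representatives; when the value does not depend
  on the representative, the union is that value.\<close>

lemma UN_fraction:
  assumes "a \<in> carrier R" "b \<in> carrier R" "b \<noteq> \<zero>"
    and "\<And>a' b'. a' \<in> carrier R \<Longrightarrow> b' \<in> carrier R \<Longrightarrow> b' \<noteq> \<zero> \<Longrightarrow> a \<otimes> b' = a' \<otimes> b \<Longrightarrow> f a' b' = f a b"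
  shows "(\<Union>(a', b')\<in>fraction R a b. f a' b') = f a b"
proof -
  have mem: "(a, b) \<in> fraction R a b" unfolding fraction_def frac_rel_def using assms(1-3) by auto
  have "f (fst z) (snd z) = f a b" if "z \<in> fraction R a b" for z
    using that assms(4)[of "fst z" "snd z"] unfolding fraction_def frac_rel_def by auto
  then have "(\<lambda>(a', b'). f a' b') z = f a b" if "z \<in> fraction R a b" for z using that by (simp add: case_prod_beta)
  then show ?thesis using mem by (metis (no_types, lifting) SUP_eq_const empty_iff)
qed

lemma fraction_mult:
  assumes "a \<in> carrier R" "b \<in> carrier R" "b \<noteq> \<zero>" "c \<in> carrier R" "d \<in> carrier R" "d \<noteq> \<zero>"
  shows "fraction R a b \<otimes>\<^bsub>frac_field R\<^esub> fraction R c d = fraction R (a \<otimes> c) (b \<otimes> d)"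
proof -
  have inner: "(\<Union>(c', d')\<in>fraction R c d. fraction R (a' \<otimes> c') (b' \<otimes> d')) = fraction R (a' \<otimes> c) (b' \<otimes> d)"
    if ab: "a' \<in> carrier R" "b' \<in> carrier R" "b' \<noteq> \<zero>" for a' b'
  proof (rule UN_fraction[OF assms(4-6)])
    fix c' d' assume cd: "c' \<in> carrier R" "d' \<in> carrier R" "d' \<noteq> \<zero>" "c \<otimes> d' = c' \<otimes> d"
    have "(a' \<otimes> c') \<otimes> (b' \<otimes> d) = (a' \<otimes> b') \<otimes> (c' \<otimes> d)" using ab cd(1-3) assms by (simp add: m_ac)
    also have "\<dots> = (a' \<otimes> c) \<otimes> (b' \<otimes> d')" unfolding cd(4)[symmetric] using ab cd(1-3) assms by (simp add: m_ac)
    finally show "fraction R (a' \<otimes> c') (b' \<otimes> d') = fraction R (a' \<otimes> c) (b' \<otimes> d)"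
      using ab cd assms by (subst fraction_eq) (simp_all add: integral_iff)
  qed
  have "(\<Union>(a', b')\<in>fraction R a b. \<Union>(c', d')\<in>fraction R c d. fraction R (a' \<otimes> c') (b' \<otimes> d'))
      = (\<Union>(c', d')\<in>fraction R c d. fraction R (a \<otimes> c') (b \<otimes> d'))"
  proof (rule UN_fraction[OF assms(1-3)])
    fix a' b' assume ab: "a' \<in> carrier R" "b' \<in> carrier R" "b' \<noteq> \<zero>" "a \<otimes> b' = a' \<otimes> b"
    have "(a' \<otimes> c) \<otimes> (b \<otimes> d) = (a' \<otimes> b) \<otimes> (c \<otimes> d)" using ab(1-3) assms by (simp add: m_ac)
    also have "\<dots> = (a \<otimes> c) \<otimes> (b' \<otimes> d)" unfolding ab(4)[symmetric] using ab(1-3) assms by (simp add: m_ac)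
    finally show "(\<Union>(c', d')\<in>fraction R c d. fraction R (a' \<otimes> c') (b' \<otimes> d'))
      = (\<Union>(c', d')\<in>fraction R c d. fraction R (a \<otimes> c') (b \<otimes> d'))"
      unfolding inner[OF ab(1-3)] inner[OF assms(1-3)]
      using ab assms by (subst fraction_eq) (simp_all add: integral_iff)
  qed
  then show ?thesis unfolding inner[OF assms(1-3)] by (simp add: frac_field_def)
qed

lemma fraction_add:
  assumes "a \<in> carrier R" "b \<in> carrier R" "b \<noteq> \<zero>" "c \<in> carrier R" "d \<in> carrier R" "d \<noteq> \<zero>"
  shows "fraction R a b \<oplus>\<^bsub>frac_field R\<^esub> fraction R c d = fraction R (a \<otimes> d \<oplus> c \<otimes> b) (b \<otimes> d)"
proof -
  let ?f = "\<lambda>a b c d. fraction R (a \<otimes> d \<oplus> c \<otimes> b) (b \<otimes> d)"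
  have inner: "(\<Union>(c', d')\<in>fraction R c d. ?f a' b' c' d') = ?f a' b' c d"
    if ab: "a' \<in> carrier R" "b' \<in> carrier R" "b' \<noteq> \<zero>" for a' b'
  proof (rule UN_fraction[OF assms(4-6)])
    fix c' d' assume cd: "c' \<in> carrier R" "d' \<in> carrier R" "d' \<noteq> \<zero>" "c \<otimes> d' = c' \<otimes> d"
    have "(a' \<otimes> d' \<oplus> c' \<otimes> b') \<otimes> (b' \<otimes> d) = a' \<otimes> d' \<otimes> b' \<otimes> d \<oplus> b' \<otimes> b' \<otimes> (c' \<otimes> d)"
      using ab cd(1-3) assms by (simp add: m_ac l_distr r_distr)
    also have "\<dots> = (a' \<otimes> d \<oplus> c \<otimes> b') \<otimes> (b' \<otimes> d')"
      unfolding cd(4)[symmetric] using ab cd(1-3) assms by (simp add: m_ac l_distr r_distr)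
    finally show "?f a' b' c' d' = ?f a' b' c d"
      using ab cd assms by (subst fraction_eq) (simp_all add: integral_iff)
  qed
  have "(\<Union>(a', b')\<in>fraction R a b. \<Union>(c', d')\<in>fraction R c d. ?f a' b' c' d')
      = (\<Union>(c', d')\<in>fraction R c d. ?f a b c' d')"
  proof (rule UN_fraction[OF assms(1-3)])
    fix a' b' assume ab: "a' \<in> carrier R" "b' \<in> carrier R" "b' \<noteq> \<zero>" "a \<otimes> b' = a' \<otimes> b"
    have "(a' \<otimes> d \<oplus> c \<otimes> b') \<otimes> (b \<otimes> d) = (a' \<otimes> b) \<otimes> (d \<otimes> d) \<oplus> c \<otimes> b' \<otimes> b \<otimes> d"
      using ab(1-3) assms by (simp add: m_ac l_distr r_distr)
    also have "\<dots> = (a \<otimes> d \<oplus> c \<otimes> b) \<otimes> (b' \<otimes> d)"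
      unfolding ab(4)[symmetric] using ab(1-3) assms by (simp add: m_ac l_distr r_distr)
    finally show "(\<Union>(c', d')\<in>fraction R c d. ?f a' b' c' d') = (\<Union>(c', d')\<in>fraction R c d. ?f a b c' d')"
      unfolding inner[OF ab(1-3)] inner[OF assms(1-3)]
      using ab assms by (subst fraction_eq) (simp_all add: integral_iff)
  qed
  then show ?thesis unfolding inner[OF assms(1-3)] by (simp add: frac_field_def)
qed

lemma frac_zero: "\<zero>\<^bsub>frac_field R\<^esub> = fraction R \<zero> \<one>" and frac_one: "\<one>\<^bsub>frac_field R\<^esub> = fraction R \<one> \<one>"
  unfolding frac_field_def by simp_all

lemma frac_field_field: "field (frac_field R)"
proof -
  note fr = fraction_mult fraction_add frac_zero frac_one fraction_eq fraction_closed integral_iff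
  have ag: "abelian_group (frac_field R)"
  proof (rule abelian_groupI)
    show "\<zero>\<^bsub>frac_field R\<^esub> \<in> carrier (frac_field R)" by (simp add: fr)
    fix x y z assume xyz: "x \<in> carrier (frac_field R)" "y \<in> carrier (frac_field R)" "z \<in> carrier (frac_field R)"
    from xyz(1) obtain a b where x: "a \<in> carrier R" "b \<in> carrier R" "b \<noteq> \<zero>" "x = fraction R a b"
      by (rule fraction_cases)
    from xyz(2) obtain c d where y: "c \<in> carrier R" "d \<in> carrier R" "d \<noteq> \<zero>" "y = fraction R c d"
      by (rule fraction_cases)
    from xyz(3) obtain f g where z: "f \<in> carrier R" "g \<in> carrier R" "g \<noteq> \<zero>" "z = fraction R f g"
      by (rule fraction_cases)
    show "x \<oplus>\<^bsub>frac_field R\<^esub> y \<in> carrier (frac_field R)" using x y by (simp add: fr)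
    show "x \<oplus>\<^bsub>frac_field R\<^esub> y \<oplus>\<^bsub>frac_field R\<^esub> z = x \<oplus>\<^bsub>frac_field R\<^esub> (y \<oplus>\<^bsub>frac_field R\<^esub> z)"
      using x y z by (simp add: fr l_distr r_distr m_ac a_ac)
    show "x \<oplus>\<^bsub>frac_field R\<^esub> y = y \<oplus>\<^bsub>frac_field R\<^esub> x" using x y by (simp add: fr m_ac a_ac)
    show "\<zero>\<^bsub>frac_field R\<^esub> \<oplus>\<^bsub>frac_field R\<^esub> x = x" using x by (simp add: fr)
    have "fraction R (\<ominus> a) b \<oplus>\<^bsub>frac_field R\<^esub> x = \<zero>\<^bsub>frac_field R\<^esub>"
      using x by (simp add: fr l_minus l_neg)
    then show "\<exists>y\<in>carrier (frac_field R). y \<oplus>\<^bsub>frac_field R\<^esub> x = \<zero>\<^bsub>frac_field R\<^esub>"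
      using fraction_closed[of "\<ominus> a" b] x by blast
  qed
  have cm: "comm_monoid (frac_field R)"
  proof (rule comm_monoidI)
    show "\<one>\<^bsub>frac_field R\<^esub> \<in> carrier (frac_field R)" by (simp add: fr)
    fix x y z assume xyz: "x \<in> carrier (frac_field R)" "y \<in> carrier (frac_field R)" "z \<in> carrier (frac_field R)"
    from xyz(1) obtain a b where x: "a \<in> carrier R" "b \<in> carrier R" "b \<noteq> \<zero>" "x = fraction R a b"
      by (rule fraction_cases)
    from xyz(2) obtain c d where y: "c \<in> carrier R" "d \<in> carrier R" "d \<noteq> \<zero>" "y = fraction R c d"
      by (rule fraction_cases)
    from xyz(3) obtain f g where z: "f \<in> carrier R" "g \<in> carrier R" "g \<noteq> \<zero>" "z = fraction R f g"
      by (rule fraction_cases)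
    show "x \<otimes>\<^bsub>frac_field R\<^esub> y \<in> carrier (frac_field R)" using x y by (simp add: fr)
    show "x \<otimes>\<^bsub>frac_field R\<^esub> y \<otimes>\<^bsub>frac_field R\<^esub> z = x \<otimes>\<^bsub>frac_field R\<^esub> (y \<otimes>\<^bsub>frac_field R\<^esub> z)"
      using x y z by (simp add: fr m_ac)
    show "x \<otimes>\<^bsub>frac_field R\<^esub> y = y \<otimes>\<^bsub>frac_field R\<^esub> x" using x y by (simp add: fr m_ac)
    show "\<one>\<^bsub>frac_field R\<^esub> \<otimes>\<^bsub>frac_field R\<^esub> x = x" using x by (simp add: fr)
  qed
  have "cring (frac_field R)"
  proof (rule cringI[OF ag cm])
    fix x y z assume xyz: "x \<in> carrier (frac_field R)" "y \<in> carrier (frac_field R)" "z \<in> carrier (frac_field R)"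
    from xyz(1) obtain a b where x: "a \<in> carrier R" "b \<in> carrier R" "b \<noteq> \<zero>" "x = fraction R a b"
      by (rule fraction_cases)
    from xyz(2) obtain c d where y: "c \<in> carrier R" "d \<in> carrier R" "d \<noteq> \<zero>" "y = fraction R c d"
      by (rule fraction_cases)
    from xyz(3) obtain f g where z: "f \<in> carrier R" "g \<in> carrier R" "g \<noteq> \<zero>" "z = fraction R f g"
      by (rule fraction_cases)
    show "(x \<oplus>\<^bsub>frac_field R\<^esub> y) \<otimes>\<^bsub>frac_field R\<^esub> z
        = x \<otimes>\<^bsub>frac_field R\<^esub> z \<oplus>\<^bsub>frac_field R\<^esub> y \<otimes>\<^bsub>frac_field R\<^esub> z"
      using x y z by (simp add: fr l_distr r_distr m_ac)
  qed
  then show ?thesis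
  proof (rule cring.cring_fieldI2)
    show "\<zero>\<^bsub>frac_field R\<^esub> \<noteq> \<one>\<^bsub>frac_field R\<^esub>" by (simp add: fr)
    fix x assume x': "x \<in> carrier (frac_field R)" "x \<noteq> \<zero>\<^bsub>frac_field R\<^esub>"
    from x'(1) obtain a b where x: "a \<in> carrier R" "b \<in> carrier R" "b \<noteq> \<zero>" "x = fraction R a b"
      by (rule fraction_cases)
    have "a \<noteq> \<zero>" using x' x by (auto simp: fr)
    then have "x \<otimes>\<^bsub>frac_field R\<^esub> fraction R b a = \<one>\<^bsub>frac_field R\<^esub>" using x by (simp add: fr m_ac)
    then show "\<exists>y\<in>carrier (frac_field R). x \<otimes>\<^bsub>frac_field R\<^esub> y = \<one>\<^bsub>frac_field R\<^esub>"
      using fraction_closed[of b a] x \<open>a \<noteq> \<zero>\<close> by blast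
  qed
qed

end

section \<open>Linear independence\<close>

context idf
begin

text \<open>Independence of a set, not of a family. Where families occur, injectivity is proved
  alongside, as in \<open>lin_indep_products\<close>.\<close>

definition lin_indep :: "'u set \<Rightarrow> 'u set \<Rightarrow> bool" where
  "lin_indep L E \<longleftrightarrow> (\<forall>c. (\<forall>y\<in>E. c y \<in> L) \<longrightarrow> (\<Sum>y\<in>E. c y * y) = 0 \<longrightarrow> (\<forall>y\<in>E. c y = 0))"

lemma lin_indepD: "lin_indep L E \<Longrightarrow> (\<And>y. y \<in> E \<Longrightarrow> c y \<in> L) \<Longrightarrow> (\<Sum>y\<in>E. c y * y) = 0 \<Longrightarrow> y \<in> E \<Longrightarrow> c y = 0"
  unfolding lin_indep_def by blast

text \<open>An element outside the span of the previous ones is appended; in a relation its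
  coefficient must vanish, since otherwise it could be divided out.\<close>

lemma exists_basis:
  assumes L: "subf L" and "finite Xs" "\<And>x. x \<in> Xs \<Longrightarrow> e * x = x"
  shows "\<exists>E. finite E \<and> E \<subseteq> Xs \<and> lin_indep L E \<and> Xs \<subseteq> mprod L E"
  using assms(2,3)
proof (induction Xs rule: finite_induct)
  case empty
  show ?case by (intro exI[of _ "{}"]) (simp add: lin_indep_def)
next
  case (insert x Xs)
  have Lr: "subr L" using subf_r[OF L] .
  obtain E where E: "finite E" "E \<subseteq> Xs" "lin_indep L E" "Xs \<subseteq> mprod L E" using insert by auto
  have Ee: "\<And>m. m \<in> E \<Longrightarrow> e * m = m" using insert.prems E(2) by blast
  have sE: "sm L (mprod L E)" using mprod_sm[OF Lr, of E] Ee by simp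
  show ?case
  proof (cases "x \<in> mprod L E")
    case True
    then show ?thesis using E by (intro exI[of _ E]) auto
  next
    case False
    have xE: "x \<notin> E" using False mprod_incl[OF Lr, of E x] Ee by blast
    have xe: "e * x = x" using insert.prems by blast
    have "lin_indep L (insert x E)"
      unfolding lin_indep_def
    proof (intro allI impI)
      fix c assume c: "\<forall>y\<in>insert x E. c y \<in> L" and rel: "(\<Sum>y\<in>insert x E. c y * y) = 0"
      have s: "c x * x + (\<Sum>y\<in>E. c y * y) = 0" using rel E(1) xE by simp
      have "c x = 0"
      proof (rule ccontr)
        assume "c x \<noteq> 0"
        then obtain g where g: "g \<in> L" "c x * g = e" using subf_inv[OF L] c by blast
        have "(\<Sum>y\<in>E. c y * y) \<in> mprod L E"
        proof (rule sm_sum[OF sE])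
          show "\<And>y. y \<in> E \<Longrightarrow> c y * y \<in> mprod L E" using c by (intro mprod_mem) auto
        qed
        then have "- g * (\<Sum>y\<in>E. c y * y) \<in> mprod L E" by (rule sm_mult[OF sE subr_minus[OF Lr g(1)]])
        moreover have "- g * (\<Sum>y\<in>E. c y * y) = x"
        proof -
          have "(\<Sum>y\<in>E. c y * y) = - (c x * x)" using s by (simp add: eq_neg_iff_add_eq_0 add.commute)
          then have "- g * (\<Sum>y\<in>E. c y * y) = (c x * g) * x" by (simp add: ac_simps)
          then show ?thesis using g xe by simp
        qed
        ultimately show False using False by simp
      qed
      moreover have "\<forall>y\<in>E. c y = 0"
      proof
        fix y assume "y \<in> E"
        then show "c y = 0" using lin_indepD[OF E(3), of c y] c s \<open>c x = 0\<close> by simp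
      qed
      ultimately show "\<forall>y\<in>insert x E. c y = 0" by blast
    qed
    moreover have "insert x Xs \<subseteq> mprod L (insert x E)"
    proof -
      have "x \<in> mprod L (insert x E)" using mprod_incl[OF Lr, of "insert x E" x] Ee xe by blast
      moreover have "mprod L E \<subseteq> mprod L (insert x E)" by (rule mprod_mono) auto
      ultimately show ?thesis using E(4) by blast
    qed
    ultimately show ?thesis using E(1,2) by (intro exI[of _ "insert x E"]) auto
  qed
qed

text \<open>A coordinate functional, obtained from a maximal subspace that avoids \<open>y0\<close>.\<close>

lemma dual_functional:
  assumes L: "subf L" and V: "sm L V" and E: "E \<subseteq> V" "finite E" "lin_indep L E" and y0: "y0 \<in> E"
  shows "\<exists>l. (\<forall>v\<in>V. l v \<in> L) \<and> (\<forall>v\<in>V. \<forall>w\<in>V. l (v + w) = l v + l w) \<and>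
    (\<forall>c\<in>L. \<forall>v\<in>V. l (c * v) = c * l v) \<and> l y0 = e \<and> (\<forall>y\<in>E - {y0}. l y = 0)"
proof -
  have Lr: "subr L" using subf_r[OF L] .
  define \<S> where "\<S> = {W. sm L W \<and> W \<subseteq> V \<and> E - {y0} \<subseteq> W \<and> y0 \<notin> W}"
  let ?W0 = "mprod L (E - {y0})"
  have Ve: "\<And>v. v \<in> V \<Longrightarrow> e * v = v" using sm_e[OF V] .
  have Ee: "\<And>m. m \<in> E - {y0} \<Longrightarrow> e * m = m" using Ve E(1) by blast
  have sW0: "sm L ?W0" using mprod_sm[OF Lr, of "E - {y0}"] Ee by simp
  have "y0 \<notin> ?W0"
  proof
    assume "y0 \<in> ?W0"
    from mprod_coeffs[OF this _ Lr] E(2)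
    obtain a where a: "\<forall>y\<in>E - {y0}. a y \<in> L" "y0 = (\<Sum>y\<in>E - {y0}. a y * y)" by (metis finite_Diff)
    define c where "c y = (if y = y0 then - e else a y)" for y
    have "(\<Sum>y\<in>E. c y * y) = c y0 * y0 + (\<Sum>y\<in>E - {y0}. c y * y)" using sum.remove[OF E(2) y0] .
    also have "(\<Sum>y\<in>E - {y0}. c y * y) = (\<Sum>y\<in>E - {y0}. a y * y)" by (intro sum.cong) (auto simp: c_def)
    also have "c y0 * y0 + (\<Sum>y\<in>E - {y0}. a y * y) = 0"
      using a(2) Ve[of y0] E(1) y0 unfolding c_def by auto
    finally have "(\<Sum>y\<in>E. c y * y) = 0" .
    moreover have "c y \<in> L" if "y \<in> E" for y using a(1) that subr_minus[OF Lr subr_e[OF Lr]] by (simp add: c_def)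
    ultimately have "c y0 = 0" using lin_indepD[OF E(3), of c y0] y0 by blast
    then show False using e0 by (simp add: c_def)
  qed
  moreover have "E - {y0} \<subseteq> ?W0" using mprod_incl[OF Lr, of "E - {y0}"] Ee by blast
  moreover have "?W0 \<subseteq> V" by (rule mprod_subset[OF V]) (use E(1) in blast)
  ultimately have W0: "?W0 \<in> \<S>" unfolding \<S>_def using sW0 by blast
  have chain: "\<Union>\<C> \<in> \<S>" if C: "\<C> \<noteq> {}" "subset.chain \<S> \<C>" for \<C>
  proof -
    have sub: "\<C> \<subseteq> \<S>" and tot: "\<And>Xs Y. Xs \<in> \<C> \<Longrightarrow> Y \<in> \<C> \<Longrightarrow> Xs \<subseteq> Y \<or> Y \<subseteq> Xs"
      using C(2) unfolding subset_chain_def by blast+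
    have "sm L (\<Union>\<C>)"
    proof (rule smI)
      fix x assume "x \<in> \<Union>\<C>"
      then show "e * x = x" using sub \<S>_def Ve by blast
    next
      obtain Xs where Xs: "Xs \<in> \<C>" using C(1) by blast
      then have "sm L Xs" using sub \<S>_def by blast
      then show "0 \<in> \<Union>\<C>" using sm_0 Xs by blast
    next
      fix x y assume "x \<in> \<Union>\<C>" "y \<in> \<Union>\<C>"
      then obtain Xs Y where XY: "Xs \<in> \<C>" "x \<in> Xs" "Y \<in> \<C>" "y \<in> Y" by blast
      then obtain Z where Z: "Z \<in> \<C>" "x \<in> Z" "y \<in> Z" using tot[OF XY(1,3)] by blast
      then have "sm L Z" using sub \<S>_def by blast
      then show "x - y \<in> \<Union>\<C>" using sm_diff[OF _ Z(2,3)] Z(1) by blast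
    next
      fix a x assume a: "a \<in> L" "x \<in> \<Union>\<C>"
      then obtain Xs where Xs: "Xs \<in> \<C>" "x \<in> Xs" by blast
      then have "sm L Xs" using sub \<S>_def by blast
      then show "a * x \<in> \<Union>\<C>" using sm_mult[OF _ a(1) Xs(2)] Xs(1) by blast
    qed
    moreover obtain Xs where "Xs \<in> \<C>" using C(1) by blast
    ultimately show ?thesis using sub unfolding \<S>_def by blast
  qed
  have "\<exists>M\<in>\<S>. \<forall>Xs\<in>\<S>. M \<subseteq> Xs \<longrightarrow> Xs = M"
    by (rule subset_Zorn_nonempty[OF _ chain]) (use W0 in blast)+
  then obtain W where W: "W \<in> \<S>" "\<And>Xs. Xs \<in> \<S> \<Longrightarrow> W \<subseteq> Xs \<Longrightarrow> Xs = W" by blast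
  have sW: "sm L W" and WV: "W \<subseteq> V" and EW: "E - {y0} \<subseteq> W" and y0W: "y0 \<notin> W" using W(1) unfolding \<S>_def by blast+
  have y0V: "y0 \<in> V" using E(1) y0 by blast
  have y0e: "e * y0 = y0" using Ve[OF y0V] .
  \<comment> \<open>By maximality of \<open>W\<close>, for \<open>v\<close> outside \<open>W\<close>
    the space \<open>W + L v\<close> contains \<open>y0\<close>, and by exchange it equals
    \<open>W + L y0\<close>. So \<open>y0\<close> spans a complement of \<open>W\<close>, and the
    functional is the coordinate along it.\<close>
  have ex: "\<exists>c\<in>L. v - c * y0 \<in> W" if v: "v \<in> V" for v
  proof (cases "v \<in> W")
    case True
    then show ?thesis using subr_0[OF Lr] by (intro bexI[of _ 0]) simp_all
  next
    case False
    have ve: "e * v = v" using Ve[OF v] .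
    let ?Xs = "lext L v W"
    have sX: "sm L ?Xs" by (rule lext_sm[OF Lr sW ve])
    have WX: "W \<subseteq> ?Xs" by (rule lext_incl[OF Lr])
    have vX: "v \<in> ?Xs" by (rule lext_self[OF Lr ve sm_0[OF sW]])
    have "?Xs \<subseteq> V" by (rule lext_least[OF V WV v])
    have "y0 \<in> ?Xs"
    proof (rule ccontr)
      assume "y0 \<notin> ?Xs"
      then have "?Xs \<in> \<S>" unfolding \<S>_def using sX \<open>?Xs \<subseteq> V\<close> EW WX by blast
      from W(2)[OF this WX] show False using vX False by blast
    qed
    then have "lext L y0 W = ?Xs" using lext_exchange[OF L sW ve _ y0W] by blast
    then have "v \<in> lext L y0 W" using vX by blast
    then obtain w c where "w \<in> W" "c \<in> L" "v = w + c * y0" by (rule lextE)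
    then show ?thesis by (intro bexI[of _ c]) simp_all
  qed
  have uniq: "c = d" if c: "c \<in> L" "v - c * y0 \<in> W" and d: "d \<in> L" "v - d * y0 \<in> W" for v c d
  proof (rule ccontr)
    assume "c \<noteq> d"
    then obtain g where g: "g \<in> L" "(d - c) * g = e" using subf_inv[OF L subr_diff[OF Lr d(1) c(1)]] by auto
    have "(v - c * y0) - (v - d * y0) \<in> W" by (rule sm_diff[OF sW c(2) d(2)])
    then have "g * ((v - c * y0) - (v - d * y0)) \<in> W" by (rule sm_mult[OF sW g(1)])
    moreover have "g * ((v - c * y0) - (v - d * y0)) = ((d - c) * g) * y0" by (simp add: algebra_simps)
    ultimately show False using g(2) y0e y0W by simp
  qed
  define l where "l v = (SOME c. c \<in> L \<and> v - c * y0 \<in> W)" for v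
  have l: "l v \<in> L \<and> v - l v * y0 \<in> W" if "v \<in> V" for v
    unfolding l_def by (rule someI_ex) (use ex[OF that] in blast)
  have leq: "l v = c" if "v \<in> V" "c \<in> L" "v - c * y0 \<in> W" for v c using uniq[of "l v" v c] l[OF that(1)] that by blast
  show ?thesis
  proof (intro exI[of _ l] conjI ballI)
    fix v assume v: "v \<in> V"
    show "l v \<in> L" using l[OF v] by blast
    {
      fix w assume w: "w \<in> V"
      have "(v - l v * y0) + (w - l w * y0) \<in> W" using sm_add[OF sW] l[OF v] l[OF w] by blast
      then have "(v + w) - (l v + l w) * y0 \<in> W" by (simp add: algebra_simps)
      then show "l (v + w) = l v + l w" using leq[OF sm_add[OF V v w]] subr_add[OF Lr] l[OF v] l[OF w] by blast
    }
    fix c assume c: "c \<in> L"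
    have "c * (v - l v * y0) \<in> W" using sm_mult[OF sW c] l[OF v] by blast
    then have "c * v - (c * l v) * y0 \<in> W" by (simp add: algebra_simps)
    then show "l (c * v) = c * l v" using leq[OF sm_mult[OF V c v]] subr_mult[OF Lr c] l[OF v] by blast
  next
    show "l y0 = e" by (rule leq[OF y0V subr_e[OF Lr]]) (use y0e sm_0[OF sW] in simp)
    fix y assume "y \<in> E - {y0}"
    then show "l y = 0" using leq[of y 0] subr_0[OF Lr] EW E(1) by auto
  qed
qed

end

section \<open>Tensor products\<close>

definition ext :: "('a \<Rightarrow> 'c \<Rightarrow> 'u::comm_ring_1) \<Rightarrow> (('a \<times> 'c) \<Rightarrow>\<^sub>0 int) \<Rightarrow> 'u" where
  "ext f u = (\<Sum>x\<in>Poly_Mapping.keys u. of_int (Poly_Mapping.lookup u x) * f (fst x) (snd x))"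

lemma ext_superset:
  assumes "finite Xs" "Poly_Mapping.keys u \<subseteq> Xs"
  shows "ext f u = (\<Sum>x\<in>Xs. of_int (Poly_Mapping.lookup u x) * f (fst x) (snd x))"
  unfolding ext_def using assms by (intro sum.mono_neutral_left) (auto simp: in_keys_iff)

lemma ext_diff: "ext f (u - v) = ext f u - ext f v"
proof -
  let ?Xs = "Poly_Mapping.keys u \<union> Poly_Mapping.keys v"
  have Xs: "finite ?Xs" "Poly_Mapping.keys u \<subseteq> ?Xs" "Poly_Mapping.keys v \<subseteq> ?Xs" by auto
  have Xs': "Poly_Mapping.keys (u - v) \<subseteq> ?Xs" by (rule keys_diff)
  show ?thesis
    unfolding ext_superset[OF Xs(1) Xs'] ext_superset[OF Xs(1,2)] ext_superset[OF Xs(1,3)]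
    by (simp add: lookup_minus left_diff_distrib sum_subtractf)
qed

lemma ext_0 [simp]: "ext f 0 = 0" unfolding ext_def by simp

lemma ext_uminus: "ext f (- u) = - ext f u" using ext_diff[of f 0 u] by simp

lemma ext_add: "ext f (u + v) = ext f u + ext f v" using ext_diff[of f u "- v"] ext_uminus[of f v] by simp

lemma ext_of [simp]: "ext f (frag_of (a, c)) = f a c"
  unfolding ext_def by simp

lemma ext_sum: "ext f (\<Sum>i\<in>I. g i) = (\<Sum>i\<in>I. ext f (g i))"
  by (induction I rule: infinite_finite_induct) (simp_all add: ext_add)

lemma frag_extend_diff_fun: "frag_extend (\<lambda>i. f i - g i) u = frag_extend f u - frag_extend g u"
proof -
  have "frag_extend (\<lambda>i. f i - g i) u = frag_extend f u - frag_extend g u"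
    if "Poly_Mapping.keys u \<subseteq> UNIV"
    using that by (induction u rule: frag_induction) (simp_all add: frag_extend_diff algebra_simps)
  then show ?thesis by simp
qed

locale tensor =
  fixes K :: "('k, 'l) ring_scheme" and A :: "('k, 'a, 'm) module_scheme" and C :: "('k, 'c, 'n) module_scheme"
  assumes algebra_A: "algebra K A" and algebra_C: "algebra K C"
begin

sublocale A: algebra K A by (rule algebra_A)
sublocale C: algebra K C by (rule algebra_C)

abbreviation "FP \<equiv> free_pairs A C"
abbreviation "pairs \<equiv> carrier A \<times> carrier C"
abbreviation "TI \<equiv> tensor_ideal K A C"

definition tmul :: "(('a \<times> 'c) \<Rightarrow>\<^sub>0 int) \<Rightarrow> (('a \<times> 'c) \<Rightarrow>\<^sub>0 int) \<Rightarrow> (('a \<times> 'c) \<Rightarrow>\<^sub>0 int)" where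
  "tmul u v = frag_extend (\<lambda>(a, c). frag_extend (\<lambda>(a', c'). frag_of (a \<otimes>\<^bsub>A\<^esub> a', c \<otimes>\<^bsub>C\<^esub> c')) v) u"

lemma FP_simps:
  "carrier FP = {u. Poly_Mapping.keys u \<subseteq> pairs}" "monoid.mult FP = tmul"
  "\<one>\<^bsub>FP\<^esub> = frag_of (\<one>\<^bsub>A\<^esub>, \<one>\<^bsub>C\<^esub>)" "\<zero>\<^bsub>FP\<^esub> = 0" "ring.add FP = (+)"
  unfolding free_pairs_def tmul_def[abs_def] by simp_all

lemma tmul_diff_left: "tmul (u - v) w = tmul u w - tmul v w"
  unfolding tmul_def by (rule frag_extend_diff)

lemma tmul_diff_right: "tmul u (v - w) = tmul u v - tmul u w"
  unfolding tmul_def by (simp add: split_def frag_extend_diff frag_extend_diff_fun)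

lemma tmul_0 [simp]: "tmul 0 w = 0" "tmul u 0 = 0"
  using tmul_diff_left[of 0 0 w] tmul_diff_right[of u 0 0] by simp_all

lemma tmul_add_left: "tmul (u + v) w = tmul u w + tmul v w"
  using tmul_diff_left[of u "- v" w] tmul_diff_left[of 0 v w] by simp

lemma tmul_of [simp]: "tmul (frag_of (a, c)) (frag_of (a', c')) = frag_of (a \<otimes>\<^bsub>A\<^esub> a', c \<otimes>\<^bsub>C\<^esub> c')"
  unfolding tmul_def by simp

lemma FP_induct [consumes 1, case_names zero one diff]:
  assumes "u \<in> carrier FP" and "P 0" and "\<And>a c. a \<in> carrier A \<Longrightarrow> c \<in> carrier C \<Longrightarrow> P (frag_of (a, c))"
    and "\<And>u v. P u \<Longrightarrow> P v \<Longrightarrow> P (u - v)"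
  shows "P u"
proof -
  have "Poly_Mapping.keys u \<subseteq> pairs" using assms(1) by (simp add: FP_simps)
  then show ?thesis by (induction u rule: frag_induction) (use assms(2-4) in auto)
qed

lemma FP_closed:
  "0 \<in> carrier FP" "u \<in> carrier FP \<Longrightarrow> v \<in> carrier FP \<Longrightarrow> u + v \<in> carrier FP"
  "u \<in> carrier FP \<Longrightarrow> v \<in> carrier FP \<Longrightarrow> u - v \<in> carrier FP" "u \<in> carrier FP \<Longrightarrow> - u \<in> carrier FP"
  "a \<in> carrier A \<Longrightarrow> c \<in> carrier C \<Longrightarrow> frag_of (a, c) \<in> carrier FP"
  using keys_add[of u v] keys_diff[of u v] by (auto simp: FP_simps)

lemma tmul_closed:
  assumes "u \<in> carrier FP" "v \<in> carrier FP" shows "tmul u v \<in> carrier FP"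
  using assms(1)
proof (induction u rule: FP_induct)
  case (one a c)
  show ?case using assms(2)
    by (induction v rule: FP_induct) (use one in \<open>simp_all add: FP_closed tmul_diff_right\<close>)
qed (simp_all add: FP_closed tmul_diff_left)

lemma tmul_comm:
  assumes "u \<in> carrier FP" "v \<in> carrier FP" shows "tmul u v = tmul v u"
  using assms(1)
proof (induction u rule: FP_induct)
  case (one a c)
  show ?case using assms(2)
    by (induction v rule: FP_induct) (use one in \<open>simp_all add: tmul_diff_left tmul_diff_right A.m_comm C.m_comm\<close>)
qed (simp_all add: tmul_diff_left tmul_diff_right)

lemma tmul_assoc:
  assumes "u \<in> carrier FP" "v \<in> carrier FP" "w \<in> carrier FP"
  shows "tmul (tmul u v) w = tmul u (tmul v w)"
  using assms(1)
proof (induction u rule: FP_induct)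
  case (one a c)
  note ac = one
  show ?case using assms(2)
  proof (induction v rule: FP_induct)
    case (one b d)
    note bd = one
    show ?case using assms(3)
      by (induction w rule: FP_induct) (use ac bd in \<open>simp_all add: tmul_diff_right A.m_assoc C.m_assoc\<close>)
  qed (simp_all add: tmul_diff_left tmul_diff_right)
qed (simp_all add: tmul_diff_left tmul_diff_right)

lemma tmul_one:
  assumes "u \<in> carrier FP" shows "tmul (frag_of (\<one>\<^bsub>A\<^esub>, \<one>\<^bsub>C\<^esub>)) u = u"
  using assms by (induction u rule: FP_induct) (simp_all add: tmul_diff_right)

lemma cring_FP: "cring FP"
proof (rule cringI)
  show "abelian_group FP"
  proof (rule abelian_groupI)
    fix x assume "x \<in> carrier FP"
    then show "\<exists>y\<in>carrier FP. y \<oplus>\<^bsub>FP\<^esub> x = \<zero>\<^bsub>FP\<^esub>"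
      using FP_closed(4) by (intro bexI[of _ "- x"]) (simp_all add: FP_simps(4,5))
  qed (simp_all add: FP_simps(4,5) FP_closed ac_simps)
  show "comm_monoid FP"
  proof (rule comm_monoidI)
    fix x y assume "x \<in> carrier FP" "y \<in> carrier FP"
    then show "x \<otimes>\<^bsub>FP\<^esub> y = y \<otimes>\<^bsub>FP\<^esub> x" unfolding FP_simps by (intro tmul_comm) (simp_all add: FP_simps)
  qed (simp_all add: FP_simps(2,3) FP_closed tmul_closed tmul_assoc tmul_one)
qed (simp add: FP_simps(2,5) tmul_add_left)

sublocale FP: cring FP by (rule cring_FP)

lemma FP_a_inv: "u \<in> carrier FP \<Longrightarrow> \<ominus>\<^bsub>FP\<^esub> u = - u"
  by (rule FP.minus_equality) (simp_all add: FP_simps(4,5) FP_closed)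

abbreviation "relations \<equiv>
    {frag_of (a \<oplus>\<^bsub>A\<^esub> a', c) - frag_of (a, c) - frag_of (a', c) | a a' c.
         a \<in> carrier A \<and> a' \<in> carrier A \<and> c \<in> carrier C}
    \<union> {frag_of (a, c \<oplus>\<^bsub>C\<^esub> c') - frag_of (a, c) - frag_of (a, c') | a c c'.
         a \<in> carrier A \<and> c \<in> carrier C \<and> c' \<in> carrier C}
    \<union> {frag_of (k \<odot>\<^bsub>A\<^esub> a, c) - frag_of (a, k \<odot>\<^bsub>C\<^esub> c) | k a c.
         k \<in> carrier K \<and> a \<in> carrier A \<and> c \<in> carrier C}"

lemma relations_carrier: "relations \<subseteq> carrier FP"
  by (auto intro!: FP_closed A.M.add.m_closed C.M.add.m_closed A.smult_closed C.smult_closed)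

lemma ideal_TI: "ideal TI FP"
  unfolding tensor_ideal_def by (rule FP.genideal_ideal[OF relations_carrier])

sublocale TI: ideal TI FP by (rule ideal_TI)

lemma relations_TI: "relations \<subseteq> TI"
  unfolding tensor_ideal_def by (rule FP.genideal_self[OF relations_carrier])

lemma TI_carrier: "TI \<subseteq> carrier FP" by (rule TI.a_subset)

lemma TI_0: "0 \<in> TI" using TI.zero_closed by (simp add: FP_simps(4))

lemma TI_add: "u \<in> TI \<Longrightarrow> v \<in> TI \<Longrightarrow> u + v \<in> TI" using TI.a_closed by (simp add: FP_simps(5))

lemma TI_diff: "u \<in> TI \<Longrightarrow> v \<in> TI \<Longrightarrow> u - v \<in> TI"
  using TI_add[of u "- v"] TI.a_inv_closed[of v] FP_a_inv[of v] TI_carrier by auto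

text \<open>The maps that factor through the tensor product. Values in a ring type suffice, since
  the rings concerned are embedded in such types.\<close>

definition balanced :: "('a \<Rightarrow> 'c \<Rightarrow> 'u::comm_ring_1) \<Rightarrow> bool" where
  "balanced f \<longleftrightarrow>
    (\<forall>a\<in>carrier A. \<forall>a'\<in>carrier A. \<forall>c\<in>carrier C. f (a \<oplus>\<^bsub>A\<^esub> a') c = f a c + f a' c) \<and>
    (\<forall>a\<in>carrier A. \<forall>c\<in>carrier C. \<forall>c'\<in>carrier C. f a (c \<oplus>\<^bsub>C\<^esub> c') = f a c + f a c') \<and>
    (\<forall>k\<in>carrier K. \<forall>a\<in>carrier A. \<forall>c\<in>carrier C. f (k \<odot>\<^bsub>A\<^esub> a) c = f a (k \<odot>\<^bsub>C\<^esub> c))"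

lemma smult_assoc2':
  "k \<in> carrier K \<Longrightarrow> x \<in> carrier A \<Longrightarrow> a \<in> carrier A \<Longrightarrow> x \<otimes>\<^bsub>A\<^esub> (k \<odot>\<^bsub>A\<^esub> a) = k \<odot>\<^bsub>A\<^esub> (x \<otimes>\<^bsub>A\<^esub> a)"
  "k \<in> carrier K \<Longrightarrow> y \<in> carrier C \<Longrightarrow> c \<in> carrier C \<Longrightarrow> y \<otimes>\<^bsub>C\<^esub> (k \<odot>\<^bsub>C\<^esub> c) = k \<odot>\<^bsub>C\<^esub> (y \<otimes>\<^bsub>C\<^esub> c)"
  using A.smult_assoc2[of k a x] C.smult_assoc2[of k c y] A.m_comm C.m_comm by simp_all

lemma balanced_translate:
  assumes "balanced f" "x \<in> carrier A" "y \<in> carrier C"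
  shows "balanced (\<lambda>a c. f (x \<otimes>\<^bsub>A\<^esub> a) (y \<otimes>\<^bsub>C\<^esub> c))"
  using assms unfolding balanced_def by (simp add: A.r_distr C.r_distr smult_assoc2')

text \<open>The elements killed by all balanced maps with values in a fixed ring type form an ideal.\<close>

lemma ext_tensor_ideal:
  fixes f :: "'a \<Rightarrow> 'c \<Rightarrow> 'u::comm_ring_1"
  assumes "balanced f" "u \<in> TI" shows "ext f u = 0"
proof -
  \<comment> \<open>All balanced maps are considered at once because multiplication by a pure tensor
    turns one balanced map into another.\<close>
  define J where "J = {u \<in> carrier FP. \<forall>f :: 'a \<Rightarrow> 'c \<Rightarrow> 'u. balanced f \<longrightarrow> ext f u = 0}"
  have shift: "ext f (tmul (frag_of (x, y)) u) = ext (\<lambda>a c. f (x \<otimes>\<^bsub>A\<^esub> a) (y \<otimes>\<^bsub>C\<^esub> c)) u"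
    if "u \<in> carrier FP" for f :: "'a \<Rightarrow> 'c \<Rightarrow> 'u" and x y u
    using that by (induction u rule: FP_induct) (simp_all add: tmul_diff_right ext_diff)
  have mulJ: "tmul v u \<in> J" if v: "v \<in> carrier FP" and u: "u \<in> J" for u v
  proof -
    have uc: "u \<in> carrier FP" using u J_def by blast
    show ?thesis using v
    proof (induction v rule: FP_induct)
      case zero
      then show ?case unfolding J_def by (simp add: FP_closed)
    next
      case (one x y)
      have "ext f (tmul (frag_of (x, y)) u) = 0" if "balanced f" for f :: "'a \<Rightarrow> 'c \<Rightarrow> 'u"
        using shift[OF uc] balanced_translate[OF that one] u unfolding J_def by simp
      then show ?case unfolding J_def using tmul_closed[OF FP_closed(5)[OF one] uc] by blast
    next
      case (diff v w)
      then show ?case unfolding J_def by (simp add: tmul_diff_left ext_diff FP_closed)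
    qed
  qed
  have idJ: "ideal J FP"
  proof (rule idealI)
    show "ring FP" by (rule FP.ring_axioms)
    show "subgroup J (add_monoid FP)"
    proof (rule FP.add.subgroupI)
      show "J \<subseteq> carrier FP" unfolding J_def by blast
      have "0 \<in> J" unfolding J_def by (simp add: FP_closed)
      then show "J \<noteq> {}" by blast
      fix u v assume uv: "u \<in> J" "v \<in> J"
      then show "u \<oplus>\<^bsub>FP\<^esub> v \<in> J" unfolding J_def by (simp add: FP_simps(5) FP_closed ext_add)
      have "- u \<in> J" using uv unfolding J_def by (simp add: FP_closed ext_uminus)
      then show "\<ominus>\<^bsub>FP\<^esub> u \<in> J" using FP_a_inv[of u] uv J_def by simp
    qed
    fix u v assume "u \<in> J" "v \<in> carrier FP"
    then show "v \<otimes>\<^bsub>FP\<^esub> u \<in> J" "u \<otimes>\<^bsub>FP\<^esub> v \<in> J"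
      using mulJ tmul_comm[of u v] J_def unfolding FP_simps(2) by simp_all
  qed
  have "relations \<subseteq> J"
  proof
    fix u assume u: "u \<in> relations"
    have "ext f u = 0" if "balanced f" for f :: "'a \<Rightarrow> 'c \<Rightarrow> 'u"
      using u that unfolding balanced_def by (auto simp: ext_diff)
    then show "u \<in> J" unfolding J_def using relations_carrier u by blast
  qed
  then have "TI \<subseteq> J" unfolding tensor_ideal_def by (rule FP.genideal_minimal[OF idJ])
  then show ?thesis using assms unfolding J_def by blast
qed

end

context tensor
begin

lemma rel_add_left:
  "a \<in> carrier A \<Longrightarrow> a' \<in> carrier A \<Longrightarrow> c \<in> carrier C \<Longrightarrow>
    frag_of (a \<oplus>\<^bsub>A\<^esub> a', c) - frag_of (a, c) - frag_of (a', c) \<in> TI"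
  by (rule subsetD[OF relations_TI]) blast

lemma rel_add_right:
  "a \<in> carrier A \<Longrightarrow> c \<in> carrier C \<Longrightarrow> c' \<in> carrier C \<Longrightarrow>
    frag_of (a, c \<oplus>\<^bsub>C\<^esub> c') - frag_of (a, c) - frag_of (a, c') \<in> TI"
  by (rule subsetD[OF relations_TI]) blast

lemma rel_smult:
  "k \<in> carrier K \<Longrightarrow> a \<in> carrier A \<Longrightarrow> c \<in> carrier C \<Longrightarrow>
    frag_of (k \<odot>\<^bsub>A\<^esub> a, c) - frag_of (a, k \<odot>\<^bsub>C\<^esub> c) \<in> TI"
  by (rule subsetD[OF relations_TI]) blast

lemma TI_uminus: "u \<in> TI \<Longrightarrow> - u \<in> TI" using TI_diff[OF TI_0] by simp

lemma TI_sum: "(\<And>i. i \<in> I \<Longrightarrow> f i \<in> TI) \<Longrightarrow> sum f I \<in> TI"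
  by (induction I rule: infinite_finite_induct) (auto intro: TI_0 TI_add)

lemma zero_left: "c \<in> carrier C \<Longrightarrow> frag_of (\<zero>\<^bsub>A\<^esub>, c) \<in> TI"
  using TI_uminus[OF rel_add_left[OF A.M.zero_closed A.M.zero_closed, of c]] by simp

lemma zero_right: "a \<in> carrier A \<Longrightarrow> frag_of (a, \<zero>\<^bsub>C\<^esub>) \<in> TI"
  using TI_uminus[OF rel_add_right[OF _ C.M.zero_closed C.M.zero_closed, of a]] by simp

definition T :: "('c, (('a \<times> 'c) \<Rightarrow>\<^sub>0 int) set) module" where "T = base_change K A C"

lemma T_simps:
  "carrier T = {TI +>\<^bsub>FP\<^esub> u | u. u \<in> carrier FP}" "monoid.mult T = rcoset_mult FP TI"
  "\<one>\<^bsub>T\<^esub> = TI +>\<^bsub>FP\<^esub> frag_of (\<one>\<^bsub>A\<^esub>, \<one>\<^bsub>C\<^esub>)" "\<zero>\<^bsub>T\<^esub> = TI" "ring.add T = set_add FP"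
  "c \<odot>\<^bsub>T\<^esub> x = rcoset_mult FP TI (pure_tensor K A C \<one>\<^bsub>A\<^esub> c) x"
  unfolding T_def base_change_def algebra_via_def FactRing_def A_RCOSETS_def' by (auto simp: FP_simps)

lemma coset_add: "u \<in> carrier FP \<Longrightarrow> v \<in> carrier FP \<Longrightarrow>
    (TI +>\<^bsub>FP\<^esub> u) \<oplus>\<^bsub>T\<^esub> (TI +>\<^bsub>FP\<^esub> v) = TI +>\<^bsub>FP\<^esub> (u + v)"
  unfolding T_simps using TI.a_rcos_sum[of u v] by (simp add: FP_simps(5))

lemma coset_mult: "u \<in> carrier FP \<Longrightarrow> v \<in> carrier FP \<Longrightarrow>
    (TI +>\<^bsub>FP\<^esub> u) \<otimes>\<^bsub>T\<^esub> (TI +>\<^bsub>FP\<^esub> v) = TI +>\<^bsub>FP\<^esub> (tmul u v)"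
  unfolding T_simps using TI.rcoset_mult_add[of u v] by (simp add: FP_simps(2))

lemma coset_TI: "u \<in> TI \<Longrightarrow> TI +>\<^bsub>FP\<^esub> u = TI"
  by (rule TI.a_rcos_const)

lemma coset_zero: "TI +>\<^bsub>FP\<^esub> 0 = TI"
  by (rule coset_TI[OF TI_0])

lemma coset_mem: "u \<in> carrier FP \<Longrightarrow> u \<in> TI +>\<^bsub>FP\<^esub> u"
  using TI.a_rcos_self by blast

lemma coset_D: "v \<in> TI +>\<^bsub>FP\<^esub> u \<Longrightarrow> v - u \<in> TI"
  unfolding a_r_coset_def' by (auto simp: FP_simps(5))

end

text \<open>\<open>disjoint\<close> is linear disjointness of the two images over \<open>K\<close>:
  elements of the second that are independent over \<open>K\<close> stay independent over the first.
  It makes the map from the tensor product to the field injective.\<close>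

locale tensor_map = tensor K A C + idf e
  for K :: "('k, 'l) ring_scheme" and A :: "('k, 'a, 'm) module_scheme" and C :: "('k, 'c, 'n) module_scheme"
    and e :: "'u::comm_ring_1" +
  fixes \<rho> :: "'a \<Rightarrow> 'u" and \<mu> :: "'c \<Rightarrow> 'u" and \<chi> :: "'k \<Rightarrow> 'u"
  assumes L: "subf (\<chi> ` carrier K)"
    and \<rho>_add: "\<And>x y. x \<in> carrier A \<Longrightarrow> y \<in> carrier A \<Longrightarrow> \<rho> (x \<oplus>\<^bsub>A\<^esub> y) = \<rho> x + \<rho> y"
    and \<rho>_mult: "\<And>x y. x \<in> carrier A \<Longrightarrow> y \<in> carrier A \<Longrightarrow> \<rho> (x \<otimes>\<^bsub>A\<^esub> y) = \<rho> x * \<rho> y"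
    and \<rho>_one: "\<rho> \<one>\<^bsub>A\<^esub> = e" and \<rho>_inj: "inj_on \<rho> (carrier A)"
    and \<mu>_add: "\<And>x y. x \<in> carrier C \<Longrightarrow> y \<in> carrier C \<Longrightarrow> \<mu> (x \<oplus>\<^bsub>C\<^esub> y) = \<mu> x + \<mu> y"
    and \<mu>_mult: "\<And>x y. x \<in> carrier C \<Longrightarrow> y \<in> carrier C \<Longrightarrow> \<mu> (x \<otimes>\<^bsub>C\<^esub> y) = \<mu> x * \<mu> y"
    and \<mu>_one: "\<mu> \<one>\<^bsub>C\<^esub> = e" and \<mu>_inj: "inj_on \<mu> (carrier C)"
    and \<rho>_smult: "\<And>k a. k \<in> carrier K \<Longrightarrow> a \<in> carrier A \<Longrightarrow> \<rho> (k \<odot>\<^bsub>A\<^esub> a) = \<chi> k * \<rho> a"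
    and \<mu>_smult: "\<And>k c. k \<in> carrier K \<Longrightarrow> c \<in> carrier C \<Longrightarrow> \<mu> (k \<odot>\<^bsub>C\<^esub> c) = \<chi> k * \<mu> c"
    and disjoint: "\<And>E r. finite E \<Longrightarrow> E \<subseteq> \<mu> ` carrier C \<Longrightarrow> lin_indep (\<chi> ` carrier K) E \<Longrightarrow>
      (\<forall>y\<in>E. r y \<in> \<rho> ` carrier A) \<Longrightarrow> (\<Sum>y\<in>E. r y * y) = 0 \<Longrightarrow> \<forall>y\<in>E. r y = 0"
begin

definition f where "f a c = \<rho> a * \<mu> c"

lemma \<rho>_e: "a \<in> carrier A \<Longrightarrow> e * \<rho> a = \<rho> a"
  using \<rho>_mult[of "\<one>\<^bsub>A\<^esub>" a] \<rho>_one by simp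

lemma \<mu>_e: "c \<in> carrier C \<Longrightarrow> e * \<mu> c = \<mu> c"
  using \<mu>_mult[of "\<one>\<^bsub>C\<^esub>" c] \<mu>_one by simp

lemma \<rho>_zero: "\<rho> \<zero>\<^bsub>A\<^esub> = 0" using \<rho>_add[of "\<zero>\<^bsub>A\<^esub>" "\<zero>\<^bsub>A\<^esub>"] by simp
lemma \<mu>_zero: "\<mu> \<zero>\<^bsub>C\<^esub> = 0" using \<mu>_add[of "\<zero>\<^bsub>C\<^esub>" "\<zero>\<^bsub>C\<^esub>"] by simp

lemma balanced_f: "balanced f"
  unfolding balanced_def f_def by (auto simp: \<rho>_add \<mu>_add \<rho>_smult \<mu>_smult algebra_simps)

lemma ext_f_mult:
  assumes "u \<in> carrier FP" "v \<in> carrier FP" shows "ext f (tmul u v) = ext f u * ext f v"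
  using assms(1)
proof (induction u rule: FP_induct)
  case (one a c)
  show ?case using assms(2)
    by (induction v rule: FP_induct)
      (use one in \<open>simp_all add: tmul_diff_right ext_diff right_diff_distrib f_def \<rho>_mult \<mu>_mult ac_simps\<close>)
qed (simp_all add: tmul_diff_left ext_diff left_diff_distrib)

text \<open>Bilinearity rewrites a pure tensor through the spanning set \<open>Y\<close>. The
  element \<open>c\<close> is built in step with its image \<open>z\<close>; injectivity of
  \<open>\<mu>\<close> later identifies it with a given element.\<close>

lemma reduce_pure:
  assumes Y: "finite Y" "Y \<subseteq> carrier C" and z: "z \<in> mprod (\<chi> ` carrier K) (\<mu> ` Y)"
  shows "\<exists>c\<in>carrier C. \<mu> c = z \<and> (\<forall>a\<in>carrier A. \<exists>r. (\<forall>y\<in>Y. r y \<in> carrier A) \<and>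
    frag_of (a, c) - (\<Sum>y\<in>Y. frag_of (r y, y)) \<in> TI)"
  using z
proof (induction rule: mprod.induct)
  case zero
  have "frag_of (a, \<zero>\<^bsub>C\<^esub>) - (\<Sum>y\<in>Y. frag_of (\<zero>\<^bsub>A\<^esub>, y)) \<in> TI" if "a \<in> carrier A" for a
    by (rule TI_diff[OF zero_right[OF that] TI_sum]) (use zero_left Y in blast)
  then show ?case using \<mu>_zero by (intro bexI[of _ "\<zero>\<^bsub>C\<^esub>"] conjI ballI exI[of _ "\<lambda>_. \<zero>\<^bsub>A\<^esub>"]) simp_all
next
  case (step z l m)
  obtain c where c: "c \<in> carrier C" "\<mu> c = z"
    and IH: "\<And>a. a \<in> carrier A \<Longrightarrow> \<exists>r. (\<forall>y\<in>Y. r y \<in> carrier A) \<and> frag_of (a, c) - (\<Sum>y\<in>Y. frag_of (r y, y)) \<in> TI"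
    using step.IH by blast
  obtain k y0 where k: "k \<in> carrier K" "l = \<chi> k" and y0: "y0 \<in> Y" "m = \<mu> y0" using step.hyps by blast
  have y0C: "y0 \<in> carrier C" using y0 Y by blast
  have kC: "k \<odot>\<^bsub>C\<^esub> y0 \<in> carrier C" using k y0C by simp
  have "\<mu> (c \<oplus>\<^bsub>C\<^esub> (k \<odot>\<^bsub>C\<^esub> y0)) = z + l * m" using \<mu>_add[OF c(1) kC] \<mu>_smult[OF k(1) y0C] c k y0 by simp
  moreover have "\<exists>r. (\<forall>y\<in>Y. r y \<in> carrier A) \<and>
      frag_of (a, c \<oplus>\<^bsub>C\<^esub> (k \<odot>\<^bsub>C\<^esub> y0)) - (\<Sum>y\<in>Y. frag_of (r y, y)) \<in> TI" if a: "a \<in> carrier A" for a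
  proof -
    obtain r where r: "\<forall>y\<in>Y. r y \<in> carrier A" "frag_of (a, c) - (\<Sum>y\<in>Y. frag_of (r y, y)) \<in> TI" using IH[OF a] by blast
    have kA: "k \<odot>\<^bsub>A\<^esub> a \<in> carrier A" using k a by simp
    have ry0: "r y0 \<in> carrier A" using r y0 by blast
    define r' where "r' = r(y0 := r y0 \<oplus>\<^bsub>A\<^esub> (k \<odot>\<^bsub>A\<^esub> a))"
    have s1: "(\<Sum>y\<in>Y. frag_of (r' y, y)) = frag_of (r y0 \<oplus>\<^bsub>A\<^esub> (k \<odot>\<^bsub>A\<^esub> a), y0) + (\<Sum>y\<in>Y - {y0}. frag_of (r y, y))"
      using sum.remove[OF Y(1) y0(1), of "\<lambda>y. frag_of (r' y, y)"] by (simp add: r'_def)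
    have s2: "(\<Sum>y\<in>Y. frag_of (r y, y)) = frag_of (r y0, y0) + (\<Sum>y\<in>Y - {y0}. frag_of (r y, y))"
      by (rule sum.remove[OF Y(1) y0(1)])
    have "frag_of (a, c \<oplus>\<^bsub>C\<^esub> (k \<odot>\<^bsub>C\<^esub> y0)) - (\<Sum>y\<in>Y. frag_of (r' y, y)) =
        (frag_of (a, c \<oplus>\<^bsub>C\<^esub> (k \<odot>\<^bsub>C\<^esub> y0)) - frag_of (a, c) - frag_of (a, k \<odot>\<^bsub>C\<^esub> y0))
        + (frag_of (a, c) - (\<Sum>y\<in>Y. frag_of (r y, y)))
        - (frag_of (k \<odot>\<^bsub>A\<^esub> a, y0) - frag_of (a, k \<odot>\<^bsub>C\<^esub> y0))
        - (frag_of (r y0 \<oplus>\<^bsub>A\<^esub> (k \<odot>\<^bsub>A\<^esub> a), y0) - frag_of (r y0, y0) - frag_of (k \<odot>\<^bsub>A\<^esub> a, y0))"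
      unfolding s1 s2 by (simp add: algebra_simps)
    also have "\<dots> \<in> TI"
      by (intro TI_diff TI_add rel_add_right[OF a c(1) kC] r(2) rel_smult[OF k(1) a y0C] rel_add_left[OF ry0 kA y0C])
    finally have "frag_of (a, c \<oplus>\<^bsub>C\<^esub> (k \<odot>\<^bsub>C\<^esub> y0)) - (\<Sum>y\<in>Y. frag_of (r' y, y)) \<in> TI" .
    moreover have "\<forall>y\<in>Y. r' y \<in> carrier A" unfolding r'_def using r(1) ry0 kA by simp
    ultimately show ?thesis by (intro exI[of _ r'] conjI)
  qed
  ultimately show ?case using c(1) kC by (intro bexI[of _ "c \<oplus>\<^bsub>C\<^esub> (k \<odot>\<^bsub>C\<^esub> y0)"]) simp_all
qed

text \<open>The second factors occurring in \<open>u\<close> are expressed through a basis over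
  \<open>K\<close> chosen among them. Modulo the tensor relations \<open>u\<close> becomes a sum of
  pure tensors with second factors in this basis, whose first factors vanish by
  \<open>disjoint\<close>.\<close>

lemma ext_kernel:
  assumes u: "u \<in> carrier FP" and u0: "ext f u = 0" shows "u \<in> TI"
proof -
  define Xs where "Xs = snd ` Poly_Mapping.keys u"
  have uk: "Poly_Mapping.keys u \<subseteq> carrier A \<times> carrier C" using u by (simp add: FP_simps)
  have Xs: "finite Xs" "Xs \<subseteq> carrier C" unfolding Xs_def using uk by auto
  have "e * x = x" if "x \<in> \<mu> ` Xs" for x using \<mu>_e Xs that by blast
  then have "\<exists>E. finite E \<and> E \<subseteq> \<mu> ` Xs \<and> lin_indep (\<chi> ` carrier K) E \<and> \<mu> ` Xs \<subseteq> mprod (\<chi> ` carrier K) E"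
    by (rule exists_basis[OF L finite_imageI[OF Xs(1)]])
  then obtain E where E: "finite E" "E \<subseteq> \<mu> ` Xs" "lin_indep (\<chi> ` carrier K) E" "\<mu> ` Xs \<subseteq> mprod (\<chi> ` carrier K) E"
    by (elim exE conjE)
  define Y where "Y = {y \<in> Xs. \<mu> y \<in> E}"
  have YX: "Y \<subseteq> Xs" and Y: "finite Y" "Y \<subseteq> carrier C" unfolding Y_def using Xs by auto
  have \<mu>Y: "\<mu> ` Y = E" unfolding Y_def using E(2) by blast
  have injY: "inj_on \<mu> Y" using \<mu>_inj Y(2) inj_on_subset by blast
  have red: "\<exists>r. (\<forall>y\<in>Y. r y \<in> carrier A) \<and> v - (\<Sum>y\<in>Y. frag_of (r y, y)) \<in> TI"
    if "Poly_Mapping.keys v \<subseteq> carrier A \<times> Xs" for v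
    using that
  proof (induction v rule: frag_induction)
    case zero
    have "0 - (\<Sum>y\<in>Y. frag_of (\<zero>\<^bsub>A\<^esub>, y)) \<in> TI" by (rule TI_diff[OF TI_0 TI_sum]) (use zero_left Y in blast)
    then show ?case by (intro exI[of _ "\<lambda>_. \<zero>\<^bsub>A\<^esub>"]) simp
  next
    case (one p)
    obtain a x where p: "p = (a, x)" "a \<in> carrier A" "x \<in> Xs" using one by (cases p) auto
    have "\<mu> x \<in> mprod (\<chi> ` carrier K) (\<mu> ` Y)" using E(4) \<mu>Y p(3) by blast
    from reduce_pure[OF Y this] obtain c where c: "c \<in> carrier C" "\<mu> c = \<mu> x"
      "\<forall>a\<in>carrier A. \<exists>r. (\<forall>y\<in>Y. r y \<in> carrier A) \<and> frag_of (a, c) - (\<Sum>y\<in>Y. frag_of (r y, y)) \<in> TI"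
      by (elim bexE conjE)
    have "c = x" using inj_onD[OF \<mu>_inj c(2) c(1)] Xs(2) p(3) by blast
    then show ?case using c(3) p(1,2) by blast
  next
    case (diff v w)
    then obtain r s where r: "\<forall>y\<in>Y. r y \<in> carrier A" "v - (\<Sum>y\<in>Y. frag_of (r y, y)) \<in> TI"
      and s: "\<forall>y\<in>Y. s y \<in> carrier A" "w - (\<Sum>y\<in>Y. frag_of (s y, y)) \<in> TI" by blast
    define q where "q y = r y \<oplus>\<^bsub>A\<^esub> (\<ominus>\<^bsub>A\<^esub> s y)" for y
    have qy: "frag_of (q y, y) - frag_of (r y, y) + frag_of (s y, y) \<in> TI" if "y \<in> Y" for y
    proof -
      have sy: "s y \<in> carrier A" "\<ominus>\<^bsub>A\<^esub> s y \<in> carrier A" and ry: "r y \<in> carrier A" and yC: "y \<in> carrier C"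
        using s r that Y by auto
      have "(frag_of (q y, y) - frag_of (r y, y) - frag_of (\<ominus>\<^bsub>A\<^esub> s y, y))
          - (frag_of (\<ominus>\<^bsub>A\<^esub> s y \<oplus>\<^bsub>A\<^esub> s y, y) - frag_of (\<ominus>\<^bsub>A\<^esub> s y, y) - frag_of (s y, y)) + frag_of (\<zero>\<^bsub>A\<^esub>, y) \<in> TI"
        unfolding q_def by (intro TI_diff TI_add rel_add_left ry sy yC zero_left)
      then show ?thesis using sy by (simp add: A.M.l_neg algebra_simps)
    qed
    have "(v - (\<Sum>y\<in>Y. frag_of (r y, y))) - (w - (\<Sum>y\<in>Y. frag_of (s y, y)))
        - (\<Sum>y\<in>Y. frag_of (q y, y) - frag_of (r y, y) + frag_of (s y, y)) \<in> TI"
      by (intro TI_diff TI_sum r s qy)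
    then have "v - w - (\<Sum>y\<in>Y. frag_of (q y, y)) \<in> TI"
      by (simp add: sum.distrib sum_subtractf algebra_simps)
    moreover have "\<forall>y\<in>Y. q y \<in> carrier A" unfolding q_def using r s by auto
    ultimately show ?case by blast
  qed
  have "Poly_Mapping.keys u \<subseteq> carrier A \<times> Xs" using uk unfolding Xs_def by force
  from red[OF this] obtain r where r: "\<forall>y\<in>Y. r y \<in> carrier A" "u - (\<Sum>y\<in>Y. frag_of (r y, y)) \<in> TI" by blast
  have "ext f (u - (\<Sum>y\<in>Y. frag_of (r y, y))) = 0" by (rule ext_tensor_ideal[OF balanced_f r(2)])
  then have s0: "(\<Sum>y\<in>Y. \<rho> (r y) * \<mu> y) = 0" using u0 by (simp add: ext_diff ext_sum f_def)
  define r' where "r' z = \<rho> (r (inv_into Y \<mu> z))" for z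
  have "(\<Sum>z\<in>E. r' z * z) = (\<Sum>y\<in>Y. \<rho> (r y) * \<mu> y)"
    unfolding \<mu>Y[symmetric] r'_def by (simp add: sum.reindex[OF injY] inv_into_f_f[OF injY])
  then have "(\<Sum>z\<in>E. r' z * z) = 0" using s0 by simp
  moreover have "\<forall>z\<in>E. r' z \<in> \<rho> ` carrier A" unfolding r'_def \<mu>Y[symmetric] using r(1) injY by (auto simp: inv_into_f_f)
  moreover have "E \<subseteq> \<mu> ` carrier C" using E(2) Xs(2) by blast
  ultimately have "\<forall>z\<in>E. r' z = 0" using disjoint[OF E(1) _ E(3)] by blast
  then have "\<rho> (r y) = 0" if "y \<in> Y" for y using that \<mu>Y unfolding r'_def by (auto simp: inv_into_f_f[OF injY])
  then have "r y = \<zero>\<^bsub>A\<^esub>" if "y \<in> Y" for y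
    using that r(1) inj_onD[OF \<rho>_inj, of "r y" "\<zero>\<^bsub>A\<^esub>"] \<rho>_zero by simp
  then have "(\<Sum>y\<in>Y. frag_of (r y, y)) \<in> TI" using zero_left Y(2) by (intro TI_sum) auto
  from TI_add[OF r(2) this] show ?thesis by simp
qed

text \<open>Evaluation at an arbitrary representative; \<open>ext_tensor_ideal\<close> makes the
  value independent of it.\<close>

definition tmap where "tmap W = ext f (SOME u. u \<in> W)"

lemma tmap_coset:
  assumes "u \<in> carrier FP" shows "tmap (TI +>\<^bsub>FP\<^esub> u) = ext f u"
proof -
  have "(SOME v. v \<in> TI +>\<^bsub>FP\<^esub> u) \<in> TI +>\<^bsub>FP\<^esub> u" using coset_mem[OF assms] by (rule someI)
  from coset_D[OF this] have "ext f ((SOME v. v \<in> TI +>\<^bsub>FP\<^esub> u) - u) = 0" by (rule ext_tensor_ideal[OF balanced_f])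
  then show ?thesis unfolding tmap_def by (simp add: ext_diff)
qed

lemma ext_f_e: "u \<in> carrier FP \<Longrightarrow> e * ext f u = ext f u"
  by (induction u rule: FP_induct)
    (simp_all add: ext_diff right_diff_distrib f_def mult.assoc[symmetric] \<rho>_e)

lemma tmap_embedding: "ring_embedding e T tmap"
proof unfold_locales
  have one: "frag_of (\<one>\<^bsub>A\<^esub>, \<one>\<^bsub>C\<^esub>) \<in> carrier FP" by (intro FP_closed) auto
  show "\<zero>\<^bsub>T\<^esub> \<in> carrier T" unfolding T_simps using coset_zero FP_closed(1) by blast
  show "\<one>\<^bsub>T\<^esub> \<in> carrier T" unfolding T_simps using one by blast
  show "tmap \<zero>\<^bsub>T\<^esub> = 0" using tmap_coset[OF FP_closed(1)] unfolding T_simps coset_zero by simp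
  show "tmap \<one>\<^bsub>T\<^esub> = e" unfolding T_simps using tmap_coset[OF one] \<rho>_one \<mu>_one ee by (simp add: f_def)
  fix x assume "x \<in> carrier T"
  then obtain u where u: "u \<in> carrier FP" "x = TI +>\<^bsub>FP\<^esub> u" unfolding T_simps by blast
  show "e * tmap x = tmap x" unfolding u(2) tmap_coset[OF u(1)] by (rule ext_f_e[OF u(1)])
  have "tmap (TI +>\<^bsub>FP\<^esub> (- u)) = - tmap x"
    unfolding u(2) tmap_coset[OF u(1)] tmap_coset[OF FP_closed(4)[OF u(1)]] by (rule ext_uminus)
  then show "\<exists>y\<in>carrier T. tmap y = - tmap x" unfolding T_simps(1) using FP_closed(4)[OF u(1)] by blast
  fix y assume "y \<in> carrier T"
  then obtain v where v: "v \<in> carrier FP" "y = TI +>\<^bsub>FP\<^esub> v" unfolding T_simps by blast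
  note uv = FP_closed(2)[OF u(1) v(1)] tmul_closed[OF u(1) v(1)]
  show "x \<oplus>\<^bsub>T\<^esub> y \<in> carrier T" unfolding u v coset_add[OF u(1) v(1)] unfolding T_simps using uv by blast
  show "x \<otimes>\<^bsub>T\<^esub> y \<in> carrier T" unfolding u v coset_mult[OF u(1) v(1)] unfolding T_simps using uv by blast
  show "tmap (x \<oplus>\<^bsub>T\<^esub> y) = tmap x + tmap y"
    unfolding u v coset_add[OF u(1) v(1)] tmap_coset[OF uv(1)] tmap_coset[OF u(1)] tmap_coset[OF v(1)] by (rule ext_add)
  show "tmap (x \<otimes>\<^bsub>T\<^esub> y) = tmap x * tmap y"
    unfolding u v coset_mult[OF u(1) v(1)] tmap_coset[OF uv(2)] tmap_coset[OF u(1)] tmap_coset[OF v(1)]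
    by (rule ext_f_mult[OF u(1) v(1)])
  assume "tmap x = tmap y"
  then have "ext f (u - v) = 0" unfolding u v tmap_coset[OF u(1)] tmap_coset[OF v(1)] by (simp add: ext_diff)
  then have "u - v \<in> TI" by (rule ext_kernel[OF FP_closed(3)[OF u(1) v(1)]])
  then have "TI +>\<^bsub>FP\<^esub> (u - v) = TI" by (rule coset_TI)
  moreover have "TI +>\<^bsub>FP\<^esub> ((u - v) + v) = (TI +>\<^bsub>FP\<^esub> (u - v)) \<oplus>\<^bsub>T\<^esub> (TI +>\<^bsub>FP\<^esub> v)"
    by (rule coset_add[symmetric, OF FP_closed(3)[OF u(1) v(1)] v(1)])
  moreover have "TI \<oplus>\<^bsub>T\<^esub> (TI +>\<^bsub>FP\<^esub> v) = TI +>\<^bsub>FP\<^esub> v" using coset_add[OF FP_closed(1) v(1)] coset_zero by simp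
  ultimately show "x = y" unfolding u v by simp
qed

lemma tmap_image: "tmap ` carrier T = mprod (\<rho> ` carrier A) (\<mu> ` carrier C)"
proof
  have neg: "- a \<in> \<rho> ` carrier A" if a: "a \<in> \<rho> ` carrier A" for a
  proof -
    obtain x where x: "x \<in> carrier A" "a = \<rho> x" using a by blast
    have "\<rho> (\<ominus>\<^bsub>A\<^esub> x) + a = 0" using \<rho>_add[of "\<ominus>\<^bsub>A\<^esub> x" x] \<rho>_zero x by (simp add: A.M.l_neg)
    then have "- a = \<rho> (\<ominus>\<^bsub>A\<^esub> x)" by (simp add: neg_eq_iff_add_eq_0 add.commute)
    then show ?thesis using x by simp
  qed
  show "tmap ` carrier T \<subseteq> mprod (\<rho> ` carrier A) (\<mu> ` carrier C)"
  proof
    fix z assume "z \<in> tmap ` carrier T"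
    then obtain u where u: "u \<in> carrier FP" "z = ext f u" unfolding T_simps using tmap_coset by auto
    from u(1) have "ext f u \<in> mprod (\<rho> ` carrier A) (\<mu> ` carrier C)"
    proof (induction u rule: FP_induct)
      case (diff v w)
      then show ?case using mprod_add[OF mprod_minus[OF diff.IH(2) neg] diff.IH(1)] by (simp add: ext_diff)
    qed (auto simp: f_def intro: mprod.zero mprod_mem)
    then show "z \<in> mprod (\<rho> ` carrier A) (\<mu> ` carrier C)" using u(2) by simp
  qed
  show "mprod (\<rho> ` carrier A) (\<mu> ` carrier C) \<subseteq> tmap ` carrier T"
  proof
    fix z assume "z \<in> mprod (\<rho> ` carrier A) (\<mu> ` carrier C)"
    then have "\<exists>u\<in>carrier FP. z = ext f u"
    proof (induction rule: mprod.induct)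
      case zero
      then show ?case using FP_closed(1) by (intro bexI[of _ 0]) simp_all
    next
      case (step z x y)
      then obtain u a c where u: "u \<in> carrier FP" "z = ext f u" "a \<in> carrier A" "x = \<rho> a" "c \<in> carrier C" "y = \<mu> c" by blast
      then show ?case
        by (intro bexI[of _ "u + frag_of (a, c)"]) (simp_all add: ext_add f_def[of a c] FP_closed)
    qed
    then obtain u where "u \<in> carrier FP" "z = ext f u" by blast
    then show "z \<in> tmap ` carrier T" unfolding T_simps using tmap_coset by (metis (mono_tags, lifting) imageI mem_Collect_eq)
  qed
qed

lemma tmap_smult:
  assumes "c \<in> carrier C" "x \<in> carrier T" shows "c \<odot>\<^bsub>T\<^esub> x \<in> carrier T" "tmap (c \<odot>\<^bsub>T\<^esub> x) = \<mu> c * tmap x"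
proof -
  interpret em: ring_embedding e T tmap by (rule tmap_embedding)
  have p: "frag_of (\<one>\<^bsub>A\<^esub>, c) \<in> carrier FP" by (intro FP_closed assms) simp
  have eq: "c \<odot>\<^bsub>T\<^esub> x = (TI +>\<^bsub>FP\<^esub> frag_of (\<one>\<^bsub>A\<^esub>, c)) \<otimes>\<^bsub>T\<^esub> x" unfolding T_simps pure_tensor_def ..
  have pc: "TI +>\<^bsub>FP\<^esub> frag_of (\<one>\<^bsub>A\<^esub>, c) \<in> carrier T" unfolding T_simps using p by blast
  show "c \<odot>\<^bsub>T\<^esub> x \<in> carrier T" unfolding eq by (rule em.mult_closed[OF pc assms(2)])
  show "tmap (c \<odot>\<^bsub>T\<^esub> x) = \<mu> c * tmap x"
    unfolding eq em.\<phi>_mult[OF pc assms(2)] tmap_coset[OF p] using \<mu>_e[OF assms(1)] by (simp add: f_def \<rho>_one)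
qed

end

section \<open>The fraction field of a tensor product that is a domain\<close>

lemma field_algebra_via: "field (algebra_via h A) = field A"
  unfolding field_def domain_def cring_def ring_def abelian_group_def abelian_monoid_def abelian_group_axioms_def
    ring_axioms_def comm_monoid_def comm_monoid_axioms_def monoid_def domain_axioms_def field_axioms_def Units_def
    comm_group_def group_def group_axioms_def algebra_via_def by simp

definition dom_unit :: "('a, 'm) ring_scheme \<Rightarrow> ('a \<times> 'a) set ring_product" where
  "dom_unit D = emb (frac_field D) \<one>\<^bsub>frac_field D\<^esub>"

definition dom_emb :: "('a, 'm) ring_scheme \<Rightarrow> 'a \<Rightarrow> ('a \<times> 'a) set ring_product" where
  "dom_emb D x = emb (frac_field D) (to_frac D x)"

lemma dom_emb_embedding:
  assumes "domain D" shows "ring_embedding (dom_unit D) D (dom_emb D)"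
proof -
  interpret domain D by fact
  have F: "field (frac_field D)" by (rule frac_field_field)
  have Fc: "cring (frac_field D)" using F by (simp add: field_def domain_def)
  interpret idf "dom_unit D" unfolding dom_unit_def by (rule emb_idf[OF F])
  have cl: "to_frac D x \<in> carrier (frac_field D)" if "x \<in> carrier D" for x
    unfolding to_frac_def using that by (intro fraction_closed) auto
  have add: "to_frac D (x \<oplus>\<^bsub>D\<^esub> y) = to_frac D x \<oplus>\<^bsub>frac_field D\<^esub> to_frac D y" if "x \<in> carrier D" "y \<in> carrier D" for x y
    unfolding to_frac_def using that by (subst fraction_add) auto
  have mult: "to_frac D (x \<otimes>\<^bsub>D\<^esub> y) = to_frac D x \<otimes>\<^bsub>frac_field D\<^esub> to_frac D y" if "x \<in> carrier D" "y \<in> carrier D" for x y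
    unfolding to_frac_def using that by (subst fraction_mult) auto
  have z: "dom_emb D \<zero>\<^bsub>D\<^esub> = 0" unfolding dom_emb_def to_frac_def frac_zero[symmetric] by (rule emb_zero[OF Fc])
  have o: "dom_emb D \<one>\<^bsub>D\<^esub> = dom_unit D" unfolding dom_emb_def dom_unit_def to_frac_def frac_one ..
  have a: "dom_emb D (x \<oplus>\<^bsub>D\<^esub> y) = dom_emb D x + dom_emb D y" if "x \<in> carrier D" "y \<in> carrier D" for x y
    unfolding dom_emb_def add[OF that] by (rule emb_add[OF Fc cl[OF that(1)] cl[OF that(2)]])
  have m: "dom_emb D (x \<otimes>\<^bsub>D\<^esub> y) = dom_emb D x * dom_emb D y" if "x \<in> carrier D" "y \<in> carrier D" for x y
    unfolding dom_emb_def mult[OF that] by (rule emb_mult[OF Fc cl[OF that(1)] cl[OF that(2)]])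
  show ?thesis
  proof
    fix x assume x: "x \<in> carrier D"
    have "dom_emb D (\<ominus>\<^bsub>D\<^esub> x) + dom_emb D x = 0" using a[of "\<ominus>\<^bsub>D\<^esub> x" x] x z by (simp add: l_neg)
    then show "\<exists>y\<in>carrier D. dom_emb D y = - dom_emb D x"
      using x by (intro bexI[of _ "\<ominus>\<^bsub>D\<^esub> x"]) (simp_all add: eq_neg_iff_add_eq_0)
    show "dom_unit D * dom_emb D x = dom_emb D x" using m[of "\<one>\<^bsub>D\<^esub>" x] x o by simp
    fix y assume y: "y \<in> carrier D"
    show "dom_emb D (x \<oplus>\<^bsub>D\<^esub> y) = dom_emb D x + dom_emb D y" by (rule a[OF x y])
    show "dom_emb D (x \<otimes>\<^bsub>D\<^esub> y) = dom_emb D x * dom_emb D y" by (rule m[OF x y])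
    assume "dom_emb D x = dom_emb D y"
    then have "to_frac D x = to_frac D y" unfolding dom_emb_def by (rule emb_inj[OF Fc cl[OF x] cl[OF y]])
    then show "x = y" unfolding to_frac_def using x y by (subst (asm) fraction_eq) auto
  qed (use z o in auto)
qed

lemma (in algebra) smult_one_inj:
  assumes "field R" "\<one>\<^bsub>M\<^esub> \<noteq> \<zero>\<^bsub>M\<^esub>" "k \<in> carrier R" "k' \<in> carrier R" "k \<odot>\<^bsub>M\<^esub> \<one>\<^bsub>M\<^esub> = k' \<odot>\<^bsub>M\<^esub> \<one>\<^bsub>M\<^esub>"
  shows "k = k'"
proof (rule ccontr)
  interpret F: field R by fact
  assume "k \<noteq> k'"
  define d where "d = k \<ominus> k'"
  have d: "d \<in> carrier R" "d \<noteq> \<zero>" unfolding d_def using assms(3,4) \<open>k \<noteq> k'\<close> by auto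
  have "d \<odot>\<^bsub>M\<^esub> \<one>\<^bsub>M\<^esub> = k \<odot>\<^bsub>M\<^esub> \<one>\<^bsub>M\<^esub> \<oplus>\<^bsub>M\<^esub> (\<ominus> k') \<odot>\<^bsub>M\<^esub> \<one>\<^bsub>M\<^esub>"
    unfolding d_def a_minus_def using assms(3,4) by (intro smult_l_distr) auto
  also have "\<dots> = \<zero>\<^bsub>M\<^esub>" using assms(3-5) by (simp add: smult_l_minus M.r_neg)
  finally have z: "d \<odot>\<^bsub>M\<^esub> \<one>\<^bsub>M\<^esub> = \<zero>\<^bsub>M\<^esub>" .
  have u: "d \<in> Units R" using d F.field_Units by blast
  have "\<one>\<^bsub>M\<^esub> = (inv d \<otimes> d) \<odot>\<^bsub>M\<^esub> \<one>\<^bsub>M\<^esub>" using u by simp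
  also have "\<dots> = inv d \<odot>\<^bsub>M\<^esub> (d \<odot>\<^bsub>M\<^esub> \<one>\<^bsub>M\<^esub>)" using u d(1) by (intro smult_assoc1) auto
  also have "\<dots> = \<zero>\<^bsub>M\<^esub>" unfolding z using u by (intro smult_r_null) auto
  finally show False using assms(2) by blast
qed

text \<open>The common field is constructed here as the fraction field of the tensor product. Both
  factors embed and are linearly disjoint in it, because a tensor product over a field is free over
  \<open>A\<close> on any basis of \<open>C\<close>.\<close>

locale domain_tensor = tensor +
  assumes fieldK: "field K" and domA: "domain A" and fieldC: "field C" and domT: "domain T"
begin

abbreviation "u\<^sub>T \<equiv> dom_unit T"
abbreviation "\<tau> \<equiv> dom_emb T"

sublocale \<tau>: ring_embedding u\<^sub>T T \<tau> by (rule dom_emb_embedding[OF domT])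

interpretation \<alpha>: ring_embedding "dom_unit A" A "dom_emb A" by (rule dom_emb_embedding[OF domA])
interpretation \<xi>: ring_embedding "dom_unit C" C "dom_emb C"
  by (rule dom_emb_embedding) (use fieldC in \<open>simp add: field_def\<close>)

definition "tc u = \<tau> (TI +>\<^bsub>FP\<^esub> u)"
definition "\<rho>\<^sub>T a = tc (frag_of (a, \<one>\<^bsub>C\<^esub>))"
definition "\<mu>\<^sub>T c = tc (frag_of (\<one>\<^bsub>A\<^esub>, c))"
definition "\<chi>\<^sub>T k = \<mu>\<^sub>T (k \<odot>\<^bsub>C\<^esub> \<one>\<^bsub>C\<^esub>)"

lemma coset_T: "u \<in> carrier FP \<Longrightarrow> TI +>\<^bsub>FP\<^esub> u \<in> carrier T" unfolding T_simps by blast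

lemma tc_add: "u \<in> carrier FP \<Longrightarrow> v \<in> carrier FP \<Longrightarrow> tc (u + v) = tc u + tc v"
  unfolding tc_def by (simp add: coset_add[symmetric] \<tau>.\<phi>_add coset_T)

lemma tc_mult: "u \<in> carrier FP \<Longrightarrow> v \<in> carrier FP \<Longrightarrow> tc (tmul u v) = tc u * tc v"
  unfolding tc_def by (simp add: coset_mult[symmetric] \<tau>.\<phi>_mult coset_T)

lemma tc_diff: "u \<in> carrier FP \<Longrightarrow> v \<in> carrier FP \<Longrightarrow> tc (u - v) = tc u - tc v"
  using tc_add[of "u - v" v] FP_closed(3)[of u v] by (simp add: eq_diff_eq)

lemma tc_TI: "u \<in> TI \<Longrightarrow> tc u = 0" unfolding tc_def using coset_TI \<tau>.\<phi>_zero T_simps(4) by simp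

lemma tc_0_TI: assumes "u \<in> carrier FP" "tc u = 0" shows "u \<in> TI"
proof -
  have "TI +>\<^bsub>FP\<^esub> u = TI"
    by (rule \<tau>.\<phi>_inj[OF coset_T[OF assms(1)]]) (use assms(2) \<tau>.unit_closed(1) \<tau>.\<phi>_zero T_simps(4) in \<open>simp_all add: tc_def\<close>)
  then show ?thesis using coset_mem[OF assms(1)] by simp
qed

lemma tc_pure: "a \<in> carrier A \<Longrightarrow> c \<in> carrier C \<Longrightarrow> tc (frag_of (a, c)) = \<rho>\<^sub>T a * \<mu>\<^sub>T c"
  unfolding \<rho>\<^sub>T_def \<mu>\<^sub>T_def by (subst tc_mult[symmetric]) (simp_all add: FP_closed)

lemma tc_add_left: "a \<in> carrier A \<Longrightarrow> a' \<in> carrier A \<Longrightarrow> c \<in> carrier C \<Longrightarrow>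
    tc (frag_of (a \<oplus>\<^bsub>A\<^esub> a', c)) = tc (frag_of (a, c)) + tc (frag_of (a', c))"
  using tc_TI[OF rel_add_left[of a a' c]] by (simp add: tc_diff tc_add FP_closed algebra_simps)

lemma tc_add_right: "a \<in> carrier A \<Longrightarrow> c \<in> carrier C \<Longrightarrow> c' \<in> carrier C \<Longrightarrow>
    tc (frag_of (a, c \<oplus>\<^bsub>C\<^esub> c')) = tc (frag_of (a, c)) + tc (frag_of (a, c'))"
  using tc_TI[OF rel_add_right[of a c c']] by (simp add: tc_diff tc_add FP_closed algebra_simps)

lemma tc_smult: "k \<in> carrier K \<Longrightarrow> a \<in> carrier A \<Longrightarrow> c \<in> carrier C \<Longrightarrow>
    tc (frag_of (k \<odot>\<^bsub>A\<^esub> a, c)) = tc (frag_of (a, k \<odot>\<^bsub>C\<^esub> c))"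
  using tc_TI[OF rel_smult[of k a c]] by (simp add: tc_diff FP_closed)

lemma ext_tc:
  assumes "u \<in> carrier FP" shows "ext (\<lambda>a c. \<rho>\<^sub>T a * \<mu>\<^sub>T c) u = tc u"
proof -
  have "u \<in> carrier FP \<and> ext (\<lambda>a c. \<rho>\<^sub>T a * \<mu>\<^sub>T c) u = tc u"
    using assms by (induction u rule: FP_induct) (simp_all add: FP_closed tc_TI TI_0 tc_pure ext_diff tc_diff)
  then show ?thesis ..
qed

lemma \<mu>_hom:
  "c \<in> carrier C \<Longrightarrow> d \<in> carrier C \<Longrightarrow> \<mu>\<^sub>T (c \<oplus>\<^bsub>C\<^esub> d) = \<mu>\<^sub>T c + \<mu>\<^sub>T d"
  "c \<in> carrier C \<Longrightarrow> d \<in> carrier C \<Longrightarrow> \<mu>\<^sub>T (c \<otimes>\<^bsub>C\<^esub> d) = \<mu>\<^sub>T c * \<mu>\<^sub>T d"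
  "\<mu>\<^sub>T \<one>\<^bsub>C\<^esub> = u\<^sub>T" "\<mu>\<^sub>T \<zero>\<^bsub>C\<^esub> = 0"
proof -
  show "c \<in> carrier C \<Longrightarrow> d \<in> carrier C \<Longrightarrow> \<mu>\<^sub>T (c \<oplus>\<^bsub>C\<^esub> d) = \<mu>\<^sub>T c + \<mu>\<^sub>T d"
    unfolding \<mu>\<^sub>T_def by (simp add: tc_add_right)
  show "c \<in> carrier C \<Longrightarrow> d \<in> carrier C \<Longrightarrow> \<mu>\<^sub>T (c \<otimes>\<^bsub>C\<^esub> d) = \<mu>\<^sub>T c * \<mu>\<^sub>T d"
    unfolding \<mu>\<^sub>T_def by (subst tc_mult[symmetric]) (simp_all add: FP_closed)
  show "\<mu>\<^sub>T \<one>\<^bsub>C\<^esub> = u\<^sub>T" unfolding \<mu>\<^sub>T_def tc_def using \<tau>.\<phi>_one T_simps(3) by simp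
  show "\<mu>\<^sub>T \<zero>\<^bsub>C\<^esub> = 0" unfolding \<mu>\<^sub>T_def by (rule tc_TI[OF zero_right]) simp
qed

lemma \<rho>_hom:
  "a \<in> carrier A \<Longrightarrow> b \<in> carrier A \<Longrightarrow> \<rho>\<^sub>T (a \<oplus>\<^bsub>A\<^esub> b) = \<rho>\<^sub>T a + \<rho>\<^sub>T b"
  "a \<in> carrier A \<Longrightarrow> b \<in> carrier A \<Longrightarrow> \<rho>\<^sub>T (a \<otimes>\<^bsub>A\<^esub> b) = \<rho>\<^sub>T a * \<rho>\<^sub>T b"
  "\<rho>\<^sub>T \<one>\<^bsub>A\<^esub> = u\<^sub>T" "\<rho>\<^sub>T \<zero>\<^bsub>A\<^esub> = 0"
proof -
  show "a \<in> carrier A \<Longrightarrow> b \<in> carrier A \<Longrightarrow> \<rho>\<^sub>T (a \<oplus>\<^bsub>A\<^esub> b) = \<rho>\<^sub>T a + \<rho>\<^sub>T b"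
    unfolding \<rho>\<^sub>T_def by (simp add: tc_add_left)
  show "a \<in> carrier A \<Longrightarrow> b \<in> carrier A \<Longrightarrow> \<rho>\<^sub>T (a \<otimes>\<^bsub>A\<^esub> b) = \<rho>\<^sub>T a * \<rho>\<^sub>T b"
    unfolding \<rho>\<^sub>T_def by (subst tc_mult[symmetric]) (simp_all add: FP_closed)
  show "\<rho>\<^sub>T \<one>\<^bsub>A\<^esub> = u\<^sub>T" unfolding \<rho>\<^sub>T_def tc_def using \<tau>.\<phi>_one T_simps(3) by simp
  show "\<rho>\<^sub>T \<zero>\<^bsub>A\<^esub> = 0" unfolding \<rho>\<^sub>T_def by (rule tc_TI[OF zero_left]) simp
qed

lemma smult_hom:
  "k \<in> carrier K \<Longrightarrow> c \<in> carrier C \<Longrightarrow> \<mu>\<^sub>T (k \<odot>\<^bsub>C\<^esub> c) = \<chi>\<^sub>T k * \<mu>\<^sub>T c"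
  "k \<in> carrier K \<Longrightarrow> a \<in> carrier A \<Longrightarrow> \<rho>\<^sub>T (k \<odot>\<^bsub>A\<^esub> a) = \<chi>\<^sub>T k * \<rho>\<^sub>T a"
proof -
  show "k \<in> carrier K \<Longrightarrow> c \<in> carrier C \<Longrightarrow> \<mu>\<^sub>T (k \<odot>\<^bsub>C\<^esub> c) = \<chi>\<^sub>T k * \<mu>\<^sub>T c"
    unfolding \<chi>\<^sub>T_def by (subst \<mu>_hom(2)[symmetric]) (simp_all add: C.smult_assoc2)
  assume k: "k \<in> carrier K" "a \<in> carrier A"
  have "\<rho>\<^sub>T (k \<odot>\<^bsub>A\<^esub> a) = tc (frag_of (a, k \<odot>\<^bsub>C\<^esub> \<one>\<^bsub>C\<^esub>))" unfolding \<rho>\<^sub>T_def using k by (simp add: tc_smult)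
  also have "\<dots> = \<rho>\<^sub>T a * \<chi>\<^sub>T k" unfolding \<chi>\<^sub>T_def using k by (intro tc_pure) auto
  finally show "\<rho>\<^sub>T (k \<odot>\<^bsub>A\<^esub> a) = \<chi>\<^sub>T k * \<rho>\<^sub>T a" by (simp add: mult.commute)
qed

lemma \<mu>_e: "c \<in> carrier C \<Longrightarrow> u\<^sub>T * \<mu>\<^sub>T c = \<mu>\<^sub>T c"
  using \<mu>_hom(2)[of "\<one>\<^bsub>C\<^esub>" c] \<mu>_hom(3) by simp

lemma one_neq: "\<one>\<^bsub>C\<^esub> \<noteq> \<zero>\<^bsub>C\<^esub>" using \<mu>_hom(3,4) \<tau>.e0 by auto

lemma \<mu>_unit:
  assumes "c \<in> carrier C" "c \<noteq> \<zero>\<^bsub>C\<^esub>" shows "\<exists>d\<in>carrier C. c \<otimes>\<^bsub>C\<^esub> d = \<one>\<^bsub>C\<^esub> \<and> \<mu>\<^sub>T c * \<mu>\<^sub>T d = u\<^sub>T"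
proof -
  interpret FC: field C by (rule fieldC)
  have "c \<in> Units C" using assms FC.field_Units by blast
  then have "inv\<^bsub>C\<^esub> c \<in> carrier C" "c \<otimes>\<^bsub>C\<^esub> inv\<^bsub>C\<^esub> c = \<one>\<^bsub>C\<^esub>" by auto
  then show ?thesis using \<mu>_hom(2)[OF assms(1)] \<mu>_hom(3) by metis
qed

lemma \<mu>_inj: "inj_on \<mu>\<^sub>T (carrier C)"
proof (rule inj_onI)
  fix c d assume cd: "c \<in> carrier C" "d \<in> carrier C" "\<mu>\<^sub>T c = \<mu>\<^sub>T d"
  define s where "s = c \<oplus>\<^bsub>C\<^esub> (\<ominus>\<^bsub>C\<^esub> d)"
  have s: "s \<in> carrier C" unfolding s_def using cd by simp
  have "\<mu>\<^sub>T (\<ominus>\<^bsub>C\<^esub> d) + \<mu>\<^sub>T d = 0" using \<mu>_hom(1)[of "\<ominus>\<^bsub>C\<^esub> d" d] \<mu>_hom(4) cd by (simp add: C.M.l_neg)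
  then have "\<mu>\<^sub>T s = 0" unfolding s_def using \<mu>_hom(1)[of c "\<ominus>\<^bsub>C\<^esub> d"] cd by (simp add: add.commute)
  then have "s = \<zero>\<^bsub>C\<^esub>" using \<mu>_unit[OF s] \<tau>.e0 by fastforce
  then have "\<ominus>\<^bsub>C\<^esub> (\<ominus>\<^bsub>C\<^esub> d) = c" unfolding s_def using cd by (intro C.M.minus_equality) auto
  then show "c = d" using cd by simp
qed

text \<open>Transfers a sum between two copies of \<open>C\<close>. The functional used in
  \<open>independent_tensor\<close> lives on the copy in the fraction field of \<open>C\<close>,
  whereas independence is given in the fraction field of the tensor product.\<close>

lemma common_sum:
  assumes "finite Y" "\<And>y. y \<in> Y \<Longrightarrow> g y \<in> carrier C"
  shows "\<exists>s\<in>carrier C. \<mu>\<^sub>T s = (\<Sum>y\<in>Y. \<mu>\<^sub>T (g y)) \<and> dom_emb C s = (\<Sum>y\<in>Y. dom_emb C (g y))"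
  using assms
proof (induction Y rule: finite_induct)
  case empty
  then show ?case using \<mu>_hom(4) \<xi>.\<phi>_zero by (intro bexI[of _ "\<zero>\<^bsub>C\<^esub>"]) simp_all
next
  case (insert y Y)
  then obtain s where s: "s \<in> carrier C" "\<mu>\<^sub>T s = (\<Sum>y\<in>Y. \<mu>\<^sub>T (g y))" "dom_emb C s = (\<Sum>y\<in>Y. dom_emb C (g y))" by auto
  have gy: "g y \<in> carrier C" using insert by blast
  show ?case using s insert.hyps gy \<mu>_hom(1)[OF gy s(1)] \<xi>.\<phi>_add[OF gy s(1)]
    by (intro bexI[of _ "g y \<oplus>\<^bsub>C\<^esub> s"]) simp_all
qed

lemma subf_scalars: "\<xi>.subf ((\<lambda>k. dom_emb C (k \<odot>\<^bsub>C\<^esub> \<one>\<^bsub>C\<^esub>)) ` carrier K)"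
  and subf_\<chi>: "\<tau>.subf (\<chi>\<^sub>T ` carrier K)"
proof -
  interpret FK: field K by (rule fieldK)
  \<comment> \<open>One computation for both copies of \<open>C\<close>.\<close>
  have *: "idf.subf e' ((\<lambda>k. \<nu> (k \<odot>\<^bsub>C\<^esub> \<one>\<^bsub>C\<^esub>)) ` carrier K)"
    if i: "idf e'" and th: "\<And>x y. x \<in> carrier C \<Longrightarrow> y \<in> carrier C \<Longrightarrow> \<nu> (x \<oplus>\<^bsub>C\<^esub> y) = \<nu> x + \<nu> y"
      "\<And>x y. x \<in> carrier C \<Longrightarrow> y \<in> carrier C \<Longrightarrow> \<nu> (x \<otimes>\<^bsub>C\<^esub> y) = \<nu> x * \<nu> y"
      "\<nu> \<one>\<^bsub>C\<^esub> = e'" "\<nu> \<zero>\<^bsub>C\<^esub> = 0" for e' :: "'z::comm_ring_1" and \<nu>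
  proof -
    interpret i: idf e' by (rule i)
    let ?j = "\<lambda>k. k \<odot>\<^bsub>C\<^esub> \<one>\<^bsub>C\<^esub>"
    have jc: "?j k \<in> carrier C" if "k \<in> carrier K" for k using that by simp
    have jm: "?j k \<otimes>\<^bsub>C\<^esub> ?j k' = ?j (k \<otimes>\<^bsub>K\<^esub> k')" if "k \<in> carrier K" "k' \<in> carrier K" for k k'
      using that by (simp add: C.smult_assoc2 C.smult_assoc1)
    have ja: "?j k \<oplus>\<^bsub>C\<^esub> ?j k' = ?j (k \<oplus>\<^bsub>K\<^esub> k')" if "k \<in> carrier K" "k' \<in> carrier K" for k k'
      using that by (simp add: C.smult_l_distr)
    have add: "\<nu> (?j k) + \<nu> (?j k') = \<nu> (?j (k \<oplus>\<^bsub>K\<^esub> k'))" if "k \<in> carrier K" "k' \<in> carrier K" for k k'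
      unfolding ja[OF that, symmetric] using th(1)[OF jc[OF that(1)] jc[OF that(2)]] by simp
    have mul: "\<nu> (?j k) * \<nu> (?j k') = \<nu> (?j (k \<otimes>\<^bsub>K\<^esub> k'))" if "k \<in> carrier K" "k' \<in> carrier K" for k k'
      unfolding jm[OF that, symmetric] using th(2)[OF jc[OF that(1)] jc[OF that(2)]] by simp
    have neg: "\<nu> (?j (\<ominus>\<^bsub>K\<^esub> k)) = - \<nu> (?j k)" if "k \<in> carrier K" for k
      using add[of "\<ominus>\<^bsub>K\<^esub> k" k] that th(4) by (simp add: A.R.l_neg eq_neg_iff_add_eq_0)
    have one: "\<nu> (?j \<one>\<^bsub>K\<^esub>) = e'" using th(3) by simp
    show ?thesis
      unfolding i.subf_def
    proof (intro conjI ballI impI)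
      show "i.subr ((\<lambda>k. \<nu> (?j k)) ` carrier K)"
      proof (rule i.subrI)
        show "e' \<in> (\<lambda>k. \<nu> (?j k)) ` carrier K" using one by (intro image_eqI[of _ _ "\<one>\<^bsub>K\<^esub>"]) simp_all
        fix x assume "x \<in> (\<lambda>k. \<nu> (?j k)) ` carrier K"
        then obtain k where k: "k \<in> carrier K" "x = \<nu> (?j k)" by blast
        show "e' * x = x" using mul[of "\<one>\<^bsub>K\<^esub>" k] one k by simp
        fix y assume "y \<in> (\<lambda>k. \<nu> (?j k)) ` carrier K"
        then obtain k' where k': "k' \<in> carrier K" "y = \<nu> (?j k')" by blast
        have "x - y = \<nu> (?j (k \<oplus>\<^bsub>K\<^esub> (\<ominus>\<^bsub>K\<^esub> k')))" using add[of k "\<ominus>\<^bsub>K\<^esub> k'"] neg k k' by simp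
        then show "x - y \<in> (\<lambda>k. \<nu> (?j k)) ` carrier K" using k k' by (intro image_eqI[of _ _ "k \<oplus>\<^bsub>K\<^esub> (\<ominus>\<^bsub>K\<^esub> k')"]) simp_all
        show "x * y \<in> (\<lambda>k. \<nu> (?j k)) ` carrier K" using mul k k' by (intro image_eqI[of _ _ "k \<otimes>\<^bsub>K\<^esub> k'"]) simp_all
      qed
      fix x assume x: "x \<in> (\<lambda>k. \<nu> (?j k)) ` carrier K" "x \<noteq> 0"
      then obtain k where k: "k \<in> carrier K" "x = \<nu> (?j k)" by blast
      have "k \<noteq> \<zero>\<^bsub>K\<^esub>" using x(2) k th(4) by auto
      then have u: "k \<in> Units K" using k FK.field_Units by blast
      have "x * \<nu> (?j (inv\<^bsub>K\<^esub> k)) = e'" using mul[of k "inv\<^bsub>K\<^esub> k"] u k one by simp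
      then show "\<exists>y\<in>(\<lambda>k. \<nu> (?j k)) ` carrier K. x * y = e'" using u by blast
    qed
  qed
  show "\<xi>.subf ((\<lambda>k. dom_emb C (k \<odot>\<^bsub>C\<^esub> \<one>\<^bsub>C\<^esub>)) ` carrier K)"
    by (rule *[OF \<xi>.idf_axioms \<xi>.\<phi>_add \<xi>.\<phi>_mult \<xi>.\<phi>_one \<xi>.\<phi>_zero])
  show "\<tau>.subf (\<chi>\<^sub>T ` carrier K)"
    unfolding \<chi>\<^sub>T_def[abs_def] by (rule *[OF \<tau>.idf_axioms \<mu>_hom])
qed

text \<open>A \<open>K\<close>-linear functional \<open>kk\<close> on \<open>C\<close> that is one
  at \<open>y0\<close> and zero on the rest of \<open>Y\<close> gives a balanced map sending
  \<open>a\<close> and \<open>c\<close> to \<open>kk c\<close> times \<open>a\<close>. The given sum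
  is mapped to \<open>r y0\<close>, and to zero because it lies in the tensor ideal.\<close>

lemma independent_tensor:
  assumes Y: "finite Y" "Y \<subseteq> carrier C" and ind: "\<tau>.lin_indep (\<chi>\<^sub>T ` carrier K) (\<mu>\<^sub>T ` Y)"
    and r: "\<And>y. y \<in> Y \<Longrightarrow> r y \<in> carrier A" and u: "(\<Sum>y\<in>Y. frag_of (r y, y)) \<in> TI" and y0: "y0 \<in> Y"
  shows "r y0 = \<zero>\<^bsub>A\<^esub>"
proof -
  interpret FK: field K by (rule fieldK)
  let ?\<xi> = "dom_emb C" and ?j = "\<lambda>k. k \<odot>\<^bsub>C\<^esub> \<one>\<^bsub>C\<^esub>"
  let ?L = "(\<lambda>k. ?\<xi> (?j k)) ` carrier K"
  have L: "\<xi>.subf ?L" by (rule subf_scalars)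
  have inj\<xi>: "inj_on ?\<xi> Y" using \<xi>.\<phi>_inj Y(2) by (intro inj_onI) blast
  have inj\<mu>: "inj_on \<mu>\<^sub>T Y" using \<mu>_inj Y(2) inj_on_subset by blast
  have jy: "?j k \<otimes>\<^bsub>C\<^esub> y = k \<odot>\<^bsub>C\<^esub> y" if "k \<in> carrier K" "y \<in> carrier C" for k y using that by (simp add: C.smult_assoc2)
  have \<xi>s: "?\<xi> (k \<odot>\<^bsub>C\<^esub> y) = ?\<xi> (?j k) * ?\<xi> y" if "k \<in> carrier K" "y \<in> carrier C" for k y
    using that \<xi>.\<phi>_mult[of "?j k" y] jy[OF that] by simp
  have ind\<xi>: "\<xi>.lin_indep ?L (?\<xi> ` Y)"
    unfolding \<xi>.lin_indep_def
  proof (intro allI impI)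
    fix c assume c: "\<forall>z\<in>?\<xi> ` Y. c z \<in> ?L" "(\<Sum>z\<in>?\<xi> ` Y. c z * z) = 0"
    have "\<forall>y\<in>Y. \<exists>k. k \<in> carrier K \<and> c (?\<xi> y) = ?\<xi> (?j k)" using c(1) by blast
    then obtain k where k: "\<forall>y\<in>Y. k y \<in> carrier K \<and> c (?\<xi> y) = ?\<xi> (?j (k y))" by (rule bchoice[THEN exE])
    have kc: "k y \<in> carrier K" "y \<in> carrier C" "c (?\<xi> y) = ?\<xi> (?j (k y))" if "y \<in> Y" for y using k that Y(2) by auto
    have gc: "k y \<odot>\<^bsub>C\<^esub> y \<in> carrier C" if "y \<in> Y" for y using kc[OF that] by simp
    have "\<exists>s\<in>carrier C. \<mu>\<^sub>T s = (\<Sum>y\<in>Y. \<mu>\<^sub>T (k y \<odot>\<^bsub>C\<^esub> y)) \<and> ?\<xi> s = (\<Sum>y\<in>Y. ?\<xi> (k y \<odot>\<^bsub>C\<^esub> y))"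
      by (rule common_sum[OF Y(1) gc])
    then obtain s where s: "s \<in> carrier C" "\<mu>\<^sub>T s = (\<Sum>y\<in>Y. \<mu>\<^sub>T (k y \<odot>\<^bsub>C\<^esub> y))" "?\<xi> s = (\<Sum>y\<in>Y. ?\<xi> (k y \<odot>\<^bsub>C\<^esub> y))"
      by (elim bexE conjE)
    have "?\<xi> s = (\<Sum>y\<in>Y. c (?\<xi> y) * ?\<xi> y)"
      unfolding s(3)
    proof (rule sum.cong[OF HOL.refl])
      fix y assume y: "y \<in> Y"
      show "?\<xi> (k y \<odot>\<^bsub>C\<^esub> y) = c (?\<xi> y) * ?\<xi> y" unfolding kc(3)[OF y] by (rule \<xi>s[OF kc(1,2)[OF y]])
    qed
    also have "\<dots> = 0" using c(2) by (simp add: sum.reindex[OF inj\<xi>])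
    finally have "s = \<zero>\<^bsub>C\<^esub>" using \<xi>.\<phi>_inj[OF s(1) \<xi>.unit_closed(1)] \<xi>.\<phi>_zero by simp
    then have "(\<Sum>y\<in>Y. \<mu>\<^sub>T (k y \<odot>\<^bsub>C\<^esub> y)) = 0" using s(2) \<mu>_hom(4) by simp
    moreover have "(\<Sum>y\<in>Y. \<mu>\<^sub>T (k y \<odot>\<^bsub>C\<^esub> y)) = (\<Sum>y\<in>Y. \<chi>\<^sub>T (k y) * \<mu>\<^sub>T y)"
      by (rule sum.cong[OF HOL.refl]) (simp add: kc smult_hom(1))
    ultimately have "(\<Sum>y\<in>Y. \<chi>\<^sub>T (k y) * \<mu>\<^sub>T y) = 0" by simp
    then have rel: "(\<Sum>z\<in>\<mu>\<^sub>T ` Y. \<chi>\<^sub>T (k (inv_into Y \<mu>\<^sub>T z)) * z) = 0"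
      by (simp add: sum.reindex[OF inj\<mu>] inv_into_f_f[OF inj\<mu>])
    have s0: "\<chi>\<^sub>T (k y) = 0" if y: "y \<in> Y" for y
    proof -
      have "\<chi>\<^sub>T (k (inv_into Y \<mu>\<^sub>T (\<mu>\<^sub>T y))) = 0"
      proof (rule \<tau>.lin_indepD[OF ind _ rel imageI[OF y]])
        fix z assume "z \<in> \<mu>\<^sub>T ` Y"
        then show "\<chi>\<^sub>T (k (inv_into Y \<mu>\<^sub>T z)) \<in> \<chi>\<^sub>T ` carrier K" using kc(1)[OF inv_into_into] by (intro imageI)
      qed
      then show ?thesis by (simp add: inv_into_f_f[OF inj\<mu> y])
    qed
    show "\<forall>z\<in>?\<xi> ` Y. c z = 0"
    proof
      fix z assume "z \<in> ?\<xi> ` Y"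
      then obtain y where y: "y \<in> Y" "z = ?\<xi> y" by blast
      have "?j (k y) = \<zero>\<^bsub>C\<^esub>"
        using inj_onD[OF \<mu>_inj, of "?j (k y)" "\<zero>\<^bsub>C\<^esub>"] s0[OF y(1)] k y(1) \<mu>_hom(4) unfolding \<chi>\<^sub>T_def by simp
      then show "c z = 0" using k y \<xi>.\<phi>_zero by simp
    qed
  qed
  have sV: "\<xi>.sm ?L (?\<xi> ` carrier C)"
  proof (rule \<xi>.smI)
    show "\<And>x. x \<in> ?\<xi> ` carrier C \<Longrightarrow> dom_unit C * x = x" using \<xi>.\<phi>_e by blast
    show "0 \<in> ?\<xi> ` carrier C" using \<xi>.\<phi>_zero \<xi>.unit_closed(1) by (metis imageI)
  next
    fix x y assume "x \<in> ?\<xi> ` carrier C" "y \<in> ?\<xi> ` carrier C"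
    then obtain a b where ab: "a \<in> carrier C" "x = ?\<xi> a" "b \<in> carrier C" "y = ?\<xi> b" by blast
    obtain b' where b': "b' \<in> carrier C" "?\<xi> b' = - ?\<xi> b" using \<xi>.neg_closed[OF ab(3)] by blast
    have "x - y = ?\<xi> (a \<oplus>\<^bsub>C\<^esub> b')" using \<xi>.\<phi>_add[OF ab(1) b'(1)] ab b' by simp
    then show "x - y \<in> ?\<xi> ` carrier C" using \<xi>.add_closed[OF ab(1) b'(1)] by blast
  next
    fix l x assume "l \<in> ?L" "x \<in> ?\<xi> ` carrier C"
    then obtain k c where kc: "k \<in> carrier K" "l = ?\<xi> (?j k)" "c \<in> carrier C" "x = ?\<xi> c" by blast
    then have "l * x = ?\<xi> (k \<odot>\<^bsub>C\<^esub> c)" using \<xi>s[OF kc(1,3)] by simp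
    then show "l * x \<in> ?\<xi> ` carrier C" using kc by blast
  qed
  have EV: "?\<xi> ` Y \<subseteq> ?\<xi> ` carrier C" using Y(2) by blast
  from \<xi>.dual_functional[OF L sV EV finite_imageI[OF Y(1)] ind\<xi> imageI[OF y0]]
  obtain l where l: "\<forall>v\<in>?\<xi> ` carrier C. l v \<in> ?L"
    "\<forall>v\<in>?\<xi> ` carrier C. \<forall>w\<in>?\<xi> ` carrier C. l (v + w) = l v + l w"
    "\<forall>c\<in>?L. \<forall>v\<in>?\<xi> ` carrier C. l (c * v) = c * l v" "l (?\<xi> y0) = dom_unit C"
    "\<forall>z\<in>?\<xi> ` Y - {?\<xi> y0}. l z = 0" by (elim exE conjE)
  have "\<forall>c\<in>carrier C. \<exists>k. k \<in> carrier K \<and> ?\<xi> (?j k) = l (?\<xi> c)"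
  proof
    fix c assume "c \<in> carrier C"
    then have "l (?\<xi> c) \<in> ?L" by (intro bspec[OF l(1)] imageI)
    then show "\<exists>k. k \<in> carrier K \<and> ?\<xi> (?j k) = l (?\<xi> c)" by (elim imageE) (intro exI conjI, simp_all)
  qed
  then obtain kk where kk: "\<forall>c\<in>carrier C. kk c \<in> carrier K \<and> ?\<xi> (?j (kk c)) = l (?\<xi> c)" by (rule bchoice[THEN exE])
  have kkI: "kk c = k" if "c \<in> carrier C" "k \<in> carrier K" "?\<xi> (?j k) = l (?\<xi> c)" for c k
  proof -
    have "?j (kk c) = ?j k" by (rule \<xi>.\<phi>_inj) (use that kk in auto)
    then show ?thesis using C.smult_one_inj[OF fieldK one_neq] kk that(1,2) by blast
  qed
  have kk_add: "kk (c \<oplus>\<^bsub>C\<^esub> d) = kk c \<oplus>\<^bsub>K\<^esub> kk d" if cd: "c \<in> carrier C" "d \<in> carrier C" for c d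
  proof (rule kkI)
    have k: "kk c \<in> carrier K" "kk d \<in> carrier K" using kk cd by blast+
    have "?\<xi> (?j (kk c \<oplus>\<^bsub>K\<^esub> kk d)) = ?\<xi> (?j (kk c) \<oplus>\<^bsub>C\<^esub> ?j (kk d))"
      using C.smult_l_distr[OF k C.one_closed] by simp
    also have "\<dots> = ?\<xi> (?j (kk c)) + ?\<xi> (?j (kk d))" by (rule \<xi>.\<phi>_add) (use k in simp_all)
    finally have "?\<xi> (?j (kk c \<oplus>\<^bsub>K\<^esub> kk d)) = ?\<xi> (?j (kk c)) + ?\<xi> (?j (kk d))" .
    then show "?\<xi> (?j (kk c \<oplus>\<^bsub>K\<^esub> kk d)) = l (?\<xi> (c \<oplus>\<^bsub>C\<^esub> d))" using kk cd l(2) \<xi>.\<phi>_add[OF cd] by simp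
  qed (use kk cd in auto)
  have kk_smult: "kk (k \<odot>\<^bsub>C\<^esub> c) = k \<otimes>\<^bsub>K\<^esub> kk c" if kc: "k \<in> carrier K" "c \<in> carrier C" for k c
  proof (rule kkI)
    have "?j (k \<otimes>\<^bsub>K\<^esub> kk c) = k \<odot>\<^bsub>C\<^esub> (?j (kk c))" using kk kc by (subst C.smult_assoc1) auto
    then have "?\<xi> (?j (k \<otimes>\<^bsub>K\<^esub> kk c)) = ?\<xi> (?j k) * ?\<xi> (?j (kk c))" using \<xi>s[of k "?j (kk c)"] kk kc by simp
    moreover have "l (?\<xi> (?j k) * ?\<xi> c) = ?\<xi> (?j k) * l (?\<xi> c)" using l(3) kc by blast
    ultimately show "?\<xi> (?j (k \<otimes>\<^bsub>K\<^esub> kk c)) = l (?\<xi> (k \<odot>\<^bsub>C\<^esub> c))" using kk kc(2) unfolding \<xi>s[OF kc] by simp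
  qed (use kk kc in auto)
  define g where "g a c = dom_emb A (kk c \<odot>\<^bsub>A\<^esub> a)" for a c
  have "balanced g"
    unfolding balanced_def g_def
  proof (intro conjI ballI)
    fix a a' c assume ac: "a \<in> carrier A" "a' \<in> carrier A" "c \<in> carrier C"
    have k: "kk c \<in> carrier K" using kk ac by blast
    show "dom_emb A (kk c \<odot>\<^bsub>A\<^esub> (a \<oplus>\<^bsub>A\<^esub> a')) = dom_emb A (kk c \<odot>\<^bsub>A\<^esub> a) + dom_emb A (kk c \<odot>\<^bsub>A\<^esub> a')"
      unfolding A.smult_r_distr[OF k ac(1,2)] by (rule \<alpha>.\<phi>_add[OF A.smult_closed[OF k ac(1)] A.smult_closed[OF k ac(2)]])
  next
    fix a c c' assume ac: "a \<in> carrier A" "c \<in> carrier C" "c' \<in> carrier C"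
    have k: "kk c \<in> carrier K" "kk c' \<in> carrier K" using kk ac by blast+
    show "dom_emb A (kk (c \<oplus>\<^bsub>C\<^esub> c') \<odot>\<^bsub>A\<^esub> a) = dom_emb A (kk c \<odot>\<^bsub>A\<^esub> a) + dom_emb A (kk c' \<odot>\<^bsub>A\<^esub> a)"
      unfolding kk_add[OF ac(2,3)] A.smult_l_distr[OF k ac(1)]
      by (rule \<alpha>.\<phi>_add[OF A.smult_closed[OF k(1) ac(1)] A.smult_closed[OF k(2) ac(1)]])
  next
    fix k a c assume kac: "k \<in> carrier K" "a \<in> carrier A" "c \<in> carrier C"
    have "kk (k \<odot>\<^bsub>C\<^esub> c) \<odot>\<^bsub>A\<^esub> a = (kk c \<otimes>\<^bsub>K\<^esub> k) \<odot>\<^bsub>A\<^esub> a"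
      unfolding kk_smult[OF kac(1,3)] using A.R.m_comm[OF kac(1), of "kk c"] kk kac(3) by simp
    also have "\<dots> = kk c \<odot>\<^bsub>A\<^esub> (k \<odot>\<^bsub>A\<^esub> a)" using kk kac by (intro A.smult_assoc1) auto
    finally show "dom_emb A (kk c \<odot>\<^bsub>A\<^esub> (k \<odot>\<^bsub>A\<^esub> a)) = dom_emb A (kk (k \<odot>\<^bsub>C\<^esub> c) \<odot>\<^bsub>A\<^esub> a)" by simp
  qed
  from ext_tensor_ideal[OF this u] have s0: "(\<Sum>y\<in>Y. g (r y) y) = 0" by (simp add: ext_sum)
  have y0C: "y0 \<in> carrier C" using y0 Y(2) by blast
  have "kk y0 = \<one>\<^bsub>K\<^esub>" by (rule kkI[OF y0C]) (use l(4) \<xi>.\<phi>_one in auto)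
  then have g0: "g (r y0) y0 = dom_emb A (r y0)" unfolding g_def using r[OF y0] by simp
  have gy: "g (r y) y = 0" if y: "y \<in> Y - {y0}" for y
  proof -
    have yC: "y \<in> carrier C" using y Y(2) by blast
    have "?\<xi> y \<noteq> ?\<xi> y0" using inj_onD[OF inj\<xi>, of y y0] y y0 by blast
    then have "l (?\<xi> y) = 0" using l(5) y by blast
    then have "kk y = \<zero>\<^bsub>K\<^esub>" by (intro kkI[OF yC]) (use \<xi>.\<phi>_zero in auto)
    then show ?thesis unfolding g_def using r[of y] y \<alpha>.\<phi>_zero by simp
  qed
  have "dom_emb A (r y0) = 0" using s0 sum.remove[OF Y(1) y0, of "\<lambda>y. g (r y) y"] g0 gy by simp
  then show ?thesis using \<alpha>.\<phi>_inj[OF r[OF y0] \<alpha>.unit_closed(1)] \<alpha>.\<phi>_zero by simp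
qed

text \<open>\<open>independent_tensor\<close> for the unit of \<open>C\<close> alone, applied to a
  difference.\<close>

lemma \<rho>_inj: "inj_on \<rho>\<^sub>T (carrier A)"
proof -
  have z: "a = \<zero>\<^bsub>A\<^esub>" if a: "a \<in> carrier A" "\<rho>\<^sub>T a = 0" for a
  proof -
    have "frag_of (a, \<one>\<^bsub>C\<^esub>) \<in> TI" by (rule tc_0_TI) (use a in \<open>auto simp: \<rho>\<^sub>T_def intro: FP_closed\<close>)
    moreover have "\<tau>.lin_indep (\<chi>\<^sub>T ` carrier K) (\<mu>\<^sub>T ` {\<one>\<^bsub>C\<^esub>})"
      unfolding \<tau>.lin_indep_def
    proof (intro allI impI)
      fix c assume c: "\<forall>y\<in>\<mu>\<^sub>T ` {\<one>\<^bsub>C\<^esub>}. c y \<in> \<chi>\<^sub>T ` carrier K" "(\<Sum>y\<in>\<mu>\<^sub>T ` {\<one>\<^bsub>C\<^esub>}. c y * y) = 0"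
      then have "u\<^sub>T * c u\<^sub>T = c u\<^sub>T" "u\<^sub>T * c u\<^sub>T = 0"
        using \<mu>_hom(3) \<tau>.subr_unit[OF \<tau>.subf_r[OF subf_\<chi>]] by (simp_all add: mult.commute)
      then show "\<forall>y\<in>\<mu>\<^sub>T ` {\<one>\<^bsub>C\<^esub>}. c y = 0" using \<mu>_hom(3) by simp
    qed
    ultimately show ?thesis using independent_tensor[of "{\<one>\<^bsub>C\<^esub>}" "\<lambda>_. a" "\<one>\<^bsub>C\<^esub>"] a(1) by simp
  qed
  show ?thesis
  proof (rule inj_onI)
    fix a b assume ab: "a \<in> carrier A" "b \<in> carrier A" "\<rho>\<^sub>T a = \<rho>\<^sub>T b"
    have "\<rho>\<^sub>T (\<ominus>\<^bsub>A\<^esub> b) + \<rho>\<^sub>T b = 0" using \<rho>_hom(1)[of "\<ominus>\<^bsub>A\<^esub> b" b] \<rho>_hom(4) ab by (simp add: A.M.l_neg)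
    then have "\<rho>\<^sub>T (a \<oplus>\<^bsub>A\<^esub> (\<ominus>\<^bsub>A\<^esub> b)) = 0" using \<rho>_hom(1)[of a "\<ominus>\<^bsub>A\<^esub> b"] ab by (simp add: add.commute)
    then have "a \<oplus>\<^bsub>A\<^esub> (\<ominus>\<^bsub>A\<^esub> b) = \<zero>\<^bsub>A\<^esub>" using z[of "a \<oplus>\<^bsub>A\<^esub> (\<ominus>\<^bsub>A\<^esub> b)"] ab by simp
    then have "\<ominus>\<^bsub>A\<^esub> (\<ominus>\<^bsub>A\<^esub> b) = a" using ab by (intro A.M.minus_equality) auto
    then show "a = b" using ab by simp
  qed
qed

lemma disjoint_T:
  assumes E: "finite E" "E \<subseteq> \<mu>\<^sub>T ` carrier C" "\<tau>.lin_indep (\<chi>\<^sub>T ` carrier K) E"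
    and r: "\<forall>y\<in>E. r y \<in> \<rho>\<^sub>T ` carrier A" "(\<Sum>y\<in>E. r y * y) = 0"
  shows "\<forall>y\<in>E. r y = 0"
proof -
  from subset_image_inj[THEN iffD1, OF E(2)]
  obtain Y where Y: "Y \<subseteq> carrier C" "inj_on \<mu>\<^sub>T Y" "E = \<mu>\<^sub>T ` Y" by (elim exE conjE)
  have fY: "finite Y" using E(1) Y(2,3) finite_image_iff by blast
  have "\<forall>y\<in>Y. \<exists>a. a \<in> carrier A \<and> r (\<mu>\<^sub>T y) = \<rho>\<^sub>T a" using r(1) Y(3) by blast
  then obtain a where a: "\<forall>y\<in>Y. a y \<in> carrier A \<and> r (\<mu>\<^sub>T y) = \<rho>\<^sub>T (a y)" by (rule bchoice[THEN exE])
  define u where "u = (\<Sum>y\<in>Y. frag_of (a y, y))"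
  have uFP: "u \<in> carrier FP"
    unfolding u_def using fY a Y(1) by (induction Y rule: finite_induct) (auto intro!: FP_closed)
  have "ext (\<lambda>a c. \<rho>\<^sub>T a * \<mu>\<^sub>T c) u = (\<Sum>y\<in>Y. \<rho>\<^sub>T (a y) * \<mu>\<^sub>T y)" unfolding u_def by (simp add: ext_sum)
  also have "\<dots> = (\<Sum>y\<in>Y. r (\<mu>\<^sub>T y) * \<mu>\<^sub>T y)" using a by (intro sum.cong) auto
  also have "\<dots> = 0" using r(2) unfolding Y(3) by (simp add: sum.reindex[OF Y(2)])
  finally have "tc u = 0" using ext_tc[OF uFP] by simp
  from tc_0_TI[OF uFP this] have uTI: "(\<Sum>y\<in>Y. frag_of (a y, y)) \<in> TI" unfolding u_def .
  have "a y = \<zero>\<^bsub>A\<^esub>" if "y \<in> Y" for y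
    by (rule independent_tensor[OF fY Y(1) _ _ uTI that]) (use E(3) Y(3) a in simp_all)
  then show ?thesis using a Y(3) \<rho>_hom(4) by auto
qed

theorem tensor_map_T: "tensor_map K A C u\<^sub>T \<rho>\<^sub>T \<mu>\<^sub>T \<chi>\<^sub>T"
  by (unfold_locales; (rule subf_\<chi> \<rho>_hom \<mu>_hom \<rho>_inj \<mu>_inj smult_hom disjoint_T; assumption?)?)

end

section \<open>Normalization\<close>

text \<open>Follows the order of \<open>ring.eval\<close>: the head is the leading coefficient and
  its exponent is the length of the rest.\<close>

primrec horner :: "'u::comm_ring_1 list \<Rightarrow> 'u \<Rightarrow> 'u" where
  "horner [] y = 0"
| "horner (c # cs) y = c * y ^ length cs + horner cs y"

context idf
begin

text \<open>All terms have degree less than \<open>length cs\<close>, so after multiplication by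
  that power of the inverse \<open>z\<close> each retains a factor \<open>z\<close>.\<close>

lemma horner_mult_inverse:
  assumes A: "subr A" and cs: "set cs \<subseteq> A" and z: "z \<in> A" "y * z = e" and ze: "e * y = y"
  shows "\<exists>w\<in>A. z ^ length cs * horner cs y = z * w"
  using cs
proof (induction cs)
  case Nil
  then show ?case using subr_0[OF A] by (intro bexI[of _ 0]) simp_all
next
  case (Cons c cs)
  then obtain w where w: "w \<in> A" "z ^ length cs * horner cs y = z * w" by auto
  have c: "c \<in> A" using Cons.prems by simp
  have "z ^ length cs * y ^ length cs * c = c"
  proof -
    have "c * (z ^ length cs * y ^ length cs) = c * (y * z) ^ length cs" by (simp add: power_mult_distrib mult.commute)
    also have "\<dots> = c" using z(2) subr_unit[OF A c] e_pow[of "length cs"]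
      by (cases "length cs = 0") (simp_all add: mult.commute)
    finally show ?thesis by (simp only: mult.commute)
  qed
  then have "z ^ length (c # cs) * horner (c # cs) y = z * (c + z * w)"
    using w(2) by (simp add: algebra_simps)
  then show ?case using subr_add[OF A c subr_mult[OF A z(1) w(1)]] by blast
qed

text \<open>A discrete valuation ring is integrally closed: otherwise the inverse \<open>z\<close> of an integral
  fraction is a non-unit that divides \<open>e\<close>.\<close>

lemma dvr_integrally_closed:
  assumes A: "subr A" and t: "t \<in> A" "t \<noteq> 0" "\<And>v. v \<in> A \<Longrightarrow> t * v \<noteq> e"
    and dvr: "\<And>s. s \<in> A \<Longrightarrow> s \<noteq> 0 \<Longrightarrow> \<exists>j u v. u \<in> A \<and> v \<in> A \<and> u * v = e \<and> s = u * t ^ j"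
    and y: "e * y = y" "b \<in> A" "b \<noteq> 0" "y * b \<in> A" and cs: "set cs \<subseteq> A" "e * y ^ length cs + horner cs y = 0"
  shows "y \<in> A"
proof (cases "y = 0")
  case True
  then show ?thesis using subr_0[OF A] by simp
next
  case False
  have yb: "y * b \<noteq> 0" using no_zero_div[OF y(1) _ subr_unit[OF A y(2)] False] y(3) by blast
  obtain j u v where b: "u \<in> A" "v \<in> A" "u * v = e" "b = u * t ^ j" using dvr[OF y(2,3)] by blast
  obtain i u' v' where yb': "u' \<in> A" "v' \<in> A" "u' * v' = e" "y * b = u' * t ^ i" using dvr[OF y(4) yb] by blast
  have te: "e * t = t" using subr_unit[OF A t(1)] .
  have ut: "y * (e * t ^ j) = v * u' * (e * t ^ i)"
  proof -
    have "y * (e * t ^ j) = (u * v) * (y * t ^ j)" using b(3) by (simp add: ac_simps)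
    also have "\<dots> = v * (y * b)" unfolding b(4) by (simp only: ac_simps)
    also have "\<dots> = e * (v * (u' * t ^ i))" unfolding yb'(4) using subr_unit[OF A b(2)] by (simp add: mult.assoc[symmetric])
    finally show ?thesis by (simp only: ac_simps)
  qed
  have tn: "e * t ^ j \<noteq> 0" for j
  proof (cases "j = 0")
    case False
    then show ?thesis using power_nz[OF te t(2)] pow_e[OF te] by simp
  qed (use e0 in simp)
  have tne: "e * (e * t ^ j) = e * t ^ j" for j using ee by (simp add: mult.assoc[symmetric])
  have tadd: "e * t ^ (i + j) = (e * t ^ i) * (e * t ^ j)" for i j
  proof -
    have "(e * t ^ i) * (e * t ^ j) = (e * e) * (t ^ i * t ^ j)" by (simp only: ac_simps)
    then show ?thesis unfolding ee by (simp add: power_add)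
  qed
  show ?thesis
  proof (cases "j \<le> i")
    case True
    define w where "w = v * u' * (e * t ^ (i - j))"
    have wA: "w \<in> A" unfolding w_def using subr_mult[OF A subr_mult[OF A b(2) yb'(1)] subr_pow[OF A t(1)]] .
    have tt: "e * t ^ i = (e * t ^ (i - j)) * (e * t ^ j)" using tadd[of "i - j" j] True by simp
    have "(e * t ^ j) * y = y * (e * t ^ j)" by (rule mult.commute)
    also have "\<dots> = (e * t ^ j) * w" unfolding ut w_def tt by (simp only: ac_simps)
    finally have "(e * t ^ j) * y = (e * t ^ j) * w" .
    then have "y = w" by (rule cancel[OF tne y(1) subr_unit[OF A wA] tn])
    then show ?thesis using wA by simp
  next
    case False
    then obtain k where k: "j = i + Suc k" using less_imp_Suc_add[of i j] by auto
    define z where "z = t * (e * t ^ k * u * v')"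
    have zA: "e * t ^ k * u * v' \<in> A" using subr_mult[OF A subr_mult[OF A subr_pow[OF A t(1)] b(1)] yb'(2)] .
    have zA': "z \<in> A" unfolding z_def by (rule subr_mult[OF A t(1) zA])
    have "(e * t ^ i) * (y * (e * t ^ Suc k)) = y * ((e * t ^ i) * (e * t ^ Suc k))" by (rule mult.left_commute)
    also have "\<dots> = y * (e * t ^ j)" unfolding k tadd ..
    also have "\<dots> = (e * t ^ i) * (v * u')" unfolding ut by (rule mult.commute)
    finally have "(e * t ^ i) * (y * (e * t ^ Suc k)) = (e * t ^ i) * (v * u')" .
    moreover have "e * (y * (e * t ^ Suc k)) = y * (e * t ^ Suc k)" using y(1) by (simp add: mult.assoc[symmetric])
    ultimately have yt: "y * (e * t ^ Suc k) = v * u'"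
      by (intro cancel[OF tne _ subr_unit[OF A subr_mult[OF A b(2) yb'(1)]] tn])
    have "y * z = (y * (e * t ^ Suc k)) * (u * v')" unfolding z_def by (simp add: ac_simps)
    also have "\<dots> = (u * v) * (u' * v')" unfolding yt by (simp only: ac_simps)
    finally have yz: "y * z = e" using b(3) yb'(3) ee by simp
    obtain w where w: "w \<in> A" "z ^ length cs * horner cs y = z * w"
      using horner_mult_inverse[OF A cs(1) zA' yz y(1)] by blast
    have "e * (z ^ length cs * y ^ length cs) = e"
    proof -
      have "e * (z ^ length cs * y ^ length cs) = e * (y * z) ^ length cs" by (simp add: power_mult_distrib mult.commute)
      then show ?thesis using yz ee e_pow[of "length cs"] by (cases "length cs = 0") simp_all
    qed
    moreover have "z ^ length cs * (e * y ^ length cs + horner cs y) = 0" using cs(2) by simp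
    ultimately have "e + z * w = 0" using w(2) by (simp add: distrib_left ac_simps)
    then have "e = - (z * w)" by (simp add: eq_neg_iff_add_eq_0)
    then have "z * - w = e" by simp
    then have "t * (e * t ^ k * u * v' * - w) = e" unfolding z_def by (simp only: mult.assoc)
    then show ?thesis using t(3) subr_mult[OF A zA subr_minus[OF A w(1)]] by blast
  qed
qed

end

text \<open>Frobenius is a ring map, so it acts on coefficients and argument separately.\<close>

lemma (in idf_char) horner_frob:
  assumes "e * y = y" "\<And>c. c \<in> set cs \<Longrightarrow> e * c = c"
  shows "e * horner cs y = horner cs y \<and> horner cs y ^ p = horner (map (\<lambda>c. c ^ p) cs) (y ^ p)"
  using assms(2)
proof (induction cs)
  case Nil
  then show ?case using p0 by (simp add: power_0_left)
next
  case (Cons c cs)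
  have ce: "e * (c * y ^ length cs) = c * y ^ length cs" using Cons.prems[of c] by (simp add: mult.assoc[symmetric])
  have IH: "e * horner cs y = horner cs y" "horner cs y ^ p = horner (map (\<lambda>c. c ^ p) cs) (y ^ p)" using Cons by auto
  have "(y ^ length cs) ^ p = (y ^ p) ^ length cs" by (simp add: power_mult[symmetric] mult.commute)
  then show ?case using frob[OF ce IH(1)] ce IH by (simp add: power_mult_distrib distrib_left)
qed

lemma (in ring_embedding) image_subr: "subr (\<phi> ` carrier A)"
proof (rule subrI)
  fix x y assume "x \<in> \<phi> ` carrier A" "y \<in> \<phi> ` carrier A"
  then obtain a b where ab: "a \<in> carrier A" "x = \<phi> a" "b \<in> carrier A" "y = \<phi> b" by blast
  obtain b' where b': "b' \<in> carrier A" "\<phi> b' = - \<phi> b" using neg_closed[OF ab(3)] by blast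
  have "x - y = \<phi> (a \<oplus> b')" using \<phi>_add[OF ab(1) b'(1)] ab b' by simp
  then show "x - y \<in> \<phi> ` carrier A" using add_closed[OF ab(1) b'(1)] by blast
  show "x * y \<in> \<phi> ` carrier A" using \<phi>_mult[OF ab(1,3)] mult_closed[OF ab(1,3)] ab(2,4) by (metis imageI)
qed (use \<phi>_e \<phi>_one unit_closed(2) in \<open>auto intro: image_eqI[of e \<phi> "\<one>"]\<close>)

text \<open>A domain \<open>D\<close> that the p-th power maps into a discrete valuation ring
  \<open>A\<close> inside it. Integrality over \<open>D\<close> then becomes a condition on p-th
  powers. The instances are \<open>T1\<close> over \<open>R\<close> and \<open>T2\<close> over
  \<open>S1\<close>.\<close>

locale normalized = idf_char e p + ring_embedding e D \<phi>
  for e :: "'u::comm_ring_1" and p and D :: "('k, 'a, 'm) module_scheme" and \<phi> :: "'a \<Rightarrow> 'u" +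
  fixes A :: "'u set" and t :: 'u
  assumes A: "subr A" and AD: "A \<subseteq> \<phi> ` carrier D" and t: "t \<in> A" "t \<noteq> 0" "\<And>v. v \<in> A \<Longrightarrow> t * v \<noteq> e"
    and dvr: "\<And>s. s \<in> A \<Longrightarrow> s \<noteq> 0 \<Longrightarrow> \<exists>j u v. u \<in> A \<and> v \<in> A \<and> u * v = e \<and> s = u * t ^ j"
    and D_pow: "\<And>m. m \<in> carrier D \<Longrightarrow> \<phi> m ^ p \<in> A"
begin

sublocale D: domain D by (rule domain)

abbreviation "Fr \<equiv> frac_field D"

lemma field_Fr: "field Fr" by (rule D.frac_field_field)

sublocale Fr: field Fr by (rule field_Fr)

text \<open>The extension of \<open>\<phi>\<close> to fractions. The value solves
  \<open>z * \<phi> b = \<phi> a\<close>; by \<open>frmap_eq\<close> all representatives have the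
  same solution.\<close>

definition frmap :: "('a \<times> 'a) set \<Rightarrow> 'u" where
  "frmap x = (SOME z. e * z = z \<and>
    (\<exists>a b. a \<in> carrier D \<and> b \<in> carrier D \<and> b \<noteq> \<zero>\<^bsub>D\<^esub> \<and> x = fraction D a b \<and> z * \<phi> b = \<phi> a))"

lemma \<phi>_nz: "b \<in> carrier D \<Longrightarrow> b \<noteq> \<zero>\<^bsub>D\<^esub> \<Longrightarrow> \<phi> b \<noteq> 0" using \<phi>_inj[OF _ unit_closed(1)] \<phi>_zero by metis

lemma frmap_eq:
  assumes ab: "a \<in> carrier D" "b \<in> carrier D" "b \<noteq> \<zero>\<^bsub>D\<^esub>" and z: "e * z = z" "z * \<phi> b = \<phi> a"
  shows "frmap (fraction D a b) = z"
  unfolding frmap_def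
proof (rule some_equality)
  show "e * z = z \<and> (\<exists>a' b'. a' \<in> carrier D \<and> b' \<in> carrier D \<and> b' \<noteq> \<zero>\<^bsub>D\<^esub> \<and>
    fraction D a b = fraction D a' b' \<and> z * \<phi> b' = \<phi> a')" using assms by blast
  fix w assume "e * w = w \<and> (\<exists>a' b'. a' \<in> carrier D \<and> b' \<in> carrier D \<and> b' \<noteq> \<zero>\<^bsub>D\<^esub> \<and>
    fraction D a b = fraction D a' b' \<and> w * \<phi> b' = \<phi> a')"
  then obtain a' b' where w: "e * w = w" "a' \<in> carrier D" "b' \<in> carrier D" "b' \<noteq> \<zero>\<^bsub>D\<^esub>"
    "fraction D a b = fraction D a' b'" "w * \<phi> b' = \<phi> a'" by blast
  have "a \<otimes>\<^bsub>D\<^esub> b' = a' \<otimes>\<^bsub>D\<^esub> b" using D.fraction_eq[OF ab w(2-4)] w(5) by simp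
  then have eq: "\<phi> a * \<phi> b' = \<phi> a' * \<phi> b" using \<phi>_mult ab w by metis
  have "(\<phi> b * \<phi> b') * w = (\<phi> b * \<phi> b') * z"
    using eq unfolding z(2)[symmetric] w(6)[symmetric] by (simp add: ac_simps)
  moreover have "\<phi> b * \<phi> b' \<noteq> 0"
    using no_zero_div[OF \<phi>_e[OF ab(2)] _ \<phi>_e[OF w(3)] \<phi>_nz[OF ab(2,3)]] \<phi>_nz[OF w(3,4)] by blast
  moreover have "e * (\<phi> b * \<phi> b') = \<phi> b * \<phi> b'" using \<phi>_e[OF ab(2)] by (simp add: mult.assoc[symmetric])
  ultimately show "w = z" using cancel[OF _ w(1) z(1)] by blast
qed

lemma frmap_cases:
  assumes "x \<in> carrier Fr"
  obtains a b where "a \<in> carrier D" "b \<in> carrier D" "b \<noteq> \<zero>\<^bsub>D\<^esub>" "x = fraction D a b"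
    "e * frmap x = frmap x" "frmap x * \<phi> b = \<phi> a"
proof -
  from assms obtain a b where ab: "a \<in> carrier D" "b \<in> carrier D" "b \<noteq> \<zero>\<^bsub>D\<^esub>" "x = fraction D a b"
    by (rule D.fraction_cases)
  obtain y where y: "e * y = y" "\<phi> b * y = e" using ex_inverse[OF \<phi>_e[OF ab(2)] \<phi>_nz[OF ab(2,3)]] by blast
  have z: "e * (\<phi> a * y) = \<phi> a * y" "(\<phi> a * y) * \<phi> b = \<phi> a"
  proof -
    show "e * (\<phi> a * y) = \<phi> a * y" using \<phi>_e[OF ab(1)] by (simp add: mult.assoc[symmetric])
    have "(\<phi> a * y) * \<phi> b = (\<phi> b * y) * \<phi> a" by (simp only: ac_simps)
    then show "(\<phi> a * y) * \<phi> b = \<phi> a" using y \<phi>_e[OF ab(1)] by simp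
  qed
  have "frmap x = \<phi> a * y" unfolding ab(4) by (rule frmap_eq[OF ab(1-3) z])
  then show ?thesis using that[OF ab] z by simp
qed

lemma frmap_to_frac: "a \<in> carrier D \<Longrightarrow> frmap (to_frac D a) = \<phi> a"
  unfolding to_frac_def using \<phi>_one \<phi>_e by (intro frmap_eq) (simp_all add: mult.commute)

lemma to_frac_closed: "a \<in> carrier D \<Longrightarrow> to_frac D a \<in> carrier Fr"
  unfolding to_frac_def by (intro D.fraction_closed) auto

lemma frmap_hom:
  assumes "x \<in> carrier Fr" "y \<in> carrier Fr"
  shows "frmap (x \<otimes>\<^bsub>Fr\<^esub> y) = frmap x * frmap y" "frmap (x \<oplus>\<^bsub>Fr\<^esub> y) = frmap x + frmap y"
    "frmap x = frmap y \<Longrightarrow> x = y"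
proof -
  from assms(1) obtain a b where x: "a \<in> carrier D" "b \<in> carrier D" "b \<noteq> \<zero>\<^bsub>D\<^esub>" "x = fraction D a b"
    "e * frmap x = frmap x" "frmap x * \<phi> b = \<phi> a" by (rule frmap_cases)
  from assms(2) obtain c d where y: "c \<in> carrier D" "d \<in> carrier D" "d \<noteq> \<zero>\<^bsub>D\<^esub>" "y = fraction D c d"
    "e * frmap y = frmap y" "frmap y * \<phi> d = \<phi> c" by (rule frmap_cases)
  have bd: "b \<otimes>\<^bsub>D\<^esub> d \<in> carrier D" "b \<otimes>\<^bsub>D\<^esub> d \<noteq> \<zero>\<^bsub>D\<^esub>" using x y by (auto simp: D.integral_iff)
  have xm: "x \<otimes>\<^bsub>Fr\<^esub> y = fraction D (a \<otimes>\<^bsub>D\<^esub> c) (b \<otimes>\<^bsub>D\<^esub> d)"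
    unfolding x(4) y(4) by (rule D.fraction_mult[OF x(1-3) y(1-3)])
  have xa: "x \<oplus>\<^bsub>Fr\<^esub> y = fraction D (a \<otimes>\<^bsub>D\<^esub> d \<oplus>\<^bsub>D\<^esub> c \<otimes>\<^bsub>D\<^esub> b) (b \<otimes>\<^bsub>D\<^esub> d)"
    unfolding x(4) y(4) by (rule D.fraction_add[OF x(1-3) y(1-3)])
  show "frmap (x \<otimes>\<^bsub>Fr\<^esub> y) = frmap x * frmap y"
    unfolding xm
  proof (rule frmap_eq[OF _ bd])
    show "e * (frmap x * frmap y) = frmap x * frmap y" using x(5) by (simp add: mult.assoc[symmetric])
    have "frmap x * frmap y * (\<phi> b * \<phi> d) = (frmap x * \<phi> b) * (frmap y * \<phi> d)" by (simp only: ac_simps)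
    then show "frmap x * frmap y * \<phi> (b \<otimes>\<^bsub>D\<^esub> d) = \<phi> (a \<otimes>\<^bsub>D\<^esub> c)"
      unfolding \<phi>_mult[OF x(2) y(2)] \<phi>_mult[OF x(1) y(1)] x(6) y(6) .
  qed (use x y in simp)
  show "frmap (x \<oplus>\<^bsub>Fr\<^esub> y) = frmap x + frmap y"
    unfolding xa
  proof (rule frmap_eq[OF _ bd])
    show "e * (frmap x + frmap y) = frmap x + frmap y" using x(5) y(5) by (simp add: distrib_left)
    have "(frmap x + frmap y) * (\<phi> b * \<phi> d) = (frmap x * \<phi> b) * \<phi> d + (frmap y * \<phi> d) * \<phi> b" by (simp add: algebra_simps)
    moreover have "\<phi> (a \<otimes>\<^bsub>D\<^esub> d \<oplus>\<^bsub>D\<^esub> c \<otimes>\<^bsub>D\<^esub> b) = \<phi> a * \<phi> d + \<phi> c * \<phi> b"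
      using x y by (subst \<phi>_add) (simp_all add: \<phi>_mult)
    ultimately show "(frmap x + frmap y) * \<phi> (b \<otimes>\<^bsub>D\<^esub> d) = \<phi> (a \<otimes>\<^bsub>D\<^esub> d \<oplus>\<^bsub>D\<^esub> c \<otimes>\<^bsub>D\<^esub> b)"
      unfolding \<phi>_mult[OF x(2) y(2)] x(6) y(6) by simp
  qed (use x y in simp)
  assume eq: "frmap x = frmap y"
  have "\<phi> a * \<phi> d = \<phi> c * \<phi> b" unfolding x(6)[symmetric] y(6)[symmetric] eq by (simp only: ac_simps)
  then have "a \<otimes>\<^bsub>D\<^esub> d = c \<otimes>\<^bsub>D\<^esub> b" by (intro \<phi>_inj) (use x y in \<open>simp_all add: \<phi>_mult\<close>)
  then show "x = y" unfolding x(4) y(4) using D.fraction_eq[OF x(1-3) y(1-3)] by simp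
qed

lemma frmap_e: "x \<in> carrier Fr \<Longrightarrow> e * frmap x = frmap x" by (erule frmap_cases)

lemma frmap_one: "frmap \<one>\<^bsub>Fr\<^esub> = e" and frmap_zero: "frmap \<zero>\<^bsub>Fr\<^esub> = 0"
  using frmap_to_frac[of "\<one>\<^bsub>D\<^esub>"] frmap_to_frac[of "\<zero>\<^bsub>D\<^esub>"] \<phi>_one \<phi>_zero
  unfolding D.frac_one D.frac_zero to_frac_def by simp_all

lemma frmap_pow: "x \<in> carrier Fr \<Longrightarrow> frmap (x [^]\<^bsub>Fr\<^esub> (n::nat)) = e * frmap x ^ n"
proof (induction n)
  case 0
  then show ?case by (simp add: frmap_one)
next
  case (Suc n)
  then show ?case using frmap_hom(1)[of "x [^]\<^bsub>Fr\<^esub> n" x] by (simp add: ac_simps)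
qed

lemma frmap_eval:
  assumes "set P \<subseteq> carrier Fr" "x \<in> carrier Fr"
  shows "Fr.eval P x \<in> carrier Fr" "frmap (Fr.eval P x) = horner (map frmap P) (frmap x)"
  using assms(1)
proof (induction P)
  case Nil
  { case 1 then show ?case by simp }
  { case 2 then show ?case by (simp add: frmap_zero) }
next
  case (Cons c P)
  { case 1 then show ?case using Cons assms(2) by simp }
  { case 2
    then have c: "c \<in> carrier Fr" and P: "set P \<subseteq> carrier Fr" by auto
    have "frmap (c \<otimes>\<^bsub>Fr\<^esub> x [^]\<^bsub>Fr\<^esub> length P) = frmap c * frmap x ^ length P"
      using frmap_hom(1)[OF c, of "x [^]\<^bsub>Fr\<^esub> length P"] frmap_pow[OF assms(2)] assms(2) frmap_e[OF c]
      by (simp add: e_absorb)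
    then show ?case using frmap_hom(2)[of "c \<otimes>\<^bsub>Fr\<^esub> x [^]\<^bsub>Fr\<^esub> length P" "Fr.eval P x"] Cons.IH[OF P] c assms(2) by simp }
qed

lemma frac_power:
  assumes "x \<in> carrier Fr"
  shows "\<exists>b\<in>A. b \<noteq> 0 \<and> frmap x ^ p * b \<in> A"
proof -
  from assms obtain a b where x: "a \<in> carrier D" "b \<in> carrier D" "b \<noteq> \<zero>\<^bsub>D\<^esub>" "x = fraction D a b"
    "e * frmap x = frmap x" "frmap x * \<phi> b = \<phi> a" by (rule frmap_cases)
  have "frmap x ^ p * \<phi> b ^ p = \<phi> a ^ p" unfolding x(6)[symmetric] by (simp add: power_mult_distrib)
  then show ?thesis
    using D_pow[OF x(1)] D_pow[OF x(2)] power_nz[OF \<phi>_e[OF x(2)] \<phi>_nz[OF x(2,3)] p0] by (intro bexI[of _ "\<phi> b ^ p"]) simp_all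
qed

text \<open>The p-th power of an integral equation for \<open>x\<close> is one for
  \<open>x ^ p\<close> with coefficients in \<open>A\<close>, which is integrally closed. Conversely
  \<open>x\<close> is a root of \<open>X^p - x^p\<close>, whose coefficients lie in \<open>A\<close>
  and hence in \<open>D\<close>.\<close>

lemma integral_iff:
  assumes x: "x \<in> carrier Fr"
  shows "integral_over Fr (to_frac D ` carrier D) x \<longleftrightarrow> frmap x ^ p \<in> A"
proof
  assume "integral_over Fr (to_frac D ` carrier D) x"
  then obtain P where P: "P \<in> carrier (univ_poly Fr (to_frac D ` carrier D))" "P \<noteq> []" "hd P = \<one>\<^bsub>Fr\<^esub>"
    "Fr.eval P x = \<zero>\<^bsub>Fr\<^esub>" unfolding integral_over_def by blast
  then obtain Q where Q: "P = \<one>\<^bsub>Fr\<^esub> # Q" by (cases P) auto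
  have PD: "set P \<subseteq> to_frac D ` carrier D" using P(1,2) unfolding univ_poly_def polynomial_def by auto
  then have PF: "set P \<subseteq> carrier Fr" using to_frac_closed by blast
  have h: "e * frmap x ^ length Q + horner (map frmap Q) (frmap x) = 0"
    using frmap_eval(2)[OF PF x] P(4) frmap_zero frmap_one unfolding Q by simp
  have Qe: "\<And>c. c \<in> set (map frmap Q) \<Longrightarrow> e * c = c" using PF Q frmap_e by auto
  have he: "e * horner (map frmap Q) (frmap x) = horner (map frmap Q) (frmap x)"
    and hp: "horner (map frmap Q) (frmap x) ^ p = horner (map (\<lambda>c. c ^ p) (map frmap Q)) (frmap x ^ p)"
    using horner_frob[OF frmap_e[OF x] Qe] by blast+
  have e1: "e * (e * frmap x ^ length Q) = e * frmap x ^ length Q" using ee by (simp add: mult.assoc[symmetric])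
  have "(e * frmap x ^ length Q + horner (map frmap Q) (frmap x)) ^ p = 0" unfolding h using p0 by (simp add: power_0_left)
  then have "(e * frmap x ^ length Q) ^ p + horner (map (\<lambda>c. c ^ p) (map frmap Q)) (frmap x ^ p) = 0"
    unfolding frob[OF e1 he] hp .
  moreover have "(e * frmap x ^ length Q) ^ p = e * (frmap x ^ p) ^ length (map (\<lambda>c. c ^ p) (map frmap Q))"
    by (simp add: power_mult_distrib e_pow[OF p0] power_mult[symmetric] mult.commute)
  ultimately have rel: "e * (frmap x ^ p) ^ length (map (\<lambda>c. c ^ p) (map frmap Q))
      + horner (map (\<lambda>c. c ^ p) (map frmap Q)) (frmap x ^ p) = 0" by simp
  have cA: "set (map (\<lambda>c. c ^ p) (map frmap Q)) \<subseteq> A"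
  proof
    fix c assume "c \<in> set (map (\<lambda>c. c ^ p) (map frmap Q))"
    then obtain q where q: "q \<in> set Q" "c = frmap q ^ p" by auto
    then obtain a where "a \<in> carrier D" "q = to_frac D a" using PD Q by auto
    then show "c \<in> A" using q(2) frmap_to_frac D_pow by simp
  qed
  obtain b where b: "b \<in> A" "b \<noteq> 0" "frmap x ^ p * b \<in> A" using frac_power[OF x] by blast
  show "frmap x ^ p \<in> A" by (rule dvr_integrally_closed[OF A t dvr pow_e[OF frmap_e[OF x] p0] b cA rel])
next
  assume xp: "frmap x ^ p \<in> A"
  obtain a where a: "a \<in> carrier D" "frmap x ^ p = \<phi> a" using xp AD by blast
  obtain a' where a': "a' \<in> carrier D" "\<phi> a' = - \<phi> a" using neg_closed[OF a(1)] by blast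
  \<comment> \<open>\<open>X^p - a\<close>, with the leading coefficient first and
    \<open>p - 1\<close> zeros in between.\<close>
  define P where "P = \<one>\<^bsub>Fr\<^esub> # replicate (p - 1) \<zero>\<^bsub>Fr\<^esub> @ [to_frac D a']"
  have oz: "\<one>\<^bsub>Fr\<^esub> \<in> to_frac D ` carrier D" "\<zero>\<^bsub>Fr\<^esub> \<in> to_frac D ` carrier D"
    unfolding D.frac_one D.frac_zero to_frac_def by auto
  have PD: "set P \<subseteq> to_frac D ` carrier D" unfolding P_def using oz a'(1) by auto
  have PF: "set P \<subseteq> carrier Fr" using PD to_frac_closed by blast
  have hz: "horner (replicate n 0 @ [c]) y = c" for n and c y :: 'u by (induction n) simp_all
  have "horner (map frmap P) (frmap x) = e * frmap x ^ p - \<phi> a"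
    unfolding P_def using p0 a' by (simp add: frmap_one frmap_zero frmap_to_frac hz)
  also have "\<dots> = 0" using pow_e[OF frmap_e[OF x] p0] a(2) by simp
  finally have "frmap (Fr.eval P x) = frmap \<zero>\<^bsub>Fr\<^esub>" using frmap_eval(2)[OF PF x] frmap_zero by simp
  then have "Fr.eval P x = \<zero>\<^bsub>Fr\<^esub>" by (rule frmap_hom(3)[OF frmap_eval(1)[OF PF x] Fr.zero_closed])
  moreover have "P \<in> carrier (univ_poly Fr (to_frac D ` carrier D))"
    using PD unfolding univ_poly_def polynomial_def by (simp add: P_def)
  moreover have "P \<noteq> []" "hd P = \<one>\<^bsub>Fr\<^esub>" unfolding P_def by simp_all
  ultimately show "integral_over Fr (to_frac D ` carrier D) x" unfolding integral_over_def by blast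
qed

abbreviation "N \<equiv> normalization D"

lemma N_simps:
  "carrier N = {x \<in> carrier Fr. integral_over Fr (to_frac D ` carrier D) x}" "monoid.mult N = monoid.mult Fr"
  "ring.add N = ring.add Fr" "\<one>\<^bsub>N\<^esub> = \<one>\<^bsub>Fr\<^esub>" "\<zero>\<^bsub>N\<^esub> = \<zero>\<^bsub>Fr\<^esub>"
  "k \<odot>\<^bsub>N\<^esub> x = to_frac D (k \<odot>\<^bsub>D\<^esub> \<one>\<^bsub>D\<^esub>) \<otimes>\<^bsub>Fr\<^esub> x"
  unfolding normalization_def algebra_via_def by simp_all

lemma N_mem: "x \<in> carrier N \<longleftrightarrow> x \<in> carrier Fr \<and> frmap x ^ p \<in> A"
  unfolding N_simps using integral_iff by auto

lemma N_image: "frmap ` carrier N = frob_closure (\<phi> ` carrier D) A"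
proof
  show "frmap ` carrier N \<subseteq> frob_closure (\<phi> ` carrier D) A"
  proof
    fix z assume "z \<in> frmap ` carrier N"
    then obtain x where x: "x \<in> carrier Fr" "frmap x ^ p \<in> A" "z = frmap x" using N_mem by blast
    from x(1) obtain a b where ab: "a \<in> carrier D" "b \<in> carrier D" "b \<noteq> \<zero>\<^bsub>D\<^esub>" "x = fraction D a b"
      "e * frmap x = frmap x" "frmap x * \<phi> b = \<phi> a" by (rule frmap_cases)
    show "z \<in> frob_closure (\<phi> ` carrier D) A"
      unfolding x(3) using ab x(2) \<phi>_nz by (intro frob_closureI[of _ "\<phi> b"]) simp_all
  qed
  show "frob_closure (\<phi> ` carrier D) A \<subseteq> frmap ` carrier N"
  proof
    fix z assume "z \<in> frob_closure (\<phi> ` carrier D) A"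
    then obtain a b where z: "e * z = z" "a \<in> carrier D" "b \<in> carrier D" "\<phi> b \<noteq> 0" "z * \<phi> b = \<phi> a" "z ^ p \<in> A"
      unfolding frob_closure_def by blast
    have b0: "b \<noteq> \<zero>\<^bsub>D\<^esub>" using z(4) \<phi>_zero by auto
    have "frmap (fraction D a b) = z" by (rule frmap_eq[OF z(2,3) b0 z(1,5)])
    moreover have "fraction D a b \<in> carrier N"
      using N_mem D.fraction_closed[OF z(2,3) b0] calculation z(6) by simp
    ultimately show "z \<in> frmap ` carrier N" by blast
  qed
qed

text \<open>Closure under the operations is that of \<open>frob_closure\<close>, where it follows
  from Frobenius, in place of sums and products of integral elements.\<close>

lemma N_embedding: "ring_embedding e N frmap"
proof -
  have DM: "subr (\<phi> ` carrier D)" by (rule image_subr)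
  have S: "subr (frmap ` carrier N)" unfolding N_image by (rule frob_closure_subr[OF DM A])
  have NF: "x \<in> carrier Fr" if "x \<in> carrier N" for x using that N_mem by blast
  have in_N: "x \<in> carrier N" if x: "x \<in> carrier Fr" "frmap x \<in> frmap ` carrier N" for x
  proof -
    obtain y where y: "y \<in> carrier N" "frmap x = frmap y" using x(2) by blast
    then show ?thesis using frmap_hom(3)[OF x(1) NF[OF y(1)]] by simp
  qed
  show ?thesis
  proof
    show "\<zero>\<^bsub>N\<^esub> \<in> carrier N" by (rule in_N) (use frmap_zero subr_0[OF S] in \<open>simp_all add: N_simps(5)\<close>)
    show "\<one>\<^bsub>N\<^esub> \<in> carrier N" by (rule in_N) (use frmap_one subr_e[OF S] in \<open>simp_all add: N_simps(4)\<close>)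
    show "frmap \<zero>\<^bsub>N\<^esub> = 0" "frmap \<one>\<^bsub>N\<^esub> = e" unfolding N_simps by (rule frmap_zero, rule frmap_one)
    fix x assume x: "x \<in> carrier N"
    show "e * frmap x = frmap x" by (rule frmap_e[OF NF[OF x]])
    have "- frmap x \<in> frmap ` carrier N" using subr_minus[OF S] x by blast
    then show "\<exists>y\<in>carrier N. frmap y = - frmap x" by force
    fix y assume y: "y \<in> carrier N"
    note xy = NF[OF x] NF[OF y]
    show "frmap (x \<oplus>\<^bsub>N\<^esub> y) = frmap x + frmap y" unfolding N_simps by (rule frmap_hom(2)[OF xy])
    show "frmap (x \<otimes>\<^bsub>N\<^esub> y) = frmap x * frmap y" unfolding N_simps by (rule frmap_hom(1)[OF xy])
    show "x \<oplus>\<^bsub>N\<^esub> y \<in> carrier N"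
      by (rule in_N) (use xy x y frmap_hom(2)[OF xy] subr_add[OF S, of "frmap x" "frmap y"] in \<open>simp_all add: N_simps(3)\<close>)
    show "x \<otimes>\<^bsub>N\<^esub> y \<in> carrier N"
      by (rule in_N) (use xy x y frmap_hom(1)[OF xy] subr_mult[OF S, of "frmap x" "frmap y"] in \<open>simp_all add: N_simps(2)\<close>)
    show "frmap x = frmap y \<Longrightarrow> x = y" by (rule frmap_hom(3)[OF xy])
  qed
qed

lemma to_frac_image: "frmap ` to_frac D ` carrier D = \<phi> ` carrier D"
  unfolding image_image using frmap_to_frac by auto

lemma to_frac_N: "to_frac D ` carrier D \<subseteq> carrier N"
  using N_mem to_frac_closed frmap_to_frac D_pow by auto

lemma N_smult:
  assumes "k \<odot>\<^bsub>D\<^esub> \<one>\<^bsub>D\<^esub> \<in> carrier D" "x \<in> carrier N"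
  shows "frmap (k \<odot>\<^bsub>N\<^esub> x) = \<phi> (k \<odot>\<^bsub>D\<^esub> \<one>\<^bsub>D\<^esub>) * frmap x" "k \<odot>\<^bsub>N\<^esub> x \<in> carrier N"
proof -
  interpret N: ring_embedding e N frmap by (rule N_embedding)
  have xF: "x \<in> carrier Fr" using assms(2) N_mem by blast
  have tN: "to_frac D (k \<odot>\<^bsub>D\<^esub> \<one>\<^bsub>D\<^esub>) \<in> carrier N" using to_frac_N assms(1) by blast
  show "frmap (k \<odot>\<^bsub>N\<^esub> x) = \<phi> (k \<odot>\<^bsub>D\<^esub> \<one>\<^bsub>D\<^esub>) * frmap x"
    unfolding N_simps frmap_hom(1)[OF to_frac_closed[OF assms(1)] xF] frmap_to_frac[OF assms(1)] ..
  show "k \<odot>\<^bsub>N\<^esub> x \<in> carrier N" unfolding N_simps(6) using N.mult_closed[OF tN assms(2)] unfolding N_simps(2) .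
qed

end

section \<open>Quotient spaces\<close>

locale scalar_embedding = ring_embedding e M \<psi>
  for e :: "'u::comm_ring_1" and M :: "('k, 'a, 'm) module_scheme" and \<psi> :: "'a \<Rightarrow> 'u" +
  fixes K :: "('k, 'l) ring_scheme" and \<chi> :: "'k \<Rightarrow> 'u"
  assumes cringK: "cring K"
    and \<chi>_add: "\<And>k l. k \<in> carrier K \<Longrightarrow> l \<in> carrier K \<Longrightarrow> \<chi> (k \<oplus>\<^bsub>K\<^esub> l) = \<chi> k + \<chi> l"
    and \<chi>_mult: "\<And>k l. k \<in> carrier K \<Longrightarrow> l \<in> carrier K \<Longrightarrow> \<chi> (k \<otimes>\<^bsub>K\<^esub> l) = \<chi> k * \<chi> l"
    and \<chi>_one: "\<chi> \<one>\<^bsub>K\<^esub> = e"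
    and smult_cl: "\<And>k x. k \<in> carrier K \<Longrightarrow> x \<in> carrier M \<Longrightarrow> k \<odot>\<^bsub>M\<^esub> x \<in> carrier M"
    and \<psi>_smult: "\<And>k x. k \<in> carrier K \<Longrightarrow> x \<in> carrier M \<Longrightarrow> \<psi> (k \<odot>\<^bsub>M\<^esub> x) = \<chi> k * \<psi> x"
begin

lemma algebra_M: "algebra K M"
proof -
  interpret K: cring K by (rule cringK)
  interpret D: domain M by (rule domain)
  show ?thesis
  proof (rule algebraI)
    fix x assume x: "x \<in> carrier M"
    show "\<one>\<^bsub>K\<^esub> \<odot>\<^bsub>M\<^esub> x = x"
      by (rule \<phi>_inj) (use x \<phi>_e[OF x] in \<open>simp_all add: smult_cl \<psi>_smult \<chi>_one\<close>)
    fix a b y assume a: "a \<in> carrier K"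
    { assume b: "b \<in> carrier K"
      show "(a \<oplus>\<^bsub>K\<^esub> b) \<odot>\<^bsub>M\<^esub> x = a \<odot>\<^bsub>M\<^esub> x \<oplus>\<^bsub>M\<^esub> b \<odot>\<^bsub>M\<^esub> x"
        by (rule \<phi>_inj) (use a b x in \<open>simp_all add: smult_cl \<psi>_smult \<chi>_add \<phi>_add distrib_right\<close>)
      show "(a \<otimes>\<^bsub>K\<^esub> b) \<odot>\<^bsub>M\<^esub> x = a \<odot>\<^bsub>M\<^esub> (b \<odot>\<^bsub>M\<^esub> x)"
        by (rule \<phi>_inj) (use a b x in \<open>simp_all add: smult_cl \<psi>_smult \<chi>_mult mult.assoc\<close>) }
    assume y: "y \<in> carrier M"
    show "a \<odot>\<^bsub>M\<^esub> (x \<oplus>\<^bsub>M\<^esub> y) = a \<odot>\<^bsub>M\<^esub> x \<oplus>\<^bsub>M\<^esub> a \<odot>\<^bsub>M\<^esub> y"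
      by (rule \<phi>_inj) (use a x y in \<open>simp_all add: smult_cl \<psi>_smult \<phi>_add distrib_left\<close>)
    show "a \<odot>\<^bsub>M\<^esub> x \<otimes>\<^bsub>M\<^esub> y = a \<odot>\<^bsub>M\<^esub> (x \<otimes>\<^bsub>M\<^esub> y)"
      by (rule \<phi>_inj) (use a x y in \<open>simp_all add: smult_cl \<psi>_smult \<phi>_mult mult.assoc\<close>)
  qed (use cringK D.cring_axioms smult_cl in auto)
qed

end

locale subspace_embedding = scalar_embedding e M \<psi> K \<chi>
  for e :: "'u::comm_ring_1" and M :: "('k, 'a, 'm) module_scheme" and \<psi> :: "'a \<Rightarrow> 'u"
    and K :: "('k, 'l) ring_scheme" and \<chi> :: "'k \<Rightarrow> 'u" +
  fixes H :: "'a set"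
  assumes fieldK: "field K" and HM: "H \<subseteq> carrier M" and H: "sm (\<chi> ` carrier K) (\<psi> ` H)"
begin

abbreviation "cls x \<equiv> H +>\<^bsub>M\<^esub> x"
abbreviation "HU \<equiv> \<psi> ` H"
abbreviation "L \<equiv> \<chi> ` carrier K"

lemma ex_diff:
  assumes "x \<in> carrier M" "y \<in> carrier M" shows "\<exists>z\<in>carrier M. \<psi> z = \<psi> x - \<psi> y"
proof -
  obtain y' where "y' \<in> carrier M" "\<psi> y' = - \<psi> y" using neg_closed[OF assms(2)] by blast
  then show ?thesis using \<phi>_add[OF assms(1), of y'] add_closed[OF assms(1), of y'] by (intro bexI[of _ "x \<oplus>\<^bsub>M\<^esub> y'"]) simp_all
qed

lemma mem_cls:
  assumes x: "x \<in> carrier M" shows "z \<in> cls x \<longleftrightarrow> z \<in> carrier M \<and> \<psi> z - \<psi> x \<in> HU"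
proof
  assume "z \<in> cls x"
  then obtain h where h: "h \<in> H" "z = h \<oplus>\<^bsub>M\<^esub> x" unfolding a_r_coset_def' by blast
  then have hM: "h \<in> carrier M" using HM by blast
  show "z \<in> carrier M \<and> \<psi> z - \<psi> x \<in> HU" unfolding h(2) \<phi>_add[OF hM x] using add_closed[OF hM x] h(1) by simp
next
  assume z: "z \<in> carrier M \<and> \<psi> z - \<psi> x \<in> HU"
  then obtain h where h: "h \<in> H" "\<psi> z - \<psi> x = \<psi> h" by blast
  then have hM: "h \<in> carrier M" using HM by blast
  have "\<psi> (h \<oplus>\<^bsub>M\<^esub> x) = \<psi> z" unfolding \<phi>_add[OF hM x] h(2)[symmetric] by simp
  then have "h \<oplus>\<^bsub>M\<^esub> x = z" by (rule \<phi>_inj[OF add_closed[OF hM x] conjunct1[OF z]])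
  then show "z \<in> cls x" unfolding a_r_coset_def' using h(1) by blast
qed

lemma cls_eq:
  assumes x: "x \<in> carrier M" and y: "y \<in> carrier M" shows "cls x = cls y \<longleftrightarrow> \<psi> x - \<psi> y \<in> HU"
proof
  assume "cls x = cls y"
  moreover have "x \<in> cls x" using mem_cls[OF x] x sm_0[OF H] by simp
  ultimately show "\<psi> x - \<psi> y \<in> HU" using mem_cls[OF y] by blast
next
  assume d: "\<psi> x - \<psi> y \<in> HU"
  have "z \<in> cls x \<longleftrightarrow> z \<in> cls y" for z
  proof
    assume "z \<in> cls x"
    then have z: "z \<in> carrier M" "\<psi> z - \<psi> x \<in> HU" using mem_cls[OF x] by blast+
    have "\<psi> z - \<psi> y \<in> HU" using sm_add[OF H z(2) d] by simp
    then show "z \<in> cls y" using mem_cls[OF y] z(1) by blast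
  next
    assume "z \<in> cls y"
    then have z: "z \<in> carrier M" "\<psi> z - \<psi> y \<in> HU" using mem_cls[OF y] by blast+
    have "\<psi> z - \<psi> x \<in> HU" using sm_diff[OF H z(2) d] by simp
    then show "z \<in> cls x" using mem_cls[OF x] z(1) by blast
  qed
  then show "cls x = cls y" by blast
qed

end

text \<open>\<open>Q\<close> is left abstract because two kinds of records are covered: the residue
  field and the quotients by \<open>quotient_module\<close>.\<close>

locale quotient_space = subspace_embedding e M \<psi> K \<chi> H
  for e :: "'u::comm_ring_1" and M :: "('k, 'a, 'm) module_scheme" and \<psi> :: "'a \<Rightarrow> 'u"
    and K :: "('k, 'l) ring_scheme" and \<chi> :: "'k \<Rightarrow> 'u" and H :: "'a set" +
  fixes Q :: "('k, 'a set) module"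
  assumes Q_carrier: "carrier Q = a_rcosets\<^bsub>M\<^esub> H" and Q_add: "ring.add Q = set_add M" and Q_zero: "ring.zero Q = H"
    and Q_smult: "\<And>k x. k \<in> carrier K \<Longrightarrow> x \<in> carrier M \<Longrightarrow> k \<odot>\<^bsub>Q\<^esub> (H +>\<^bsub>M\<^esub> x) = H +>\<^bsub>M\<^esub> (k \<odot>\<^bsub>M\<^esub> x)"
begin

lemma cls_zero: "\<zero>\<^bsub>Q\<^esub> = cls \<zero>\<^bsub>M\<^esub>"
proof -
  have "z \<in> cls \<zero>\<^bsub>M\<^esub> \<longleftrightarrow> z \<in> H" for z
  proof
    assume "z \<in> cls \<zero>\<^bsub>M\<^esub>"
    then have z: "z \<in> carrier M" "\<psi> z \<in> HU" using mem_cls[OF unit_closed(1)] \<phi>_zero by simp_all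
    then obtain h where "h \<in> H" "\<psi> z = \<psi> h" by blast
    then show "z \<in> H" using \<phi>_inj[OF z(1), of h] HM by blast
  next
    assume "z \<in> H"
    then show "z \<in> cls \<zero>\<^bsub>M\<^esub>" using mem_cls[OF unit_closed(1)] \<phi>_zero HM by auto
  qed
  then show ?thesis unfolding Q_zero by blast
qed

lemma cls_closed: "x \<in> carrier M \<Longrightarrow> cls x \<in> carrier Q"
  unfolding Q_carrier A_RCOSETS_def' by blast

lemma cls_cases: "q \<in> carrier Q \<Longrightarrow> \<exists>x\<in>carrier M. q = cls x"
  unfolding Q_carrier A_RCOSETS_def' by blast

lemma cls_add:
  assumes x: "x \<in> carrier M" and y: "y \<in> carrier M" shows "cls x \<oplus>\<^bsub>Q\<^esub> cls y = cls (x \<oplus>\<^bsub>M\<^esub> y)"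
proof -
  note xy = add_closed[OF x y]
  have "z \<in> cls x <+>\<^bsub>M\<^esub> cls y \<longleftrightarrow> z \<in> cls (x \<oplus>\<^bsub>M\<^esub> y)" for z
  proof
    assume "z \<in> cls x <+>\<^bsub>M\<^esub> cls y"
    then obtain a b where ab: "a \<in> cls x" "b \<in> cls y" "z = a \<oplus>\<^bsub>M\<^esub> b" unfolding set_add_def' by blast
    then have a: "a \<in> carrier M" "\<psi> a - \<psi> x \<in> HU" and b: "b \<in> carrier M" "\<psi> b - \<psi> y \<in> HU"
      using mem_cls[OF x] mem_cls[OF y] by blast+
    have "\<psi> z - \<psi> (x \<oplus>\<^bsub>M\<^esub> y) = (\<psi> a - \<psi> x) + (\<psi> b - \<psi> y)" unfolding ab(3) \<phi>_add[OF a(1) b(1)] \<phi>_add[OF x y] by simp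
    then have "\<psi> z - \<psi> (x \<oplus>\<^bsub>M\<^esub> y) \<in> HU" using sm_add[OF H a(2) b(2)] by simp
    then show "z \<in> cls (x \<oplus>\<^bsub>M\<^esub> y)" using mem_cls[OF xy] add_closed[OF a(1) b(1)] ab(3) by blast
  next
    assume "z \<in> cls (x \<oplus>\<^bsub>M\<^esub> y)"
    then have z: "z \<in> carrier M" "\<psi> z - \<psi> (x \<oplus>\<^bsub>M\<^esub> y) \<in> HU" using mem_cls[OF xy] by blast+
    obtain a where a: "a \<in> carrier M" "\<psi> a = \<psi> z - \<psi> y" using ex_diff[OF z(1) y] by blast
    have "\<psi> a - \<psi> x \<in> HU" using z(2) unfolding a(2) \<phi>_add[OF x y] by (simp add: algebra_simps)
    then have ac: "a \<in> cls x" using mem_cls[OF x] a(1) by blast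
    have yc: "y \<in> cls y" using mem_cls[OF y] y sm_0[OF H] by simp
    have "\<psi> (a \<oplus>\<^bsub>M\<^esub> y) = \<psi> z" unfolding \<phi>_add[OF a(1) y] a(2) by simp
    then have "a \<oplus>\<^bsub>M\<^esub> y = z" by (rule \<phi>_inj[OF add_closed[OF a(1) y] z(1)])
    then show "z \<in> cls x <+>\<^bsub>M\<^esub> cls y" unfolding set_add_def' using ac yc by blast
  qed
  then show ?thesis unfolding Q_add by blast
qed

lemma vectorspace_Q: "vectorspace K Q"
proof -
  interpret K: field K by (rule fieldK)
  interpret A: algebra K M by (rule algebra_M)
  have "abelian_group Q"
  proof (rule abelian_groupI)
    show "\<zero>\<^bsub>Q\<^esub> \<in> carrier Q" unfolding cls_zero by (rule cls_closed) simp
    fix q r s assume q: "q \<in> carrier Q"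
    obtain x where x: "x \<in> carrier M" "q = cls x" using cls_cases[OF q] by blast
    show "\<zero>\<^bsub>Q\<^esub> \<oplus>\<^bsub>Q\<^esub> q = q" unfolding cls_zero x(2) using x(1) by (subst cls_add) simp_all
    show "\<exists>r\<in>carrier Q. r \<oplus>\<^bsub>Q\<^esub> q = \<zero>\<^bsub>Q\<^esub>"
      unfolding cls_zero x(2)
    proof (rule bexI)
      show "cls (\<ominus>\<^bsub>M\<^esub> x) \<oplus>\<^bsub>Q\<^esub> cls x = cls \<zero>\<^bsub>M\<^esub>" using x(1) by (subst cls_add) (simp_all add: A.M.l_neg)
      show "cls (\<ominus>\<^bsub>M\<^esub> x) \<in> carrier Q" using x(1) by (intro cls_closed) simp
    qed
    assume r: "r \<in> carrier Q"
    obtain y where y: "y \<in> carrier M" "r = cls y" using cls_cases[OF r] by blast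
    show "q \<oplus>\<^bsub>Q\<^esub> r \<in> carrier Q" unfolding x(2) y(2) cls_add[OF x(1) y(1)] using x(1) y(1) by (intro cls_closed) simp
    show "q \<oplus>\<^bsub>Q\<^esub> r = r \<oplus>\<^bsub>Q\<^esub> q" unfolding x(2) y(2) cls_add[OF x(1) y(1)] cls_add[OF y(1) x(1)]
      using x(1) y(1) by (simp add: A.M.a_comm)
    assume s: "s \<in> carrier Q"
    obtain z where z: "z \<in> carrier M" "s = cls z" using cls_cases[OF s] by blast
    show "q \<oplus>\<^bsub>Q\<^esub> r \<oplus>\<^bsub>Q\<^esub> s = q \<oplus>\<^bsub>Q\<^esub> (r \<oplus>\<^bsub>Q\<^esub> s)"
      unfolding x(2) y(2) z(2) cls_add[OF x(1) y(1)] cls_add[OF y(1) z(1)]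
        cls_add[OF add_closed[OF x(1) y(1)] z(1)] cls_add[OF x(1) add_closed[OF y(1) z(1)]]
      using x(1) y(1) z(1) by (simp add: A.M.a_assoc)
  qed
  then have "module K Q"
  proof (rule moduleI[OF cringK])
    fix q assume q: "q \<in> carrier Q"
    obtain x where x: "x \<in> carrier M" "q = cls x" using cls_cases[OF q] by blast
    show "\<one>\<^bsub>K\<^esub> \<odot>\<^bsub>Q\<^esub> q = q" unfolding x(2) Q_smult[OF K.one_closed x(1)] using A.smult_one[OF x(1)] by simp
    fix a b r assume a: "a \<in> carrier K"
    note ax = smult_cl[OF a x(1)]
    show "a \<odot>\<^bsub>Q\<^esub> q \<in> carrier Q" unfolding x(2) Q_smult[OF a x(1)] by (rule cls_closed[OF ax])
    { assume b: "b \<in> carrier K"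
      note bx = smult_cl[OF b x(1)]
      show "(a \<oplus>\<^bsub>K\<^esub> b) \<odot>\<^bsub>Q\<^esub> q = a \<odot>\<^bsub>Q\<^esub> q \<oplus>\<^bsub>Q\<^esub> b \<odot>\<^bsub>Q\<^esub> q"
        unfolding x(2) Q_smult[OF a x(1)] Q_smult[OF b x(1)] Q_smult[OF K.add.m_closed[OF a b] x(1)] cls_add[OF ax bx]
        using A.smult_l_distr[OF a b x(1)] by simp
      show "(a \<otimes>\<^bsub>K\<^esub> b) \<odot>\<^bsub>Q\<^esub> q = a \<odot>\<^bsub>Q\<^esub> (b \<odot>\<^bsub>Q\<^esub> q)"
        unfolding x(2) Q_smult[OF b x(1)] Q_smult[OF a bx] Q_smult[OF K.m_closed[OF a b] x(1)]
        using A.smult_assoc1[OF a b x(1)] by simp }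
    assume r: "r \<in> carrier Q"
    obtain y where y: "y \<in> carrier M" "r = cls y" using cls_cases[OF r] by blast
    show "a \<odot>\<^bsub>Q\<^esub> (q \<oplus>\<^bsub>Q\<^esub> r) = a \<odot>\<^bsub>Q\<^esub> q \<oplus>\<^bsub>Q\<^esub> a \<odot>\<^bsub>Q\<^esub> r"
      unfolding x(2) y(2) cls_add[OF x(1) y(1)] Q_smult[OF a add_closed[OF x(1) y(1)]] Q_smult[OF a x(1)] Q_smult[OF a y(1)]
        cls_add[OF ax smult_cl[OF a y(1)]]
      using A.smult_r_distr[OF a x(1) y(1)] by simp
  qed
  then show ?thesis using fieldK by (simp add: vectorspace_def)
qed

lemma subr_L: "subr L"
proof (rule subrI)
  interpret K: cring K by (rule cringK)
  show "e \<in> L" using \<chi>_one by (intro image_eqI[of _ _ "\<one>\<^bsub>K\<^esub>"]) simp_all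
  fix a assume "a \<in> L"
  then obtain k where k: "k \<in> carrier K" "a = \<chi> k" by blast
  show "e * a = a" using \<chi>_mult[of "\<one>\<^bsub>K\<^esub>" k] k \<chi>_one by simp
  fix b assume "b \<in> L"
  then obtain l where l: "l \<in> carrier K" "b = \<chi> l" by blast
  have "\<chi> \<zero>\<^bsub>K\<^esub> = 0" using \<chi>_add[of "\<zero>\<^bsub>K\<^esub>" "\<zero>\<^bsub>K\<^esub>"] by simp
  then have "\<chi> (\<ominus>\<^bsub>K\<^esub> l) = - \<chi> l" using \<chi>_add[of "\<ominus>\<^bsub>K\<^esub> l" l] l by (simp add: K.l_neg eq_neg_iff_add_eq_0)
  then have "a - b = \<chi> (k \<oplus>\<^bsub>K\<^esub> \<ominus>\<^bsub>K\<^esub> l)" using \<chi>_add[of k "\<ominus>\<^bsub>K\<^esub> l"] k l by simp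
  then show "a - b \<in> L" using k l by simp
  have "a * b = \<chi> (k \<otimes>\<^bsub>K\<^esub> l)" using \<chi>_mult k l by simp
  then show "a * b \<in> L" using k l by simp
qed

text \<open>The classes with a representative in the sum of \<open>HU\<close> and the span of
  \<open>Z\<close> form a submodule that contains \<open>A\<close>, hence all of \<open>Q\<close>.
  No linear combination in \<open>Q\<close> has to be written out.\<close>

lemma generators:
  assumes A: "finite A" "A \<subseteq> carrier Q" "LinearCombinations.module.span K Q A = carrier Q"
  shows "\<exists>Z. finite Z \<and> Z \<subseteq> \<psi> ` carrier M \<and> card Z \<le> card A \<and> \<psi> ` carrier M \<subseteq> sumset HU (mprod L Z)"
proof -
  interpret V: vectorspace K Q by (rule vectorspace_Q)
  have "\<forall>q\<in>A. \<exists>x. x \<in> carrier M \<and> q = cls x" using A(2) cls_cases by blast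
  then obtain x where x: "\<forall>q\<in>A. x q \<in> carrier M \<and> q = cls (x q)" by (rule bchoice[THEN exE])
  define Z where "Z = (\<lambda>q. \<psi> (x q)) ` A"
  have Z: "finite Z" "card Z \<le> card A" "Z \<subseteq> \<psi> ` carrier M"
    unfolding Z_def using A(1) card_image_le[OF A(1)] x by auto
  have Ze: "e * z = z" if "z \<in> Z" for z using that Z(3) \<phi>_e by blast
  have sZ: "sm L (mprod L Z)" by (rule mprod_sm[OF subr_L Ze])
  have sS: "sm L (sumset HU (mprod L Z))" by (rule sumset_sm[OF H sZ])
  define P where "P = {cls v | v. v \<in> carrier M \<and> \<psi> v \<in> sumset HU (mprod L Z)}"
  have "LinearCombinations.submodule K P Q"
  proof (unfold_locales)
    show "P \<subseteq> carrier Q" unfolding P_def using cls_closed by blast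
    show "\<zero>\<^bsub>Q\<^esub> \<in> P" unfolding P_def cls_zero using unit_closed(1) \<phi>_zero sm_0[OF sS] by auto
    fix q assume "q \<in> P"
    then obtain v where v: "v \<in> carrier M" "\<psi> v \<in> sumset HU (mprod L Z)" "q = cls v" unfolding P_def by blast
    { fix r assume "r \<in> P"
      then obtain w where w: "w \<in> carrier M" "\<psi> w \<in> sumset HU (mprod L Z)" "r = cls w" unfolding P_def by blast
      have "\<psi> (v \<oplus>\<^bsub>M\<^esub> w) \<in> sumset HU (mprod L Z)" unfolding \<phi>_add[OF v(1) w(1)] by (rule sm_add[OF sS v(2) w(2)])
      then show "q \<oplus>\<^bsub>Q\<^esub> r \<in> P" unfolding P_def v(3) w(3) cls_add[OF v(1) w(1)] using add_closed[OF v(1) w(1)] by blast }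
    fix c assume c: "c \<in> carrier K"
    have "\<psi> (c \<odot>\<^bsub>M\<^esub> v) \<in> sumset HU (mprod L Z)" unfolding \<psi>_smult[OF c v(1)] by (rule sm_mult[OF sS imageI[OF c] v(2)])
    then show "c \<odot>\<^bsub>Q\<^esub> q \<in> P" unfolding P_def v(3) Q_smult[OF c v(1)] using smult_cl[OF c v(1)] by blast
  qed
  moreover have "A \<subseteq> P"
  proof
    fix q assume q: "q \<in> A"
    have "\<psi> (x q) \<in> mprod L Z" by (rule mprod_incl[OF subr_L Ze]) (use q Z_def in auto)
    then have "\<psi> (x q) \<in> sumset HU (mprod L Z)" using subsetD[OF sumset_incl2[OF sm_0[OF H]]] by blast
    then show "q \<in> P" unfolding P_def using x q by blast
  qed
  ultimately have CP: "carrier Q \<subseteq> P" using V.span_is_subset A(3) by metis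
  have "\<psi> ` carrier M \<subseteq> sumset HU (mprod L Z)"
  proof
    fix m assume "m \<in> \<psi> ` carrier M"
    then obtain v where v: "v \<in> carrier M" "m = \<psi> v" by blast
    have "cls v \<in> P" using CP cls_closed[OF v(1)] by blast
    then obtain w where w: "w \<in> carrier M" "\<psi> w \<in> sumset HU (mprod L Z)" "cls v = cls w" unfolding P_def by blast
    have "\<psi> v - \<psi> w \<in> HU" using cls_eq[OF v(1) w(1)] w(3) by blast
    then have "\<psi> v - \<psi> w \<in> sumset HU (mprod L Z)" using subsetD[OF sumset_incl1[OF sm_0[OF sZ]]] by blast
    from sm_add[OF sS this w(2)] show "m \<in> sumset HU (mprod L Z)" unfolding v(2) by simp
  qed
  then show ?thesis using Z by blast
qed

text \<open>The dimension is the least size of a finite generating set, so a set of that size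
  exists.\<close>

lemma generators_edim:
  assumes "edim K Q = enat N"
  shows "\<exists>Z. finite Z \<and> Z \<subseteq> \<psi> ` carrier M \<and> card Z \<le> N \<and> \<psi> ` carrier M \<subseteq> sumset HU (mprod L Z)"
proof -
  interpret V: vectorspace K Q by (rule vectorspace_Q)
  have fd: "V.fin_dim" and dim: "V.dim = N" using assms unfolding edim_def by (auto split: if_splits)
  from fd have "\<exists>n A. finite A \<and> card A = n \<and> A \<subseteq> carrier Q \<and> V.gen_set A" unfolding V.fin_dim_def by blast
  from LeastI_ex[OF this] obtain A where "finite A" "card A = V.dim" "A \<subseteq> carrier Q" "V.gen_set A"
    unfolding V.dim_def by blast
  then show ?thesis using generators[of A] dim by metis
qed

text \<open>The classes of preimages of \<open>Z\<close> generate the quotient, which gives finite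
  dimension and the bound at once.\<close>

lemma edim_le:
  assumes Z: "finite Z" "Z \<subseteq> \<psi> ` carrier M" "\<psi> ` carrier M \<subseteq> sumset HU (mprod L Z)"
  shows "edim K Q \<le> enat (card Z)"
proof -
  interpret V: vectorspace K Q by (rule vectorspace_Q)
  have "\<forall>z\<in>Z. \<exists>x. x \<in> carrier M \<and> \<psi> x = z" using Z(2) by blast
  then obtain x where x: "\<forall>z\<in>Z. x z \<in> carrier M \<and> \<psi> (x z) = z" by (rule bchoice[THEN exE])
  define A where "A = (\<lambda>z. cls (x z)) ` Z"
  have A: "finite A" "card A \<le> card Z" unfolding A_def using Z(1) card_image_le[OF Z(1)] by auto
  have AQ: "A \<subseteq> carrier Q" unfolding A_def using x cls_closed by blast
  have sub: "LinearCombinations.submodule K (V.span A) Q" by (rule V.span_is_submodule[OF AQ])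
  have span: "\<exists>v\<in>carrier M. \<psi> v = y \<and> cls v \<in> V.span A" if "y \<in> mprod L Z" for y
    using that
  proof (induction rule: mprod.induct)
    case zero
    have "cls \<zero>\<^bsub>M\<^esub> \<in> V.span A" using LinearCombinations.submodule.zero_closed[OF sub] unfolding cls_zero .
    then show ?case using unit_closed(1) \<phi>_zero by blast
  next
    case (step y l z)
    then obtain v where v: "v \<in> carrier M" "\<psi> v = y" "cls v \<in> V.span A" by blast
    obtain k where k: "k \<in> carrier K" "l = \<chi> k" using step.hyps by blast
    have xz: "x z \<in> carrier M" "\<psi> (x z) = z" "cls (x z) \<in> A" using x step.hyps unfolding A_def by blast+
    have zS: "cls (x z) \<in> V.span A" using V.in_own_span[OF AQ] xz(3) by blast
    have kx: "k \<odot>\<^bsub>M\<^esub> x z \<in> carrier M" by (rule smult_cl[OF k(1) xz(1)])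
    have "cls v \<oplus>\<^bsub>Q\<^esub> k \<odot>\<^bsub>Q\<^esub> cls (x z) \<in> V.span A"
      by (rule LinearCombinations.submodule.m_closed[OF sub v(3) LinearCombinations.submodule.smult_closed[OF sub k(1) zS]])
    then have "cls (v \<oplus>\<^bsub>M\<^esub> k \<odot>\<^bsub>M\<^esub> x z) \<in> V.span A" unfolding Q_smult[OF k(1) xz(1)] cls_add[OF v(1) kx] .
    moreover have "\<psi> (v \<oplus>\<^bsub>M\<^esub> k \<odot>\<^bsub>M\<^esub> x z) = y + l * z"
      unfolding \<phi>_add[OF v(1) kx] \<psi>_smult[OF k(1) xz(1)] v(2) xz(2) k(2) ..
    ultimately show ?case using add_closed[OF v(1) kx] by blast
  qed
  have "carrier Q \<subseteq> V.span A"
  proof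
    fix q assume "q \<in> carrier Q"
    then obtain v where v: "v \<in> carrier M" "q = cls v" using cls_cases by blast
    have "\<psi> v \<in> sumset HU (mprod L Z)" using Z(3) v(1) by blast
    then obtain h y where hy: "h \<in> HU" "y \<in> mprod L Z" "\<psi> v = h + y" by (rule sumsetE)
    obtain w where w: "w \<in> carrier M" "\<psi> w = y" "cls w \<in> V.span A" using span[OF hy(2)] by blast
    have "cls v = cls w" using cls_eq[OF v(1) w(1)] hy(1,3) w(2) by simp
    then show "q \<in> V.span A" using w(3) v(2) by simp
  qed
  then have gen: "V.gen_set A" using V.span_is_subset2[OF AQ] by blast
  have "V.fin_dim" unfolding V.fin_dim_def using A(1) AQ gen by blast
  moreover have "V.dim \<le> card A" by (rule V.gen_ge_dim[OF A(1) AQ gen])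
  ultimately show ?thesis unfolding edim_def using A(2) by simp
qed

end

text \<open>Scalar multiplication in \<open>quotient_module\<close> is a union over a class; it
  collapses because scalars preserve \<open>H\<close>.\<close>

lemma (in subspace_embedding) quotient_space_quotient_module:
  "quotient_space e M \<psi> K \<chi> H (quotient_module M H)"
proof
  fix k x assume k: "k \<in> carrier K" and x: "x \<in> carrier M"
  have "cls (k \<odot>\<^bsub>M\<^esub> u) = cls (k \<odot>\<^bsub>M\<^esub> x)" if "u \<in> cls x" for u
  proof -
    have u: "u \<in> carrier M" "\<psi> u - \<psi> x \<in> HU" using that mem_cls[OF x] by blast+
    have "\<psi> (k \<odot>\<^bsub>M\<^esub> u) - \<psi> (k \<odot>\<^bsub>M\<^esub> x) = \<chi> k * (\<psi> u - \<psi> x)"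
      unfolding \<psi>_smult[OF k u(1)] \<psi>_smult[OF k x] by (simp add: right_diff_distrib)
    then have "\<psi> (k \<odot>\<^bsub>M\<^esub> u) - \<psi> (k \<odot>\<^bsub>M\<^esub> x) \<in> HU" using sm_mult[OF H imageI[OF k] u(2)] by simp
    then show ?thesis using cls_eq[OF smult_cl[OF k u(1)] smult_cl[OF k x]] by blast
  qed
  moreover have "x \<in> cls x" using mem_cls[OF x] x sm_0[OF H] by simp
  ultimately have "(\<Union>u\<in>cls x. cls (k \<odot>\<^bsub>M\<^esub> u)) = cls (k \<odot>\<^bsub>M\<^esub> x)" by blast
  then show "k \<odot>\<^bsub>quotient_module M H\<^esub> (cls x) = cls (k \<odot>\<^bsub>M\<^esub> x)" unfolding quotient_module_def module.select_convs .
qed (simp_all add: quotient_module_def)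

lemma cring_algebra_via: "cring (algebra_via h A) = cring A"
  unfolding cring_def ring_def abelian_group_def abelian_monoid_def abelian_group_axioms_def
    ring_axioms_def comm_monoid_def comm_monoid_axioms_def monoid_def Units_def
    comm_group_def group_def group_axioms_def algebra_via_def by simp

lemma algebra_algebra_via:
  assumes K: "cring K" and A: "cring A" and h: "h \<in> ring_hom K A"
  shows "algebra K (algebra_via h A)"
proof -
  interpret K: cring K by fact
  interpret A: cring A by fact
  have hc: "h k \<in> carrier A" if "k \<in> carrier K" for k using ring_hom_closed[OF h that] .
  have "cring (algebra_via h A)" using A by (simp add: cring_algebra_via)
  then show ?thesis
    by (rule algebraI[OF K])
      (use hc ring_hom_add[OF h] ring_hom_mult[OF h] ring_hom_one[OF h] in
        \<open>simp_all add: algebra_via_def A.l_distr A.r_distr A.m_assoc\<close>)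
qed

section \<open>Discrete valuation rings\<close>

context discrete_valuation_ring
begin

lemma maximalideal_max_ideal: "maximalideal (max_ideal R) R"
  unfolding max_ideal_def by (rule theI'[OF unique_maximal])

lemma ex_nonunit: "\<exists>a\<in>carrier R - {\<zero>}. a \<notin> Units R"
proof (rule ccontr)
  assume "\<not> ?thesis"
  moreover have "u \<noteq> \<zero>" if u: "u \<in> Units R" for u
    using Units_r_inv_ex[OF u] zero_not_one by auto
  then have "Units R \<subseteq> carrier R - {\<zero>}" using Units_closed by blast
  ultimately have "Units R = carrier R - {\<zero>}" by blast
  then have "field R" by (intro field.intro domain_axioms field_axioms.intro)
  then show False using not_field by blast
qed

text \<open>In a principal domain irreducible elements generate maximal ideals, and here there is
  only one. So all irreducibles are associated with the generator \<open>w\<close>, and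
  factorization turns every nonzero element into a unit times a power of \<open>w\<close>.\<close>

lemma max_ideal_uniformizer:
  obtains w where "w \<in> carrier R" "max_ideal R = PIdl w" "w \<noteq> \<zero>" "w \<notin> Units R"
    "\<And>s. s \<in> carrier R \<Longrightarrow> s \<noteq> \<zero> \<Longrightarrow> \<exists>(j::nat). \<exists>u\<in>Units R. s = u \<otimes> w [^] j"
proof -
  interpret max: maximalideal "max_ideal R" R by (rule maximalideal_max_ideal)
  obtain w where w: "w \<in> carrier R" "max_ideal R = PIdl w" using exists_gen[OF max.ideal_axioms] by blast
  have wu: "w \<notin> Units R" using max.I_notcarr ideal_eq_carrier_iff[OF w(1)] unfolding w(2) by blast
  have irr: "\<exists>u\<in>Units R. f = u \<otimes> w" if f: "f \<in> carrier R" "ring_irreducible f" for f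
  proof -
    have "maximalideal (PIdl f) R" by (rule irreducible_imp_maximalideal[OF f])
    then have "PIdl f = max_ideal R" using maximalideal_max_ideal unique_maximal by blast
    then have "f \<sim> w" using associated_iff_same_ideal[OF f(1) w(1)] w(2) by simp
    then have "w divides f" "f divides w" unfolding associated_def by auto
    then obtain c d where c: "c \<in> carrier R" "f = w \<otimes> c" and d: "d \<in> carrier R" "w = f \<otimes> d" unfolding factor_def by blast
    have "c \<in> Units R"
    proof -
      have f0: "f \<noteq> \<zero>" using f ring_irreducibleE(1) by blast
      have "f \<otimes> (d \<otimes> c) = f \<otimes> \<one>" using c d f(1) by (metis m_assoc r_one)
      then have "d \<otimes> c = \<one>" using m_lcancel[OF f0 f(1), of "d \<otimes> c" \<one>] c(1) d(1) by simp
      then show ?thesis using c(1) d(1) m_comm[OF c(1) d(1)] unfolding Units_def by auto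
    qed
    then show ?thesis using c m_comm[OF w(1) c(1)] by auto
  qed
  \<comment> \<open>If \<open>w\<close> were zero, so would be every irreducible; but
    \<open>R\<close> is not a field, and a nonzero nonunit has an irreducible divisor.\<close>
  have w0: "w \<noteq> \<zero>"
  proof
    assume w0: "w = \<zero>"
    obtain a where a: "a \<in> carrier R - {\<zero>}" "a \<notin> Units R" using ex_nonunit by blast
    obtain b where b: "b \<in> carrier R" "ring_irreducible b" using exists_irreducible_divisor[OF a] by blast
    obtain u where u: "u \<in> Units R" "b = u \<otimes> w" using irr[OF b] by blast
    then have "b = \<zero>" using w0 Units_closed[OF u(1)] by simp
    then show False using ring_irreducibleE(1)[OF b] by blast
  qed
  have prod: "\<exists>(j::nat). \<exists>u\<in>Units R. foldr (\<otimes>) fs \<one> = u \<otimes> w [^] j"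
    if "\<forall>f\<in>set fs. f \<in> carrier R \<and> ring_irreducible f" for fs
    using that
  proof (induction fs)
    case Nil
    show ?case by (intro exI[of _ "0::nat"] bexI[of _ \<one>]) simp_all
  next
    case (Cons f fs)
    then obtain j :: nat and u where u: "u \<in> Units R" "foldr (\<otimes>) fs \<one> = u \<otimes> w [^] j" by auto
    obtain v where v: "v \<in> Units R" "f = v \<otimes> w" using irr[of f] Cons.prems by auto
    have uv: "u \<in> carrier R" "v \<in> carrier R" using u(1) v(1) by blast+
    have "foldr (\<otimes>) (f # fs) \<one> = (v \<otimes> w) \<otimes> (u \<otimes> w [^] j)" using u v by simp
    also have "\<dots> = (v \<otimes> u) \<otimes> (w \<otimes> w [^] j)" using uv w(1) by (simp add: m_ac)
    also have "\<dots> = (v \<otimes> u) \<otimes> w [^] Suc j" using w(1) nat_pow_Suc2[OF w(1), of j] by simp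
    finally show ?case using u v by (intro exI[of _ "Suc j"] bexI[of _ "v \<otimes> u"]) simp_all
  qed
  have "\<exists>(j::nat). \<exists>u\<in>Units R. s = u \<otimes> w [^] j" if s: "s \<in> carrier R" "s \<noteq> \<zero>" for s
  proof (cases "s \<in> Units R")
    case True
    then show ?thesis using s by (intro exI[of _ "0::nat"] bexI[of _ s]) simp_all
  next
    case False
    have "s \<in> carrier R - {\<zero>}" using s by blast
    from factorization_property[OF this False]
    obtain fs where fs: "set fs \<subseteq> carrier (mult_of R)" "wfactors (mult_of R) fs s" by blast
    have fi: "\<forall>f\<in>set fs. f \<in> carrier R \<and> ring_irreducible f"
    proof
      fix f assume f: "f \<in> set fs"
      have fc: "f \<in> carrier R - {\<zero>}" using fs(1) f by auto
      moreover have "irreducible (mult_of R) f" using fs(2) f unfolding wfactors_def by blast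
      ultimately show "f \<in> carrier R \<and> ring_irreducible f" using ring_irreducibleI'[of f] by blast
    qed
    obtain j :: nat and u where u: "u \<in> Units R" "foldr (\<otimes>) fs \<one> = u \<otimes> w [^] j" using prod[OF fi] by blast
    have uc: "u \<in> carrier R" using u(1) by blast
    have "foldr (\<otimes>\<^bsub>mult_of R\<^esub>) fs \<one>\<^bsub>mult_of R\<^esub> \<sim>\<^bsub>mult_of R\<^esub> s" using fs(2) unfolding wfactors_def by blast
    then have as: "foldr (\<otimes>) fs \<one> \<sim>\<^bsub>mult_of R\<^esub> s" by simp
    define y where "y = foldr (\<otimes>) fs \<one>"
    have yc: "y \<in> carrier R" unfolding y_def u(2) using uc w(1) by simp
    from as have ex: "\<exists>c\<in>carrier (mult_of R). s = y \<otimes>\<^bsub>mult_of R\<^esub> c" "\<exists>d\<in>carrier (mult_of R). y = s \<otimes>\<^bsub>mult_of R\<^esub> d"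
      unfolding associated_def factor_def y_def by blast+
    from ex(1) obtain c where "c \<in> carrier (mult_of R)" "s = y \<otimes>\<^bsub>mult_of R\<^esub> c" by (rule bexE)
    then have c: "c \<in> carrier R" "s = y \<otimes> c" by simp_all
    from ex(2) obtain d where "d \<in> carrier (mult_of R)" "y = s \<otimes>\<^bsub>mult_of R\<^esub> d" by (rule bexE)
    then have d: "d \<in> carrier R" "y = s \<otimes> d" by simp_all
    have "s \<otimes> (d \<otimes> c) = s \<otimes> \<one>" using c d s(1) by (metis m_assoc r_one)
    then have "d \<otimes> c = \<one>" using m_lcancel[OF s(2,1), of "d \<otimes> c" \<one>] c(1) d(1) by simp
    then have cu: "c \<in> Units R" using c(1) d(1) m_comm[OF c(1) d(1)] unfolding Units_def by auto
    have "s = (c \<otimes> u) \<otimes> w [^] j" unfolding c(2) y_def u(2) using c(1) uc w(1) by (simp add: m_ac)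
    then show ?thesis using cu u(1) by (intro exI[of _ j] bexI[of _ "c \<otimes> u"]) simp_all
  qed
  then show ?thesis using that[OF w w0 wu] by blast
qed

end

section \<open>Embeddings of fields\<close>

context idf
begin

text \<open>The tower law: grouping by \<open>y\<close> gives coefficients in \<open>k1\<close>,
  which vanish, and each is a relation of \<open>F\<close> over \<open>k\<close>. Injectivity
  follows from the relation with coefficients \<open>e\<close> and \<open>- e\<close>.\<close>

lemma lin_indep_products:
  assumes k: "subf k" and k1: "subf k1" "k \<subseteq> k1" and F: "finite F" "F \<subseteq> k1" "lin_indep k F"
    and E: "finite E" "lin_indep k1 E"
  shows "inj_on (\<lambda>(y, x). x * y) (E \<times> F) \<and> lin_indep k ((\<lambda>(y, x). x * y) ` (E \<times> F))"
proof -
  let ?g = "\<lambda>(y, x). x * y"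
  have k1r: "subr k1" by (rule subf_r[OF k1(1)])
  have kr: "subr k" by (rule subf_r[OF k])
  have fam: "c q = 0" if c: "\<And>q. q \<in> E \<times> F \<Longrightarrow> c q \<in> k" and s: "(\<Sum>q\<in>E \<times> F. c q * ?g q) = 0" and q: "q \<in> E \<times> F" for c q
  proof -
    obtain y x where yx: "y \<in> E" "x \<in> F" "q = (y, x)" using q by blast
    have "(\<Sum>y\<in>E. (\<Sum>x\<in>F. c (y, x) * x) * y) = (\<Sum>y\<in>E. \<Sum>x\<in>F. c (y, x) * (x * y))"
      by (simp add: sum_distrib_right mult.assoc)
    also have "\<dots> = (\<Sum>q\<in>E \<times> F. c q * ?g q)" by (simp add: sum.cartesian_product split_def)
    finally have s1: "(\<Sum>y\<in>E. (\<Sum>x\<in>F. c (y, x) * x) * y) = 0" using s by simp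
    have "(\<Sum>x\<in>F. c (y, x) * x) = 0"
    proof (rule lin_indepD[OF E(2) _ s1 yx(1)])
      fix y assume y: "y \<in> E"
      show "(\<Sum>x\<in>F. c (y, x) * x) \<in> k1"
      proof (rule sm_sum[OF subr_sm[OF k1r]])
        fix x assume x: "x \<in> F"
        have "c (y, x) \<in> k1" using c[of "(y, x)"] x y k1(2) by blast
        then show "c (y, x) * x \<in> k1" using subr_mult[OF k1r] x F(2) by blast
      qed
    qed
    then have "c (y, x) = 0" by (rule lin_indepD[OF F(3), rotated]) (use c yx in auto)
    then show ?thesis using yx by simp
  qed
  have inj: "inj_on ?g (E \<times> F)"
  proof (rule inj_onI, rule ccontr)
    fix q r assume qr: "q \<in> E \<times> F" "r \<in> E \<times> F" "?g q = ?g r" "q \<noteq> r"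
    define c where "c s = (if s = q then e else if s = r then - e else 0)" for s
    have fin: "finite (E \<times> F)" using E(1) F(1) by simp
    have "(\<Sum>s\<in>E \<times> F. c s * ?g s) = (\<Sum>s\<in>{q, r}. c s * ?g s)"
      by (rule sum.mono_neutral_right[OF fin]) (use qr in \<open>auto simp: c_def\<close>)
    also have "\<dots> = 0" using qr(3,4) by (simp add: c_def)
    finally have "c q = 0"
      by (rule fam[rotated]) (use qr(1) subr_e[OF kr] subr_0[OF kr] subr_minus[OF kr subr_e[OF kr]] in \<open>auto simp: c_def\<close>)
    then show False using e0 by (simp add: c_def)
  qed
  have "lin_indep k (?g ` (E \<times> F))"
    unfolding lin_indep_def
  proof (intro allI impI ballI)
    fix c z assume c: "\<forall>z\<in>?g ` (E \<times> F). c z \<in> k" "(\<Sum>z\<in>?g ` (E \<times> F). c z * z) = 0" and z: "z \<in> ?g ` (E \<times> F)"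
    then obtain q where q: "q \<in> E \<times> F" "z = ?g q" by blast
    have "(\<Sum>q\<in>E \<times> F. c (?g q) * ?g q) = 0" using c(2) by (simp add: sum.reindex[OF inj])
    then have "c (?g q) = 0" by (rule fam[rotated]) (use c(1) q(1) in blast)+
    then show "c z = 0" using q(2) by simp
  qed
  then show ?thesis using inj by blast
qed

end

text \<open>A homomorphism defined on a subfield only. It carries \<open>generate_field\<close> and
  \<open>dimension\<close> from the given fields into the ring type.\<close>

locale field_map = idf e for e :: "'u::comm_ring_1" +
  fixes A :: "('a, 'm) ring_scheme" (structure) and F :: "'a set" and \<nu> :: "'a \<Rightarrow> 'u"
  assumes fieldA: "field A" and F: "subfield F A"
    and \<nu>_add: "\<And>x y. x \<in> F \<Longrightarrow> y \<in> F \<Longrightarrow> \<nu> (x \<oplus> y) = \<nu> x + \<nu> y"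
    and \<nu>_mult: "\<And>x y. x \<in> F \<Longrightarrow> y \<in> F \<Longrightarrow> \<nu> (x \<otimes> y) = \<nu> x * \<nu> y"
    and \<nu>_one: "\<nu> \<one> = e"
begin

interpretation A: field A by (rule fieldA)

lemmas F_sub = subfieldE(3)[OF F]
lemmas F_ring = subfieldE(1)[OF F]

lemma F_closed: "\<zero> \<in> F" "\<one> \<in> F" "x \<in> F \<Longrightarrow> \<ominus> x \<in> F" "x \<in> F \<Longrightarrow> y \<in> F \<Longrightarrow> x \<oplus> y \<in> F" "x \<in> F \<Longrightarrow> y \<in> F \<Longrightarrow> x \<otimes> y \<in> F"
  using subringE(2,3,5,6,7)[OF F_ring] by blast+

lemma \<nu>_zero: "\<nu> \<zero> = 0" using \<nu>_add[of \<zero> \<zero>] F_closed(1) by simp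

lemma \<nu>_minus: assumes "x \<in> F" shows "\<nu> (\<ominus> x) = - \<nu> x"
proof -
  have "x \<in> carrier A" using assms F_sub by blast
  then have "\<nu> (\<ominus> x) + \<nu> x = 0" using \<nu>_add[OF F_closed(3)[OF assms] assms] \<nu>_zero by (simp add: A.l_neg)
  then show ?thesis by (simp add: eq_neg_iff_add_eq_0)
qed

lemma \<nu>_e: "x \<in> F \<Longrightarrow> e * \<nu> x = \<nu> x"
  using \<nu>_mult[OF F_closed(2), of x] \<nu>_one F_sub by auto

lemma F_pow: "x \<in> F \<Longrightarrow> x [^] (n::nat) \<in> F"
  by (induction n) (simp_all add: F_closed)

lemma \<nu>_pow: "x \<in> F \<Longrightarrow> \<nu> (x [^] (n::nat)) = e * \<nu> x ^ n"
proof (induction n)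
  case 0
  then show ?case by (simp add: \<nu>_one)
next
  case (Suc n)
  then show ?case using \<nu>_mult[OF F_pow[OF Suc.prems, of n] Suc.prems] by (simp add: ac_simps)
qed

lemma \<nu>_pow': "x \<in> F \<Longrightarrow> n > 0 \<Longrightarrow> \<nu> (x [^] (n::nat)) = \<nu> x ^ n"
  unfolding \<nu>_pow by (rule pow_e[OF \<nu>_e, symmetric, symmetric])

lemma \<nu>_inverse:
  assumes "x \<in> F" "x \<noteq> \<zero>" shows "inv x \<in> F" "\<nu> x * \<nu> (inv x) = e"
proof -
  have "x \<in> F - {\<zero>}" using assms by blast
  from A.subfield_m_inv[OF F this] show i: "inv x \<in> F" and "\<nu> x * \<nu> (inv x) = e"
    using \<nu>_mult[OF assms(1), of "inv x"] \<nu>_one by auto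
qed

lemma \<nu>_nz: "x \<in> F \<Longrightarrow> x \<noteq> \<zero> \<Longrightarrow> \<nu> x \<noteq> 0"
  using \<nu>_inverse(2)[of x] e0 by auto

lemma \<nu>_inj: "inj_on \<nu> F"
proof (rule inj_onI)
  fix x y assume xy: "x \<in> F" "y \<in> F" "\<nu> x = \<nu> y"
  have d: "x \<oplus> \<ominus> y \<in> F" using xy F_closed by blast
  have "\<nu> (x \<oplus> \<ominus> y) = 0" using \<nu>_add[OF xy(1) F_closed(3)[OF xy(2)]] \<nu>_minus[OF xy(2)] xy(3) by simp
  then have "x \<oplus> \<ominus> y = \<zero>" using \<nu>_nz[OF d] by blast
  moreover have "x \<in> carrier A" "y \<in> carrier A" using xy(1,2) F_sub by blast+
  ultimately have "\<ominus> (\<ominus> y) = x" by (intro A.minus_equality) simp_all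
  then show "x = y" using \<open>y \<in> carrier A\<close> by simp
qed

lemma image_subf:
  assumes G: "subfield G A" "G \<subseteq> F" shows "subf (\<nu> ` G)"
  unfolding subf_def
proof (intro conjI ballI impI)
  note Gr = subfieldE(1)[OF G(1)]
  show "subr (\<nu> ` G)"
  proof (rule subrI)
    show "e \<in> \<nu> ` G" using \<nu>_one subringE(3)[OF Gr] by (metis imageI)
    fix x assume "x \<in> \<nu> ` G"
    then obtain a where a: "a \<in> G" "a \<in> F" "x = \<nu> a" using G(2) by blast
    show "e * x = x" using \<nu>_e a by simp
    fix y assume "y \<in> \<nu> ` G"
    then obtain b where b: "b \<in> G" "b \<in> F" "y = \<nu> b" using G(2) by blast
    have "x - y = \<nu> (a \<oplus> \<ominus> b)" using \<nu>_add[OF a(2) F_closed(3)[OF b(2)]] \<nu>_minus[OF b(2)] a(3) b(3) by simp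
    then show "x - y \<in> \<nu> ` G" using subringE(5,7)[OF Gr] a(1) b(1) by blast
    have "x * y = \<nu> (a \<otimes> b)" using \<nu>_mult a b by simp
    then show "x * y \<in> \<nu> ` G" using subringE(6)[OF Gr] a(1) b(1) by blast
  qed
  fix x assume x: "x \<in> \<nu> ` G" "x \<noteq> 0"
  then obtain a where a: "a \<in> G" "x = \<nu> a" by blast
  have a0: "a \<noteq> \<zero>" using x(2) a(2) \<nu>_zero by blast
  have "inv a \<in> G" using A.subfield_m_inv(1)[OF G(1), of a] a(1) a0 by blast
  then show "\<exists>y\<in>\<nu> ` G. x * y = e" using \<nu>_inverse(2)[of a] a G(2) a0 by blast
qed

lemma vimage_subfield:
  assumes G: "subf G" shows "subfield {x \<in> F. \<nu> x \<in> G} A"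
proof (rule A.subfieldI')
  have Gr: "subr G" by (rule subf_r[OF G])
  show "subring {x \<in> F. \<nu> x \<in> G} A"
  proof (rule A.subringI)
    show "{x \<in> F. \<nu> x \<in> G} \<subseteq> carrier A" using F_sub by blast
    show "\<one> \<in> {x \<in> F. \<nu> x \<in> G}" using F_closed(2) \<nu>_one subr_e[OF Gr] by simp
    fix x assume x: "x \<in> {x \<in> F. \<nu> x \<in> G}"
    then show "\<ominus> x \<in> {x \<in> F. \<nu> x \<in> G}" using F_closed(3) \<nu>_minus subr_minus[OF Gr] by simp
    fix y assume y: "y \<in> {x \<in> F. \<nu> x \<in> G}"
    show "x \<otimes> y \<in> {x \<in> F. \<nu> x \<in> G}" using x y F_closed(5) \<nu>_mult subr_mult[OF Gr] by simp
    show "x \<oplus> y \<in> {x \<in> F. \<nu> x \<in> G}" using x y F_closed(4) \<nu>_add subr_add[OF Gr] by simp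
  qed
  fix x assume "x \<in> {x \<in> F. \<nu> x \<in> G} - {\<zero>}"
  then have x: "x \<in> F" "\<nu> x \<in> G" "x \<noteq> \<zero>" by blast+
  note i = \<nu>_inverse[OF x(1,3)]
  obtain g where g: "g \<in> G" "\<nu> x * g = e" using subf_inv[OF G x(2) \<nu>_nz[OF x(1,3)]] by blast
  have "\<nu> x * \<nu> (inv x) = \<nu> x * g" using i(2) g(2) by simp
  then have "\<nu> (inv x) = g" by (rule cancel[OF \<nu>_e[OF x(1)] \<nu>_e[OF i(1)] subr_unit[OF Gr g(1)] \<nu>_nz[OF x(1,3)]])
  then show "inv x \<in> {x \<in> F. \<nu> x \<in> G}" using g(1) i(1) by simp
qed

text \<open>The elements of \<open>F\<close> mapped into \<open>G\<close> form a subfield containing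
  \<open>H\<close>.\<close>

lemma image_generate_field:
  assumes "H \<subseteq> F" "subf G" "\<nu> ` H \<subseteq> G" shows "\<nu> ` generate_field A H \<subseteq> G"
proof -
  have "generate_field A H \<subseteq> {x \<in> F. \<nu> x \<in> G}"
    by (rule A.generate_field_min_subfield1[OF _ vimage_subfield[OF assms(2)]]) (use assms F_sub in blast)+
  then show ?thesis by blast
qed

text \<open>Both notions adjoin one vector at a time, so chains correspond; a dimension is a
  codimension over \<open>{0}\<close>.\<close>

lemma dimension_codim:
  assumes FA: "F = carrier A" and P: "P \<subseteq> F" and E: "A.dimension n P E"
  shows "E \<subseteq> F \<and> codim (\<nu> ` P) {0} n (\<nu> ` E)"
  using E P
proof (induction rule: A.dimension.induct)
  case (zero_dim K)
  show ?case using codim.codim_refl F_closed(1) \<nu>_zero by simp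
next
  case (Suc_dim v E n K)
  then have vF: "v \<in> F" and EF: "E \<subseteq> F" and c: "codim (\<nu> ` K) {0} n (\<nu> ` E)" and KF: "K \<subseteq> F" using FA by blast+
  have \<nu>v: "\<nu> (k \<otimes> v \<oplus> y) = \<nu> y + \<nu> k * \<nu> v" if "k \<in> K" "y \<in> E" for k y
    using \<nu>_add[of "k \<otimes> v" y] \<nu>_mult[of k v] F_closed(5)[of k v] subsetD[OF KF that(1)] subsetD[OF EF that(2)] vF by simp
  have "\<nu> ` A.line_extension K v E = lext (\<nu> ` K) (\<nu> v) (\<nu> ` E)"
  proof
    show "\<nu> ` A.line_extension K v E \<subseteq> lext (\<nu> ` K) (\<nu> v) (\<nu> ` E)"
    proof
      fix z assume "z \<in> \<nu> ` A.line_extension K v E"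
      then obtain w where w: "w \<in> A.line_extension K v E" "z = \<nu> w" by blast
      from w(1) obtain k y where "k \<in> K" "y \<in> E" "w = k \<otimes> v \<oplus> y" unfolding A.line_extension_mem_iff by blast
      then have ky: "k \<in> K" "y \<in> E" "z = \<nu> (k \<otimes> v \<oplus> y)" using w(2) by simp_all
      show "z \<in> lext (\<nu> ` K) (\<nu> v) (\<nu> ` E)" unfolding ky(3) \<nu>v[OF ky(1,2)] using ky by (intro lextI imageI)
    qed
    show "lext (\<nu> ` K) (\<nu> v) (\<nu> ` E) \<subseteq> \<nu> ` A.line_extension K v E"
    proof
      fix z assume "z \<in> lext (\<nu> ` K) (\<nu> v) (\<nu> ` E)"
      then obtain k y where ky: "k \<in> K" "y \<in> E" "z = \<nu> y + \<nu> k * \<nu> v" by (elim lextE imageE) simp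
      have "k \<otimes> v \<oplus> y \<in> A.line_extension K v E" using ky unfolding A.line_extension_mem_iff by blast
      then show "z \<in> \<nu> ` A.line_extension K v E" unfolding ky(3) \<nu>v[OF ky(1,2), symmetric] by (rule imageI)
    qed
  qed
  moreover have "\<nu> v \<notin> \<nu> ` E"
  proof
    assume "\<nu> v \<in> \<nu> ` E"
    then obtain y where "y \<in> E" "\<nu> v = \<nu> y" by blast
    then show False using inj_onD[OF \<nu>_inj, of v y] vF EF Suc_dim.hyps(2) by blast
  qed
  moreover have "A.line_extension K v E \<subseteq> F"
  proof
    fix z assume "z \<in> A.line_extension K v E"
    then obtain k y where "k \<in> K" "y \<in> E" "z = k \<otimes> v \<oplus> y" unfolding A.line_extension_mem_iff by blast
    then show "z \<in> F" using F_closed(4,5) KF EF vF by (metis subsetD)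
  qed
  ultimately show ?case using codim.codim_lext[OF c \<nu>_e[OF vF]] by simp
qed

end

text \<open>Passes from \<open>R\<close> and \<open>K2\<close> over \<open>K\<close> to
  \<open>S1\<close> and \<open>K2\<close> over \<open>K1\<close>, as the second tensor product
  requires. A common denominator moves the coefficients into \<open>T1\<close>, where they are
  expanded over elements \<open>F\<close> of \<open>K1\<close> independent over \<open>K\<close>;
  the products of \<open>F\<close> and \<open>E\<close> are independent over \<open>K\<close> by the
  tower law.\<close>

lemma (in tower) S1_disjoint:
  assumes big: "\<And>E r. finite E \<Longrightarrow> E \<subseteq> K2 \<Longrightarrow> lin_indep K E \<Longrightarrow> (\<forall>y\<in>E. r y \<in> R) \<Longrightarrow>
      (\<Sum>y\<in>E. r y * y) = 0 \<Longrightarrow> \<forall>y\<in>E. r y = 0"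
    and E: "finite E" "E \<subseteq> K2" "lin_indep K1 E" and r: "\<forall>y\<in>E. r y \<in> S1" "(\<Sum>y\<in>E. r y * y) = 0"
  shows "\<forall>y\<in>E. r y = 0"
proof -
  have "\<exists>b\<in>T1. b \<noteq> 0 \<and> (\<forall>y\<in>E'. r y * b \<in> T1)" if "finite E'" "E' \<subseteq> E" for E'
    using that
  proof (induction E' rule: finite_induct)
    case empty
    show ?case using subr_e[OF subr_T1] e0 by blast
  next
    case (insert y E')
    then obtain b where b: "b \<in> T1" "b \<noteq> 0" "\<forall>z\<in>E'. r z * b \<in> T1" by blast
    have "r y \<in> S1" using insert.prems r(1) by blast
    then obtain b' where b': "b' \<in> T1" "b' \<noteq> 0" "r y * b' \<in> T1" unfolding S1_def frob_closure_def by blast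
    have "r z * (b * b') \<in> T1" if "z \<in> insert y E'" for z
    proof (cases "z = y")
      case True
      have "r z * (b * b') = (r y * b') * b" unfolding True by (simp only: ac_simps)
      then show ?thesis using subr_mult[OF subr_T1 b'(3) b(1)] by simp
    next
      case False
      then have "r z * b \<in> T1" using that b(3) by blast
      then have "(r z * b) * b' \<in> T1" by (rule subr_mult[OF subr_T1 _ b'(1)])
      then show ?thesis by (simp only: mult.assoc)
    qed
    then show ?case using subr_mult[OF subr_T1 b(1) b'(1)] subr_nz_mult[OF subr_T1 b(1) b'(1) b(2) b'(2)] by blast
  qed
  then obtain b where b: "b \<in> T1" "b \<noteq> 0" "\<forall>y\<in>E. r y * b \<in> T1" using E(1) by blast
  define t where "t y = r y * b" for y
  have tT: "t y \<in> mprod R K1" if "y \<in> E" for y using b(3) that unfolding t_def T1_def by blast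
  have "\<exists>Xs. finite Xs \<and> Xs \<subseteq> K1 \<and> (\<forall>y\<in>E. t y \<in> mprod R Xs)"
    by (rule mprod_finite_support[OF E(1) tT])
  then obtain Xs where Xs: "finite Xs" "Xs \<subseteq> K1" "\<forall>y\<in>E. t y \<in> mprod R Xs" by (elim exE conjE)
  have Xe: "e * x = x" if "x \<in> Xs" for x using subr_unit[OF subf_r[OF K1]] Xs(2) that by blast
  have "\<exists>F. finite F \<and> F \<subseteq> Xs \<and> lin_indep K F \<and> Xs \<subseteq> mprod K F" by (rule exists_basis[OF K Xs(1) Xe])
  then obtain F where F: "finite F" "F \<subseteq> Xs" "lin_indep K F" "Xs \<subseteq> mprod K F" by (elim exE conjE)
  have FK1: "F \<subseteq> K1" using F(2) Xs(2) by blast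
  have Fe: "e * x = x" if "x \<in> F" for x using Xe F(2) that by blast
  have sub: "mprod R Xs \<subseteq> mprod R F"
    by (rule mprod_subset[OF mprod_sm[OF R Fe]]) (use F(4) mprod_mono[OF KR subset_refl] in blast)+
  have "\<forall>y\<in>E. \<exists>a. (\<forall>x\<in>F. a x \<in> R) \<and> t y = (\<Sum>x\<in>F. a x * x)"
  proof
    fix y assume "y \<in> E"
    then have "t y \<in> mprod R F" using Xs(3) sub by blast
    then show "\<exists>a. (\<forall>x\<in>F. a x \<in> R) \<and> t y = (\<Sum>x\<in>F. a x * x)" by (rule mprod_coeffs[OF _ F(1) R])
  qed
  then obtain a where a: "\<forall>y\<in>E. (\<forall>x\<in>F. a y x \<in> R) \<and> t y = (\<Sum>x\<in>F. a y x * x)" by (rule bchoice[THEN exE])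
  let ?g = "\<lambda>(y, x). x * y"
  have prods: "inj_on ?g (E \<times> F) \<and> lin_indep K (?g ` (E \<times> F))"
    by (rule lin_indep_products[OF K K1 KK1 F(1) FK1 F(3) E(1,3)])
  note inj = conjunct1[OF prods]
  define r' where "r' z = (case inv_into (E \<times> F) ?g z of (y, x) \<Rightarrow> a y x)" for z
  have r'g: "r' (?g q) = (case q of (y, x) \<Rightarrow> a y x)" if "q \<in> E \<times> F" for q
    unfolding r'_def inv_into_f_f[OF inj that] ..
  have "(\<Sum>z\<in>?g ` (E \<times> F). r' z * z) = (\<Sum>q\<in>E \<times> F. r' (?g q) * ?g q)" by (simp add: sum.reindex[OF inj])
  also have "\<dots> = (\<Sum>q\<in>E \<times> F. (case q of (y, x) \<Rightarrow> a y x * (x * y)))"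
    by (rule sum.cong[OF HOL.refl], subst r'g) (auto split: prod.splits)
  also have "\<dots> = (\<Sum>y\<in>E. \<Sum>x\<in>F. a y x * (x * y))" by (simp add: sum.cartesian_product)
  also have "\<dots> = (\<Sum>y\<in>E. t y * y)" using a by (intro sum.cong) (simp_all add: sum_distrib_right mult.assoc)
  also have "\<dots> = b * (\<Sum>y\<in>E. r y * y)" unfolding t_def sum_distrib_left by (rule sum.cong) (simp_all add: ac_simps)
  also have "\<dots> = 0" using r(2) by simp
  finally have rel: "(\<Sum>z\<in>?g ` (E \<times> F). r' z * z) = 0" .
  have gK2: "?g ` (E \<times> F) \<subseteq> K2"
  proof
    fix z assume "z \<in> ?g ` (E \<times> F)"
    then obtain y x where yx: "y \<in> E" "x \<in> F" "z = x * y" by auto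
    then show "z \<in> K2" using subr_mult[OF subf_r[OF K2], of x y] E(2) FK1 K1K2 by blast
  qed
  have fin: "finite (?g ` (E \<times> F))" using E(1) F(1) by simp
  have r'R: "\<forall>z\<in>?g ` (E \<times> F). r' z \<in> R"
  proof
    fix z assume "z \<in> ?g ` (E \<times> F)"
    then obtain q where q: "q \<in> E \<times> F" "z = ?g q" by blast
    show "r' z \<in> R" unfolding q(2) r'g[OF q(1)] using a q(1) by (auto split: prod.splits)
  qed
  have z0: "\<forall>z\<in>?g ` (E \<times> F). r' z = 0" by (rule big[OF fin gK2 conjunct2[OF prods] r'R rel])
  show ?thesis
  proof (rule ballI, rule ccontr)
    fix y assume y: "y \<in> E" "r y \<noteq> 0"
    have "a y x = 0" if "x \<in> F" for x
    proof -
      have q: "(y, x) \<in> E \<times> F" using y(1) that by blast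
      have "r' (?g (y, x)) = 0" using z0 q by blast
      then show ?thesis unfolding r'g[OF q] by simp
    qed
    then have "t y = 0" using a y(1) by simp
    moreover have "t y \<noteq> 0"
      unfolding t_def by (rule subr_nz_mult[OF subr_S1 _ subsetD[OF T1_S1 b(1)] y(2) b(2)]) (use r(1) y(1) in blast)
    ultimately show False by blast
  qed
qed

section \<open>Adjoining roots\<close>

locale root_setting =
  fixes K :: "'k ring" and \<Omega> :: "'o ring" and \<iota> :: "'k \<Rightarrow> 'o"
    and R :: "('k, 'r) module" and p :: nat and B :: "'k set"
  assumes fieldK: "field K" and char: "has_characteristic K p" and p_pos: "p > 0"
    and \<iota>: "\<iota> \<in> ring_hom K \<Omega>" and closure: "algebraic_closure \<Omega> (\<iota> ` carrier K)"
    and p_basis: "\<exists>C. p_basis K p C \<and> B \<subseteq> C"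
    and algebra_R: "algebra K R" and dvr: "discrete_valuation_ring R"
    and fin_dim: "vectorspace.fin_dim K (residue_field R)"
    and B_int: "B_integral \<Omega> K \<iota> p B R"
begin

sublocale K: field K by (rule fieldK)
sublocale \<Omega>: algebraic_closure \<Omega> "\<iota> ` carrier K" by (rule closure)

lemma prime_p: "Factorial_Ring.prime p"
proof (rule Factorial_Ring.primeI)
  have ch: "add_pow K n \<one>\<^bsub>K\<^esub> = \<zero>\<^bsub>K\<^esub> \<longleftrightarrow> p dvd n" for n :: nat using char unfolding has_characteristic_def by blast
  show "prime_elem p"
  proof (rule Factorial_Ring.prime_elemI)
    show "p \<noteq> 0" using p_pos by simp
    have "add_pow K (1::nat) \<one>\<^bsub>K\<^esub> \<noteq> \<zero>\<^bsub>K\<^esub>" using K.one_not_zero by simp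
    then show "\<not> p dvd 1" using ch by blast
    fix a b assume ab: "p dvd a * b"
    have "add_pow K a \<one>\<^bsub>K\<^esub> \<otimes>\<^bsub>K\<^esub> add_pow K b \<one>\<^bsub>K\<^esub> = add_pow K a (add_pow K b \<one>\<^bsub>K\<^esub>)"
      using K.add_pow_ldistr[of "\<one>\<^bsub>K\<^esub>" "add_pow K b \<one>\<^bsub>K\<^esub>" a] by simp
    also have "\<dots> = add_pow K (b * a) \<one>\<^bsub>K\<^esub>" by (rule K.add.nat_pow_pow) simp
    also have "\<dots> = \<zero>\<^bsub>K\<^esub>" using ch[of "b * a"] ab by (simp add: mult.commute)
    finally have "add_pow K a \<one>\<^bsub>K\<^esub> = \<zero>\<^bsub>K\<^esub> \<or> add_pow K b \<one>\<^bsub>K\<^esub> = \<zero>\<^bsub>K\<^esub>" by (intro K.integral) simp_all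
    then show "p dvd a \<or> p dvd b" using ch by blast
  qed
qed simp

lemma B_carrier: "B \<subseteq> carrier K" using p_basis unfolding p_basis_def by blast

lemma \<iota>_closed: "k \<in> carrier K \<Longrightarrow> \<iota> k \<in> carrier \<Omega>" by (rule ring_hom_closed[OF \<iota>])

text \<open>The polynomial \<open>X^m - a\<close> splits over the algebraic closure.\<close>

lemma root_exists:
  assumes "m > 0" "a \<in> carrier \<Omega>" shows "\<exists>z\<in>carrier \<Omega>. z [^]\<^bsub>\<Omega>\<^esub> (m::nat) = a"
proof -
  define P where "P = \<one>\<^bsub>\<Omega>\<^esub> # replicate (m - 1) \<zero>\<^bsub>\<Omega>\<^esub> @ [\<ominus>\<^bsub>\<Omega>\<^esub> a]"
  have P: "P \<in> carrier (poly_ring \<Omega>)" unfolding P_def univ_poly_def polynomial_def using assms(2) by auto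
  have len: "length P = Suc m" unfolding P_def using assms(1) by simp
  have "size (\<Omega>.roots P) = m" using \<Omega>.roots_over_carrier[OF P] len unfolding \<Omega>.splitted_def by simp
  then have "\<Omega>.roots P \<noteq> {#}" using assms(1) by auto
  then obtain z where "z \<in># \<Omega>.roots P" by blast
  then have "\<Omega>.is_root P z" using \<Omega>.roots_mem_iff_is_root[OF P] by blast
  then have z: "z \<in> carrier \<Omega>" "\<Omega>.eval P z = \<zero>\<^bsub>\<Omega>\<^esub>" unfolding \<Omega>.is_root_def by blast+
  have "\<Omega>.eval (replicate (m - 1) \<zero>\<^bsub>\<Omega>\<^esub> @ [\<ominus>\<^bsub>\<Omega>\<^esub> a]) z = \<Omega>.eval [\<ominus>\<^bsub>\<Omega>\<^esub> a] z"
    by (rule \<Omega>.eval_replicate) (use assms(2) z(1) in simp_all)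
  then have "z [^]\<^bsub>\<Omega>\<^esub> m \<oplus>\<^bsub>\<Omega>\<^esub> \<ominus>\<^bsub>\<Omega>\<^esub> a = \<zero>\<^bsub>\<Omega>\<^esub>" using z assms unfolding P_def by simp
  then have "\<ominus>\<^bsub>\<Omega>\<^esub> (\<ominus>\<^bsub>\<Omega>\<^esub> a) = z [^]\<^bsub>\<Omega>\<^esub> m" using z(1) assms(2) by (intro \<Omega>.minus_equality) simp_all
  then show ?thesis using z(1) assms(2) by auto
qed

text \<open>\<open>Kc n\<close> and \<open>Kinf\<close> are the fields \<open>K(B^(1/p^n))\<close>
  and \<open>K(B^(1/p^\<infinity>))\<close> as plain subsets of \<open>\<Omega>\<close>.\<close>

definition "roots_gen n = \<iota> ` carrier K \<union> {y \<in> carrier \<Omega>. y [^]\<^bsub>\<Omega>\<^esub> (p ^ n) \<in> \<iota> ` B}"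
definition "Kc n = generate_field \<Omega> (roots_gen n)"
definition "Kinf = (\<Union>n\<in>{1..}. Kc n)"

lemma adjoin_Kc: "adjoin_roots \<Omega> K \<iota> p B n = \<Omega>\<lparr>carrier := Kc n\<rparr>"
  unfolding adjoin_roots_def Kc_def roots_gen_def ..

lemma adjoin_Kinf: "adjoin_all_roots \<Omega> K \<iota> p B = \<Omega>\<lparr>carrier := Kinf\<rparr>"
  unfolding adjoin_all_roots_def Kinf_def adjoin_Kc by simp

lemma roots_gen_carrier: "roots_gen n \<subseteq> carrier \<Omega>" unfolding roots_gen_def using \<iota>_closed by blast

lemma roots_gen_Kc: "roots_gen n \<subseteq> Kc n" unfolding Kc_def by (auto intro: generate_field.incl)

lemma subfield_Kc: "subfield (Kc n) \<Omega>" unfolding Kc_def by (rule \<Omega>.generate_field_is_subfield[OF roots_gen_carrier])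

lemma Kc_pow: "y \<in> Kc n \<Longrightarrow> y [^]\<^bsub>\<Omega>\<^esub> (m::nat) \<in> Kc n"
  by (induction m) (simp_all add: subringE(3,6)[OF subfieldE(1)[OF subfield_Kc]])

text \<open>A \<open>p^n\<close>-th root is the p-th power of a root one level higher, which exists
  in the algebraic closure.\<close>

lemma Kc_Suc: "Kc n \<subseteq> Kc (Suc n)"
proof -
  have "roots_gen n \<subseteq> Kc (Suc n)"
  proof
    fix y assume y: "y \<in> roots_gen n"
    show "y \<in> Kc (Suc n)"
    proof (cases "y \<in> \<iota> ` carrier K")
      case True
      then show ?thesis using roots_gen_Kc[of "Suc n"] unfolding roots_gen_def by blast
    next
      case False
      then have yc: "y \<in> carrier \<Omega>" "y [^]\<^bsub>\<Omega>\<^esub> (p ^ n) \<in> \<iota> ` B" using y unfolding roots_gen_def by blast+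
      obtain z where z: "z \<in> carrier \<Omega>" "z [^]\<^bsub>\<Omega>\<^esub> p = y" using root_exists[OF p_pos yc(1)] by blast
      have "z [^]\<^bsub>\<Omega>\<^esub> (p ^ Suc n) = y [^]\<^bsub>\<Omega>\<^esub> (p ^ n)" using \<Omega>.nat_pow_pow[OF z(1), of p "p ^ n"] z(2) by simp
      then have "z \<in> Kc (Suc n)" using roots_gen_Kc[of "Suc n"] z(1) yc(2) unfolding roots_gen_def by auto
      then show ?thesis using Kc_pow[of z "Suc n" p] z(2) by simp
    qed
  qed
  then show ?thesis
    unfolding Kc_def[of n] by (rule \<Omega>.generate_field_min_subfield1[OF roots_gen_carrier subfield_Kc])
qed

lemma Kc_mono: "m \<le> n \<Longrightarrow> Kc m \<subseteq> Kc n" by (rule lift_Suc_mono_le[of Kc, OF Kc_Suc])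

lemma Kc_Kinf: "n \<ge> 1 \<Longrightarrow> Kc n \<subseteq> Kinf" unfolding Kinf_def by blast

lemma subfield_Kinf: "subfield Kinf \<Omega>"
proof -
  have two: "\<exists>n\<ge>1. x \<in> Kc n \<and> y \<in> Kc n" if xy: "x \<in> Kinf" "y \<in> Kinf" for x y
  proof -
    obtain m n where mn: "m \<ge> 1" "x \<in> Kc m" "n \<ge> 1" "y \<in> Kc n" using xy unfolding Kinf_def by auto
    have "x \<in> Kc (max m n)" "y \<in> Kc (max m n)" using mn Kc_mono[of m "max m n"] Kc_mono[of n "max m n"] by auto
    then show ?thesis using mn(1) by (intro exI[of _ "max m n"]) simp
  qed
  note rg = subringE[OF subfieldE(1)[OF subfield_Kc]]
  show ?thesis
  proof (rule \<Omega>.subfieldI')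
    show "subring Kinf \<Omega>"
    proof (rule \<Omega>.subringI)
      show "Kinf \<subseteq> carrier \<Omega>" unfolding Kinf_def using subfieldE(3)[OF subfield_Kc] by blast
      show "\<one>\<^bsub>\<Omega>\<^esub> \<in> Kinf" using rg(3)[of 1] Kc_Kinf[of 1] by auto
      fix x assume x: "x \<in> Kinf"
      obtain n where n: "n \<ge> 1" "x \<in> Kc n" using two[OF x x] by blast
      show "\<ominus>\<^bsub>\<Omega>\<^esub> x \<in> Kinf" using rg(5)[OF n(2)] Kc_Kinf[OF n(1)] by blast
      fix y assume y: "y \<in> Kinf"
      obtain m where m: "m \<ge> 1" "x \<in> Kc m" "y \<in> Kc m" using two[OF x y] by blast
      show "x \<otimes>\<^bsub>\<Omega>\<^esub> y \<in> Kinf" using rg(6)[OF m(2,3)] Kc_Kinf[OF m(1)] by blast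
      show "x \<oplus>\<^bsub>\<Omega>\<^esub> y \<in> Kinf" using rg(7)[OF m(2,3)] Kc_Kinf[OF m(1)] by blast
    qed
    fix x assume x: "x \<in> Kinf - {\<zero>\<^bsub>\<Omega>\<^esub>}"
    obtain n where n: "n \<ge> 1" "x \<in> Kc n" using two[of x x] x by blast
    have "inv\<^bsub>\<Omega>\<^esub> x \<in> Kc n" using \<Omega>.subfield_m_inv(1)[OF subfield_Kc, of x n] n(2) x by blast
    then show "inv\<^bsub>\<Omega>\<^esub> x \<in> Kinf" using Kc_Kinf[OF n(1)] by blast
  qed
qed

lemma \<iota>_Kc: "\<iota> ` carrier K \<subseteq> Kc n" using roots_gen_Kc[of n] unfolding roots_gen_def by blast

lemma \<iota>_Kinf: "\<iota> ` carrier K \<subseteq> Kinf" using \<iota>_Kc[of 1] Kc_Kinf[of 1] by simp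

lemma algebra_subfield:
  assumes F: "subfield F \<Omega>" "\<iota> ` carrier K \<subseteq> F"
  shows "cring (\<Omega>\<lparr>carrier := F\<rparr>)" "\<iota> \<in> ring_hom K (\<Omega>\<lparr>carrier := F\<rparr>)"
proof -
  show "cring (\<Omega>\<lparr>carrier := F\<rparr>)"
    using \<Omega>.subfield_iff(2)[OF F(1)] by (simp add: field_def domain_def)
  show "\<iota> \<in> ring_hom K (\<Omega>\<lparr>carrier := F\<rparr>)"
    using \<iota> F(2) unfolding ring_hom_def by auto
qed

end

section \<open>Normalizations as vector spaces over the adjoined fields\<close>

context normalized
begin

lemma scalar_N:
  assumes k: "cring k" and add: "\<And>x y. x \<in> carrier k \<Longrightarrow> y \<in> carrier k \<Longrightarrow> \<nu> (x \<oplus>\<^bsub>k\<^esub> y) = \<nu> x + \<nu> y"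
    and mult: "\<And>x y. x \<in> carrier k \<Longrightarrow> y \<in> carrier k \<Longrightarrow> \<nu> (x \<otimes>\<^bsub>k\<^esub> y) = \<nu> x * \<nu> y"
    and one: "\<nu> \<one>\<^bsub>k\<^esub> = e"
    and cl: "\<And>c x. c \<in> carrier k \<Longrightarrow> x \<in> carrier D \<Longrightarrow> c \<odot>\<^bsub>D\<^esub> x \<in> carrier D"
    and sm: "\<And>c x. c \<in> carrier k \<Longrightarrow> x \<in> carrier D \<Longrightarrow> \<phi> (c \<odot>\<^bsub>D\<^esub> x) = \<nu> c * \<phi> x"
  shows "scalar_embedding e N frmap k \<nu>"
proof (intro scalar_embedding.intro scalar_embedding_axioms.intro)
  interpret k: cring k by fact
  show "ring_embedding e N frmap" by (rule N_embedding)
  show "cring k" by fact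
  show "\<nu> \<one>\<^bsub>k\<^esub> = e" by (rule one)
  fix c d assume c: "c \<in> carrier k"
  { assume d: "d \<in> carrier k"
    show "\<nu> (c \<oplus>\<^bsub>k\<^esub> d) = \<nu> c + \<nu> d" by (rule add[OF c d])
    show "\<nu> (c \<otimes>\<^bsub>k\<^esub> d) = \<nu> c * \<nu> d" by (rule mult[OF c d]) }
  fix x assume x: "x \<in> carrier N"
  have c1: "c \<odot>\<^bsub>D\<^esub> \<one>\<^bsub>D\<^esub> \<in> carrier D" by (rule cl[OF c unit_closed(2)])
  have "e * \<nu> c = \<nu> c" using mult[OF k.one_closed c] one c by simp
  then have "\<phi> (c \<odot>\<^bsub>D\<^esub> \<one>\<^bsub>D\<^esub>) = \<nu> c" using sm[OF c unit_closed(2)] \<phi>_one by (simp add: mult.commute)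
  then show "frmap (c \<odot>\<^bsub>N\<^esub> x) = \<nu> c * frmap x" using N_smult(1)[OF c1 x] by simp
  show "c \<odot>\<^bsub>N\<^esub> x \<in> carrier N" by (rule N_smult(2)[OF c1 x])
qed

lemma quotient_N:
  assumes sc: "scalar_embedding e N frmap k \<nu>" and k: "field k"
    and cl: "\<And>c x. c \<in> carrier k \<Longrightarrow> x \<in> carrier D \<Longrightarrow> c \<odot>\<^bsub>D\<^esub> x \<in> carrier D"
    and sm: "\<And>c x. c \<in> carrier k \<Longrightarrow> x \<in> carrier D \<Longrightarrow> \<phi> (c \<odot>\<^bsub>D\<^esub> x) = \<nu> c * \<phi> x"
  shows "quotient_space e N frmap k \<nu> (to_frac D ` carrier D) (quotient_module N (to_frac D ` carrier D))"
proof (rule subspace_embedding.quotient_space_quotient_module)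
  show "subspace_embedding e N frmap k \<nu> (to_frac D ` carrier D)"
  proof (intro subspace_embedding.intro subspace_embedding_axioms.intro)
    show "scalar_embedding e N frmap k \<nu>" "field k" by fact+
    show "to_frac D ` carrier D \<subseteq> carrier N" by (rule to_frac_N)
    have r: "subr (\<phi> ` carrier D)" by (rule image_subr)
    show "idf.sm e (\<nu> ` carrier k) (frmap ` to_frac D ` carrier D)"
      unfolding to_frac_image
    proof (rule smI)
      show "e * x = x" if "x \<in> \<phi> ` carrier D" for x by (rule subr_unit[OF r that])
      show "0 \<in> \<phi> ` carrier D" by (rule subr_0[OF r])
      show "x - y \<in> \<phi> ` carrier D" if "x \<in> \<phi> ` carrier D" "y \<in> \<phi> ` carrier D" for x y by (rule subr_diff[OF r that])
      fix a x assume "a \<in> \<nu> ` carrier k" "x \<in> \<phi> ` carrier D"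
      then obtain c d where cd: "c \<in> carrier k" "a = \<nu> c" "d \<in> carrier D" "x = \<phi> d" by blast
      show "a * x \<in> \<phi> ` carrier D"
        unfolding cd(2,4) sm[OF cd(1,3), symmetric] by (rule imageI[OF cl[OF cd(1,3)]])
    qed
  qed
qed

end

text \<open>\<open>B\<close>-integrality enters here. It concerns the union of all levels, so one
  fraction field contains every finite level.\<close>

lemma (in root_setting) domain_tensor_Kinf:
  "domain_tensor K R (algebra_via \<iota> (adjoin_all_roots \<Omega> K \<iota> p B))"
proof -
  interpret D: discrete_valuation_ring R by (rule dvr)
  have "algebra K (algebra_via \<iota> (adjoin_all_roots \<Omega> K \<iota> p B))"
    unfolding adjoin_Kinf by (rule algebra_algebra_via[OF K.cring_axioms algebra_subfield[OF subfield_Kinf \<iota>_Kinf]])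
  then have t: "tensor K R (algebra_via \<iota> (adjoin_all_roots \<Omega> K \<iota> p B))" by (intro tensor.intro algebra_R)
  show ?thesis
  proof (intro domain_tensor.intro domain_tensor_axioms.intro)
    show "tensor K R (algebra_via \<iota> (adjoin_all_roots \<Omega> K \<iota> p B))" by (rule t)
    show "field K" by (rule fieldK)
    show "domain R" by (rule D.domain_axioms)
    show "field (algebra_via \<iota> (adjoin_all_roots \<Omega> K \<iota> p B))"
      unfolding field_algebra_via adjoin_Kinf by (rule \<Omega>.subfield_iff(2)[OF subfield_Kinf])
    show "domain (tensor.T K R (algebra_via \<iota> (adjoin_all_roots \<Omega> K \<iota> p B)))"
      unfolding tensor.T_def[OF t] using B_int unfolding B_integral_def .
  qed
qed

section \<open>The given data inside the common field\<close>

locale embedded_setting = root_setting K \<Omega> \<iota> R p B +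
    tensor_map K R "algebra_via \<iota> (adjoin_all_roots \<Omega> K \<iota> p B)" e \<rho> \<mu> \<chi>
  for K :: "'k ring" and \<Omega> :: "'o ring" and \<iota> :: "'k \<Rightarrow> 'o" and R :: "('k, 'r) module" and p :: nat
    and B :: "'k set" and e :: "'u::comm_ring_1" and \<rho> :: "'r \<Rightarrow> 'u" and \<mu> :: "'o \<Rightarrow> 'u" and \<chi> :: "'k \<Rightarrow> 'u"
begin

abbreviation "Cinf \<equiv> algebra_via \<iota> (adjoin_all_roots \<Omega> K \<iota> p B)"

lemma Cinf_simps:
  "carrier Cinf = Kinf" "ring.add Cinf = ring.add \<Omega>" "monoid.mult Cinf = monoid.mult \<Omega>" "\<one>\<^bsub>Cinf\<^esub> = \<one>\<^bsub>\<Omega>\<^esub>"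
  "k \<odot>\<^bsub>Cinf\<^esub> c = \<iota> k \<otimes>\<^bsub>\<Omega>\<^esub> c"
  unfolding adjoin_Kinf by (simp_all add: algebra_via_def)

sublocale FM: field_map e \<Omega> Kinf \<mu>
  by (intro field_map.intro field_map_axioms.intro idf_axioms \<Omega>.field_axioms subfield_Kinf
      \<mu>_add[unfolded Cinf_simps] \<mu>_mult[unfolded Cinf_simps] \<mu>_one[unfolded Cinf_simps])

lemma \<chi>_\<iota>:
  assumes k: "k \<in> carrier K" shows "\<chi> k = \<mu> (\<iota> k)"
proof -
  have "\<mu> (\<iota> k \<otimes>\<^bsub>\<Omega>\<^esub> \<one>\<^bsub>\<Omega>\<^esub>) = \<chi> k * \<mu> \<one>\<^bsub>\<Omega>\<^esub>"
    using \<mu>_smult[unfolded Cinf_simps, OF k FM.F_closed(2)] .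
  moreover have "e * \<chi> k = \<chi> k" by (rule subr_unit[OF subf_r[OF L] imageI[OF k]])
  ultimately show ?thesis using \<iota>_closed[OF k] FM.\<nu>_one by (simp add: mult.commute)
qed

lemma \<iota>K: "k \<in> carrier K \<Longrightarrow> \<iota> k \<in> Kinf" using \<iota>_Kinf by blast

sublocale SM: field_map e K "carrier K" \<chi>
proof (intro field_map.intro field_map_axioms.intro)
  show "idf e" by (rule idf_axioms)
  show "field K" by (rule fieldK)
  show "subfield (carrier K) K" by (rule K.carrier_is_subfield)
  show "\<chi> \<one>\<^bsub>K\<^esub> = e" using \<chi>_\<iota>[OF K.one_closed] ring_hom_one[OF \<iota>] FM.\<nu>_one by simp
  fix k l assume kl: "k \<in> carrier K" "l \<in> carrier K"
  show "\<chi> (k \<oplus>\<^bsub>K\<^esub> l) = \<chi> k + \<chi> l"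
    unfolding \<chi>_\<iota>[OF kl(1)] \<chi>_\<iota>[OF kl(2)] \<chi>_\<iota>[OF K.add.m_closed[OF kl]] ring_hom_add[OF \<iota> kl]
    by (rule FM.\<nu>_add[OF \<iota>K[OF kl(1)] \<iota>K[OF kl(2)]])
  show "\<chi> (k \<otimes>\<^bsub>K\<^esub> l) = \<chi> k * \<chi> l"
    unfolding \<chi>_\<iota>[OF kl(1)] \<chi>_\<iota>[OF kl(2)] \<chi>_\<iota>[OF K.m_closed[OF kl]] ring_hom_mult[OF \<iota> kl]
    by (rule FM.\<nu>_mult[OF \<iota>K[OF kl(1)] \<iota>K[OF kl(2)]])
qed

lemma char_e: "of_nat n * e = \<chi> (add_pow K n \<one>\<^bsub>K\<^esub>)"
proof (induction n)
  case 0
  then show ?case by (simp add: SM.\<nu>_zero)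
next
  case (Suc n)
  then show ?case using SM.\<nu>_add[of "add_pow K n \<one>\<^bsub>K\<^esub>" "\<one>\<^bsub>K\<^esub>"] SM.\<nu>_one by (simp add: distrib_right)
qed

sublocale idf_char e p
proof (intro idf_char.intro idf_char_axioms.intro)
  show "idf e" by (rule idf_axioms)
  show "Factorial_Ring.prime p" by (rule prime_p)
  have "add_pow K p \<one>\<^bsub>K\<^esub> = \<zero>\<^bsub>K\<^esub> \<longleftrightarrow> p dvd p" using char unfolding has_characteristic_def by (rule spec)
  then have "add_pow K p \<one>\<^bsub>K\<^esub> = \<zero>\<^bsub>K\<^esub>" by (rule iffD2) (rule dvd_refl)
  then show "of_nat p * e = 0" using char_e[of p] SM.\<nu>_zero by simp
qed

abbreviation "RU \<equiv> \<rho> ` carrier R"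
abbreviation "KU \<equiv> \<chi> ` carrier K"
abbreviation "KcU n \<equiv> \<mu> ` Kc n"

lemma subf_KcU: "n \<ge> 1 \<Longrightarrow> subf (KcU n)" by (rule FM.image_subf[OF subfield_Kc Kc_Kinf])

lemma KU_KcU: "KU \<subseteq> KcU n"
proof
  fix x assume "x \<in> KU"
  then obtain k where k: "k \<in> carrier K" "x = \<chi> k" by blast
  then show "x \<in> KcU n" using \<chi>_\<iota> \<iota>_Kc[of n] by auto
qed

lemma KcU_root:
  assumes "n \<ge> 1" "b \<in> \<chi> ` B" shows "\<exists>y\<in>KcU n. y ^ (p ^ n) = b"
proof -
  obtain b' where b': "b' \<in> B" "b = \<chi> b'" using assms(2) by blast
  have bK: "b' \<in> carrier K" using b'(1) B_carrier by blast
  have pn: "p ^ n > 0" using p_pos by simp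
  obtain y where y: "y \<in> carrier \<Omega>" "y [^]\<^bsub>\<Omega>\<^esub> (p ^ n) = \<iota> b'" using root_exists[OF pn \<iota>_closed[OF bK]] by blast
  have yK: "y \<in> Kc n" using roots_gen_Kc[of n] y b'(1) unfolding roots_gen_def by auto
  have "\<mu> y ^ (p ^ n) = b" using FM.\<nu>_pow'[OF subsetD[OF Kc_Kinf[OF assms(1)] yK] pn] y(2) \<chi>_\<iota>[OF bK] b'(2) by simp
  then show ?thesis using yK by blast
qed

lemma KcU_min:
  assumes n: "n \<ge> 1" and F: "subf F" "KU \<subseteq> F" "\<And>y. e * y = y \<Longrightarrow> y ^ (p ^ n) \<in> \<chi> ` B \<Longrightarrow> y \<in> F"
  shows "KcU n \<subseteq> F"
  unfolding Kc_def
proof (rule FM.image_generate_field[OF _ F(1)])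
  show g: "roots_gen n \<subseteq> Kinf" using roots_gen_Kc[of n] Kc_Kinf[OF n] by blast
  have pn: "p ^ n > 0" using p_pos by simp
  show "\<mu> ` roots_gen n \<subseteq> F"
  proof
    fix x assume "x \<in> \<mu> ` roots_gen n"
    then obtain y where y: "y \<in> roots_gen n" "x = \<mu> y" by blast
    show "x \<in> F"
    proof (cases "y \<in> \<iota> ` carrier K")
      case True
      then show ?thesis using y(2) \<chi>_\<iota> F(2) by auto
    next
      case False
      then obtain b where b: "b \<in> B" "y [^]\<^bsub>\<Omega>\<^esub> (p ^ n) = \<iota> b" using y(1) unfolding roots_gen_def by blast
      have bK: "b \<in> carrier K" using b(1) B_carrier by blast
      have yI: "y \<in> Kinf" using y(1) g by blast
      have "\<mu> y ^ (p ^ n) = \<chi> b" using FM.\<nu>_pow'[OF yI pn] b(2) \<chi>_\<iota>[OF bK] by simp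
      then show ?thesis using F(3)[OF FM.\<nu>_e[OF yI]] b(1) y(2) by simp
    qed
  qed
qed

text \<open>The p-basis condition speaks of subsets of \<open>B\<close>. A set \<open>S'\<close>
  mapped injectively onto \<open>S\<close> has the same cardinality, and
  \<open>dimension_codim\<close> transports the degree.\<close>

lemma p_independent:
  assumes S: "finite S" "S \<subseteq> \<chi> ` B"
  shows "\<exists>W. codim ((\<lambda>x. x ^ p) ` KU) {0} (p ^ card S) W \<and>
      (\<forall>F. subf F \<longrightarrow> (\<lambda>x. x ^ p) ` KU \<subseteq> F \<longrightarrow> S \<subseteq> F \<longrightarrow> W \<subseteq> F)"
proof -
  have "\<exists>S'\<subseteq>B. inj_on \<chi> S' \<and> S = \<chi> ` S'" using S(2) subset_image_inj by metis
  then obtain S' where S': "S' \<subseteq> B" "inj_on \<chi> S'" "S = \<chi> ` S'" by (elim exE conjE)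
  have fS: "finite S'" using S(1) finite_image_iff[OF S'(2)] unfolding S'(3) by blast
  have cS: "card S = card S'" unfolding S'(3) by (rule card_image[OF S'(2)])
  have SK: "S' \<subseteq> carrier K" using S'(1) B_carrier by blast
  obtain C where C: "p_basis K p C" "B \<subseteq> C" using p_basis by blast
  have PK: "pth_powers K p \<subseteq> carrier K" unfolding pth_powers_def by auto
  have dim: "K.dimension (p ^ card S') (pth_powers K p) (generate_field K (pth_powers K p \<union> S'))"
    using C fS S'(1) unfolding p_basis_def by blast
  have P: "\<chi> ` pth_powers K p = (\<lambda>x. x ^ p) ` KU"
    unfolding pth_powers_def image_image by (rule image_cong[OF HOL.refl]) (rule SM.\<nu>_pow'[OF _ p_pos])
  have c: "codim (\<chi> ` pth_powers K p) {0} (p ^ card S') (\<chi> ` generate_field K (pth_powers K p \<union> S'))"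
    by (rule conjunct2[OF SM.dimension_codim[OF HOL.refl PK dim]])
  show ?thesis
  proof (intro exI conjI allI impI)
    show "codim ((\<lambda>x. x ^ p) ` KU) {0} (p ^ card S) (\<chi> ` generate_field K (pth_powers K p \<union> S'))"
      using c unfolding P cS .
    fix F assume F: "subf F" "(\<lambda>x. x ^ p) ` KU \<subseteq> F" "S \<subseteq> F"
    show "\<chi> ` generate_field K (pth_powers K p \<union> S') \<subseteq> F"
    proof (rule SM.image_generate_field[OF _ F(1)])
      show "pth_powers K p \<union> S' \<subseteq> carrier K" using PK SK by blast
      show "\<chi> ` (pth_powers K p \<union> S') \<subseteq> F" unfolding image_Un P S'(3)[symmetric] using F(2,3) by blast
    qed
  qed
qed

lemma p_root_tower_U: "p_root_tower e p KU (KcU 1) (KcU 2) (\<chi> ` B)"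
proof (intro p_root_tower.intro p_root_tower_axioms.intro)
  show "idf_char e p" by (rule idf_char_axioms)
  show "subf KU" by (rule L)
  show "\<chi> ` B \<subseteq> KU" using B_carrier by blast
  show "subf (KcU 1)" "subf (KcU 2)" by (rule subf_KcU, simp)+
  show "KU \<subseteq> KcU 1" "KU \<subseteq> KcU 2" by (rule KU_KcU)+
  show "\<exists>y\<in>KcU 1. y ^ p = b" if "b \<in> \<chi> ` B" for b using KcU_root[OF _ that, of 1] by simp
  have pp: "y ^ (p ^ 2) = (y ^ p) ^ p" for y :: 'u by (simp add: power_mult[symmetric] power2_eq_square)
  show "\<exists>y\<in>KcU 2. (y ^ p) ^ p = b" if "b \<in> \<chi> ` B" for b using KcU_root[OF _ that, of 2] unfolding pp by simp
  show "KcU 1 \<subseteq> F" if "subf F" "KU \<subseteq> F" "\<And>y. e * y = y \<Longrightarrow> y ^ p \<in> \<chi> ` B \<Longrightarrow> y \<in> F" for F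
    by (rule KcU_min) (use that in simp_all)
  show "KcU 2 \<subseteq> F" if "subf F" "KU \<subseteq> F" "\<And>y. e * y = y \<Longrightarrow> (y ^ p) ^ p \<in> \<chi> ` B \<Longrightarrow> y \<in> F" for F
  proof (rule KcU_min[OF _ that(1,2)])
    show "y \<in> F" if "e * y = y" "y ^ p ^ 2 \<in> \<chi> ` B" for y
      using \<open>\<And>y. e * y = y \<Longrightarrow> (y ^ p) ^ p \<in> \<chi> ` B \<Longrightarrow> y \<in> F\<close>[OF that(1)] that(2) unfolding pp by blast
  qed simp
  show "\<exists>W. codim ((\<lambda>x. x ^ p) ` KU) {0} (p ^ card S) W \<and>
      (\<forall>F. subf F \<longrightarrow> (\<lambda>x. x ^ p) ` KU \<subseteq> F \<longrightarrow> S \<subseteq> F \<longrightarrow> W \<subseteq> F)" if "finite S" "S \<subseteq> \<chi> ` B" for S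
    by (rule p_independent[OF that])
qed

lemma emb_R: "ring_embedding e R \<rho>"
proof (intro ring_embedding.intro ring_embedding_axioms.intro)
  show "idf e" by (rule idf_axioms)
  show "\<zero>\<^bsub>R\<^esub> \<in> carrier R" "\<one>\<^bsub>R\<^esub> \<in> carrier R" by simp_all
  show "\<rho> \<zero>\<^bsub>R\<^esub> = 0" by (rule \<rho>_zero)
  show "\<rho> \<one>\<^bsub>R\<^esub> = e" by (rule \<rho>_one)
  fix x assume x: "x \<in> carrier R"
  show "e * \<rho> x = \<rho> x" by (rule \<rho>_e[OF x])
  have "\<rho> (\<ominus>\<^bsub>R\<^esub> x) + \<rho> x = 0" using \<rho>_add[of "\<ominus>\<^bsub>R\<^esub> x" x] \<rho>_zero x by (simp add: A.M.l_neg)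
  then show "\<exists>y\<in>carrier R. \<rho> y = - \<rho> x"
    using x by (intro bexI[of _ "\<ominus>\<^bsub>R\<^esub> x"]) (simp_all add: eq_neg_iff_add_eq_0)
  fix y assume y: "y \<in> carrier R"
  show "x \<oplus>\<^bsub>R\<^esub> y \<in> carrier R" "x \<otimes>\<^bsub>R\<^esub> y \<in> carrier R" using x y by simp_all
  show "\<rho> (x \<oplus>\<^bsub>R\<^esub> y) = \<rho> x + \<rho> y" by (rule \<rho>_add[OF x y])
  show "\<rho> (x \<otimes>\<^bsub>R\<^esub> y) = \<rho> x * \<rho> y" by (rule \<rho>_mult[OF x y])
  show "\<rho> x = \<rho> y \<Longrightarrow> x = y" using inj_onD[OF \<rho>_inj _ x y] by blast
qed

text \<open>The residue field is the quotient space of \<open>R\<close> by its maximal ideal, so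
  finitely many generators of it lift to \<open>R\<close>.\<close>

lemma residue_generators:
  "\<exists>Z. finite Z \<and> Z \<subseteq> RU \<and> RU \<subseteq> sumset (\<rho> ` max_ideal R) (mprod KU Z)"
proof -
  interpret D: discrete_valuation_ring R by (rule dvr)
  interpret max: maximalideal "max_ideal R" R by (rule D.maximalideal_max_ideal)
  have sc: "scalar_embedding e R \<rho> K \<chi>"
    by (intro scalar_embedding.intro scalar_embedding_axioms.intro emb_R K.cring_axioms
        SM.\<nu>_add SM.\<nu>_mult SM.\<nu>_one A.smult_closed \<rho>_smult)
  have Rr: "subr RU" by (rule ring_embedding.image_subr[OF emb_R])
  have "subspace_embedding e R \<rho> K \<chi> (max_ideal R)"
  proof (intro subspace_embedding.intro subspace_embedding_axioms.intro)
    show "scalar_embedding e R \<rho> K \<chi>" by (rule sc)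
    show "field K" by (rule fieldK)
    show sub: "max_ideal R \<subseteq> carrier R" by (rule max.a_subset)
    show "sm KU (\<rho> ` max_ideal R)"
    proof (rule smI)
      show "e * x = x" if "x \<in> \<rho> ` max_ideal R" for x using that sub \<rho>_e by blast
      show "0 \<in> \<rho> ` max_ideal R" using max.zero_closed \<rho>_zero by (metis imageI)
      fix x assume "x \<in> \<rho> ` max_ideal R"
      then obtain a where a: "a \<in> max_ideal R" "a \<in> carrier R" "x = \<rho> a" using sub by blast
      { fix y assume "y \<in> \<rho> ` max_ideal R"
        then obtain b where b: "b \<in> max_ideal R" "b \<in> carrier R" "y = \<rho> b" using sub by blast
        have "\<rho> (\<ominus>\<^bsub>R\<^esub> b) + \<rho> b = 0" using \<rho>_add[of "\<ominus>\<^bsub>R\<^esub> b" b] \<rho>_zero b(2) by (simp add: A.M.l_neg)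
        then have "x - y = \<rho> (a \<oplus>\<^bsub>R\<^esub> \<ominus>\<^bsub>R\<^esub> b)"
          using \<rho>_add[of a "\<ominus>\<^bsub>R\<^esub> b"] a b by (simp add: eq_neg_iff_add_eq_0[symmetric])
        then show "x - y \<in> \<rho> ` max_ideal R" using max.a_closed[OF a(1) max.a_inv_closed[OF b(1)]] by blast }
      fix l assume "l \<in> KU"
      then obtain k where k: "k \<in> carrier K" "l = \<chi> k" by blast
      have "k \<odot>\<^bsub>R\<^esub> a = (k \<odot>\<^bsub>R\<^esub> \<one>\<^bsub>R\<^esub>) \<otimes>\<^bsub>R\<^esub> a" using A.smult_assoc2[OF k(1) A.one_closed a(2)] a(2) by simp
      then have "k \<odot>\<^bsub>R\<^esub> a \<in> max_ideal R" using max.I_l_closed[OF a(1)] A.smult_closed[OF k(1) A.one_closed] by simp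
      then show "l * x \<in> \<rho> ` max_ideal R" unfolding k(2) a(3) \<rho>_smult[OF k(1) a(2), symmetric] by (rule imageI)
    qed
  qed
  then have "quotient_space e R \<rho> K \<chi> (max_ideal R) (residue_field R)"
  proof (intro quotient_space.intro quotient_space_axioms.intro)
    show "carrier (residue_field R) = a_rcosets\<^bsub>R\<^esub> (max_ideal R)" "ring.add (residue_field R) = set_add R"
      "\<zero>\<^bsub>residue_field R\<^esub> = max_ideal R"
      unfolding residue_field_def algebra_via_def FactRing_def by simp_all
    fix k x assume k: "k \<in> carrier K" and x: "x \<in> carrier R"
    have k1: "k \<odot>\<^bsub>R\<^esub> \<one>\<^bsub>R\<^esub> \<in> carrier R" by (rule A.smult_closed[OF k A.one_closed])
    have "k \<odot>\<^bsub>residue_field R\<^esub> (max_ideal R +>\<^bsub>R\<^esub> x) =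
        rcoset_mult R (max_ideal R) (max_ideal R +>\<^bsub>R\<^esub> (k \<odot>\<^bsub>R\<^esub> \<one>\<^bsub>R\<^esub>)) (max_ideal R +>\<^bsub>R\<^esub> x)"
      unfolding residue_field_def algebra_via_def FactRing_def by simp
    also have "\<dots> = max_ideal R +>\<^bsub>R\<^esub> ((k \<odot>\<^bsub>R\<^esub> \<one>\<^bsub>R\<^esub>) \<otimes>\<^bsub>R\<^esub> x)" by (rule max.rcoset_mult_add[OF k1 x])
    also have "(k \<odot>\<^bsub>R\<^esub> \<one>\<^bsub>R\<^esub>) \<otimes>\<^bsub>R\<^esub> x = k \<odot>\<^bsub>R\<^esub> x" using A.smult_assoc2[OF k A.one_closed x] x by simp
    finally show "k \<odot>\<^bsub>residue_field R\<^esub> (max_ideal R +>\<^bsub>R\<^esub> x) = max_ideal R +>\<^bsub>R\<^esub> (k \<odot>\<^bsub>R\<^esub> x)" .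
  qed
  note Q = this
  have V: "vectorspace K (residue_field R)" by (rule quotient_space.vectorspace_Q[OF Q])
  obtain G where G: "finite G" "G \<subseteq> carrier (residue_field R)"
    "LinearCombinations.module.span K (residue_field R) G = carrier (residue_field R)"
    using fin_dim unfolding vectorspace.fin_dim_def[OF V] by (elim exE conjE)
  show ?thesis using quotient_space.generators[OF Q G] by (elim exE conjE) (intro exI conjI)
qed

lemma disjoint_KcU:
  assumes "n \<ge> 1" "finite E" "E \<subseteq> KcU n" "lin_indep KU E" "\<forall>y\<in>E. r y \<in> RU" "(\<Sum>y\<in>E. r y * y) = 0"
  shows "\<forall>y\<in>E. r y = 0"
  by (rule disjoint[OF assms(2) _ assms(4-6)]) (use assms(3) Kc_Kinf[OF assms(1)] Cinf_simps(1) in blast)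

lemma tower_U: "\<exists>\<eta> Z0. tower e p RU KU (KcU 1) (KcU 2) \<eta> Z0"
proof -
  interpret D: discrete_valuation_ring R by (rule dvr)
  interpret E: ring_embedding e R \<rho> by (rule emb_R)
  interpret P: p_root_tower e p KU "KcU 1" "KcU 2" "\<chi> ` B" by (rule p_root_tower_U)
  obtain w where w: "w \<in> carrier R" "max_ideal R = PIdl\<^bsub>R\<^esub> w" "w \<noteq> \<zero>\<^bsub>R\<^esub>" "w \<notin> Units R"
    "\<forall>s\<in>carrier R. s \<noteq> \<zero>\<^bsub>R\<^esub> \<longrightarrow> (\<exists>(j::nat). \<exists>u\<in>Units R. s = u \<otimes>\<^bsub>R\<^esub> w [^]\<^bsub>R\<^esub> j)"
    by (rule D.max_ideal_uniformizer) (rule that; blast)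
  obtain Z where Z: "finite Z" "Z \<subseteq> RU" "RU \<subseteq> sumset (\<rho> ` max_ideal R) (mprod KU Z)"
    using residue_generators by (elim exE conjE)
  have rpow: "\<rho> (w [^]\<^bsub>R\<^esub> j) = e * \<rho> w ^ j" for j :: nat
  proof (induction j)
    case 0
    then show ?case by (simp add: \<rho>_one)
  next
    case (Suc j)
    then show ?case using \<rho>_mult[of "w [^]\<^bsub>R\<^esub> j" w] w(1) by (simp add: ac_simps)
  qed
  have "tower e p RU KU (KcU 1) (KcU 2) (\<rho> w) Z"
  proof (intro tower.intro tower_axioms.intro)
    show "idf_char e p" by (rule idf_char_axioms)
    show "subr RU" by (rule E.image_subr)
    show "subf KU" by (rule L)
    show "KU \<subseteq> RU"
    proof
      fix x assume "x \<in> KU"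
      then obtain k where k: "k \<in> carrier K" "x = \<chi> k" by blast
      have "\<rho> (k \<odot>\<^bsub>R\<^esub> \<one>\<^bsub>R\<^esub>) = \<chi> k" using \<rho>_smult[OF k(1) A.one_closed] \<rho>_one SM.\<nu>_e[OF k(1)] by (simp add: mult.commute)
      then show "x \<in> RU" using k A.smult_closed[OF k(1) A.one_closed] by (metis imageI)
    qed
    show "subf (KcU 1)" "subf (KcU 2)" by (rule subf_KcU, simp)+
    show "KU \<subseteq> KcU 1" by (rule KU_KcU)
    show "KcU 1 \<subseteq> KcU 2" by (rule P.K1_K2)
    show "(\<lambda>x. x ^ p) ` KcU 1 \<subseteq> KU" by (rule P.K1_pow)
    show "(\<lambda>x. x ^ p) ` KcU 2 \<subseteq> KcU 1" by (rule P.K2_pow)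
    show "\<rho> w \<in> RU" using w(1) by blast
    show "\<rho> w \<noteq> 0" using w(1,3) E.\<phi>_inj[OF w(1) A.M.zero_closed] \<rho>_zero by auto
    show "\<rho> w * v \<noteq> e" if v: "v \<in> RU" for v
    proof
      assume wv: "\<rho> w * v = e"
      obtain x where x: "x \<in> carrier R" "v = \<rho> x" using v by blast
      have "\<rho> (w \<otimes>\<^bsub>R\<^esub> x) = \<rho> \<one>\<^bsub>R\<^esub>" using wv x \<rho>_mult[OF w(1) x(1)] \<rho>_one by simp
      then have "w \<otimes>\<^bsub>R\<^esub> x = \<one>\<^bsub>R\<^esub>" using E.\<phi>_inj[of "w \<otimes>\<^bsub>R\<^esub> x" "\<one>\<^bsub>R\<^esub>"] w(1) x(1) by simp
      then have "w \<in> Units R" using w(1) x(1) A.m_comm[OF w(1) x(1)] unfolding Units_def by auto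
      then show False using w(4) by blast
    qed
    show "\<exists>j u v. u \<in> RU \<and> v \<in> RU \<and> u * v = e \<and> r = u * \<rho> w ^ j" if r: "r \<in> RU" "r \<noteq> 0" for r
    proof -
      obtain s where s: "s \<in> carrier R" "r = \<rho> s" using r(1) by blast
      have "s \<noteq> \<zero>\<^bsub>R\<^esub>" using r(2) s(2) \<rho>_zero by auto
      then obtain j :: nat and u where u: "u \<in> Units R" "s = u \<otimes>\<^bsub>R\<^esub> w [^]\<^bsub>R\<^esub> j" using w(5) s(1) by blast
      have uc: "u \<in> carrier R" "inv\<^bsub>R\<^esub> u \<in> carrier R" "u \<otimes>\<^bsub>R\<^esub> inv\<^bsub>R\<^esub> u = \<one>\<^bsub>R\<^esub>" using u(1) by auto
      have "\<rho> u * \<rho> (inv\<^bsub>R\<^esub> u) = e" using \<rho>_mult[OF uc(1,2)] uc(3) \<rho>_one by simp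
      moreover have "r = (e * \<rho> u) * \<rho> w ^ j"
        unfolding s(2) u(2) using \<rho>_mult[OF uc(1), of "w [^]\<^bsub>R\<^esub> j"] w(1) rpow by (simp add: ac_simps)
      ultimately show ?thesis unfolding \<rho>_e[OF uc(1)] using uc(1,2) by blast
    qed
    show "finite Z" "Z \<subseteq> RU" by (rule Z)+
    have "\<rho> ` max_ideal R = (*) (\<rho> w) ` RU"
    proof
      show "\<rho> ` max_ideal R \<subseteq> (*) (\<rho> w) ` RU"
      proof
        fix z assume "z \<in> \<rho> ` max_ideal R"
        then obtain x where x: "x \<in> carrier R" "z = \<rho> (x \<otimes>\<^bsub>R\<^esub> w)" unfolding w(2) cgenideal_def by blast
        have "z = \<rho> w * \<rho> x" unfolding x(2) \<rho>_mult[OF x(1) w(1)] by (rule mult.commute)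
        then show "z \<in> (*) (\<rho> w) ` RU" using x(1) by blast
      qed
      show "(*) (\<rho> w) ` RU \<subseteq> \<rho> ` max_ideal R"
      proof
        fix z assume "z \<in> (*) (\<rho> w) ` RU"
        then obtain x where x: "x \<in> carrier R" "z = \<rho> w * \<rho> x" by blast
        have "z = \<rho> (x \<otimes>\<^bsub>R\<^esub> w)" unfolding x(2) \<rho>_mult[OF x(1) w(1)] by (rule mult.commute)
        then show "z \<in> \<rho> ` max_ideal R" unfolding w(2) cgenideal_def using x(1) by blast
      qed
    qed
    then show "RU \<subseteq> sumset ((*) (\<rho> w) ` RU) (mprod KU Z)" using Z(3) by simp
    show "KcU 1 \<subseteq> mprod KU ((\<lambda>x. x ^ p) ` KcU 2)" by (rule P.K1_generated)
    show "\<exists>E. finite E \<and> E \<subseteq> (\<lambda>x. x ^ p) ` KcU 2 \<and> Xs \<subseteq> mprod ((\<lambda>x. x ^ p) ` KcU 1) E \<and>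
        (\<forall>c. (\<forall>y\<in>E. c y \<in> KU) \<longrightarrow> (\<Sum>y\<in>E. c y * y) = 0 \<longrightarrow> (\<forall>y\<in>E. c y = 0))"
      if "finite Xs" "Xs \<subseteq> (\<lambda>x. x ^ p) ` KcU 2" for Xs
      by (rule P.k2_independent_basis[OF that])
    show "\<forall>y\<in>E. r y = 0" if "finite E" "E \<subseteq> KcU 1"
      "\<forall>c. (\<forall>y\<in>E. c y \<in> KU) \<longrightarrow> (\<Sum>y\<in>E. c y * y) = 0 \<longrightarrow> (\<forall>y\<in>E. c y = 0)"
      "\<forall>y\<in>E. r y \<in> RU" "(\<Sum>y\<in>E. r y * y) = 0" for E r
      by (rule disjoint_KcU[OF _ that(1,2) _ that(4,5)]) (use that(3) in \<open>simp_all add: lin_indep_def\<close>)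
  qed
  then show ?thesis by blast
qed

end

section \<open>Both levels of the tower and the inequality\<close>

context embedded_setting
begin

abbreviation "Kr n \<equiv> adjoin_roots \<Omega> K \<iota> p B n"
abbreviation "Cn n \<equiv> algebra_via \<iota> (Kr n)"

lemma Cn_simps:
  "carrier (Cn n) = Kc n" "ring.add (Cn n) = ring.add \<Omega>" "monoid.mult (Cn n) = monoid.mult \<Omega>" "\<one>\<^bsub>Cn n\<^esub> = \<one>\<^bsub>\<Omega>\<^esub>"
  "k \<odot>\<^bsub>Cn n\<^esub> c = \<iota> k \<otimes>\<^bsub>\<Omega>\<^esub> c"
  unfolding adjoin_Kc by (simp_all add: algebra_via_def)

lemma Kr_simps:
  "carrier (Kr n) = Kc n" "ring.add (Kr n) = ring.add \<Omega>" "monoid.mult (Kr n) = monoid.mult \<Omega>" "\<one>\<^bsub>Kr n\<^esub> = \<one>\<^bsub>\<Omega>\<^esub>"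
  unfolding adjoin_Kc by simp_all

lemma field_Kr: "field (Kr n)" unfolding adjoin_Kc by (rule \<Omega>.subfield_iff(2)[OF subfield_Kc])

lemma cring_Kr: "cring (Kr n)" using field_Kr[of n] by (simp add: field_def domain_def)

lemma \<mu>_Kc_add: "n \<ge> 1 \<Longrightarrow> x \<in> Kc n \<Longrightarrow> y \<in> Kc n \<Longrightarrow> \<mu> (x \<oplus>\<^bsub>\<Omega>\<^esub> y) = \<mu> x + \<mu> y"
  and \<mu>_Kc_mult: "n \<ge> 1 \<Longrightarrow> x \<in> Kc n \<Longrightarrow> y \<in> Kc n \<Longrightarrow> \<mu> (x \<otimes>\<^bsub>\<Omega>\<^esub> y) = \<mu> x * \<mu> y"
  using FM.\<nu>_add[of x y] FM.\<nu>_mult[of x y] Kc_Kinf[of n] by blast+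

lemma inj_on_Kc: "n \<ge> 1 \<Longrightarrow> inj_on \<mu> (Kc n)"
  using inj_on_subset[OF FM.\<nu>_inj Kc_Kinf] .

text \<open>Linear disjointness is inherited by the subfield \<open>Kc n\<close> of
  \<open>Kinf\<close>, so each finite level embeds in the common field as well.\<close>

lemma tensor_map_Kc:
  assumes n: "n \<ge> 1" shows "tensor_map K R (Cn n) e \<rho> \<mu> \<chi>"
proof (intro tensor_map.intro tensor_map_axioms.intro)
  have "algebra K (Cn n)"
    unfolding adjoin_Kc by (rule algebra_algebra_via[OF K.cring_axioms algebra_subfield[OF subfield_Kc \<iota>_Kc]])
  then show "tensor K R (Cn n)" by (intro tensor.intro algebra_R)
  show "idf e" by (rule idf_axioms)
  show "subf (\<chi> ` carrier K)" by (rule L)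
  show "\<rho> \<one>\<^bsub>R\<^esub> = e" "inj_on \<rho> (carrier R)" by (rule \<rho>_one, rule \<rho>_inj)
  show "\<rho> (x \<oplus>\<^bsub>R\<^esub> y) = \<rho> x + \<rho> y" if "x \<in> carrier R" "y \<in> carrier R" for x y by (rule \<rho>_add[OF that])
  show "\<rho> (x \<otimes>\<^bsub>R\<^esub> y) = \<rho> x * \<rho> y" if "x \<in> carrier R" "y \<in> carrier R" for x y by (rule \<rho>_mult[OF that])
  show "\<rho> (k \<odot>\<^bsub>R\<^esub> a) = \<chi> k * \<rho> a" if "k \<in> carrier K" "a \<in> carrier R" for k a by (rule \<rho>_smult[OF that])
  show "\<mu> (x \<oplus>\<^bsub>Cn n\<^esub> y) = \<mu> x + \<mu> y" if "x \<in> carrier (Cn n)" "y \<in> carrier (Cn n)" for x y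
    using that unfolding Cn_simps by (rule \<mu>_Kc_add[OF n])
  show "\<mu> (x \<otimes>\<^bsub>Cn n\<^esub> y) = \<mu> x * \<mu> y" if "x \<in> carrier (Cn n)" "y \<in> carrier (Cn n)" for x y
    using that unfolding Cn_simps by (rule \<mu>_Kc_mult[OF n])
  show "\<mu> \<one>\<^bsub>Cn n\<^esub> = e" unfolding Cn_simps by (rule FM.\<nu>_one)
  show "inj_on \<mu> (carrier (Cn n))" unfolding Cn_simps by (rule inj_on_Kc[OF n])
  show "\<mu> (k \<odot>\<^bsub>Cn n\<^esub> c) = \<chi> k * \<mu> c" if "k \<in> carrier K" "c \<in> carrier (Cn n)" for k c
    using \<mu>_Kc_mult[OF n, of "\<iota> k" c] that \<iota>_Kc[of n] unfolding Cn_simps \<chi>_\<iota>[OF that(1)] by blast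
  show "\<forall>y\<in>E. r y = 0" if "finite E" "E \<subseteq> \<mu> ` carrier (Cn n)" "lin_indep (\<chi> ` carrier K) E"
    "\<forall>y\<in>E. r y \<in> \<rho> ` carrier R" "(\<Sum>y\<in>E. r y * y) = 0" for E r
    by (rule disjoint_KcU[OF n that[unfolded Cn_simps(1)]])
qed

text \<open>The records of the statement are matched with subsets of the common field, each built on
  the embedding of the preceding one: \<open>M1\<close> and \<open>M2\<close> for the tensor
  products, \<open>N1\<close> and \<open>N2\<close> for their normalizations.\<close>

lemma gap_inequality:
  "let K1 = adjoin_roots \<Omega> K \<iota> p B 1;
       K2 = adjoin_roots \<Omega> K \<iota> p B 2;
       T1 = base_change K R (algebra_via \<iota> K1);
       R1 = normalization T1;
       T2 = base_change K1 R1 (algebra_via (\<lambda>x. x) K2);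
       R2 = normalization T2;
       g10 = edim K1 (quotient_module R1 (to_frac T1 ` carrier T1));
       g21 = edim K2 (quotient_module R2 (to_frac T2 ` carrier T2))
   in enat p * g21 \<le> g10"
proof -
  obtain \<eta> Z0 where "tower e p RU KU (KcU 1) (KcU 2) \<eta> Z0" using tower_U by blast
  then interpret tw: tower e p RU KU "KcU 1" "KcU 2" \<eta> Z0 .
  interpret M1: tensor_map K R "Cn 1" e \<rho> \<mu> \<chi> by (rule tensor_map_Kc) simp
  have imT1: "M1.tmap ` carrier M1.T = tw.T1" unfolding M1.tmap_image tw.T1_def Cn_simps(1) ..
  interpret N1: normalized e p M1.T M1.tmap RU \<eta>
  proof (intro normalized.intro normalized_axioms.intro)
    show "idf_char e p" by (rule idf_char_axioms)
    show "ring_embedding e M1.T M1.tmap" by (rule M1.tmap_embedding)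
    show "subr RU" by (rule tw.R)
    show "RU \<subseteq> M1.tmap ` carrier M1.T" unfolding imT1 by (rule tw.R_T1)
    show "\<eta> \<in> RU" "\<eta> \<noteq> 0" by (rule tw.\<eta>R, rule tw.\<eta>0)
    show "\<eta> * v \<noteq> e" if "v \<in> RU" for v by (rule tw.\<eta>_nonunit[OF that])
    show "\<exists>j u v. u \<in> RU \<and> v \<in> RU \<and> u * v = e \<and> s = u * \<eta> ^ j" if "s \<in> RU" "s \<noteq> 0" for s by (rule tw.dvr_R[OF that])
    show "M1.tmap m ^ p \<in> RU" if "m \<in> carrier M1.T" for m by (rule tw.T1_pow) (use that imT1 in blast)
  qed
  have imS1: "N1.frmap ` carrier N1.N = tw.S1" unfolding N1.N_image imT1 tw.S1_def ..
  have cl1: "c \<odot>\<^bsub>M1.T\<^esub> x \<in> carrier M1.T" and sm1: "M1.tmap (c \<odot>\<^bsub>M1.T\<^esub> x) = \<mu> c * M1.tmap x"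
    if "c \<in> carrier (Kr 1)" "x \<in> carrier M1.T" for c x
    using M1.tmap_smult[unfolded Cn_simps(1), of c x] that unfolding Kr_simps by blast+
  have sc1: "scalar_embedding e N1.N N1.frmap (Kr 1) \<mu>"
  proof (rule N1.scalar_N[OF cring_Kr _ _ _ cl1 sm1])
    show "\<mu> \<one>\<^bsub>Kr 1\<^esub> = e" unfolding Kr_simps by (rule FM.\<nu>_one)
    fix x y assume xy: "x \<in> carrier (Kr 1)" "y \<in> carrier (Kr 1)"
    show "\<mu> (x \<oplus>\<^bsub>Kr 1\<^esub> y) = \<mu> x + \<mu> y" using xy unfolding Kr_simps by (rule \<mu>_Kc_add[OF Orderings.order_refl])
    show "\<mu> (x \<otimes>\<^bsub>Kr 1\<^esub> y) = \<mu> x * \<mu> y" using xy unfolding Kr_simps by (rule \<mu>_Kc_mult[OF Orderings.order_refl])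
  qed
  have Q1: "quotient_space e N1.N N1.frmap (Kr 1) \<mu> (to_frac M1.T ` carrier M1.T)
      (quotient_module N1.N (to_frac M1.T ` carrier M1.T))"
    by (rule N1.quotient_N[OF sc1 field_Kr cl1 sm1])
  let ?C2 = "algebra_via (\<lambda>x. x) (Kr 2)"
  have C2: "carrier ?C2 = Kc 2" "ring.add ?C2 = ring.add \<Omega>" "monoid.mult ?C2 = monoid.mult \<Omega>" "\<one>\<^bsub>?C2\<^esub> = \<one>\<^bsub>\<Omega>\<^esub>"
    "\<And>k c. k \<odot>\<^bsub>?C2\<^esub> c = k \<otimes>\<^bsub>\<Omega>\<^esub> c"
    unfolding adjoin_Kc by (simp_all add: algebra_via_def)
  have two: "(2::nat) \<ge> 1" by simp
  have K12: "Kc 1 \<subseteq> Kc 2" by (rule Kc_mono[OF two])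
  interpret S: scalar_embedding e N1.N N1.frmap "Kr 1" \<mu> by (rule sc1)
  \<comment> \<open>The second tensor product is over the first root field, with the normalization
    as left factor; its disjointness comes from \<open>S1_disjoint\<close>.\<close>
  interpret M2: tensor_map "Kr 1" N1.N ?C2 e N1.frmap \<mu> \<mu>
  proof (intro tensor_map.intro tensor_map_axioms.intro)
    have "(\<lambda>x. x) \<in> ring_hom (Kr 1) (Kr 2)"
      unfolding ring_hom_def using K12 by (auto simp: Kr_simps)
    then have "algebra (Kr 1) ?C2" by (rule algebra_algebra_via[OF cring_Kr cring_Kr])
    then show "tensor (Kr 1) N1.N ?C2" by (intro tensor.intro S.algebra_M)
    show "idf e" by (rule idf_axioms)
    show "subf (\<mu> ` carrier (Kr 1))" unfolding Kr_simps by (rule subf_KcU) simp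
    show "N1.frmap \<one>\<^bsub>N1.N\<^esub> = e" by (rule S.\<phi>_one)
    show "inj_on N1.frmap (carrier N1.N)" using S.\<phi>_inj by (intro inj_onI) blast
    show "N1.frmap (x \<oplus>\<^bsub>N1.N\<^esub> y) = N1.frmap x + N1.frmap y" if "x \<in> carrier N1.N" "y \<in> carrier N1.N" for x y
      by (rule S.\<phi>_add[OF that])
    show "N1.frmap (x \<otimes>\<^bsub>N1.N\<^esub> y) = N1.frmap x * N1.frmap y" if "x \<in> carrier N1.N" "y \<in> carrier N1.N" for x y
      by (rule S.\<phi>_mult[OF that])
    show "N1.frmap (k \<odot>\<^bsub>N1.N\<^esub> a) = \<mu> k * N1.frmap a" if "k \<in> carrier (Kr 1)" "a \<in> carrier N1.N" for k a
      by (rule S.\<psi>_smult[OF that])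
    show "\<mu> (x \<oplus>\<^bsub>?C2\<^esub> y) = \<mu> x + \<mu> y" if "x \<in> carrier ?C2" "y \<in> carrier ?C2" for x y
      using that unfolding C2 by (rule \<mu>_Kc_add[OF two])
    show "\<mu> (x \<otimes>\<^bsub>?C2\<^esub> y) = \<mu> x * \<mu> y" if "x \<in> carrier ?C2" "y \<in> carrier ?C2" for x y
      using that unfolding C2 by (rule \<mu>_Kc_mult[OF two])
    show "\<mu> \<one>\<^bsub>?C2\<^esub> = e" unfolding C2 by (rule FM.\<nu>_one)
    show "inj_on \<mu> (carrier ?C2)" unfolding C2 by (rule inj_on_Kc[OF two])
    show "\<mu> (k \<odot>\<^bsub>?C2\<^esub> c) = \<mu> k * \<mu> c" if "k \<in> carrier (Kr 1)" "c \<in> carrier ?C2" for k c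
      using \<mu>_Kc_mult[OF two, of k c] that K12 unfolding C2 Kr_simps by blast
    show "\<forall>y\<in>E. r y = 0" if "finite E" "E \<subseteq> \<mu> ` carrier ?C2" "lin_indep (\<mu> ` carrier (Kr 1)) E"
      "\<forall>y\<in>E. r y \<in> N1.frmap ` carrier N1.N" "(\<Sum>y\<in>E. r y * y) = 0" for E r
      by (rule tw.S1_disjoint[OF disjoint_KcU[OF two] that[unfolded C2(1) Kr_simps(1) imS1]])
  qed
  have imT2: "M2.tmap ` carrier M2.T = tw.T2" unfolding M2.tmap_image tw.T2_def C2(1) imS1 ..
  \<comment> \<open>\<open>S1\<close> is again a discrete valuation ring and takes the place of
    \<open>R\<close> at the second level.\<close>
  obtain t k where t: "tw.vanishes t k" "k > 0" "t \<noteq> 0"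
    and dvr_t: "\<forall>s\<in>tw.S1. s \<noteq> 0 \<longrightarrow> (\<exists>j u v. u \<in> tw.S1 \<and> v \<in> tw.S1 \<and> u * v = e \<and> s = u * t ^ j)"
    using tw.S1_uniformizer by (elim exE conjE)
  interpret N2: normalized e p M2.T M2.tmap tw.S1 t
  proof (intro normalized.intro normalized_axioms.intro)
    show "idf_char e p" by (rule idf_char_axioms)
    show "ring_embedding e M2.T M2.tmap" by (rule M2.tmap_embedding)
    show "subr tw.S1" by (rule tw.subr_S1)
    show "tw.S1 \<subseteq> M2.tmap ` carrier M2.T"
      unfolding imT2 tw.T2_def
    proof
      fix s assume s: "s \<in> tw.S1"
      have "s * e \<in> mprod tw.S1 (KcU 2)" by (rule mprod_mem[OF s subr_e[OF subf_r[OF tw.K2]]])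
      then show "s \<in> mprod tw.S1 (KcU 2)" using subr_unit[OF tw.subr_S1 s] by (simp add: mult.commute)
    qed
    show "t \<in> tw.S1" using t(1) unfolding tw.vanishes_def by blast
    show "t \<noteq> 0" by (rule t(3))
    show "t * v \<noteq> e" if "v \<in> tw.S1" for v by (rule tw.vanishes_nonunit[OF t(1,2) that])
    show "\<exists>j u v. u \<in> tw.S1 \<and> v \<in> tw.S1 \<and> u * v = e \<and> s = u * t ^ j" if "s \<in> tw.S1" "s \<noteq> 0" for s
      using dvr_t that by blast
    show "M2.tmap m ^ p \<in> tw.S1" if "m \<in> carrier M2.T" for m by (rule tw.T2_pow) (use that imT2 in blast)
  qed
  have imS2: "N2.frmap ` carrier N2.N = tw.S2" unfolding N2.N_image imT2 tw.S2_def ..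
  have cl2: "c \<odot>\<^bsub>M2.T\<^esub> x \<in> carrier M2.T" and sm2: "M2.tmap (c \<odot>\<^bsub>M2.T\<^esub> x) = \<mu> c * M2.tmap x"
    if "c \<in> carrier (Kr 2)" "x \<in> carrier M2.T" for c x
    using M2.tmap_smult[unfolded C2(1), of c x] that unfolding Kr_simps by blast+
  have sc2: "scalar_embedding e N2.N N2.frmap (Kr 2) \<mu>"
  proof (rule N2.scalar_N[OF cring_Kr _ _ _ cl2 sm2])
    show "\<mu> \<one>\<^bsub>Kr 2\<^esub> = e" unfolding Kr_simps by (rule FM.\<nu>_one)
    fix x y assume xy: "x \<in> carrier (Kr 2)" "y \<in> carrier (Kr 2)"
    show "\<mu> (x \<oplus>\<^bsub>Kr 2\<^esub> y) = \<mu> x + \<mu> y" using xy unfolding Kr_simps by (rule \<mu>_Kc_add[OF two])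
    show "\<mu> (x \<otimes>\<^bsub>Kr 2\<^esub> y) = \<mu> x * \<mu> y" using xy unfolding Kr_simps by (rule \<mu>_Kc_mult[OF two])
  qed
  have Q2: "quotient_space e N2.N N2.frmap (Kr 2) \<mu> (to_frac M2.T ` carrier M2.T)
      (quotient_module N2.N (to_frac M2.T ` carrier M2.T))"
    by (rule N2.quotient_N[OF sc2 field_Kr cl2 sm2])
  let ?Q1 = "quotient_module N1.N (to_frac M1.T ` carrier M1.T)" and ?Q2 = "quotient_module N2.N (to_frac M2.T ` carrier M2.T)"
  have "enat p * edim (Kr 2) ?Q2 \<le> edim (Kr 1) ?Q1"
  \<comment> \<open>An infinite right-hand side bounds everything. A finite one is a generating set,
    to which \<open>tower_bound\<close> applies.\<close>
  proof (cases "edim (Kr 1) ?Q1")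
    case (enat N)
    from quotient_space.generators_edim[OF Q1 enat, unfolded N1.to_frac_image imS1 imT1 Kr_simps]
    obtain Z where Z: "finite Z" "Z \<subseteq> tw.S1" "card Z \<le> N" "tw.S1 \<subseteq> sumset tw.T1 (mprod (KcU 1) Z)"
      by (elim exE conjE)
    from tw.tower_bound[OF Z(1,2,4)]
    obtain Z2 where Z2: "finite Z2" "Z2 \<subseteq> tw.S2" "tw.S2 \<subseteq> sumset tw.T2 (mprod (KcU 2) Z2)" "p * card Z2 \<le> card Z"
      by (elim exE conjE)
    have "edim (Kr 2) ?Q2 \<le> enat (card Z2)"
      by (rule quotient_space.edim_le[OF Q2 Z2(1), unfolded N2.to_frac_image imS2 imT2 Kr_simps, OF Z2(2,3)])
    then have "enat p * edim (Kr 2) ?Q2 \<le> enat p * enat (card Z2)" by (rule mult_left_mono) simp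
    also have "\<dots> = enat (p * card Z2)" by simp
    also have "\<dots> \<le> enat N" using Z2(4) Z(3) by simp
    finally show ?thesis unfolding enat .
  qed simp
  then show ?thesis unfolding Let_def M1.T_def[symmetric] M2.T_def[symmetric] .
qed

end

theorem proposition5p16:
  fixes K :: "'k ring" and \<Omega> :: "'o ring" and \<iota> :: "'k \<Rightarrow> 'o"
    and R :: "('k, 'r) module" and p :: nat and B :: "'k set"
  assumes "field K" and "has_characteristic K p" and "p > 0"
    and "\<iota> \<in> ring_hom K \<Omega>" and "algebraic_closure \<Omega> (\<iota> ` carrier K)"
    and "\<exists>C. p_basis K p C \<and> B \<subseteq> C"
    and "algebra K R" and "discrete_valuation_ring R"
    and "vectorspace.fin_dim K (residue_field R)"
    and "B_integral \<Omega> K \<iota> p B R" and "B_Japanese \<Omega> K \<iota> p B R"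
  shows "let K1 = adjoin_roots \<Omega> K \<iota> p B 1;
             K2 = adjoin_roots \<Omega> K \<iota> p B 2;
             T1 = base_change K R (algebra_via \<iota> K1);
             R1 = normalization T1;
             T2 = base_change K1 R1 (algebra_via (\<lambda>x. x) K2);
             R2 = normalization T2;
             g10 = edim K1 (quotient_module R1 (to_frac T1 ` carrier T1));
             g21 = edim K2 (quotient_module R2 (to_frac T2 ` carrier T2))
         in enat p * g21 \<le> g10"
proof -
  have rs: "root_setting K \<Omega> \<iota> R p B" by (rule root_setting.intro[OF assms(1-10)])
  \<comment> \<open>The common field is fixed here: the fraction field of the tensor product of
    \<open>R\<close> with the field of all roots.\<close>
  note tm = domain_tensor.tensor_map_T[OF root_setting.domain_tensor_Kinf[OF rs]]
  show ?thesis by (rule embedded_setting.gap_inequality[OF embedded_setting.intro[OF rs tm]])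
qed

end
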